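(* Let $n$ be a positive integer, $w=\mathrm{polylog}(n)$, and let $S$ be a set of $n$ points in $[2^{w}]^2$. For any choice of a constant $0<\alpha<1$, one can construct in $\tilde{O}(n^3)$ time with high probability a data structure using $\tilde{O}(n^{3-\alpha/4})$ words of space which answers the following queries in $\tilde{O}(n^{\alpha})$ time: given three two-dimensional boxes $B_1,B_2,B_3$ and an integer $k$, return the triangle with the $k$th largest area among all those formed by three points in $(S\cap B_1)\times(S\cap B_2)\times(S\cap B_3)$.
   Context: $[M]$ denotes $\{0,1,\dots,M-1\}$. The notation $\tilde{O}(\cdot)$ omits factors polylogarithmic in $n$. A "box" is an axis-aligned rectangle. Space is measured in machine words (word RAM model). *)

theory Defs
  imports
    "HOL-Probability.Probability"
    "HOL-Analysis.Simplex_Content"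
    "HOL-Library.Landau_Symbols"
    "HOL-Library.Log_Nat"
begin

section \<open>Asymptotics up to polylogarithmic factors\<close>

definition soft_O :: "(nat \<Rightarrow> real) \<Rightarrow> (nat \<Rightarrow> real) set" where
  "soft_O g = {f. \<exists>k::nat. f \<in> O(\<lambda>n. g n * ln (real n) ^ k)}"

definition polylog :: "(nat \<Rightarrow> nat) \<Rightarrow> bool" where
  "polylog w \<longleftrightarrow> (\<lambda>n. real (w n)) \<in> soft_O (\<lambda>_. 1)"


section \<open>A randomised word RAM\<close>

text \<open>
  A machine has unboundedly many registers, addressed by constants in the program, and a memory
  addressed by words. All words have \<open>b\<close> bits, where \<open>b\<close> is a parameter of the semantics;
  arithmetic is modulo \<open>2 ^ b\<close>. Each instruction takes one unit of time. \<open>Rand\<close> draws a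
  uniformly distributed word, independently of everything else. A machine halts when its
  program counter leaves the program.
\<close>

datatype alu_op =
  Plus | Minus | Times | Divide | Modulo | BitAnd | BitOr | BitXor | ShiftL | ShiftR | Less | Equal

datatype instr =
    Const nat nat                \<comment> \<open>destination register, constant\<close>
  | Alu alu_op nat nat nat       \<comment> \<open>destination register, two source registers\<close>
  | Load nat nat                 \<comment> \<open>destination register, register holding the address\<close>
  | Store nat nat                \<comment> \<open>register holding the address, source register\<close>
  | Rand nat                     \<comment> \<open>destination register\<close>
  | Jump nat                     \<comment> \<open>target\<close>
  | JumpZero nat nat             \<comment> \<open>tested register, target\<close>

type_synonym program = "instr list"

record config =
  pc :: nat
  reg :: "nat \<Rightarrow> nat"
  mem :: "nat \<Rightarrow> nat"

primrec alu :: "nat \<Rightarrow> alu_op \<Rightarrow> nat \<Rightarrow> nat \<Rightarrow> nat" where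
  "alu b Plus x y = take_bit b (x + y)"
| "alu b Minus x y = take_bit b (x + 2 ^ b - y)"
| "alu b Times x y = take_bit b (x * y)"
| "alu b Divide x y = x div y"
| "alu b Modulo x y = x mod y"
| "alu b BitAnd x y = semiring_bit_operations_class.and x y"
| "alu b BitOr x y = semiring_bit_operations_class.or x y"
| "alu b BitXor x y = semiring_bit_operations_class.xor x y"
| "alu b ShiftL x y = take_bit b (push_bit y x)"
| "alu b ShiftR x y = drop_bit y x"
| "alu b Less x y = take_bit b (of_bool (x < y))"
| "alu b Equal x y = take_bit b (of_bool (x = y))"

definition set_reg :: "nat \<Rightarrow> nat \<Rightarrow> config \<Rightarrow> config" where
  "set_reg d v s = s\<lparr>reg := (reg s)(d := v), pc := Suc (pc s)\<rparr>"

primrec exec_instr :: "nat \<Rightarrow> instr \<Rightarrow> config \<Rightarrow> config pmf" where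
  "exec_instr b (Const d v) s = return_pmf (set_reg d (take_bit b v) s)"
| "exec_instr b (Alu f d x y) s = return_pmf (set_reg d (alu b f (reg s x) (reg s y)) s)"
| "exec_instr b (Load d a) s = return_pmf (set_reg d (mem s (reg s a)) s)"
| "exec_instr b (Store a x) s =
     return_pmf (s\<lparr>mem := (mem s)(reg s a := reg s x), pc := Suc (pc s)\<rparr>)"
| "exec_instr b (Rand d) s = map_pmf (\<lambda>v. set_reg d v s) (pmf_of_set {..<2 ^ b})"
| "exec_instr b (Jump l) s = return_pmf (s\<lparr>pc := l\<rparr>)"
| "exec_instr b (JumpZero x l) s =
     return_pmf (s\<lparr>pc := (if reg s x = 0 then l else Suc (pc s))\<rparr>)"

definition halted :: "program \<Rightarrow> config \<Rightarrow> bool" where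
  "halted P s \<longleftrightarrow> length P \<le> pc s"

definition step :: "nat \<Rightarrow> program \<Rightarrow> config \<Rightarrow> config pmf" where
  "step b P s = (if halted P s then return_pmf s else exec_instr b (P ! pc s) s)"

primrec run :: "nat \<Rightarrow> program \<Rightarrow> nat \<Rightarrow> config \<Rightarrow> config pmf" where
  "run b P 0 s = return_pmf s"
| "run b P (Suc t) s = bind_pmf (run b P t s) (step b P)"

definition init_config :: "nat list \<Rightarrow> nat list \<Rightarrow> config" where
  "init_config rs ms =
     \<lparr>pc = 0,
      reg = (\<lambda>i. if i < length rs then rs ! i else 0),
      mem = (\<lambda>i. if i < length ms then ms ! i else 0)\<rparr>"


section \<open>Points, boxes and triangles\<close>

type_synonym point = "nat \<times> nat"

definition grid :: "nat \<Rightarrow> point set" where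
  "grid w = {..<2 ^ w} \<times> {..<2 ^ w}"

text \<open>
  A box is given by its lower left and its upper right corner and is closed. On a set of grid
  points, every axis-aligned rectangle is equivalent to one with corners in the grid.
\<close>

type_synonym rect = "point \<times> point"

fun rect_set :: "rect \<Rightarrow> point set" where
  "rect_set ((x1, y1), (x2, y2)) = {x1..x2} \<times> {y1..y2}"

definition in_plane :: "point \<Rightarrow> real ^ 2" where
  "in_plane p = vector [real (fst p), real (snd p)]"

fun triangle_area :: "point \<times> point \<times> point \<Rightarrow> real" where
  "triangle_area (p, q, r) = measure lborel (convex hull {in_plane p, in_plane q, in_plane r})"

text \<open>
  \<open>x\<close> is a \<open>k\<close>th largest element of \<open>A\<close> with respect to \<open>f\<close>, where \<open>k\<close> counts from 1 and ties are
  broken arbitrarily.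
\<close>

definition kth_largest :: "('a \<Rightarrow> real) \<Rightarrow> 'a set \<Rightarrow> nat \<Rightarrow> 'a \<Rightarrow> bool" where
  "kth_largest f A k x \<longleftrightarrow>
     (\<exists>xs. distinct xs \<and> set xs = A \<and> sorted_wrt (\<lambda>y z. f y \<ge> f z) xs \<and>
           1 \<le> k \<and> k \<le> length xs \<and> xs ! (k - 1) = x)"

definition candidates :: "point set \<Rightarrow> rect \<Rightarrow> rect \<Rightarrow> rect \<Rightarrow> (point \<times> point \<times> point) set" where
  "candidates S B1 B2 B3 = (S \<inter> rect_set B1) \<times> (S \<inter> rect_set B2) \<times> (S \<inter> rect_set B3)"


section \<open>Data structures\<close>

text \<open>
  With \<open>c\<close> constant, this is a word length of \<open>\<Theta>(w + log n)\<close> bits. As \<open>c \<ge> 3\<close>, every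
  coordinate and every number up to \<open>n ^ 3\<close> fits into one word.
\<close>

definition word_length :: "nat \<Rightarrow> nat \<Rightarrow> nat \<Rightarrow> nat" where
  "word_length c w n = c * (w + floorlog 2 n)"

text \<open>
  The construction receives \<open>n\<close>, \<open>w\<close> and the trade-off parameter \<open>\<lfloor>n ^ \<alpha>\<rfloor>\<close> in registers, since
  neither \<open>w\<close> nor \<open>\<alpha>\<close> needs to be computable, and the points in memory.
\<close>

definition build_config :: "real \<Rightarrow> nat \<Rightarrow> point list \<Rightarrow> config" where
  "build_config \<alpha> w pts =
     init_config [length pts, w, nat \<lfloor>real (length pts) powr \<alpha>\<rfloor>]
       (concat (map (\<lambda>(x, y). [x, y]) pts))"

text \<open>
  The data structure is the initial part of the memory, of the length left in register 0. It is
  the only thing that a query inherits from the construction.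
\<close>

definition built_structure :: "config \<Rightarrow> nat list" where
  "built_structure s = map (mem s) [0..<reg s 0]"

fun rect_words :: "rect \<Rightarrow> nat list" where
  "rect_words ((x1, y1), (x2, y2)) = [x1, y1, x2, y2]"

definition query_config :: "nat list \<Rightarrow> rect \<Rightarrow> rect \<Rightarrow> rect \<Rightarrow> nat \<Rightarrow> config" where
  "query_config D B1 B2 B3 k =
     init_config (rect_words B1 @ rect_words B2 @ rect_words B3 @ [k]) D"

definition query_answer :: "config \<Rightarrow> point \<times> point \<times> point" where
  "query_answer s = ((reg s 0, reg s 1), (reg s 2, reg s 3), (reg s 4, reg s 5))"

text \<open>
  The query algorithm succeeds within time \<open>t\<close> on all queries, whatever random words it
  draws; so it may as well be deterministic.
\<close>

definition answers_queries ::
    "nat \<Rightarrow> program \<Rightarrow> nat \<Rightarrow> nat \<Rightarrow> point set \<Rightarrow> nat list \<Rightarrow> bool" where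
  "answers_queries b Q t w S D \<longleftrightarrow>
     (\<forall>B1 B2 B3 k.
        B1 \<in> grid w \<times> grid w \<longrightarrow> B2 \<in> grid w \<times> grid w \<longrightarrow> B3 \<in> grid w \<times> grid w \<longrightarrow>
        1 \<le> k \<longrightarrow> k \<le> card (candidates S B1 B2 B3) \<longrightarrow>
        (\<forall>s \<in> set_pmf (run b Q t (query_config D B1 B2 B3 k)).
           halted Q s \<and>
           kth_largest triangle_area (candidates S B1 B2 B3) k (query_answer s)))"

end

(*
  The triples of points are ordered by twice the area of their triangles, ties being broken by the
  code of the triple. The answer to a query is found bit by bit: each step counts the triples in the
  three boxes whose position in this order starts with given bits. Decomposing the six coordinate
  ranges into dyadic intervals makes such a count a signed sum over polylogarithmically many nodes of
  a binary tree, where a node fixes a dyadic interval for every coordinate and a prefix of the area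
  and of the code. The leaves below a node are items, that is, triples with a level for every
  coordinate; there are N = n^3 polylog(n) of them.

  Only counts above a threshold s, about n^(alpha/4), are stored, in space N/s up to polylogarithmic
  factors. The highest nodes without a stored count are buckets of at most s items, and the other
  counts are obtained by listing the items of a bucket, that is, by inverting the function F from
  items to buckets. This is done with rainbow tables: a chain of length s alternates F with pairwise
  independent hash functions from buckets to items, and only its first element is stored, under its
  last one. By the second moment method, a table with N/(4s^2) chains recovers a given item with
  probability at least 1/(16s), so s polylog(n) tables recover all items with high probability. An
  inversion walks along s columns of each table from each of s positions, which takes time
  s^3 <= n^alpha up to polylogarithmic factors.
*)


theory Submission
  imports Defs
begin

section \<open>Structured programs, their running time, and compilation to RAM instructions\<close>

section \<open>A structured language over the word RAM\<close>

text \<open>One tree serves all queries because the bits of an item are arranged in the order of a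
  query's conditions: nodes of the six coordinates, then area and code, then levels. Each condition
  is a prefix, and the items below a node without a stored count lie in one bucket. So a single
  function F has to be inverted.

  F depends on the points and need not look random. A fresh hash function per column makes every
  step of a chain independent of the earlier ones; within a column, pairwise independence is enough
  for first and second moments.

  The constants balance three quantities. Two given chains of length s over buckets of size s merge
  with probability at most s^2/N, so N/(4s^2) chains rarely merge and still visit a given item with
  probability of order 1/s. The tables then take about s * N/s^2 = N/s words, as much as the counts
  above the threshold s.

  An inversion only yields candidates, and the same item may turn up repeatedly. Each candidate is
  therefore verified and marked with the number of the current count, which avoids clearing the
  marks. A union bound makes one choice of random words work for all items at once, so queries are
  deterministic and never fail after a successful construction.\<close>

text \<open>
 A loop \<open>For x p c\<close> counts the register \<open>x\<close> down from \<open>k - 1\<close> to \<open>0\<close>, where \<open>k\<close> is the value of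
 register \<open>p\<close>. A state consists of the registers and the memory.
\<close>

datatype exp = Rg nat | Cn nat | Op alu_op exp exp

datatype com =
  Skip
 | Set nat exp
 | Ld nat exp
 | St exp exp
 | Seq com com (infixr \<open>;;\<close> 60)
 | Cond exp com com
 | For nat nat com

type_synonym st = "(nat => nat) \<times> (nat => nat)"

primrec eval :: "nat => exp => (nat => nat) => nat" where
 "eval b (Rg x) r = r x"
| "eval b (Cn c) r = take_bit b c"
| "eval b (Op f x y) r = alu b f (eval b x r) (eval b y r)"

primrec loopf :: "(nat => 'a => 'a) => nat => 'a => 'a" where
 "loopf f 0 s = s"
| "loopf f (Suc i) s = loopf f i (f i s)"

definition upd :: "nat => nat => st => st" where
 "upd x v s = ((fst s)(x := v), snd s)"

definition updm :: "nat => nat => st => st" where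
 "updm a v s = (fst s, (snd s)(a := v))"

primrec sem :: "nat => com => st => st" where
 "sem b Skip s = s"
| "sem b (Set x e) s = upd x (eval b e (fst s)) s"
| "sem b (Ld x e) s = upd x (snd s (eval b e (fst s))) s"
| "sem b (St a e) s = updm (eval b a (fst s)) (eval b e (fst s)) s"
| "sem b (c1 ;; c2) s = sem b c2 (sem b c1 s)"
| "sem b (Cond e c1 c2) s = (if eval b e (fst s) \<noteq> 0 then sem b c1 s else sem b c2 s)"
| "sem b (For x p c) s =
  loopf (\<lambda>i ms. sem b c (upd x i ms)) (fst s p) (upd x (fst s p) s)"

primrec esize :: "exp => nat" where
 "esize (Rg x) = 1"
| "esize (Cn c) = 1"
| "esize (Op f x y) = esize x + esize y + 1"

text \<open>The 4 is the overhead of an iteration in \<open>ccom\<close>: \<open>JumpZero\<close>,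
  \<open>Const\<close>, \<open>Minus\<close> and the closing \<open>Jump\<close>. The 2 in
  \<open>tim\<close> for a loop pays for the copy of the bound and the last
  \<open>JumpZero\<close>.\<close>

primrec loopt :: "(nat => 'a => 'a) => (nat => 'a => nat) => nat => 'a => nat" where
 "loopt f g 0 s = 0"
| "loopt f g (Suc i) s = g i s + 4 + loopt f g i (f i s)"

primrec tim :: "nat => com => st => nat" where
 "tim b Skip s = 0"
| "tim b (Set x e) s = esize e + 1"
| "tim b (Ld x e) s = esize e + 1"
| "tim b (St a e) s = esize a + esize e + 1"
| "tim b (c1 ;; c2) s = tim b c1 s + tim b c2 (sem b c1 s)"
| "tim b (Cond e c1 c2) s =
  esize e + 1 + (if eval b e (fst s) \<noteq> 0 then tim b c1 s + 1 else tim b c2 s)"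
| "tim b (For x p c) s =
  2 + loopt (\<lambda>i ms. sem b c (upd x i ms)) (\<lambda>i ms. tim b c (upd x i ms)) (fst s p) (upd x (fst s p) s)"

primrec wr :: "com => nat set" where
 "wr Skip = {}"
| "wr (Set x e) = {x}"
| "wr (Ld x e) = {x}"
| "wr (St a e) = {}"
| "wr (c1 ;; c2) = wr c1 \<union> wr c2"
| "wr (Cond e c1 c2) = wr c1 \<union> wr c2"
| "wr (For x p c) = insert x (wr c)"

primrec stores :: "com => bool" where
 "stores Skip = False"
| "stores (Set x e) = False"
| "stores (Ld x e) = False"
| "stores (St a e) = True"
| "stores (c1 ;; c2) = (stores c1 \<or> stores c2)"
| "stores (Cond e c1 c2) = (stores c1 \<or> stores c2)"
| "stores (For x p c) = stores c"

text \<open>The registers whose values bound the numbers of iterations of the loops.\<close>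

primrec lp :: "com => nat set" where
 "lp Skip = {}"
| "lp (Set x e) = {}"
| "lp (Ld x e) = {}"
| "lp (St a e) = {}"
| "lp (c1 ;; c2) = lp c1 \<union> lp c2"
| "lp (Cond e c1 c2) = lp c1 \<union> lp c2"
| "lp (For x p c) = insert p (lp c)"

primrec eregs :: "exp => nat set" where
 "eregs (Rg x) = {x}"
| "eregs (Cn c) = {}"
| "eregs (Op f x y) = eregs x \<union> eregs y"

text \<open>Registers from 1000 on are reserved for the evaluation of expressions.\<close>

primrec wfc :: "com => bool" where
 "wfc Skip = True"
| "wfc (Set x e) = (x < 1000 \<and> eregs e \<subseteq> {..<1000})"
| "wfc (Ld x e) = (x < 1000 \<and> eregs e \<subseteq> {..<1000})"
| "wfc (St a e) = (eregs a \<subseteq> {..<1000} \<and> eregs e \<subseteq> {..<1000})"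
| "wfc (c1 ;; c2) = (wfc c1 \<and> wfc c2)"
| "wfc (Cond e c1 c2) = (eregs e \<subseteq> {..<1000} \<and> wfc c1 \<and> wfc c2)"
| "wfc (For x p c) = (x < 1000 \<and> p < 1000 \<and> x \<noteq> p \<and> x \<notin> wr c \<and> p \<notin> wr c \<and> wfc c)"

text \<open>No part of the program changes a register that bounds a loop executed later. All numbers
  of iterations can then be read off the registers at the start, which makes \<open>tm\<close> an
  upper bound for \<open>tim\<close>.\<close>

primrec steady :: "com => bool" where
 "steady Skip = True"
| "steady (Set x e) = True"
| "steady (Ld x e) = True"
| "steady (St a e) = True"
| "steady (c1 ;; c2) = (steady c1 \<and> steady c2 \<and> wr c1 \<inter> lp c2 = {})"
| "steady (Cond e c1 c2) = (steady c1 \<and> steady c2)"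
| "steady (For x p c) = (steady c \<and> insert x (wr c) \<inter> lp c = {})"

text \<open>Adding both branches of \<open>Cond\<close> costs at most a constant factor and lets the
  growth of \<open>tm\<close> be computed with sums and products alone.\<close>

primrec tm :: "com => (nat => nat) => nat" where
 "tm Skip r = 0"
| "tm (Set x e) r = esize e + 1"
| "tm (Ld x e) r = esize e + 1"
| "tm (St a e) r = esize a + esize e + 1"
| "tm (c1 ;; c2) r = tm c1 r + tm c2 r"
| "tm (Cond e c1 c2) r = esize e + 2 + tm c1 r + tm c2 r"
| "tm (For x p c) r = 2 + r p * (tm c r + 4)"

lemma upd_simps [simp]:
 "fst (upd x v s) = (fst s)(x := v)" "snd (upd x v s) = snd s"
 "fst (updm a v s) = fst s" "snd (updm a v s) = (snd s)(a := v)"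
 by (simp_all add: upd_def updm_def)

lemma loopf_inv:
 assumes "I p s" "\<And>i ms. i < p ==> I (Suc i) ms ==> I i (f i ms)"
 shows "I 0 (loopf f p s)"
 using assms by (induction p arbitrary: s) auto

lemma loopf_keep:
 assumes "\<And>i ms. P (f i ms) = P ms"
 shows "P (loopf f p s) = P s"
 using assms by (induction p arbitrary: s) auto

lemma sem_frame [simp]: "x \<notin> wr c ==> fst (sem b c s) x = fst s x"
proof (induction c arbitrary: s)
 case (For y p c)
 thus ?case
  using loopf_keep[where P="\<lambda>s. fst s x" and f="\<lambda>i ms. sem b c (upd y i ms)"] by auto
qed auto

lemma sem_mem_frame [simp]: "\<not> stores c ==> snd (sem b c s) = snd s"
proof (induction c arbitrary: s)
 case (For y p c)
 thus ?case
  using loopf_keep[where P="\<lambda>s. snd s" and f="\<lambda>i ms. sem b c (upd y i ms)"] by auto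
qed auto

lemma sem_For_inv:
 assumes "I (fst s p) (upd x (fst s p) s)"
  and "\<And>i ms. i < fst s p ==> I (Suc i) ms ==> I i (sem b c (upd x i ms))"
 shows "I 0 (sem b (For x p c) s)"
 using assms unfolding sem.simps by (rule loopf_inv)

text \<open>Nested loops run through a rectangle of pairs; the set of the pairs done so far indexes the invariant.\<close>

lemma sem_For_pairs:
 assumes start: "J {} s"
  and len: "\<And>P s. J P s ==> fst s p = k \<and> fst s q = l"
  and up: "\<And>P s z v. J P s ==> z \<in> {x, y} ==> J P (upd z v s)"
  and pre: "\<And>P s i. J P s ==> fst s x = i ==> i < k ==> J P (sem b A s) \<and> H i (sem b A s)"
  and H_up: "\<And>i j s. H i s ==> H i (upd y j s)"
  and step: "\<And>P s i j. J P s ==> H i s ==> fst s y = j ==> i < k ==> j < l ==> (i, j) \<notin> P ==>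
    P \<subseteq> {..<k} \<times> {..<l} ==> J (insert (i, j) P) (sem b B s) \<and> H i (sem b B s)"
 shows "J ({..<k} \<times> {..<l}) (sem b (For x p (A ;; For y q B)) s)"
proof -
 have ivl: "{i..<n} = insert i {Suc i..<n}" if "i < n" for i n :: nat using that by auto
 have "J ({0..<k} \<times> {..<l}) (sem b (For x p (A ;; For y q B)) s)"
 proof (rule sem_For_inv[where I="\<lambda>i. J ({i..<k} \<times> {..<l})"], goal_cases)
  case 1
  show ?case using len[OF start] up[OF start] by simp
 next
  case (2 i t)
  hence i: "i < k" using len[OF start] by simp
  let ?P = "\<lambda>j. {Suc i..<k} \<times> {..<l} \<union> {i} \<times> {j..<l}" and ?t = "sem b A (upd x i t)"
  have t: "J ({Suc i..<k} \<times> {..<l}) ?t \<and> H i ?t" by (rule pre[OF up[OF 2(2)] _ i]) simp_all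
  have "J (?P 0) (sem b (For y q B) ?t) \<and> H i (sem b (For y q B) ?t)"
  proof (rule sem_For_inv[where I="\<lambda>j t. J (?P j) t \<and> H i t"], goal_cases)
   case 1
   show ?case using len[OF conjunct1[OF t]] up[OF conjunct1[OF t], of y] H_up[OF conjunct2[OF t]] by simp
  next
   case (2 j t')
   hence j: "j < l" using len[OF conjunct1[OF t]] by simp
   have "insert (i, j) (?P (Suc j)) = ?P j" using ivl[OF j] by auto
   moreover have "J (insert (i, j) (?P (Suc j))) (sem b B (upd y j t')) \<and> H i (sem b B (upd y j t'))"
    using 2(2) up[of "?P (Suc j)" t' y j] H_up i j by (intro step) auto
   ultimately show ?case by simp
  qed
  moreover have "?P 0 = {i..<k} \<times> {..<l}" using ivl[OF i] by auto
  ultimately show ?case by simp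
 qed
 thus ?thesis by (simp add: lessThan_atLeast0)
qed

lemma sem_For_For:
 assumes "J {} s" "\<And>P s. J P s ==> fst s p = k \<and> fst s q = l"
  and "\<And>P s z v. J P s ==> z \<in> {x, y} ==> J P (upd z v s)"
  and B: "x \<noteq> y" "x \<notin> wr B"
  and "\<And>P s i j. J P s ==> fst s x = i ==> fst s y = j ==> i < k ==> j < l ==> (i, j) \<notin> P ==>
    P \<subseteq> {..<k} \<times> {..<l} ==> J (insert (i, j) P) (sem b B s)"
 shows "J ({..<k} \<times> {..<l}) (sem b (For x p (For y q B)) s)"
proof -
 have "J ({..<k} \<times> {..<l}) (sem b (For x p (Skip ;; For y q B)) s)"
  by (rule sem_For_pairs[where H="\<lambda>i s. fst s x = i"]) (use assms in simp_all)
 thus ?thesis by simp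
qed

lemma tm_cong: "(\<And>x. x \<in> lp c ==> r x = r' x) ==> tm c r = tm c r'"
 by (induction c) auto

lemma tim_le_tm: "steady c ==> tim b c s \<le> tm c (fst s)"
proof (induction c arbitrary: s)
 case (Seq c1 c2)
 have "tm c2 (fst (sem b c1 s)) = tm c2 (fst s)"
  using Seq.prems by (intro tm_cong sem_frame) auto
 thus ?case using Seq.IH(1)[of s] Seq.IH(2)[of "sem b c1 s"] Seq.prems by simp
next
 case (Cond e c1 c2)
 have "tim b c1 s \<le> tm c1 (fst s)" "tim b c2 s \<le> tm c2 (fst s)"
  using Cond.IH(1)[of s] Cond.IH(2)[of s] Cond.prems by simp_all
 thus ?case by simp
next
 case (For x p c)
 let ?f = "\<lambda>i ms. sem b c (upd x i ms)" and ?g = "\<lambda>i ms. tim b c (upd x i ms)"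
 have "loopt ?f ?g k ms \<le> k * (tm c (fst s) + 4)"
  if "\<And>y. y \<in> lp c ==> fst ms y = fst s y" for k ms
  using that
 proof (induction k arbitrary: ms)
  case (Suc k)
  have "tim b c (upd x k ms) \<le> tm c (fst (upd x k ms))"
   by (rule For.IH) (use For.prems in simp)
  also have "\<dots> = tm c (fst s)"
   using For.prems Suc.prems by (intro tm_cong) auto
  finally have "?g k ms \<le> tm c (fst s)" .
  moreover have "loopt ?f ?g k (?f k ms) \<le> k * (tm c (fst s) + 4)"
  proof (rule Suc.IH)
   fix y assume y: "y \<in> lp c"
   hence "y \<notin> wr c" "y \<noteq> x" using For.prems by auto
   thus "fst (?f k ms) y = fst s y" using Suc.prems[OF y] by simp
  qed
  ultimately show ?case by simp
 qed simp
 moreover have "\<And>y. y \<in> lp c ==> fst (upd x (fst s p) s) y = fst s y"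
  using For.prems by auto
 ultimately show ?case by simp
qed auto

subsection \<open>Compilation\<close>

text \<open>Register \<open>d\<close> is the top of an evaluation stack; everything below it is
  preserved. \<open>BitOr d x x\<close> serves as a register move.\<close>

primrec cexp :: "nat => exp => instr list" where
 "cexp d (Rg x) = [Alu BitOr d x x]"
| "cexp d (Cn c) = [Const d c]"
| "cexp d (Op f x y) = cexp d x @ cexp (Suc d) y @ [Alu f d d (Suc d)]"

primrec csize :: "com => nat" where
 "csize Skip = 0"
| "csize (Set x e) = esize e + 1"
| "csize (Ld x e) = esize e + 1"
| "csize (St a e) = esize a + esize e + 1"
| "csize (c1 ;; c2) = csize c1 + csize c2"
| "csize (Cond e c1 c2) = esize e + csize c1 + csize c2 + 2"
| "csize (For x p c) = csize c + 5"

primrec ccom :: "nat => com => instr list" where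
 "ccom l Skip = []"
| "ccom l (Set x e) = cexp 1000 e @ [Alu BitOr x 1000 1000]"
| "ccom l (Ld x e) = cexp 1000 e @ [Load x 1000]"
| "ccom l (St a e) = cexp 1000 a @ cexp 1001 e @ [Store 1000 1001]"
| "ccom l (c1 ;; c2) = ccom l c1 @ ccom (l + csize c1) c2"
| "ccom l (Cond e c1 c2) =
  cexp 1000 e @ [JumpZero 1000 (l + esize e + csize c1 + 2)] @ ccom (l + esize e + 1) c1 @
  [Jump (l + esize e + csize c1 + csize c2 + 2)] @ ccom (l + esize e + csize c1 + 2) c2"
| "ccom l (For x p c) =
  [Alu BitOr x p p, JumpZero x (l + csize c + 5), Const 1000 1, Alu Minus x x 1000] @
  ccom (l + 4) c @ [Jump (l + 1)]"

lemma length_cexp [simp]: "length (cexp d e) = esize e"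
 by (induction e arbitrary: d) auto

lemma length_ccom [simp]: "length (ccom l c) = csize c"
 by (induction c arbitrary: l) auto

lemma run_add: "run b P (s + t) ms = bind_pmf (run b P s ms) (run b P t)"
proof (induction t)
 case 0
 thus ?case by (simp add: bind_return_pmf')
next
 case (Suc t)
 thus ?case by (simp add: bind_assoc_pmf)
qed

definition reaches :: "nat => program => nat => config => config => bool" where
 "reaches b P t ms ms' \<longleftrightarrow> run b P t ms = return_pmf ms'"

lemma reaches_trans: "reaches b P s ms ms' ==> reaches b P t ms' ms'' ==> reaches b P (s + t) ms ms''"
 by (simp add: reaches_def run_add bind_return_pmf)

lemma reaches_0: "reaches b P 0 ms ms" by (simp add: reaches_def)

definition at_pos :: "program => nat => instr list => bool" where
 "at_pos P l I \<longleftrightarrow> (\<exists>xs ys. P = xs @ I @ ys \<and> length xs = l)"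

lemma at_pos_append: "at_pos P l (I @ J) \<longleftrightarrow> at_pos P l I \<and> at_pos P (l + length I) J"
proof
 assume "at_pos P l (I @ J)"
 then obtain xs ys where "P = xs @ (I @ J) @ ys" "length xs = l" unfolding at_pos_def by auto
 hence "P = xs @ I @ (J @ ys) \<and> length xs = l" "P = (xs @ I) @ J @ ys \<and> length (xs @ I) = l + length I"
  by auto
 thus "at_pos P l I \<and> at_pos P (l + length I) J" unfolding at_pos_def by blast
next
 assume "at_pos P l I \<and> at_pos P (l + length I) J"
 then obtain xs ys xs' ys' where
  1: "P = xs @ I @ ys" "length xs = l" and 2: "P = xs' @ J @ ys'" "length xs' = l + length I"
  unfolding at_pos_def by blast
 have "xs' = xs @ I" using 1 2 by (metis append_assoc append_eq_append_conv length_append)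
 thus "at_pos P l (I @ J)" using 1 2 unfolding at_pos_def by auto
qed

lemma at_pos_Cons: "at_pos P l (i # I) \<longleftrightarrow> at_pos P l [i] \<and> at_pos P (Suc l) I"
 using at_pos_append[of P l "[i]" I] by simp

lemma at_pos_Cons2: "at_pos P l (i # j # I) \<longleftrightarrow> at_pos P l [i] \<and> at_pos P (Suc l) (j # I)"
 using at_pos_append[of P l "[i]" "j # I"] by simp

lemma at_pos_nth: "at_pos P l [i] ==> l < length P \<and> P ! l = i"
 unfolding at_pos_def by auto

lemma reaches_step:
 assumes "at_pos P (pc ms) [i]" "exec_instr b i ms = return_pmf ms'"
 shows "reaches b P 1 ms ms'"
 using at_pos_nth[OF assms(1)] assms(2)
 by (simp add: reaches_def step_def halted_def bind_return_pmf)

lemma cexp_correct: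
 assumes "at_pos P (pc ms) (cexp d e)" "eregs e \<subseteq> {..<1000}" "1000 \<le> d"
 shows "\<exists>ms'. reaches b P (esize e) ms ms' \<and> pc ms' = pc ms + esize e \<and> mem ms' = mem ms \<and>
     reg ms' d = eval b e (reg ms) \<and> (\<forall>x<d. reg ms' x = reg ms x)"
 using assms
proof (induction e arbitrary: d ms)
 case (Rg x)
 have "reaches b P 1 ms (set_reg d (reg ms x) ms)"
  using Rg by (intro reaches_step[where i="Alu BitOr d x x"]) auto
 thus ?case by (intro exI[of _ "set_reg d (reg ms x) ms"]) (simp add: set_reg_def)
next
 case (Cn c)
 have "reaches b P 1 ms (set_reg d (take_bit b c) ms)"
  using Cn by (intro reaches_step[where i="Const d c"]) auto
 thus ?case by (intro exI[of _ "set_reg d (take_bit b c) ms"]) (simp add: set_reg_def)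
next
 case (Op f x y)
 have eq: "eval b e r = eval b e r'" if "\<And>z. z \<in> eregs e ==> r z = r' z" for e r r'
  using that by (induction e) auto
 from Op.prems have a: "at_pos P (pc ms) (cexp d x)" "at_pos P (pc ms + esize x) (cexp (Suc d) y)"
  "at_pos P (pc ms + esize x + esize y) [Alu f d d (Suc d)]"
  by (auto simp: at_pos_append add.assoc)
 obtain ms1 where 1: "reaches b P (esize x) ms ms1" "pc ms1 = pc ms + esize x" "mem ms1 = mem ms"
  "reg ms1 d = eval b x (reg ms)" "\<forall>x<d. reg ms1 x = reg ms x"
  using Op.IH(1)[OF a(1)] Op.prems by auto
 obtain ms2 where 2: "reaches b P (esize y) ms1 ms2" "pc ms2 = pc ms1 + esize y" "mem ms2 = mem ms1"
  "reg ms2 (Suc d) = eval b y (reg ms1)" "\<forall>x<Suc d. reg ms2 x = reg ms1 x"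
  using Op.IH(2)[of ms1 "Suc d"] a(2) 1(2) Op.prems by auto
 let ?ms = "set_reg d (alu b f (reg ms2 d) (reg ms2 (Suc d))) ms2"
 have r: "reaches b P 1 ms2 ?ms"
  using a(3) 1(2) 2(2) by (intro reaches_step[where i="Alu f d d (Suc d)"]) auto
 moreover have "eval b y (reg ms1) = eval b y (reg ms)"
  using Op.prems 1(5) by (intro eq) auto
 ultimately show ?case
  using reaches_trans[OF reaches_trans[OF 1(1) 2(1)] r] 1 2
  by (intro exI[of _ ?ms]) (auto simp: set_reg_def)
qed

definition agree :: "config => st => bool" where
 "agree ms s \<longleftrightarrow> (\<forall>x<1000. reg ms x = fst s x) \<and> mem ms = snd s"

definition bounded_st :: "nat => st => bool" where
 "bounded_st b s \<longleftrightarrow> (\<forall>x. fst s x < 2 ^ b) \<and> (\<forall>a. snd s a < 2 ^ b)"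

lemma alu_bounded:
 assumes "x < 2 ^ b" "y < 2 ^ b"
 shows "alu b f x y < 2 ^ b"
proof (cases f)
 case BitAnd
 thus ?thesis using assms by (metis alu.simps(6) take_bit_and take_bit_nat_eq_self_iff)
next
 case BitOr
 thus ?thesis using assms by (metis alu.simps(7) take_bit_or take_bit_nat_eq_self_iff)
next
 case BitXor
 thus ?thesis using assms by (metis alu.simps(8) take_bit_xor take_bit_nat_eq_self_iff)
next
 case Divide
 thus ?thesis using assms by (simp add: order.strict_trans1[OF div_le_dividend])
next
 case Modulo
 thus ?thesis using assms by (simp add: order.strict_trans1[OF mod_less_eq_dividend])
next
 case ShiftR
 thus ?thesis using assms by (simp add: drop_bit_eq_div order.strict_trans1[OF div_le_dividend])
qed (simp_all add: take_bit_nat_less_exp del: One_nat_def)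

lemma eval_bounded: "(\<And>x. r x < 2 ^ b) ==> eval b e r < 2 ^ b"
 by (induction e) (auto intro: alu_bounded simp: take_bit_nat_less_exp)

lemma bounded_upd: "bounded_st b s ==> v < 2 ^ b ==> bounded_st b (upd x v s)"
 "bounded_st b s ==> v < 2 ^ b ==> bounded_st b (updm x v s)"
 by (auto simp: bounded_st_def)

lemma loopf_bounded:
 assumes "p < 2 ^ b" "\<And>i ms. i < 2 ^ b ==> bounded_st b ms ==> bounded_st b (f i ms)" "bounded_st b s"
 shows "bounded_st b (loopf f p s)"
 using assms by (induction p arbitrary: s) auto

lemma sem_bounded: "bounded_st b s ==> bounded_st b (sem b c s)"
proof (induction c arbitrary: s)
 case (For x p c)
 hence "fst s p < 2 ^ b" by (simp add: bounded_st_def)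
 show ?case unfolding sem.simps
  by (rule loopf_bounded) (use For \<open>fst s p < 2 ^ b\<close> in \<open>simp_all add: bounded_upd\<close>)
qed (auto intro!: bounded_upd eval_bounded simp: bounded_st_def)

lemma eval_agree: "agree ms s ==> eregs e \<subseteq> {..<1000} ==> eval b e (reg ms) = eval b e (fst s)"
 by (induction e) (auto simp: agree_def)

text \<open>\<open>bounded_st\<close> makes the decrement of a loop counter exact:
  \<open>Suc k + 2 ^ b - 1\<close> is reduced modulo \<open>2 ^ b\<close> to \<open>k\<close> only
  for \<open>k < 2 ^ b\<close>.\<close>

theorem ccom_correct:
 assumes "at_pos P (pc ms) (ccom (pc ms) c)" "wfc c" "agree ms s" "bounded_st b s"
 shows "\<exists>ms'. reaches b P (tim b c s) ms ms' \<and> pc ms' = pc ms + csize c \<and> agree ms' (sem b c s)"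
 using assms
proof (induction c arbitrary: ms s)
 case Skip
 thus ?case using reaches_0 by auto
next
 case (Set x e)
 from Set.prems have a: "at_pos P (pc ms) (cexp 1000 e)" "at_pos P (pc ms + esize e) [Alu BitOr x 1000 1000]"
  by (auto simp: at_pos_append)
 obtain ms1 where 1: "reaches b P (esize e) ms ms1" "pc ms1 = pc ms + esize e" "mem ms1 = mem ms"
  "reg ms1 1000 = eval b e (reg ms)" "\<forall>x<1000. reg ms1 x = reg ms x"
  using cexp_correct[OF a(1), of b] Set.prems by auto
 let ?ms = "set_reg x (reg ms1 1000) ms1"
 have r: "reaches b P 1 ms1 ?ms"
  using a(2) 1(2) by (intro reaches_step[where i="Alu BitOr x 1000 1000"]) auto
 thus ?case
  using reaches_trans[OF 1(1) r] 1 Set.prems eval_agree[OF Set.prems(3), of e b]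
  by (intro exI[of _ ?ms]) (auto simp: set_reg_def agree_def)
next
 case (Ld x e)
 from Ld.prems have a: "at_pos P (pc ms) (cexp 1000 e)" "at_pos P (pc ms + esize e) [Load x 1000]"
  by (auto simp: at_pos_append)
 obtain ms1 where 1: "reaches b P (esize e) ms ms1" "pc ms1 = pc ms + esize e" "mem ms1 = mem ms"
  "reg ms1 1000 = eval b e (reg ms)" "\<forall>x<1000. reg ms1 x = reg ms x"
  using cexp_correct[OF a(1), of b] Ld.prems by auto
 let ?ms = "set_reg x (mem ms1 (reg ms1 1000)) ms1"
 have r: "reaches b P 1 ms1 ?ms"
  using a(2) 1(2) by (intro reaches_step[where i="Load x 1000"]) auto
 thus ?case
  using reaches_trans[OF 1(1) r] 1 Ld.prems eval_agree[OF Ld.prems(3), of e b]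
  by (intro exI[of _ ?ms]) (auto simp: set_reg_def agree_def)
next
 case (St x e)
 from St.prems have a: "at_pos P (pc ms) (cexp 1000 x)" "at_pos P (pc ms + esize x) (cexp 1001 e)"
  "at_pos P (pc ms + esize x + esize e) [Store 1000 1001]"
  by (auto simp: at_pos_append add.assoc)
 obtain ms1 where 1: "reaches b P (esize x) ms ms1" "pc ms1 = pc ms + esize x" "mem ms1 = mem ms"
  "reg ms1 1000 = eval b x (reg ms)" "\<forall>x<1000. reg ms1 x = reg ms x"
  using cexp_correct[OF a(1), of b] St.prems by auto
 have ag: "agree ms1 s" using 1 St.prems by (auto simp: agree_def)
 obtain ms2 where 2: "reaches b P (esize e) ms1 ms2" "pc ms2 = pc ms1 + esize e" "mem ms2 = mem ms1"
  "reg ms2 1001 = eval b e (reg ms1)" "\<forall>x<1001. reg ms2 x = reg ms1 x"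
  using cexp_correct[of P ms1 1001 e b] a(2) 1(2) St.prems by auto
 let ?ms = "ms2\<lparr>mem := (mem ms2)(reg ms2 1000 := reg ms2 1001), pc := Suc (pc ms2)\<rparr>"
 have r: "reaches b P 1 ms2 ?ms"
  using a(3) 1(2) 2(2) by (intro reaches_step[where i="Store 1000 1001"]) auto
 moreover have "reg ms2 1000 = eval b x (fst s)" "reg ms2 1001 = eval b e (fst s)"
  using 1 2 St.prems eval_agree[OF St.prems(3), of x b] eval_agree[OF ag, of e b] by auto
 ultimately show ?case
  using reaches_trans[OF reaches_trans[OF 1(1) 2(1)] r] 1 2 St.prems
  by (intro exI[of _ ?ms]) (auto simp: agree_def)
next
 case (Seq c1 c2)
 from Seq.prems have a: "at_pos P (pc ms) (ccom (pc ms) c1)"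
  "at_pos P (pc ms + csize c1) (ccom (pc ms + csize c1) c2)"
  by (auto simp: at_pos_append)
 obtain ms1 where 1: "reaches b P (tim b c1 s) ms ms1" "pc ms1 = pc ms + csize c1" "agree ms1 (sem b c1 s)"
  using Seq.IH(1)[OF a(1), of s] Seq.prems by auto
 obtain ms2 where 2: "reaches b P (tim b c2 (sem b c1 s)) ms1 ms2" "pc ms2 = pc ms1 + csize c2"
  "agree ms2 (sem b c2 (sem b c1 s))"
  using Seq.IH(2)[of ms1 "sem b c1 s"] a(2) 1 Seq.prems(2) sem_bounded[OF Seq.prems(4)]
  by (simp only: wfc.simps) blast
 show ?case using reaches_trans[OF 1(1) 2(1)] 1(2) 2(2,3) by (intro exI[of _ ms2]) simp
next
 case (Cond e c1 c2)
 from Cond.prems have a: "at_pos P (pc ms) (cexp 1000 e)"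
  "at_pos P (pc ms + esize e) [JumpZero 1000 (pc ms + esize e + csize c1 + 2)]"
  "at_pos P (pc ms + esize e + 1) (ccom (pc ms + esize e + 1) c1)"
  "at_pos P (pc ms + esize e + 1 + csize c1) [Jump (pc ms + esize e + csize c1 + csize c2 + 2)]"
  "at_pos P (pc ms + esize e + csize c1 + 2) (ccom (pc ms + esize e + csize c1 + 2) c2)"
  by (auto simp: at_pos_append at_pos_Cons[of _ _ _ "_ @ _"] at_pos_Cons[of _ _ "Jump _" "ccom _ _"] add.assoc)
 obtain ms1 where 1: "reaches b P (esize e) ms ms1" "pc ms1 = pc ms + esize e" "mem ms1 = mem ms"
  "reg ms1 1000 = eval b e (reg ms)" "\<forall>x<1000. reg ms1 x = reg ms x"
  using cexp_correct[OF a(1), of b] Cond.prems by auto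
 have v: "reg ms1 1000 = eval b e (fst s)" using 1 Cond.prems eval_agree[OF Cond.prems(3), of e b] by auto
 show ?case
 proof (cases "eval b e (fst s) = 0")
  case True
  let ?ms = "ms1\<lparr>pc := pc ms + esize e + csize c1 + 2\<rparr>"
  have r: "reaches b P 1 ms1 ?ms"
   using a(2) 1(2) v True by (intro reaches_step[OF _, where i="JumpZero 1000 (pc ms + esize e + csize c1 + 2)"]) auto
  have "agree ?ms s" using 1 Cond.prems by (auto simp: agree_def)
  then obtain ms2 where 2: "reaches b P (tim b c2 s) ?ms ms2" "pc ms2 = pc ?ms + csize c2" "agree ms2 (sem b c2 s)"
   using Cond.IH(2)[of ?ms s] a(5) Cond.prems by auto
  show ?thesis
   using reaches_trans[OF reaches_trans[OF 1(1) r] 2(1)] 2 True by (intro exI[of _ ms2]) auto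
 next
  case False
  let ?ms = "ms1\<lparr>pc := Suc (pc ms1)\<rparr>"
  have r: "reaches b P 1 ms1 ?ms"
   using a(2) 1(2) v False by (intro reaches_step[OF _, where i="JumpZero 1000 (pc ms + esize e + csize c1 + 2)"]) auto
  have "agree ?ms s" using 1 Cond.prems by (auto simp: agree_def)
  then obtain ms2 where 2: "reaches b P (tim b c1 s) ?ms ms2" "pc ms2 = pc ?ms + csize c1" "agree ms2 (sem b c1 s)"
   using Cond.IH(1)[of ?ms s] a(3) Cond.prems 1 by auto
  let ?ms3 = "ms2\<lparr>pc := pc ms + esize e + csize c1 + csize c2 + 2\<rparr>"
  have r3: "reaches b P 1 ms2 ?ms3"
   using a(4) 1(2) 2(2)
   by (intro reaches_step[OF _, where i="Jump (pc ms + esize e + csize c1 + csize c2 + 2)"]) auto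
  show ?thesis
   using reaches_trans[OF reaches_trans[OF reaches_trans[OF 1(1) r] 2(1)] r3] 2 False
   by (intro exI[of _ ?ms3]) (auto simp: agree_def add.assoc)
 qed
next
 case (For x p c)
 let ?l = "pc ms"
 from For.prems have a: "at_pos P ?l [Alu BitOr x p p]"
  "at_pos P (?l + 1) [JumpZero x (?l + csize c + 5)]"
  "at_pos P (?l + 2) [Const 1000 1]" "at_pos P (?l + 3) [Alu Minus x x 1000]"
  "at_pos P (?l + 4) (ccom (?l + 4) c)" "at_pos P (?l + 4 + csize c) [Jump (?l + 1)]"
  by (auto simp: at_pos_append at_pos_Cons2 at_pos_Cons[of _ _ _ "ccom _ _ @ _"] numeral_eq_Suc)
 let ?f = "\<lambda>i ms. sem b c (upd x i ms)" and ?g = "\<lambda>i ms. tim b c (upd x i ms)"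
 \<comment> \<open>The claim starts behind the initialisation of the counter, since that is where
   every iteration jumps back to.\<close>
 have loop: "\<exists>ms''. reaches b P (1 + loopt ?f ?g k s') ms' ms'' \<and> pc ms'' = ?l + csize c + 5 \<and>
        agree ms'' (loopf ?f k s')"
  if "pc ms' = ?l + 1" "agree ms' s'" "bounded_st b s'" "fst s' x = k" for k ms' s'
  using that
 proof (induction k arbitrary: ms' s')
  case 0
  let ?ms = "ms'\<lparr>pc := ?l + csize c + 5\<rparr>"
  have "reg ms' x = 0" using 0 For.prems by (auto simp: agree_def)
  hence "reaches b P 1 ms' ?ms"
   using a(2) 0 by (intro reaches_step[OF _, where i="JumpZero x (?l + csize c + 5)"]) auto
  thus ?case using 0 by (intro exI[of _ ?ms]) (auto simp: agree_def)
 next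
  case (Suc k)
  have b: "Suc k < 2 ^ b" using Suc.prems(3,4) unfolding bounded_st_def by metis
  have x: "reg ms' x = Suc k" using Suc.prems For.prems by (auto simp: agree_def)
  have b1: "b \<ge> 1" using b by (cases b) auto
  let ?ms1 = "ms'\<lparr>pc := ?l + 2\<rparr>"
  let ?ms2 = "set_reg 1000 1 ?ms1"
  let ?ms3 = "set_reg x k ?ms2"
  have r1: "reaches b P 1 ms' ?ms1"
   using a(2) Suc.prems x by (intro reaches_step[OF _, where i="JumpZero x (?l + csize c + 5)"]) auto
  have r2: "reaches b P 1 ?ms1 ?ms2"
   using a(3) b1 by (intro reaches_step[OF _, where i="Const 1000 1"]) auto
  have "take_bit b (Suc k + 2 ^ b - 1) = k"
  proof -
   have "Suc k + 2 ^ b - 1 = k + 2 ^ b" by simp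
   thus ?thesis using b by (simp add: take_bit_eq_mod)
  qed
  hence r3: "reaches b P 1 ?ms2 ?ms3"
   using a(4) x For.prems
   by (intro reaches_step[OF _, where i="Alu Minus x x 1000"]) (auto simp: set_reg_def numeral_3_eq_3)
  have ag: "agree ?ms3 (upd x k s')"
   using Suc.prems For.prems by (auto simp: agree_def set_reg_def)
  have bd: "bounded_st b (upd x k s')" using Suc.prems b by (intro bounded_upd) auto
  have pc3: "pc ?ms3 = ?l + 4" by (simp add: set_reg_def)
  then obtain ms4 where 4: "reaches b P (?g k s') ?ms3 ms4" "pc ms4 = ?l + 4 + csize c"
   "agree ms4 (?f k s')"
   using For.IH[of ?ms3 "upd x k s'"] a(5) ag bd For.prems by auto
  let ?ms5 = "ms4\<lparr>pc := ?l + 1\<rparr>"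
  have r5: "reaches b P 1 ms4 ?ms5"
   using a(6) 4 by (intro reaches_step[OF _, where i="Jump (?l + 1)"]) auto
  have "agree ?ms5 (?f k s')" using 4 by (auto simp: agree_def)
  moreover have "bounded_st b (?f k s')" using bd sem_bounded by auto
  moreover have "fst (?f k s') x = k" using For.prems by simp
  ultimately obtain ms6 where 6: "reaches b P (1 + loopt ?f ?g k (?f k s')) ?ms5 ms6"
   "pc ms6 = ?l + csize c + 5" "agree ms6 (loopf ?f k (?f k s'))"
   using Suc.IH[of ?ms5 "?f k s'"] by auto
  have "1 + 1 + 1 + ?g k s' + 1 + (1 + loopt ?f ?g k (?f k s')) = 1 + loopt ?f ?g (Suc k) s'"
   by simp
  thus ?case
   using reaches_trans[OF reaches_trans[OF reaches_trans[OF reaches_trans[OF reaches_trans[OF r1 r2] r3] 4(1)] r5] 6(1)] 6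
   by (intro exI[of _ ms6]) (auto simp del: loopt.simps)
 qed
 let ?ms1 = "set_reg x (reg ms p) ms"
 have r1: "reaches b P 1 ms ?ms1"
  using a(1) by (intro reaches_step[OF _, where i="Alu BitOr x p p"]) auto
 have "agree ?ms1 (upd x (fst s p) s)" using For.prems by (auto simp: agree_def set_reg_def)
 moreover have "bounded_st b (upd x (fst s p) s)"
  using For.prems by (intro bounded_upd) (auto simp: bounded_st_def)
 ultimately obtain ms2 where 2: "reaches b P (1 + loopt ?f ?g (fst s p) (upd x (fst s p) s)) ?ms1 ms2"
  "pc ms2 = ?l + csize c + 5" "agree ms2 (loopf ?f (fst s p) (upd x (fst s p) s))"
  using loop[of ?ms1 "upd x (fst s p) s" "fst s p"] by (auto simp: set_reg_def)
 show ?case using reaches_trans[OF r1 2(1)] 2 by (intro exI[of _ ms2]) auto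
qed

lemma run_halted: "halted P ms ==> run b P t ms = return_pmf ms"
 by (induction t) (auto simp: bind_return_pmf step_def)

section \<open>Averages over independent uniform words, and the machine loop that draws them\<close>

section \<open>Uniformly random words\<close>

text \<open>Averages over \<open>k\<close> independent uniformly random elements of \<open>{..<B}\<close>.\<close>

primrec avg :: "nat => nat => ((nat => nat) => real) => real" where
 "avg B 0 f = f (\<lambda>_. 0)"
| "avg B (Suc k) f = (\<Sum>v<B. avg B k (\<lambda>g. f (g(k := v)))) / real B"

primrec words :: "nat => nat => (nat => nat) pmf" where
 "words b 0 = return_pmf (\<lambda>_. 0)"
| "words b (Suc k) =
  bind_pmf (pmf_of_set {..<2 ^ b}) (\<lambda>v. bind_pmf (words b k) (\<lambda>f. return_pmf (f(k := v))))"

lemma set_pmf_of_set_less [simp]: "set_pmf (pmf_of_set {..<(2::nat) ^ b}) = {..<2 ^ b}"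
 by (rule set_pmf_of_set) (auto simp: lessThan_empty_iff)

lemma finite_words: "finite (set_pmf (words b k))"
 by (induction k) auto

lemma words_bounded: "f \<in> set_pmf (words b k) ==> f i < 2 ^ b"
 by (induction k arbitrary: f) auto

text \<open>Passes from probabilities to iterated finite averages, in which single words can be
  resampled and blocks of words split off.\<close>

lemma expectation_words:
 "measure_pmf.expectation (words b k) f = avg (2 ^ b) k f" for f :: "(nat => nat) => real"
proof (induction k arbitrary: f)
 case (Suc k)
 have "measure_pmf.expectation (words b (Suc k)) f =
   (\<Sum>v<2 ^ b. measure_pmf.expectation (words b k \<bind> (\<lambda>g. return_pmf (g(k := v)))) f /\<^sub>R real (2 ^ b))"
  unfolding words.simps
  by (subst pmf_expectation_bind_pmf_of_set)
   (auto simp: lessThan_empty_iff sum_divide_distrib sum_distrib_left finite_words divide_inverse)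
 also have "\<dots> = (\<Sum>v<2 ^ b. measure_pmf.expectation (words b k) (\<lambda>g. f (g(k := v))) /\<^sub>R real (2 ^ b))"
  by (simp add: map_pmf_def [symmetric])
 also have "\<dots> = avg (2 ^ b) (Suc k) f"
  by (simp add: Suc.IH sum_divide_distrib divide_inverse sum_distrib_left mult.commute)
 finally show ?case .
qed simp

lemma prob_words: "measure_pmf.prob (words b k) A = avg (2 ^ b) k (indicator A)"
 by (simp add: expectation_words [symmetric])

lemma avg_cong:
 assumes "\<And>g. (\<And>i. i < k ==> g i < B) ==> (\<And>i. k \<le> i ==> g i = 0) ==> f g = f' g"
 shows "avg B k f = avg B k f'"
 using assms
proof (induction k arbitrary: f f')
 case (Suc k)
 have "avg B k (\<lambda>g. f (g(k := v))) = avg B k (\<lambda>g. f' (g(k := v)))" if "v < B" for v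
  using that by (intro Suc.IH Suc.prems) (auto simp: less_Suc_eq)
 thus ?case by simp
qed auto

lemma avg_mono:
 assumes "\<And>g. (\<And>i. i < k ==> g i < B) ==> f g \<le> f' g"
 shows "avg B k f \<le> avg B k f'"
 using assms
proof (induction k arbitrary: f f')
 case (Suc k)
 have "avg B k (\<lambda>g. f (g(k := v))) \<le> avg B k (\<lambda>g. f' (g(k := v)))" if "v < B" for v
  using that by (intro Suc.IH Suc.prems) (auto simp: less_Suc_eq)
 thus ?case by (auto intro!: divide_right_mono sum_mono)
qed auto

lemma avg_add: "avg B k (\<lambda>g. f g + f' g) = avg B k f + avg B k f'"
 by (induction k arbitrary: f f') (auto simp: sum.distrib add_divide_distrib)

lemma avg_cmult: "avg B k (\<lambda>g. c * f g) = c * avg B k f"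
 by (induction k arbitrary: f) (auto simp: sum_distrib_left)

lemma avg_const: "0 < B ==> avg B k (\<lambda>g. c) = c"
 by (induction k) auto

lemma avg_sum: "0 < B ==> avg B k (\<lambda>g. \<Sum>x\<in>A. f x g) = (\<Sum>x\<in>A. avg B k (f x))"
 by (induction A rule: infinite_finite_induct) (auto simp: avg_add avg_const)

lemma avg_divide: "avg B k (\<lambda>g. f g / c) = avg B k f / c"
 using avg_cmult[of B k "1 / c" f] by simp

text \<open>Used to single out the one word of a hash function that randomises a given value, with
  all other words held fixed.\<close>

lemma avg_resample:
 assumes "0 < B" "i < k"
 shows "avg B k f = avg B k (\<lambda>g. (\<Sum>v<B. f (g(i := v))) / real B)"
 using assms(2)
proof (induction k arbitrary: f)
 case (Suc k)
 show ?case
 proof (cases "i = k")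
  case True
  have "avg B (Suc k) (\<lambda>g. (\<Sum>v<B. f (g(i := v))) / real B) =
    (\<Sum>u<B. avg B k (\<lambda>g. (\<Sum>v<B. f (g(k := v))) / real B)) / real B"
   by (simp only: avg.simps True fun_upd_upd)
  also have "\<dots> = avg B (Suc k) f"
   using assms(1) by (simp add: avg_divide avg_sum)
  finally show ?thesis by (rule sym)
 next
  case False
  hence "avg B k (\<lambda>g. f (g(k := u))) = avg B k (\<lambda>g. (\<Sum>v<B. f (g(k := u, i := v))) / real B)" for u
   using Suc.prems by (subst Suc.IH) (auto simp: fun_upd_twist)
  thus ?thesis unfolding avg.simps by (simp only:)
 qed
qed simp

definition glue :: "nat => (nat => nat) => (nat => nat) => nat => nat" where
 "glue a lo hi i = (if i < a then lo i else hi (i - a))"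

lemma glue_simps [simp]: "i < a ==> glue a lo hi i = lo i" "glue a lo hi (a + i) = hi i"
 by (auto simp: glue_def)

text \<open>Fubini: the words from \<open>a\<close> on are drawn first, and the average over the
  others is taken given these. Chains visit the columns with the highest words first, so this is the
  order of a walk.\<close>

lemma avg_split: "avg B (a + c) f = avg B c (\<lambda>hi. avg B a (\<lambda>lo. f (glue a lo hi)))"
proof (induction c arbitrary: f)
 case 0
 have "glue a g (\<lambda>_. 0) = g" if "\<And>i. a \<le> i ==> g i = 0" for g
  using that by (auto simp: glue_def fun_eq_iff)
 thus ?case by (auto intro: avg_cong)
next
 case (Suc c)
 have "(glue a lo hi)(a + c := v) = glue a lo (hi(c := v))" for lo hi v
  by (auto simp: glue_def fun_eq_iff)
 thus ?case by (simp add: Suc.IH)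
qed

subsection \<open>Drawing the words\<close>

text \<open>All randomness is drawn here. The loop is written in machine code because the structured
  language is deterministic; the words go to memory from the address in register \<open>a\<close>
  on.\<close>

definition rand_loop :: "nat => nat => nat => nat => instr list" where
 "rand_loop l x p a =
  [Alu BitOr x p p, JumpZero x (l + 8), Const 1000 1, Alu Minus x x 1000,
   Rand 1000, Alu Plus 1001 a x, Store 1001 1000, Jump (l + 1)]"

definition overlay :: "nat => nat => (nat => nat) => (nat => nat) => nat => nat" where
 "overlay a k \<rho> m i = (if a \<le> i \<and> i < a + k then \<rho> (i - a) else m i)"

text \<open>A coupling: every outcome of \<open>words\<close> is matched with the configuration that
  has it in memory. The recursion of \<open>words\<close> fixes the word of highest index first,
  just as the loop counts down. One round takes 7 instructions.\<close>

lemma rand_loop_aux: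
 assumes "at_pos P l (rand_loop l x p a)" "x < 1000" "a < 1000" "x \<noteq> a"
  and "pc ms = l + 1" "agree ms s" "fst s x = k" "k < 2 ^ b" "fst s a + k \<le> 2 ^ b"
 shows "rel_pmf (\<lambda>\<rho> ms'. pc ms' = l + 8 \<and> agree ms' ((fst s)(x := 0), overlay (fst s a) k \<rho> (snd s)))
     (words b k) (run b P (1 + 7 * k) ms)"
 using assms(5-)
proof (induction k arbitrary: ms s)
 case 0
 have "at_pos P (l + 1) [JumpZero x (l + 8)]"
  using assms(1) by (auto simp: rand_loop_def at_pos_Cons2)
 hence "reaches b P 1 ms (ms\<lparr>pc := l + 8\<rparr>)"
  using 0 assms by (intro reaches_step[OF _, where i="JumpZero x (l + 8)"]) (auto simp: agree_def)
 moreover have "overlay (fst s a) 0 \<rho> m = m" for \<rho> m by (auto simp: overlay_def fun_eq_iff)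
 ultimately show ?case using 0
  by (auto simp: reaches_def rel_pmf_return_pmf1 agree_def)
next
 case (Suc k)
 have a: "at_pos P (l + 1) [JumpZero x (l + 8)]" "at_pos P (l + 2) [Const 1000 1]"
  "at_pos P (l + 3) [Alu Minus x x 1000]" "at_pos P (l + 4) [Rand 1000]"
  "at_pos P (l + 5) [Alu Plus 1001 a x]" "at_pos P (l + 6) [Store 1001 1000]"
  "at_pos P (l + 7) [Jump (l + 1)]"
  using assms(1) by (auto simp: rand_loop_def at_pos_Cons2 numeral_eq_Suc)
 have l: "l + 3 = Suc (Suc (Suc l))" "l + 4 = Suc (Suc (Suc (Suc l)))"
  "l + 5 = Suc (Suc (Suc (Suc (Suc l))))" "l + 6 = Suc (Suc (Suc (Suc (Suc (Suc l)))))" by simp_all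
 have x: "reg ms x = Suc k" using Suc.prems assms by (auto simp: agree_def)
 have b1: "b \<ge> 1" using Suc.prems by (cases b) auto
 let ?ms1 = "ms\<lparr>pc := l + 2\<rparr>"
 let ?ms2 = "set_reg 1000 1 ?ms1"
 let ?ms3 = "set_reg x k ?ms2"
 have r1: "reaches b P 1 ms ?ms1"
  using a(1) Suc.prems x by (intro reaches_step[OF _, where i="JumpZero x (l + 8)"]) auto
 have r2: "reaches b P 1 ?ms1 ?ms2"
  using a(2) b1 by (intro reaches_step[OF _, where i="Const 1000 1"]) auto
 have "Suc k + 2 ^ b - 1 = k + 2 ^ b" by simp
 hence "take_bit b (Suc k + 2 ^ b - 1) = k"
  using Suc.prems by (simp add: take_bit_eq_mod)
 hence r3: "reaches b P 1 ?ms2 ?ms3"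
  using a(3) x assms by (intro reaches_step[OF _, where i="Alu Minus x x 1000"]) (auto simp: set_reg_def l)
 have r13: "run b P 3 ms = return_pmf ?ms3"
  using reaches_trans[OF reaches_trans[OF r1 r2] r3] by (simp add: reaches_def numeral_3_eq_3)
 have r4: "run b P 1 ?ms3 = bind_pmf (pmf_of_set {..<2 ^ b}) (\<lambda>v. return_pmf (set_reg 1000 v ?ms3))"
  using at_pos_nth[OF a(4)]
  by (simp add: step_def halted_def set_reg_def bind_return_pmf map_pmf_def l)
 let ?s = "\<lambda>v. ((fst s)(x := k), (snd s)(fst s a + k := v))"
 let ?ms6 = "\<lambda>v. (set_reg 1001 (fst s a + k) (set_reg 1000 v ?ms3))\<lparr>pc := l + 1, mem := snd (?s v)\<rparr>"
 have r6: "run b P 3 (set_reg 1000 v ?ms3) = return_pmf (?ms6 v)" if "v < 2 ^ b" for v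
 proof -
  let ?\<tau> = "set_reg 1000 v ?ms3"
  have "take_bit b (fst s a + k) = fst s a + k"
   using Suc.prems by (simp add: take_bit_nat_eq_self)
  hence "reaches b P 1 ?\<tau> (set_reg 1001 (fst s a + k) ?\<tau>)"
   using a(5) Suc.prems assms
   by (intro reaches_step[OF _, where i="Alu Plus 1001 a x"]) (auto simp: set_reg_def agree_def l)
  moreover have "reaches b P 1 (set_reg 1001 (fst s a + k) ?\<tau>)
    ((set_reg 1001 (fst s a + k) ?\<tau>)\<lparr>pc := l + 7, mem := snd (?s v)\<rparr>)"
   using a(6) Suc.prems assms
   by (intro reaches_step[OF _, where i="Store 1001 1000"]) (auto simp: set_reg_def agree_def l)
  moreover have "reaches b P 1 ((set_reg 1001 (fst s a + k) ?\<tau>)\<lparr>pc := l + 7, mem := snd (?s v)\<rparr>) (?ms6 v)"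
   using a(7) by (intro reaches_step[OF _, where i="Jump (l + 1)"]) auto
  ultimately show ?thesis
   using reaches_trans[OF reaches_trans] by (fastforce simp: reaches_def numeral_3_eq_3)
 qed
 have "run b P (1 + 7 * Suc k) ms =
   bind_pmf (run b P 3 ms) (\<lambda>ms3. bind_pmf (run b P 1 ms3) (\<lambda>ms4. bind_pmf (run b P 3 ms4) (run b P (1 + 7 * k))))"
 proof -
  have eq: "1 + 7 * Suc k = 3 + (1 + (3 + (1 + 7 * k)))" by simp
  have "run b P (s + t) = (\<lambda>ms. bind_pmf (run b P s ms) (run b P t))" for s t
   by (rule ext) (rule run_add)
  hence "run b P (s + (t + (u + v))) ms =
   bind_pmf (run b P s ms) (\<lambda>ms3. bind_pmf (run b P t ms3) (\<lambda>ms4. bind_pmf (run b P u ms4) (run b P v)))" for s t u v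
   by (simp only:)
  thus ?thesis unfolding eq .
 qed
 also have "\<dots> = bind_pmf (pmf_of_set {..<2 ^ b}) (\<lambda>v. bind_pmf (run b P 3 (set_reg 1000 v ?ms3)) (run b P (1 + 7 * k)))"
  by (simp only: r13 r4 bind_return_pmf bind_assoc_pmf)
 also have "\<dots> = bind_pmf (pmf_of_set {..<2 ^ b}) (\<lambda>v. run b P (1 + 7 * k) (?ms6 v))"
  by (intro bind_pmf_cong refl, subst r6) (simp_all only: set_pmf_of_set_less lessThan_iff bind_return_pmf)
 finally have run: "run b P (1 + 7 * Suc k) ms = \<dots>" .
 have IH: "rel_pmf (\<lambda>\<rho> ms'. pc ms' = l + 8 \<and> agree ms' ((fst s)(x := 0), overlay (fst s a) k \<rho> (snd (?s v))))
     (words b k) (run b P (1 + 7 * k) (?ms6 v))" for v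
 proof -
  have ag: "agree (?ms6 v) (?s v)" using Suc.prems assms by (auto simp: set_reg_def agree_def)
  have eq: "(fst (?s v))(x := 0) = (fst s)(x := 0)" "fst (?s v) a = fst s a" using assms by auto
  have "fst (?s v) a + k \<le> 2 ^ b" "k < 2 ^ b" unfolding eq using Suc.prems by auto
  from Suc.IH[OF _ ag _ this(2,1)] show ?thesis unfolding eq by (simp del: fun_upd_apply add: fun_upd_same)
 qed
 have ov: "overlay c k \<rho> (m(c + k := v)) = overlay c (Suc k) (\<rho>(k := v)) m" for c \<rho> m v
  by (auto simp: overlay_def fun_eq_iff)
 show ?case
  unfolding run words.simps
 proof (rule rel_pmf_bindI[where R="(=)"])
  show "rel_pmf (=) (pmf_of_set {..<(2::nat) ^ b}) (pmf_of_set {..<2 ^ b})" by (simp add: pmf.rel_eq)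
  fix v v' :: nat assume "v = v'"
  thus "rel_pmf (\<lambda>\<rho> ms'. pc ms' = l + 8 \<and> agree ms' ((fst s)(x := 0), overlay (fst s a) (Suc k) \<rho> (snd s)))
    (words b k \<bind> (\<lambda>f. return_pmf (f(k := v)))) (run b P (1 + 7 * k) (?ms6 v'))"
   using IH[of v]
   by (simp add: map_pmf_def[symmetric] pmf.rel_map ov del: run.simps fun_upd_apply)
 qed
qed

definition rand_program :: "com => nat => nat => nat => com => program" where
 "rand_program c0 x p a c1 =
  ccom 0 c0 @ rand_loop (csize c0) x p a @ ccom (csize c0 + 8) c1"

lemma rel_pmf_measure_le:
 assumes "rel_pmf R p q" "\<And>x y. x \<in> A ==> R x y ==> y \<in> B"
 shows "measure_pmf.prob p A \<le> measure_pmf.prob q B"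
proof -
 have "measure_pmf.prob p A \<le> measure_pmf.prob q {y. \<exists>x\<in>A. R x y}"
  by (rule rel_pmf_measureD[OF assms(1)])
 also have "\<dots> \<le> measure_pmf.prob q B"
  using assms(2) by (intro measure_pmf.finite_measure_mono) auto
 finally show ?thesis .
qed

text \<open>After this coupling, a probability about final configurations is a probability about
  \<open>words\<close>. The time bound has to hold for every outcome, so that the same
  \<open>T\<close> serves all of them.\<close>

theorem rand_program_correct:
 fixes s :: st and c0 c1 :: com and b x p a :: nat
 defines "s1 \<equiv> sem b c0 s"
 defines "k \<equiv> fst s1 p"
 defines "s2 \<equiv> \<lambda>\<rho>. ((fst s1)(x := 0), overlay (fst s1 a) k \<rho> (snd s1))"
 assumes wf: "wfc c0" "wfc c1" "x < 1000" "p < 1000" "a < 1000" "x \<noteq> a" "x \<noteq> p"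
  and init: "pc ms = 0" "agree ms s" "bounded_st b s" and fits: "fst s1 a + k \<le> 2 ^ b"
  and T: "\<And>\<rho>. tim b c0 s + (2 + 7 * k) + tim b c1 (s2 \<rho>) \<le> T"
 shows "rel_pmf (\<lambda>\<rho> ms'. halted (rand_program c0 x p a c1) ms' \<and> agree ms' (sem b c1 (s2 \<rho>)))
     (words b k) (run b (rand_program c0 x p a c1) T ms)"
proof -
 let ?P = "rand_program c0 x p a c1"
 have at: "at_pos ?P 0 (ccom 0 c0)" "at_pos ?P (csize c0) (rand_loop (csize c0) x p a)"
  "at_pos ?P (csize c0 + 8) (ccom (csize c0 + 8) c1)"
 proof -
  have "at_pos ?P 0 (ccom 0 c0 @ rand_loop (csize c0) x p a @ ccom (csize c0 + 8) c1)"
   by (auto simp: at_pos_def rand_program_def)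
  thus "at_pos ?P 0 (ccom 0 c0)" "at_pos ?P (csize c0) (rand_loop (csize c0) x p a)"
   "at_pos ?P (csize c0 + 8) (ccom (csize c0 + 8) c1)"
   unfolding at_pos_append by (auto simp: rand_loop_def eval_nat_numeral)
 qed
 obtain ms1 where 1: "reaches b ?P (tim b c0 s) ms ms1" "pc ms1 = csize c0" "agree ms1 s1"
  using ccom_correct[of ?P ms c0 s b] at(1) init wf by (auto simp: s1_def)
 have bd1: "bounded_st b s1" unfolding s1_def by (rule sem_bounded[OF init(3)])
 hence kb: "k < 2 ^ b" by (simp add: bounded_st_def k_def)
 let ?ms2 = "set_reg x (reg ms1 p) ms1"
 have "at_pos ?P (csize c0) [Alu BitOr x p p]"
  using at(2) by (auto simp: rand_loop_def at_pos_Cons2)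
 hence 2: "reaches b ?P 1 ms1 ?ms2"
  using 1 by (intro reaches_step[OF _, where i="Alu BitOr x p p"]) auto
 let ?t = "tim b c0 s + 1"
 let ?u = "T - (?t + (1 + 7 * k))"
 have 3: "rel_pmf (\<lambda>\<rho> ms'. pc ms' = csize c0 + 8 \<and> agree ms' (s2 \<rho>))
     (words b k) (run b ?P (1 + 7 * k) ?ms2)"
  using rand_loop_aux[OF at(2), of ?ms2 "upd x k s1" k b] wf 1 kb fits
  by (auto simp: set_reg_def agree_def k_def s2_def)
 have 4: "run b ?P ?t ms = return_pmf ?ms2"
  using reaches_trans[OF 1(1) 2] by (simp add: reaches_def)
 have "T = ?t + ((1 + 7 * k) + ?u)" using T[of undefined] by simp
 hence "run b ?P T ms = bind_pmf (run b ?P ?t ms) (\<lambda>ms. bind_pmf (run b ?P (1 + 7 * k) ms) (run b ?P ?u))"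
  by (metis (no_types, lifting) run_add bind_pmf_cong)
 also have "\<dots> = bind_pmf (run b ?P (1 + 7 * k) ?ms2) (run b ?P ?u)"
  by (simp only: 4 bind_return_pmf)
 finally have run: "run b ?P T ms = \<dots>" .
 \<comment> \<open>The time that remains after the last instruction is spent in the halted
   configuration.\<close>
 have fin: "rel_pmf (\<lambda>\<rho> ms'. halted ?P ms' \<and> agree ms' (sem b c1 (s2 \<rho>))) (return_pmf \<rho>) (run b ?P ?u ms')"
  if r: "\<rho> \<in> set_pmf (words b k)" "pc ms' = csize c0 + 8" "agree ms' (s2 \<rho>)" for \<rho> ms'
 proof -
  have "bounded_st b (s2 \<rho>)"
   using bd1 words_bounded[OF r(1)] by (auto simp: s2_def bounded_st_def overlay_def)
  then obtain ms'' where 5: "reaches b ?P (tim b c1 (s2 \<rho>)) ms' ms''" "pc ms'' = csize c0 + 8 + csize c1"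
   "agree ms'' (sem b c1 (s2 \<rho>))"
   using ccom_correct[of ?P ms' c1 "s2 \<rho>" b] at(3) r(3) wf unfolding r(2) by auto
  have h: "halted ?P ms''" using 5 by (simp add: halted_def rand_program_def rand_loop_def)
  have "?u = tim b c1 (s2 \<rho>) + (?u - tim b c1 (s2 \<rho>))" using T[of \<rho>] by simp
  hence "run b ?P ?u ms' = bind_pmf (run b ?P (tim b c1 (s2 \<rho>)) ms') (run b ?P (?u - tim b c1 (s2 \<rho>)))"
   by (metis run_add)
  also have "\<dots> = return_pmf ms''"
   using 5(1) run_halted[OF h] by (simp add: reaches_def bind_return_pmf)
  finally show ?thesis using 5 h by simp
 qed
 show ?thesis
  unfolding run
  by (subst bind_return_pmf'[symmetric])
   (rule rel_pmf_bindI[OF pmf.rel_mono_strong[OF 3, of "\<lambda>\<rho> ms'. \<rho> \<in> set_pmf (words b k) \<and> pc ms' = csize c0 + 8 \<and> agree ms' (s2 \<rho>)"]],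
    use fin in auto)
qed

theorem com_program_correct:
 assumes "wfc c" "pc ms = 0" "agree ms s" "bounded_st b s" "tim b c s \<le> T"
 shows "\<exists>ms'. run b (ccom 0 c) T ms = return_pmf ms' \<and> halted (ccom 0 c) ms' \<and> agree ms' (sem b c s)"
proof -
 have "at_pos (ccom 0 c) 0 (ccom 0 c)" by (auto simp: at_pos_def)
 then obtain ms' where 1: "reaches b (ccom 0 c) (tim b c s) ms ms'" "pc ms' = csize c" "agree ms' (sem b c s)"
  using ccom_correct[of "ccom 0 c" ms c s b] assms by auto
 have h: "halted (ccom 0 c) ms'" using 1 by (simp add: halted_def)
 have "run b (ccom 0 c) T ms = bind_pmf (run b (ccom 0 c) (tim b c s) ms) (run b (ccom 0 c) (T - tim b c s))"
  using assms(5) by (metis le_add_diff_inverse run_add)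
 thus ?thesis using 1 h run_halted[OF h] by (auto simp: reaches_def bind_return_pmf)
qed

section \<open>Second moment analysis of rainbow tables\<close>

section \<open>Rainbow tables\<close>

lemma digits_less: "i < m ==> j < n ==> i * n + j < m * n" for i j m n :: nat
proof -
 assume "i < m" "j < n"
 hence "i * n + j < Suc i * n" by simp
 also have "\<dots> \<le> m * n" using \<open>i < m\<close> by (intro mult_le_mono1) simp
 finally show ?thesis .
qed

subsection \<open>A pairwise independent hash family\<close>

text \<open>An offset plus the words selected by the bits of \<open>y\<close>. This takes only
  additions of single words, and it is pairwise independent for every modulus that divides the
  number of word values.\<close>

definition hash :: "nat => nat => (nat => nat) => nat => nat" where
 "hash K N g y = (g 0 + (\<Sum>k<K. (y div 2 ^ k mod 2) * g (Suc k))) mod N"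

lemma sum_periodic:
 fixes \<phi> :: "nat => real"
 assumes "0 < N"
 shows "(\<Sum>v<N * m. \<phi> ((c + v) mod N)) = real m * (\<Sum>x<N. \<phi> x)"
proof (induction m)
 case (Suc m)
 have "(\<Sum>v<N * Suc m. \<phi> ((c + v) mod N)) =
   (\<Sum>v<N * m. \<phi> ((c + v) mod N)) + (\<Sum>v\<in>{N * m..<N * m + N}. \<phi> ((c + v) mod N))"
  by (simp add: lessThan_atLeast0 sum.atLeastLessThan_concat add.commute[of N])
 also have "(\<Sum>v\<in>{N * m..<N * m + N}. \<phi> ((c + v) mod N)) = (\<Sum>v<N. \<phi> ((c + v) mod N))"
  using sum.shift_bounds_nat_ivl[of "\<lambda>v. \<phi> ((c + v) mod N)" 0 "N * m" N]
  by (simp add: lessThan_atLeast0 add.commute[of _ "N * m"] add.left_commute[of c "N * m"])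
 also have "\<dots> = (\<Sum>x<N. \<phi> x)"
 proof (rule sum.reindex_bij_betw)
  have inj: "inj_on (\<lambda>v. (c + v) mod N) {..<N}"
  proof (rule inj_onI)
   have aux: "u = v" if "u \<le> v" "v < N" "(c + v) mod N = (c + u) mod N" for u v
    using that mod_eq_dvd_iff_nat[of "c + u" "c + v" N] by (auto dest: dvd_imp_le)
   fix u v assume "u \<in> {..<N}" "v \<in> {..<N}" "(c + u) mod N = (c + v) mod N"
   thus "u = v"
    using aux[of u v] aux[of v u] by (cases "u \<le> v") auto
  qed
  moreover have "(\<lambda>v. (c + v) mod N) ` {..<N} \<subseteq> {..<N}" using assms by auto
  ultimately have "(\<lambda>v. (c + v) mod N) ` {..<N} = {..<N}"
   by (intro card_subset_eq) (auto simp: card_image)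
  with inj show "bij_betw (\<lambda>v. (c + v) mod N) {..<N} {..<N}" by (simp add: bij_betw_def)
 qed
 finally show ?case using Suc by (simp add: algebra_simps)
qed simp

text \<open>Since \<open>N\<close> divides \<open>B\<close>, the sums \<open>c + v\<close> run
  through whole periods and hit every residue equally often.\<close>

lemma avg_mod:
 fixes \<phi> :: "nat => real"
 assumes "N dvd B" "0 < B"
 shows "(\<Sum>v<B. \<phi> ((c + v) mod N)) / real B = (\<Sum>x<N. \<phi> x) / real N"
proof -
 obtain m where m: "B = N * m" using assms by (auto elim: dvdE)
 hence "N > 0" "m > 0" using assms by auto
 thus ?thesis using sum_periodic[of N \<phi> c m] by (simp add: m field_simps)
qed

lemma hash_upd_0: "hash K N (g(0 := v)) y = ((\<Sum>k<K. (y div 2 ^ k mod 2) * g (Suc k)) + v) mod N"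
 by (simp add: hash_def add.commute)

lemma avg_hash:
 fixes \<phi> :: "nat => real"
 assumes "N dvd B" "0 < B"
 shows "avg B (Suc K) (\<lambda>g. \<phi> (hash K N g y)) = (\<Sum>x<N. \<phi> x) / real N"
 using assms by (subst avg_resample[of _ 0]) (auto simp: hash_upd_0 avg_mod avg_const)

lemma bits_differ:
 fixes y y' :: nat
 assumes "y \<noteq> y'" "y < 2 ^ K" "y' < 2 ^ K"
 shows "\<exists>k<K. y div 2 ^ k mod 2 \<noteq> y' div 2 ^ k mod 2"
proof (rule ccontr)
 assume "\<not> ?thesis"
 hence "bit y k = bit y' k" if "k < K" for k
  using that by (auto simp: bit_iff_odd even_iff_mod_2_eq_zero)
 hence "take_bit K y = take_bit K y'"
  by (auto simp: bit_eq_iff bit_take_bit_iff)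
 thus False using assms by (simp add: take_bit_nat_eq_self)
qed

text \<open>Choose a bit \<open>k\<close> in which \<open>y\<close> and \<open>y'\<close> differ, so
  that word \<open>Suc k\<close> enters exactly one of the two values. Averaging over this word
  makes that value uniform whatever the other one is; averaging over word 0 then makes the other one
  uniform.\<close>

lemma avg_hash2:
 fixes \<phi> :: "nat => nat => real"
 assumes "N dvd B" "0 < B" "y \<noteq> y'" "y < 2 ^ K" "y' < 2 ^ K"
 shows "avg B (Suc K) (\<lambda>g. \<phi> (hash K N g y) (hash K N g y')) =
     (\<Sum>x<N. \<Sum>x'<N. \<phi> x x') / (real N)\<^sup>2"
proof -
 have aux: "avg B (Suc K) (\<lambda>g. \<phi> (hash K N g y) (hash K N g y')) =
     (\<Sum>x<N. \<Sum>x'<N. \<phi> x x') / (real N)\<^sup>2"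
  if k: "k < K" "y div 2 ^ k mod 2 = 0" "y' div 2 ^ k mod 2 = 1"
  for k y y' and \<phi> :: "nat => nat => real"
 proof -
  let ?S = "\<lambda>g y. \<Sum>j\<in>{..<K} - {k}. (y div 2 ^ j mod 2) * g (Suc j)"
  have split: "(\<Sum>j<K. (y div 2 ^ j mod 2) * g (Suc j)) = (y div 2 ^ k mod 2) * g (Suc k) + ?S g y" for g y
   using k by (intro sum.remove) auto
  have h: "hash K N (g(0 := u, Suc k := v)) y = (?S g y + u) mod N"
   "hash K N (g(0 := u, Suc k := v)) y' = ((?S g y' + u) + v) mod N" for g u v
   unfolding hash_def split using k by (auto intro!: arg_cong[of _ _ "\<lambda>x. x mod N"] sum.cong)
  have "avg B (Suc K) (\<lambda>g. \<phi> (hash K N g y) (hash K N g y')) =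
    avg B (Suc K) (\<lambda>g. (\<Sum>v<B. \<phi> (hash K N (g(Suc k := v)) y) (hash K N (g(Suc k := v)) y')) / real B)"
   using assms(2) k by (subst avg_resample[of _ "Suc k"]) auto
  also have "\<dots> = avg B (Suc K) (\<lambda>g. (\<Sum>u<B. (\<Sum>v<B. \<phi> (hash K N (g(0 := u, Suc k := v)) y)
    (hash K N (g(0 := u, Suc k := v)) y')) / real B) / real B)"
   using assms(2) by (subst avg_resample[of _ 0]) auto
  also have "\<dots> = avg B (Suc K) (\<lambda>g. (\<Sum>x<N. \<Sum>x'<N. \<phi> x x') / (real N)\<^sup>2)"
  proof -
   have "(\<Sum>u<B. (\<Sum>v<B. \<phi> ((a + u) mod N) ((c + u + v) mod N)) / real B) / real B =
     (\<Sum>x<N. \<Sum>x'<N. \<phi> x x') / (real N)\<^sup>2" for a c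
   proof -
    have "(\<Sum>u<B. (\<Sum>v<B. \<phi> ((a + u) mod N) ((c + u + v) mod N)) / real B) / real B =
      (\<Sum>u<B. (\<Sum>x'<N. \<phi> ((a + u) mod N) x') / real N) / real B"
     by (simp only: avg_mod[OF assms(1,2)])
    also have "\<dots> = (\<Sum>x<N. (\<Sum>x'<N. \<phi> x x') / real N) / real N"
     by (rule avg_mod[OF assms(1,2)])
    finally show ?thesis by (simp add: sum_divide_distrib power2_eq_square)
   qed
   thus ?thesis by (simp only: h)
  qed
  also have "\<dots> = (\<Sum>x<N. \<Sum>x'<N. \<phi> x x') / (real N)\<^sup>2"
   using assms(2) by (rule avg_const)
  finally show ?thesis .
 qed
 obtain k where k: "k < K" "y div 2 ^ k mod 2 \<noteq> y' div 2 ^ k mod 2"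
  using bits_differ assms by blast
 show ?thesis
 proof (cases "y div 2 ^ k mod 2 = 0")
  case True
  thus ?thesis using k by (intro aux[of k]) auto
 next
  case False
  thus ?thesis using k aux[of k y' y "\<lambda>x x'. \<phi> x' x"] by (subst sum.swap) auto
 qed
qed

declare avg.simps(2) [simp del]

subsection \<open>Chains\<close>

locale rainbow =
 fixes B K N g :: nat and F :: "nat => nat"
 assumes N_dvd: "N dvd B" and B_pos: "0 < B"
  and F_less: "\<And>x. x < N ==> F x < 2 ^ K"
  and bucket: "\<And>x. x < N ==> card {x'. x' < N \<and> F x' = F x} \<le> g"
begin

text \<open>
 A chain runs through the columns in descending order. \<open>C = Suc K\<close> random words determine the
 hash function of a column.
\<close>

definition col :: "(nat => nat) => nat => nat => nat" where
 "col \<rho> i y = hash K N (\<lambda>k. \<rho> (i * Suc K + k)) y"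

text \<open>With the predicate \<open>P\<close>, a whole chain, its part above a column and its part
  below a column are instances of one function, and of one program \<open>walk_com\<close>.\<close>

primrec walk :: "(nat => nat) => (nat => bool) => nat => nat => nat" where
 "walk \<rho> P 0 y = y"
| "walk \<rho> P (Suc i) y = walk \<rho> P i (if P i then F (col \<rho> i y) else y)"

abbreviation "chain_end \<rho> \<equiv> walk \<rho> (\<lambda>_. True)"

primrec hits :: "(nat => nat) => nat => nat => nat => real" where
 "hits \<rho> 0 x y = 0"
| "hits \<rho> (Suc i) x y = of_bool (col \<rho> i y = x) + hits \<rho> i x (F (col \<rho> i y))"

text \<open>Counts the pairs of columns \<open>i > i'\<close> such that the chain from
  \<open>y\<close> is at \<open>x\<close> in column \<open>i\<close> and the chain from
  \<open>y'\<close> in column \<open>i'\<close>. Equal columns are left out because only different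
  columns have independent hash functions.\<close>

primrec pairs :: "(nat => nat) => nat => nat => nat => nat => real" where
 "pairs \<rho> 0 x y y' = 0"
| "pairs \<rho> (Suc i) x y y' =
  of_bool (col \<rho> i y = x) * hits \<rho> i x (F (col \<rho> i y')) +
  pairs \<rho> i x (F (col \<rho> i y)) (F (col \<rho> i y'))"

text \<open>The start of a chain is stored under its end, so chains with equal ends overwrite each
  other. Only a chain with a unique end is certain to be found again.\<close>

definition good :: "(nat => nat) => nat => nat => nat => bool" where
 "good \<rho> t m x \<longleftrightarrow> (\<exists>j<m. 0 < hits \<rho> t x j \<and> (\<forall>j'<m. j' \<noteq> j --> chain_end \<rho> t j' \<noteq> chain_end \<rho> t j))"

lemma N_pos: "0 < N"
 using N_dvd B_pos by (auto intro!: Nat.gr0I)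

lemma col_less: "col \<rho> i y < N"
 using N_pos by (simp add: col_def hash_def)

lemma hits_nonneg: "0 \<le> hits \<rho> t x y"
 by (induction t arbitrary: y) auto

lemma pairs_nonneg: "0 \<le> pairs \<rho> t x y y'"
 by (induction t arbitrary: y y') (auto simp: hits_nonneg)

text \<open>The basis of inversion: the end of the chain can be computed from the bucket
  \<open>F x\<close> with the columns below \<open>i\<close>, and the start stored under it leads
  back to \<open>x\<close> through the columns above \<open>i\<close>.\<close>

lemma hits_witness:
 "0 < hits \<rho> t x y ==>
  \<exists>i<t. col \<rho> i (walk \<rho> (\<lambda>i'. i < i') t y) = x \<and> chain_end \<rho> t y = walk \<rho> (\<lambda>i'. i' < i) t (F x)"
proof (induction t arbitrary: y)
 case (Suc t)
 have stop: "walk \<rho> (\<lambda>i'. i < i') s z = z" if "s \<le> Suc i" for s i z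
  using that by (induction s) auto
 have same: "walk \<rho> (\<lambda>i'. i' < i) s z = chain_end \<rho> s z" if "s \<le> i" for s i z
  using that by (induction s arbitrary: z) auto
 show ?case
 proof (cases "col \<rho> t y = x")
  case True
  thus ?thesis by (intro exI[of _ t]) (auto simp: stop same)
 next
  case False
  hence "0 < hits \<rho> t x (F (col \<rho> t y))" using Suc.prems by auto
  then obtain i where "i < t" "col \<rho> i (walk \<rho> (\<lambda>i'. i < i') t (F (col \<rho> t y))) = x"
   "chain_end \<rho> t (F (col \<rho> t y)) = walk \<rho> (\<lambda>i'. i' < i) t (F x)"
   using Suc.IH by blast
  thus ?thesis by (intro exI[of _ i]) auto
 qed
qed simp

lemma cong_below:
 assumes "\<And>k. k < t * Suc K ==> \<rho> k = \<rho>' k"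
 shows "chain_end \<rho> t y = chain_end \<rho>' t y" "hits \<rho> t x y = hits \<rho>' t x y"
  "pairs \<rho> t x y y' = pairs \<rho>' t x y y'"
proof -
 have col: "col \<rho> i y = col \<rho>' i y" if "i < t" for i y
 proof -
  have "i * Suc K + k < t * Suc K" if "k \<le> K" for k
   using \<open>i < t\<close> that by (intro digits_less) auto
  hence "\<rho> (i * Suc K + k) = \<rho>' (i * Suc K + k)" if "k \<le> K" for k using assms that by blast
  from this[of 0] this show ?thesis
   unfolding col_def hash_def
   by (intro arg_cong[of _ _ "\<lambda>x. x mod N"] arg_cong2[of _ _ _ _ "(+)"] sum.cong refl)
    (auto simp del: mult_Suc_right add_Suc_right)
 qed
 have *: "\<forall>y y'. walk \<rho> (\<lambda>_. True) s y = walk \<rho>' (\<lambda>_. True) s y \<and> hits \<rho> s x y = hits \<rho>' s x y \<and>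
  pairs \<rho> s x y y' = pairs \<rho>' s x y y'" if "s \<le> t" for s
  using that by (induction s) (auto simp: col)
 from *[of t] show "chain_end \<rho> t y = chain_end \<rho>' t y" "hits \<rho> t x y = hits \<rho>' t x y"
  "pairs \<rho> t x y y' = pairs \<rho>' t x y y'" by auto
qed

text \<open>The words of column \<open>t\<close>, which a chain through the columns \<open>t, ..., 0\<close> visits first, are split off.\<close>

lemma avg_Suc:
 "avg B (Suc t * Suc K) f = avg B (Suc K) (\<lambda>h. avg B (t * Suc K) (\<lambda>\<rho>. f (glue (t * Suc K) \<rho> h)))"
proof -
 have "Suc t * Suc K = t * Suc K + Suc K" by simp
 thus ?thesis by (simp only: avg_split)
qed

lemma glue_below:
 "chain_end (glue (t * Suc K) \<rho> h) t y = chain_end \<rho> t y"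
 "hits (glue (t * Suc K) \<rho> h) t x y = hits \<rho> t x y"
 "pairs (glue (t * Suc K) \<rho> h) t x y y' = pairs \<rho> t x y y'"
 by (rule cong_below, simp only: glue_simps)+

lemma glue_col: "col (glue (t * Suc K) \<rho> h) t y = hash K N h y"
 unfolding col_def by (simp only: glue_simps)

lemmas glue_col_below = glue_below glue_col

lemma hash_less: "hash K N h y < N"
 using N_pos by (simp add: hash_def)

lemma sum_bool_eq: "x < N ==> (\<Sum>z<N. of_bool (z = x) * f z) = (f x :: real)"
proof -
 assume "x < N"
 have "(\<Sum>z<N. of_bool (z = x) * f z) = (\<Sum>z<N. if z = x then f z else 0)" by (rule sum.cong) auto
 thus ?thesis using \<open>x < N\<close> by simp
qed

lemma avg_hits:
 assumes "x < N" "y < 2 ^ K"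
 shows "avg B (t * Suc K) (\<lambda>\<rho>. hits \<rho> t x y) = real t / real N"
 using assms(2)
proof (induction t arbitrary: y)
 case (Suc t)
 have "avg B (Suc t * Suc K) (\<lambda>\<rho>. hits \<rho> (Suc t) x y) =
  avg B (Suc K) (\<lambda>h. of_bool (hash K N h y = x) + real t / real N)"
  unfolding avg_Suc hits.simps glue_col_below avg_add
  by (simp add: avg_const B_pos Suc.IH F_less hash_less del: mult_Suc_right)
 also have "\<dots> = avg B (Suc K) (\<lambda>h. of_bool (hash K N h y = x)) + real t / real N"
  unfolding avg_add by (simp only: avg_const[OF B_pos])
 also have "avg B (Suc K) (\<lambda>h. of_bool (hash K N h y = x)) = 1 / real N"
  using avg_hash[OF N_dvd B_pos, of K "\<lambda>z. of_bool (z = x)" y] sum_bool_eq[OF assms(1), of "\<lambda>_. 1"]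
  by (simp del: avg.simps)
 finally show ?case by (simp add: add_divide_distrib)
qed simp

text \<open>The two hash values form a uniform pair, and at most \<open>N * g\<close> of the
  \<open>N ^ 2\<close> pairs lie in a common bucket.\<close>

lemma collide:
 assumes "y \<noteq> y'" "y < 2 ^ K" "y' < 2 ^ K"
 shows "avg B (Suc K) (\<lambda>h. of_bool (F (hash K N h y) = F (hash K N h y'))) \<le> real g / real N"
proof -
 have "avg B (Suc K) (\<lambda>h. of_bool (F (hash K N h y) = F (hash K N h y'))) =
   (\<Sum>x<N. \<Sum>x'<N. of_bool (F x = F x')) / (real N)\<^sup>2"
  by (rule avg_hash2[OF N_dvd B_pos assms])
 also have "(\<Sum>x<N. \<Sum>x'<N. of_bool (F x = F x')) \<le> (\<Sum>x<N. real g)"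
 proof (rule sum_mono)
  fix x assume "x \<in> {..<N}"
  have "(\<Sum>x'<N. of_bool (F x = F x') :: real) = real (card {x'. x' < N \<and> F x' = F x})"
   by (subst of_bool_def, subst sum.If_cases) (auto intro!: arg_cong[of _ _ card])
  thus "(\<Sum>x'<N. of_bool (F x = F x')) \<le> real g" using bucket \<open>x \<in> {..<N}\<close> by auto
 qed
 also have "(\<Sum>x<N. real g) / (real N)\<^sup>2 = real g / real N" using N_pos by (simp add: power2_eq_square)
 finally show ?thesis by (simp add: divide_right_mono)
qed

text \<open>As long as two chains have not merged they are at different values, so each column
  merges them with probability at most \<open>g / N\<close>, independently of the past.\<close>

lemma avg_merge:
 assumes "y \<noteq> y'" "y < 2 ^ K" "y' < 2 ^ K"
 shows "avg B (t * Suc K) (\<lambda>\<rho>. of_bool (chain_end \<rho> t y = chain_end \<rho> t y')) \<le> real t * real g / real N"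
 using assms
proof (induction t arbitrary: y y')
 case (Suc t)
 have "avg B (Suc t * Suc K) (\<lambda>\<rho>. of_bool (chain_end \<rho> (Suc t) y = chain_end \<rho> (Suc t) y')) \<le>
  avg B (Suc K) (\<lambda>h. of_bool (F (hash K N h y) = F (hash K N h y')) + real t * real g / real N)"
  unfolding avg_Suc walk.simps if_True glue_col_below
 proof (rule avg_mono)
  fix h
  show "avg B (t * Suc K) (\<lambda>\<rho>. of_bool (chain_end \<rho> t (F (hash K N h y)) = chain_end \<rho> t (F (hash K N h y'))))
   \<le> of_bool (F (hash K N h y) = F (hash K N h y')) + real t * real g / real N"
  proof (cases "F (hash K N h y) = F (hash K N h y')")
   case True
   thus ?thesis by (simp add: avg_const B_pos)
  next
   case False
   thus ?thesis using Suc.IH[OF False] by (simp add: F_less hash_less)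
  qed
 qed
 also have "\<dots> \<le> real g / real N + real t * real g / real N"
  unfolding avg_add avg_const[OF B_pos] by (intro add_right_mono collide Suc.prems)
 also have "\<dots> = real (Suc t) * real g / real N" by (simp add: add_divide_distrib distrib_right)
 finally show ?case .
qed simp

text \<open>The first column adds \<open>(2 * t + 1) * g / N ^ 2\<close>: visit and merge in it give
  \<open>g / N ^ 2\<close>, visit now and merge later \<open>t * g / N ^ 2\<close>, merge now and
  visit later again \<open>t * g / N ^ 2\<close>. These increments sum up to the square.\<close>

lemma avg_hits_merge:
 assumes "x < N" "y \<noteq> y'" "y < 2 ^ K" "y' < 2 ^ K"
 shows "avg B (t * Suc K) (\<lambda>\<rho>. hits \<rho> t x y * of_bool (chain_end \<rho> t y = chain_end \<rho> t y'))
     \<le> (real t)\<^sup>2 * real g / (real N)\<^sup>2"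
 using assms(2-)
proof (induction t arbitrary: y y')
 case (Suc t)
 let ?h = "hash K N" and ?c = "real t * real g / real N"
 let ?A = "\<lambda>\<rho> z z'. of_bool (chain_end \<rho> t z = chain_end \<rho> t z') :: real"
 have "avg B (Suc t * Suc K)
    (\<lambda>\<rho>. hits \<rho> (Suc t) x y * of_bool (chain_end \<rho> (Suc t) y = chain_end \<rho> (Suc t) y')) =
  avg B (Suc K) (\<lambda>h. avg B (t * Suc K) (\<lambda>\<rho>.
    (of_bool (?h h y = x) + hits \<rho> t x (F (?h h y))) * ?A \<rho> (F (?h h y)) (F (?h h y'))))"
  unfolding avg_Suc walk.simps hits.simps if_True glue_col_below ..
 also have "\<dots> \<le> avg B (Suc K) (\<lambda>h.
   (of_bool (?h h y = x) * (of_bool (F (?h h y) = F (?h h y')) + ?c)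
   + of_bool (F (?h h y) = F (?h h y')) * (real t / real N)) + (real t)\<^sup>2 * real g / (real N)\<^sup>2)"
 proof (rule avg_mono)
  fix h
  let ?z = "F (?h h y)" and ?z' = "F (?h h y')"
  have z: "?z < 2 ^ K" "?z' < 2 ^ K" by (auto simp: F_less hash_less)
  have "avg B (t * Suc K) (\<lambda>\<rho>. (of_bool (?h h y = x) + hits \<rho> t x ?z) * ?A \<rho> ?z ?z') =
   of_bool (?h h y = x) * avg B (t * Suc K) (\<lambda>\<rho>. ?A \<rho> ?z ?z') +
   avg B (t * Suc K) (\<lambda>\<rho>. hits \<rho> t x ?z * ?A \<rho> ?z ?z')"
   by (simp only: distrib_right avg_add avg_cmult)
  also have "\<dots> \<le> (of_bool (?h h y = x) * (of_bool (?z = ?z') + ?c)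
   + of_bool (?z = ?z') * (real t / real N)) + (real t)\<^sup>2 * real g / (real N)\<^sup>2"
  \<comment> \<open>Once merged, the chains coincide and only the expected number of later visits
    matters. Otherwise they are at different values and the induction hypothesis applies.\<close>
  proof (cases "?z = ?z'")
   case True
   have "avg B (t * Suc K) (\<lambda>\<rho>. hits \<rho> t x ?z * ?A \<rho> ?z ?z') = real t / real N"
    using avg_hits[OF assms(1) z(1), of t] True by simp
   thus ?thesis using True by (simp add: avg_const B_pos)
  next
   case False
   have "avg B (t * Suc K) (\<lambda>\<rho>. hits \<rho> t x ?z * ?A \<rho> ?z ?z') \<le> (real t)\<^sup>2 * real g / (real N)\<^sup>2"
    using Suc.IH[OF False z] .
   moreover have "avg B (t * Suc K) (\<lambda>\<rho>. ?A \<rho> ?z ?z') \<le> ?c" by (rule avg_merge[OF False z])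
   ultimately show ?thesis using False by (auto simp: of_bool_def)
  qed
  finally show "avg B (t * Suc K) (\<lambda>\<rho>. (of_bool (?h h y = x) + hits \<rho> t x ?z) * ?A \<rho> ?z ?z') \<le>
   (of_bool (?h h y = x) * (of_bool (?z = ?z') + ?c)
   + of_bool (?z = ?z') * (real t / real N)) + (real t)\<^sup>2 * real g / (real N)\<^sup>2" .
 qed
 also have "\<dots> = avg B (Suc K) (\<lambda>h. of_bool (?h h y = x) * (of_bool (F (?h h y) = F (?h h y')) + ?c))
   + avg B (Suc K) (\<lambda>h. of_bool (F (?h h y) = F (?h h y'))) * (real t / real N)
   + (real t)\<^sup>2 * real g / (real N)\<^sup>2"
  unfolding avg_add avg_const[OF B_pos] by (simp only: avg_cmult mult.commute[of _ "real t / real N"])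
 also have "avg B (Suc K) (\<lambda>h. of_bool (?h h y = x) * (of_bool (F (?h h y) = F (?h h y')) + ?c)) \<le>
   real g / (real N)\<^sup>2 + ?c / real N"
 proof -
  have "avg B (Suc K) (\<lambda>h. of_bool (?h h y = x) * (of_bool (F (?h h y) = F (?h h y')) + ?c)) =
   (\<Sum>z<N. \<Sum>z'<N. of_bool (z = x) * (of_bool (F z = F z') + ?c)) / (real N)\<^sup>2"
   by (rule avg_hash2[OF N_dvd B_pos Suc.prems])
  also have "(\<Sum>z<N. \<Sum>z'<N. of_bool (z = x) * (of_bool (F z = F z') + ?c)) =
   (\<Sum>z'<N. of_bool (F x = F z') + ?c)"
   unfolding sum_distrib_left[symmetric] by (rule sum_bool_eq[OF assms(1)])
  also have "\<dots> = real (card {x'. x' < N \<and> F x' = F x}) + real N * ?c"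
   unfolding sum.distrib
   by (subst of_bool_def, subst sum.If_cases) (auto intro!: arg_cong[of _ _ card])
  also have "\<dots> \<le> real g + real N * ?c" using bucket[OF assms(1)] by simp
  finally have "avg B (Suc K) (\<lambda>h. of_bool (?h h y = x) * (of_bool (F (?h h y) = F (?h h y')) + ?c)) \<le>
   (real g + real N * ?c) / (real N)\<^sup>2" by (simp add: divide_right_mono)
  thus ?thesis using N_pos by (simp add: field_simps power2_eq_square)
 qed
 also have "avg B (Suc K) (\<lambda>h. of_bool (F (?h h y) = F (?h h y'))) * (real t / real N) \<le>
   real g / real N * (real t / real N)"
  by (intro mult_right_mono collide Suc.prems) auto
 finally have "avg B (Suc t * Suc K)
    (\<lambda>\<rho>. hits \<rho> (Suc t) x y * of_bool (chain_end \<rho> (Suc t) y = chain_end \<rho> (Suc t) y'))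
  \<le> real g / (real N)\<^sup>2 + ?c / real N + real g / real N * (real t / real N) + (real t)\<^sup>2 * real g / (real N)\<^sup>2"
  by simp
 also have "\<dots> = (real (Suc t))\<^sup>2 * real g / (real N)\<^sup>2"
  using N_pos by (simp add: field_simps power2_eq_square)
 finally show ?case .
qed simp

text \<open>The two visits of a pair happen in different columns, hence with probability
  \<open>1 / N ^ 2\<close>, and there are fewer than \<open>t ^ 2 / 2\<close> pairs of
  columns.\<close>

lemma avg_pairs:
 assumes "x < N" "y < 2 ^ K" "y' < 2 ^ K"
 shows "avg B (t * Suc K) (\<lambda>\<rho>. pairs \<rho> t x y y') \<le> (real t)\<^sup>2 / (2 * (real N)\<^sup>2)"
 using assms(2-)
proof (induction t arbitrary: y y')
 case (Suc t)
 let ?h = "hash K N"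
 have "avg B (Suc t * Suc K) (\<lambda>\<rho>. pairs \<rho> (Suc t) x y y') =
  avg B (Suc K) (\<lambda>h. of_bool (?h h y = x) * avg B (t * Suc K) (\<lambda>\<rho>. hits \<rho> t x (F (?h h y'))) +
    avg B (t * Suc K) (\<lambda>\<rho>. pairs \<rho> t x (F (?h h y)) (F (?h h y'))))"
  unfolding avg_Suc pairs.simps glue_col_below by (simp only: avg_add avg_cmult)
 also have "\<dots> \<le> avg B (Suc K) (\<lambda>h. of_bool (?h h y = x) * (real t / real N) + (real t)\<^sup>2 / (2 * (real N)\<^sup>2))"
  by (rule avg_mono) (use Suc.IH in \<open>simp add: avg_hits assms(1) F_less hash_less del: mult_Suc_right\<close>)
 also have "\<dots> = avg B (Suc K) (\<lambda>h. of_bool (?h h y = x)) * (real t / real N) + (real t)\<^sup>2 / (2 * (real N)\<^sup>2)"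
  unfolding avg_add avg_const[OF B_pos] by (simp only: avg_cmult mult.commute[of _ "real t / real N"])
 also have "avg B (Suc K) (\<lambda>h. of_bool (?h h y = x)) = 1 / real N"
  using avg_hash[OF N_dvd B_pos, of K "\<lambda>z. of_bool (z = x)" y] sum_bool_eq[OF assms(1), of "\<lambda>_. 1"]
  by (simp del: avg.simps)
 also have "1 / real N * (real t / real N) + (real t)\<^sup>2 / (2 * (real N)\<^sup>2) \<le> (real (Suc t))\<^sup>2 / (2 * (real N)\<^sup>2)"
  using N_pos by (simp add: field_simps power2_eq_square)
 finally show ?case .
qed simp

text \<open>Chains with different ends cannot visit \<open>x\<close> in the same column, since they
  would continue from the same value \<open>F x\<close>. So all visits by \<open>U\<close> are in
  different columns, and \<open>h\<close> visits produce \<open>h * (h - 1) / 2\<close>, at least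
  \<open>h - 1\<close>, pairs.\<close>

lemma hits_le_pairs:
 assumes "finite U" "inj_on (chain_end \<rho> t) U"
 shows "(\<Sum>y\<in>U. hits \<rho> t x y) \<le> 1 + (\<Sum>y\<in>U. \<Sum>y'\<in>U. pairs \<rho> t x y y')"
 using assms
proof (induction t arbitrary: U)
 case (Suc t)
 let ?s = "\<lambda>y. F (col \<rho> t y)"
 let ?a = "\<Sum>y\<in>U. of_bool (col \<rho> t y = x) :: real"
 have inj: "inj_on ?s U" "inj_on (chain_end \<rho> t) (?s ` U)"
  using Suc.prems(2) by (auto simp: inj_on_def)
 have img: "sum f (?s ` U) = (\<Sum>y\<in>U. f (?s y))" for f :: "nat => real"
  by (simp add: sum.reindex[OF inj(1)])
 have IH: "(\<Sum>y\<in>U. hits \<rho> t x (?s y)) \<le> 1 + (\<Sum>y\<in>U. \<Sum>y'\<in>U. pairs \<rho> t x (?s y) (?s y'))"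
  using Suc.IH[of "?s ` U"] inj Suc.prems(1) by (simp add: img)
 \<comment> \<open>Two chains at \<open>x\<close> in column \<open>t\<close> would have the same
   next value, against injectivity.\<close>
 have "card {y\<in>U. col \<rho> t y = x} \<le> Suc 0"
  using inj(1) Suc.prems(1) by (subst card_le_Suc0_iff_eq) (auto simp: inj_on_def)
 moreover have "?a = real (card {y\<in>U. col \<rho> t y = x})"
  using Suc.prems(1) by (subst of_bool_def, subst sum.If_cases) (auto intro!: arg_cong[of _ _ card])
 ultimately have a: "?a = 0 \<or> ?a = 1" by (cases "card {y\<in>U. col \<rho> t y = x}") auto
 have S: "0 \<le> (\<Sum>y\<in>U. hits \<rho> t x (?s y))" "0 \<le> (\<Sum>y\<in>U. \<Sum>y'\<in>U. pairs \<rho> t x (?s y) (?s y'))"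
  by (auto intro!: sum_nonneg hits_nonneg pairs_nonneg)
 have "(\<Sum>y\<in>U. \<Sum>y'\<in>U. pairs \<rho> (Suc t) x y y') =
  ?a * (\<Sum>y\<in>U. hits \<rho> t x (?s y)) + (\<Sum>y\<in>U. \<Sum>y'\<in>U. pairs \<rho> t x (?s y) (?s y'))"
  by (simp add: sum.distrib sum_product)
 moreover have "(\<Sum>y\<in>U. hits \<rho> (Suc t) x y) = ?a + (\<Sum>y\<in>U. hits \<rho> t x (?s y))"
  by (simp add: sum.distrib)
 ultimately show ?case using a IH S by auto
qed (simp add: sum_nonneg)

text \<open>Visits by chains with a shared end are charged to a merging, the others to
  \<open>hits_le_pairs\<close> for the set \<open>U\<close> of chains with a unique end. The 1 in
  that lemma is the indicator of \<open>good\<close>.\<close>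

lemma hits_le_good:
 "(\<Sum>j<m. hits \<rho> t x j) \<le> of_bool (good \<rho> t m x) +
  (\<Sum>j<m. \<Sum>j'\<in>{..<m} - {j}. hits \<rho> t x j * of_bool (chain_end \<rho> t j = chain_end \<rho> t j')) +
  (\<Sum>j<m. \<Sum>j'<m. pairs \<rho> t x j j')"
proof -
 define U where "U = {j. j < m \<and> (\<forall>j'<m. j' \<noteq> j --> chain_end \<rho> t j' \<noteq> chain_end \<rho> t j)}"
 have U: "U \<subseteq> {..<m}" "finite U" by (auto simp: U_def)
 have inj: "inj_on (chain_end \<rho> t) U" by (auto simp: inj_on_def U_def)
 have 1: "(\<Sum>j<m. hits \<rho> t x j) = (\<Sum>j\<in>U. hits \<rho> t x j) + (\<Sum>j\<in>{..<m} - U. hits \<rho> t x j)"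
  using U by (subst sum.subset_diff[of U "{..<m}"]) auto
 have "(\<Sum>j\<in>{..<m} - U. hits \<rho> t x j) \<le>
  (\<Sum>j\<in>{..<m} - U. \<Sum>j'\<in>{..<m} - {j}. hits \<rho> t x j * of_bool (chain_end \<rho> t j = chain_end \<rho> t j'))"
 proof (rule sum_mono)
  fix j assume "j \<in> {..<m} - U"
  then obtain j' where j': "j' < m" "j' \<noteq> j" "chain_end \<rho> t j' = chain_end \<rho> t j" by (auto simp: U_def)
  hence "hits \<rho> t x j = hits \<rho> t x j * of_bool (chain_end \<rho> t j = chain_end \<rho> t j')" by simp
  also have "\<dots> \<le> (\<Sum>j'\<in>{..<m} - {j}. hits \<rho> t x j * of_bool (chain_end \<rho> t j = chain_end \<rho> t j'))"
   using j' by (intro member_le_sum) (auto simp: hits_nonneg)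
  finally show "hits \<rho> t x j \<le> \<dots>" .
 qed
 also have "\<dots> \<le> (\<Sum>j<m. \<Sum>j'\<in>{..<m} - {j}. hits \<rho> t x j * of_bool (chain_end \<rho> t j = chain_end \<rho> t j'))"
  by (rule sum_mono2) (auto intro!: sum_nonneg simp: hits_nonneg)
 finally have 2: "(\<Sum>j\<in>{..<m} - U. hits \<rho> t x j) \<le> \<dots>" .
 have "(\<Sum>j\<in>U. hits \<rho> t x j) \<le> of_bool (good \<rho> t m x) + (\<Sum>j<m. \<Sum>j'<m. pairs \<rho> t x j j')"
 proof (cases "good \<rho> t m x")
  case True
  have "(\<Sum>y\<in>U. \<Sum>y'\<in>U. pairs \<rho> t x y y') \<le> (\<Sum>y\<in>U. \<Sum>y'<m. pairs \<rho> t x y y')"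
   using U by (intro sum_mono sum_mono2) (auto simp: pairs_nonneg)
  also have "\<dots> \<le> (\<Sum>y<m. \<Sum>y'<m. pairs \<rho> t x y y')"
   using U by (intro sum_mono2) (auto intro!: sum_nonneg simp: pairs_nonneg)
  finally show ?thesis using True hits_le_pairs[OF U(2) inj, of x] by simp
 next
  case False
  have "hits \<rho> t x j = 0" if "j \<in> U" for j
  proof -
   have "\<not> 0 < hits \<rho> t x j" using that False unfolding good_def U_def by blast
   thus ?thesis using hits_nonneg[of \<rho> t x j] by linarith
  qed
  thus ?thesis using False by (simp add: sum_nonneg pairs_nonneg)
 qed
 with 1 2 show ?thesis by linarith
qed

text \<open>The expected number of visits minus the losses by merging and by repeated visits. Starts
  have to be \<open>K\<close>-bit numbers, since the hash functions separate only those.\<close>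

theorem avg_good:
 assumes "x < N" "m \<le> 2 ^ K"
 shows "real m * real t / real N - (real m)\<^sup>2 * (real t)\<^sup>2 * real g / (real N)\<^sup>2
      - (real m)\<^sup>2 * (real t)\<^sup>2 / (2 * (real N)\<^sup>2)
    \<le> avg B (t * Suc K) (\<lambda>\<rho>. of_bool (good \<rho> t m x))"
proof -
 let ?E = "avg B (t * Suc K)"
 have j: "j < 2 ^ K" if "j < m" for j using that assms by simp
 have "real m * real t / real N = (\<Sum>j<m. ?E (\<lambda>\<rho>. hits \<rho> t x j))"
  using j by (simp add: avg_hits assms(1) del: mult_Suc_right)
 also have "\<dots> = ?E (\<lambda>\<rho>. \<Sum>j<m. hits \<rho> t x j)" by (rule avg_sum[OF B_pos, symmetric])
 also have "\<dots> \<le> ?E (\<lambda>\<rho>. of_bool (good \<rho> t m x) +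
  (\<Sum>j<m. \<Sum>j'\<in>{..<m} - {j}. hits \<rho> t x j * of_bool (chain_end \<rho> t j = chain_end \<rho> t j')) +
  (\<Sum>j<m. \<Sum>j'<m. pairs \<rho> t x j j'))"
  by (intro avg_mono hits_le_good)
 also have "\<dots> = ?E (\<lambda>\<rho>. of_bool (good \<rho> t m x)) +
  (\<Sum>j<m. \<Sum>j'\<in>{..<m} - {j}. ?E (\<lambda>\<rho>. hits \<rho> t x j * of_bool (chain_end \<rho> t j = chain_end \<rho> t j'))) +
  (\<Sum>j<m. \<Sum>j'<m. ?E (\<lambda>\<rho>. pairs \<rho> t x j j'))"
  by (simp only: avg_add avg_sum[OF B_pos])
 finally have 1: "real m * real t / real N \<le> \<dots>" .
 have "(\<Sum>j<m. \<Sum>j'\<in>{..<m} - {j}. ?E (\<lambda>\<rho>. hits \<rho> t x j * of_bool (chain_end \<rho> t j = chain_end \<rho> t j')))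
  \<le> (\<Sum>j<m. \<Sum>j'\<in>{..<m} - {j}. (real t)\<^sup>2 * real g / (real N)\<^sup>2)"
  using j by (intro sum_mono avg_hits_merge assms(1)) auto
 also have "\<dots> \<le> (\<Sum>j<m. \<Sum>j'<m. (real t)\<^sup>2 * real g / (real N)\<^sup>2)"
  by (intro sum_mono sum_mono2) auto
 also have "\<dots> = (real m)\<^sup>2 * (real t)\<^sup>2 * real g / (real N)\<^sup>2"
  by (simp add: power2_eq_square algebra_simps)
 finally have 2: "(\<Sum>j<m. \<Sum>j'\<in>{..<m} - {j}. ?E (\<lambda>\<rho>. hits \<rho> t x j * of_bool (chain_end \<rho> t j = chain_end \<rho> t j')))
  \<le> \<dots>" .
 have "(\<Sum>j<m. \<Sum>j'<m. ?E (\<lambda>\<rho>. pairs \<rho> t x j j')) \<le> (\<Sum>j<m. \<Sum>j'<m. (real t)\<^sup>2 / (2 * (real N)\<^sup>2))"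
  using j by (intro sum_mono avg_pairs assms(1)) auto
 also have "\<dots> = (real m)\<^sup>2 * (real t)\<^sup>2 / (2 * (real N)\<^sup>2)"
  by (simp add: power2_eq_square algebra_simps)
 finally show ?thesis using 1 2 by linarith
qed

subsection \<open>Many tables\<close>

definition table :: "nat => (nat => nat) => nat => nat => nat" where
 "table t \<rho> \<tau> i = \<rho> (\<tau> * (t * Suc K) + i)"

lemma good_cong: "(\<And>k. k < t * Suc K ==> \<rho> k = \<rho>' k) ==> good \<rho> t m x = good \<rho>' t m x"
 unfolding good_def using cong_below[of t \<rho> \<rho>'] by auto

text \<open>Different tables use disjoint blocks of words, so the average over all of them
  factors.\<close>

lemma avg_all_bad:
 assumes "x < N" "0 \<le> \<delta>" "\<delta> \<le> avg B (t * Suc K) (\<lambda>\<rho>. of_bool (good \<rho> t m x))"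
 shows "avg B (l * (t * Suc K)) (\<lambda>\<rho>. of_bool (\<forall>\<tau><l. \<not> good (table t \<rho> \<tau>) t m x)) \<le> (1 - \<delta>) ^ l"
proof (induction l)
 case 0
 thus ?case by simp
next
 case (Suc l)
 let ?c = "t * Suc K"
 have below: "good (table t (glue (l * ?c) \<rho> h) \<tau>) t m x = good (table t \<rho> \<tau>) t m x" if "\<tau> < l" for \<rho> h \<tau>
 proof (rule good_cong)
  fix k assume "k < ?c"
  hence "\<tau> * ?c + k < l * ?c" using \<open>\<tau> < l\<close>
   by (intro digits_less) auto
  thus "table t (glue (l * ?c) \<rho> h) \<tau> k = table t \<rho> \<tau> k" by (simp add: table_def)
 qed
 have last: "good (table t (glue (l * ?c) \<rho> h) l) t m x = good h t m x" for \<rho> h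
  by (rule good_cong) (simp only: table_def glue_simps)
 have one: "avg B ?c (\<lambda>h. of_bool (\<not> good h t m x)) \<le> 1 - \<delta>"
 proof -
  have "avg B ?c (\<lambda>h. of_bool (\<not> good h t m x)) = avg B ?c (\<lambda>h. 1 + (-1) * of_bool (good h t m x))"
   by (intro avg_cong) auto
  also have "\<dots> = 1 + (-1) * avg B ?c (\<lambda>h. of_bool (good h t m x))"
   unfolding avg_add avg_cmult avg_const[OF B_pos] ..
  finally show ?thesis using assms(3) by linarith
 qed
 have all: "(\<forall>\<tau><Suc l. \<not> good (table t (glue (l * ?c) \<rho> h) \<tau>) t m x) \<longleftrightarrow>
   \<not> good h t m x \<and> (\<forall>\<tau><l. \<not> good (table t \<rho> \<tau>) t m x)" for \<rho> h
  using below last by (auto simp: less_Suc_eq)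
 have "avg B (Suc l * ?c) (\<lambda>\<rho>. of_bool (\<forall>\<tau><Suc l. \<not> good (table t \<rho> \<tau>) t m x)) =
  avg B ?c (\<lambda>h. avg B (l * ?c) (\<lambda>\<rho>. of_bool (\<not> good h t m x) * of_bool (\<forall>\<tau><l. \<not> good (table t \<rho> \<tau>) t m x)))"
 proof -
  have eq: "Suc l * ?c = l * ?c + ?c" by simp
  show ?thesis unfolding eq avg_split all of_bool_conj ..
 qed
 also have "\<dots> = avg B ?c (\<lambda>h. of_bool (\<not> good h t m x)) * avg B (l * ?c) (\<lambda>\<rho>. of_bool (\<forall>\<tau><l. \<not> good (table t \<rho> \<tau>) t m x))"
  by (subst avg_cmult, subst (1 2) mult.commute, rule avg_cmult)
 also have "\<dots> \<le> (1 - \<delta>) * (1 - \<delta>) ^ l"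
 proof (rule mult_mono[OF one Suc])
  have "avg B ?c (\<lambda>h. 0) \<le> avg B ?c (\<lambda>h. of_bool (\<not> good h t m x))" by (rule avg_mono) auto
  thus "0 \<le> 1 - \<delta>" using one avg_const[OF B_pos, of ?c 0] by linarith
  have "avg B (l * ?c) (\<lambda>h. 0) \<le> avg B (l * ?c) (\<lambda>\<rho>. of_bool (\<forall>\<tau><l. \<not> good (table t \<rho> \<tau>) t m x))"
   by (rule avg_mono) auto
  thus "0 \<le> avg B (l * ?c) (\<lambda>\<rho>. of_bool (\<forall>\<tau><l. \<not> good (table t \<rho> \<tau>) t m x))"
   using avg_const[OF B_pos, of "l * ?c" 0] by linarith
 qed
 finally show ?case by simp
qed

definition covers :: "(nat => nat) => nat => nat => nat => bool" where
 "covers \<rho> l t m \<longleftrightarrow> (\<forall>x<N. \<exists>\<tau><l. good (table t \<rho> \<tau>) t m x)"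

text \<open>Union bound over the items.\<close>

theorem avg_covers:
 assumes "0 \<le> \<delta>" "\<And>x. x < N ==> \<delta> \<le> avg B (t * Suc K) (\<lambda>\<rho>. of_bool (good \<rho> t m x))"
 shows "1 - real N * (1 - \<delta>) ^ l \<le> avg B (l * (t * Suc K)) (\<lambda>\<rho>. of_bool (covers \<rho> l t m))"
proof -
 let ?E = "avg B (l * (t * Suc K))"
 have "1 = ?E (\<lambda>\<rho>. 1)" by (rule avg_const[OF B_pos, symmetric])
 also have "\<dots> \<le> ?E (\<lambda>\<rho>. of_bool (covers \<rho> l t m) + (\<Sum>x<N. of_bool (\<forall>\<tau><l. \<not> good (table t \<rho> \<tau>) t m x)))"
 proof (rule avg_mono)
  fix \<rho>
  show "1 \<le> of_bool (covers \<rho> l t m) + (\<Sum>x<N. of_bool (\<forall>\<tau><l. \<not> good (table t \<rho> \<tau>) t m x) :: real)"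
  proof (cases "covers \<rho> l t m")
   case False
   then obtain x where x: "x < N" "\<forall>\<tau><l. \<not> good (table t \<rho> \<tau>) t m x" by (auto simp: covers_def)
   have "of_bool (\<forall>\<tau><l. \<not> good (table t \<rho> \<tau>) t m x) \<le>
     (\<Sum>x<N. of_bool (\<forall>\<tau><l. \<not> good (table t \<rho> \<tau>) t m x) :: real)"
    by (rule member_le_sum) (use x in auto)
   thus ?thesis using x False by simp
  qed (simp add: sum_nonneg)
 qed
 also have "\<dots> = ?E (\<lambda>\<rho>. of_bool (covers \<rho> l t m)) + (\<Sum>x<N. ?E (\<lambda>\<rho>. of_bool (\<forall>\<tau><l. \<not> good (table t \<rho> \<tau>) t m x)))"
  by (simp only: avg_add avg_sum[OF B_pos])
 also have "(\<Sum>x<N. ?E (\<lambda>\<rho>. of_bool (\<forall>\<tau><l. \<not> good (table t \<rho> \<tau>) t m x))) \<le> (\<Sum>x<N. (1 - \<delta>) ^ l)"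
  using assms by (intro sum_mono avg_all_bad) auto
 finally show ?thesis by simp
qed

end

section \<open>Binary tries as dictionaries with worst-case access time\<close>

section \<open>Tries\<close>

subsection \<open>Arithmetic without overflow\<close>

abbreviation Add (infixl \<open>[+]\<close> 65) where "x [+] y \<equiv> Op Plus x y"
abbreviation Sub (infixl \<open>[-]\<close> 65) where "x [-] y \<equiv> Op Minus x y"
abbreviation Mul (infixl \<open>[*]\<close> 70) where "x [*] y \<equiv> Op Times x y"
abbreviation Div (infixl \<open>[div]\<close> 70) where "x [div] y \<equiv> Op Divide x y"
abbreviation Mod (infixl \<open>[mod]\<close> 70) where "x [mod] y \<equiv> Op Modulo x y"
abbreviation Shl (infixl \<open>[<<]\<close> 75) where "x [<<] y \<equiv> Op ShiftL x y"
abbreviation Shr (infixl \<open>[>>]\<close> 75) where "x [>>] y \<equiv> Op ShiftR x y"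
abbreviation Lss (infix \<open>[<]\<close> 50) where "x [<] y \<equiv> Op Less x y"
abbreviation Eql (infix \<open>[=]\<close> 50) where "x [=] y \<equiv> Op Equal x y"

text \<open>Twenty bits hold every numeral in the programs. Constants that depend on
  \<open>e\<close> are treated where they occur.\<close>

locale word_machine =
 fixes b :: nat
 assumes b20: "20 \<le> b"
begin

lemma small: "c < 2 ^ 20 ==> c < (2::nat) ^ b"
 using power_increasing[OF b20, of "2::nat"] by linarith

lemma Cn_small [simp]: "c < 2 ^ 20 ==> take_bit b c = (c :: nat)"
 using small by (simp add: take_bit_nat_eq_self)

lemma le_b [simp]: "numeral k \<le> (20 :: nat) ==> numeral k \<le> b"
 by (rule order_trans[OF _ b20])

lemma b_pos [simp]: "0 < b" "Suc 0 \<le> b" "Suc 0 < b"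
 using b20 by linarith+

lemma alu_Plus: "x + y < 2 ^ b ==> alu b Plus x y = x + y"
 by (simp add: take_bit_nat_eq_self)

lemma alu_Minus: "y \<le> x ==> x < 2 ^ b ==> alu b Minus x y = x - y"
proof -
 assume "y \<le> x" "x < 2 ^ b"
 hence "x + 2 ^ b - y = (x - y) + 2 ^ b" by simp
 hence "alu b Minus x y = (x - y + 2 ^ b) mod 2 ^ b" by (simp only: alu.simps take_bit_eq_mod)
 thus ?thesis using \<open>x < 2 ^ b\<close> by simp
qed

lemma alu_Times: "x * y < 2 ^ b ==> alu b Times x y = x * y"
 by (simp add: take_bit_nat_eq_self)

lemma alu_ShiftL: "x * 2 ^ y < 2 ^ b ==> alu b ShiftL x y = x * 2 ^ y"
 by (simp add: take_bit_nat_eq_self push_bit_eq_mult)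

lemma alu_ShiftR: "alu b ShiftR x y = x div 2 ^ y"
 by (simp add: drop_bit_eq_div)

lemma alu_bool: "alu b Less x y = of_bool (x < y)" "alu b Equal x y = of_bool (x = y)"
 by (auto simp: of_bool_def)

end

declare alu.simps(1,2,3,9,10,11,12) [simp del]

subsection \<open>Tries in memory\<close>

text \<open>
 A key consists of \<open>K\<close> bits, read from the least significant one. The node for the first \<open>d\<close> bits
 \<open>z\<close> of a key occupies the two words at \<open>\<nu> (d, z)\<close>, which contain its children if \<open>d < K\<close>; the
 first word of a node of depth \<open>K\<close> contains the value. Node 0 represents all absent nodes.
\<close>

definition trie ::
  "nat => (nat => nat) => nat => (nat \<times> nat) set => (nat \<times> nat => nat) => (nat => nat) => bool" where
 "trie K M f P \<nu> V \<longleftrightarrow>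
  P \<subseteq> Sigma {..K} (\<lambda>d. {..<2 ^ d}) \<and> f = 2 + 2 * card P \<and> (0, 0) \<in> P \<and> \<nu> (0, 0) = 2 \<and>
  (\<forall>p\<in>P. 2 \<le> \<nu> p \<and> even (\<nu> p) \<and> \<nu> p + 2 \<le> f) \<and> inj_on \<nu> P \<and>
  (\<forall>d z. (Suc d, z) \<in> P --> (d, z mod 2 ^ d) \<in> P) \<and>
  (\<forall>d z \<beta>. (d, z) \<in> P --> d < K --> \<beta> < 2 -->
    M (\<nu> (d, z) + \<beta>) = (if (Suc d, z + \<beta> * 2 ^ d) \<in> P then \<nu> (Suc d, z + \<beta> * 2 ^ d) else 0)) \<and>
  (\<forall>k. V k = (if (K, k) \<in> P then M (\<nu> (K, k)) else 0)) \<and>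
  M 0 = 0 \<and> M 1 = 0 \<and> (\<forall>a. f \<le> a --> a < 2 ^ (K + 3) --> M a = 0)"

definition prefixes :: "nat => nat set => (nat \<times> nat) set" where
 "prefixes K A = insert (0, 0) ((\<lambda>(k, d). (d, k mod 2 ^ d)) ` (A \<times> {1..K}))"

text \<open>\<open>A\<close> bounds the inserted keys from above. The construction can thus name its
  final key set from the start, and the space depends on that set alone.\<close>

definition dict :: "nat => (nat => nat) => nat => nat set => (nat => nat) => bool" where
 "dict K M f A V \<longleftrightarrow> (\<exists>P \<nu>. trie K M f P \<nu> V \<and> P \<subseteq> prefixes K A)"

lemma card_all_nodes: "card (Sigma {..K} (\<lambda>d. {..<(2::nat) ^ d})) = 2 ^ Suc K - 1"
proof -
 have "(\<Sum>d\<le>K. 2 ^ d) = (2::nat) ^ Suc K - 1" by (induction K) auto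
 thus ?thesis by (simp add: card_SigmaI)
qed

text \<open>The complete binary tree has fewer than \<open>2 ^ (K + 1)\<close> nodes of two words,
  so allocation never leaves the region of \<open>2 ^ (K + 3)\<close> words reserved for the
  trie.\<close>

lemma trie_free_le: "trie K M f P \<nu> V ==> f \<le> 2 ^ (K + 2)"
proof -
 assume t: "trie K M f P \<nu> V"
 hence "card P \<le> 2 ^ Suc K - 1"
  unfolding card_all_nodes[symmetric] by (intro card_mono) (auto simp: trie_def)
 moreover have "f = 2 + 2 * card P" using t by (simp add: trie_def)
 moreover have "(1::nat) \<le> 2 ^ K" by simp
 ultimately have "f \<le> 4 * 2 ^ K" unfolding power_Suc by linarith
 thus ?thesis by (simp add: power_add)
qed

lemma dict_free_le: "dict K M f A V ==> f \<le> 2 ^ (K + 2)"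
 unfolding dict_def using trie_free_le by blast

text \<open>Every key brings at most \<open>K\<close> nodes besides the root, each of two words. The
  4 consists of the root and the null node.\<close>

lemma dict_free_le_card:
 assumes "dict K M f A V" "finite A"
 shows "f \<le> 4 + 2 * (K * card A)"
proof -
 obtain P \<nu> where P: "trie K M f P \<nu> V" "P \<subseteq> prefixes K A" using assms(1) by (auto simp: dict_def)
 have "card P \<le> card (prefixes K A)"
  using P(2) assms(2) by (intro card_mono) (auto simp: prefixes_def)
 also have "\<dots> \<le> Suc (card ((\<lambda>(k, d). (d, k mod 2 ^ d)) ` (A \<times> {1..K})))"
  unfolding prefixes_def using assms(2) by (subst card_insert_if) auto
 also have "\<dots> \<le> Suc (card (A \<times> {1..K}))"
  using assms(2) by (intro Suc_le_mono[THEN iffD2] card_image_le) auto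
 finally show ?thesis using P(1) by (simp add: trie_def card_cartesian_product algebra_simps)
qed

lemma dict_mono: "dict K M f A V ==> A \<subseteq> A' ==> dict K M f A' V"
proof -
 assume "dict K M f A V" "A \<subseteq> A'"
 moreover from \<open>A \<subseteq> A'\<close> have "prefixes K A \<subseteq> prefixes K A'" unfolding prefixes_def by blast
 ultimately show ?thesis unfolding dict_def by blast
qed

lemma trie_empty:
 assumes "\<And>a. a < 2 ^ (K + 3) ==> M a = 0"
 shows "trie K M 4 {(0, 0)} (\<lambda>_. 2) (\<lambda>_. 0)"
proof -
 have "(8::nat) \<le> 2 ^ (K + 3)" by (simp add: power_add)
 thus ?thesis using assms[of 0] assms[of 1] assms[of 2] assms[of 3] assms
  by (auto simp: trie_def less_2_cases_iff numeral_eq_Suc)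
qed

lemma dict_empty: "(\<And>a. a < 2 ^ (K + 3) ==> M a = 0) ==> dict K M 4 {} (\<lambda>_. 0)"
 unfolding dict_def prefixes_def using trie_empty by blast

lemma mod_double: "k mod 2 ^ Suc d = k mod 2 ^ d + (k div 2 ^ d mod 2) * 2 ^ d" for k :: nat
 by (metis add.commute mod_mult2_eq mult.commute power_Suc2)

text \<open>Both words of node 0 are 0, so a descent that has left the trie stays at node 0. Lookups
  need no test for absence, and missing keys have the value 0.\<close>

lemma trie_step:
 assumes t: "trie K M f P \<nu> V" and "d < K"
  and node: "node = (if (d, k mod 2 ^ d) \<in> P then \<nu> (d, k mod 2 ^ d) else 0)"
 shows "M (node + k div 2 ^ d mod 2) =
     (if (Suc d, k mod 2 ^ Suc d) \<in> P then \<nu> (Suc d, k mod 2 ^ Suc d) else 0)"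
proof (cases "(d, k mod 2 ^ d) \<in> P")
 case True
 moreover have "\<forall>d z \<beta>. (d, z) \<in> P --> d < K --> \<beta> < 2 -->
    M (\<nu> (d, z) + \<beta>) = (if (Suc d, z + \<beta> * 2 ^ d) \<in> P then \<nu> (Suc d, z + \<beta> * 2 ^ d) else 0)"
  using t unfolding trie_def by blast
 ultimately show ?thesis using node \<open>d < K\<close> unfolding mod_double by simp
next
 case False
 have cl: "\<forall>d z. (Suc d, z) \<in> P --> (d, z mod 2 ^ d) \<in> P" and M: "M 0 = 0" "M 1 = 0"
  using t unfolding trie_def by blast+
 have "k mod 2 ^ Suc d mod 2 ^ d = k mod 2 ^ d"
  by (simp add: mod_mod_cancel le_imp_power_dvd)
 hence "(Suc d, k mod 2 ^ Suc d) \<notin> P" using cl False by metis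
 moreover have "k div 2 ^ d mod 2 = 0 \<or> k div 2 ^ d mod 2 = 1" by auto
 ultimately show ?thesis using False node M by auto
qed

text \<open>Parity tells the two words of a node apart, hence words of different nodes never
  coincide.\<close>

lemma even_slot:
 fixes x y :: nat
 assumes "even x" "even y" "\<beta> < 2" "\<beta>' < 2"
 shows "x + \<beta> = y + \<beta>' \<longleftrightarrow> x = y \<and> \<beta> = \<beta>'"
 using assms by presburger

text \<open>The words from \<open>f\<close> on are 0. A node allocated there has no children and the
  value 0, so the represented function stays the same while the parent gains a pointer.\<close>

lemma trie_new:
 assumes t: "trie K M f P \<nu> V" and d: "d < K" and p: "(d, k mod 2 ^ d) \<in> P"
  and new: "(Suc d, k mod 2 ^ Suc d) \<notin> P"
 defines "a \<equiv> \<nu> (d, k mod 2 ^ d) + k div 2 ^ d mod 2"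
 shows "trie K (M(a := f)) (f + 2) (insert (Suc d, k mod 2 ^ Suc d) P)
     (\<nu>((Suc d, k mod 2 ^ Suc d) := f)) V"
proof -
 let ?z = "k mod 2 ^ d" and ?q = "(Suc d, k mod 2 ^ Suc d)"
 let ?\<beta> = "k div 2 ^ d mod 2"
 have t': "P \<subseteq> Sigma {..K} (\<lambda>d. {..<2 ^ d})" "f = 2 + 2 * card P" "(0, 0) \<in> P" "\<nu> (0, 0) = 2"
  "\<forall>p\<in>P. 2 \<le> \<nu> p \<and> even (\<nu> p) \<and> \<nu> p + 2 \<le> f" "inj_on \<nu> P"
  "\<forall>d z. (Suc d, z) \<in> P --> (d, z mod 2 ^ d) \<in> P"
  "\<forall>d z \<beta>. (d, z) \<in> P --> d < K --> \<beta> < 2 -->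
    M (\<nu> (d, z) + \<beta>) = (if (Suc d, z + \<beta> * 2 ^ d) \<in> P then \<nu> (Suc d, z + \<beta> * 2 ^ d) else 0)"
  "\<forall>k. V k = (if (K, k) \<in> P then M (\<nu> (K, k)) else 0)"
  "M 0 = 0" "M 1 = 0" "\<forall>a. f \<le> a --> a < 2 ^ (K + 3) --> M a = 0"
  using t unfolding trie_def by - (elim conjE, assumption)+
 note P = t'(1) and f = t'(2) and root = t'(3,4) and ev = t'(5)[rule_format] and inj = t'(6)
  and cl = t'(7)[rule_format] and ch = t'(8)[rule_format] and V = t'(9)[rule_format]
  and M = t'(10,11) t'(12)[rule_format]
 have fin: "finite P" using P finite_subset by blast
 have lim: "f + 2 \<le> 2 ^ (K + 3)"
 proof -
  have "f \<le> 2 ^ (K + 2)" by (rule trie_free_le[OF t])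
  moreover have "(4::nat) * 1 \<le> 4 * 2 ^ K" by (intro mult_le_mono) auto
  moreover have "(2::nat) ^ (K + 2) = 4 * 2 ^ K" "(2::nat) ^ (K + 3) = 8 * 2 ^ K" by (simp_all add: power_add)
  ultimately show ?thesis by linarith
 qed
 have slot: "\<nu> p + \<beta> = \<nu> p' + \<beta>' \<longleftrightarrow> p = p' \<and> \<beta> = \<beta>'"
  if "p \<in> P" "p' \<in> P" "\<beta> < 2" "\<beta>' < 2" for p p' \<beta> \<beta>'
  using even_slot[of "\<nu> p" "\<nu> p'"] ev[OF that(1)] ev[OF that(2)] that inj_on_eq_iff[OF inj that(1,2)]
  by metis
 have a: "2 \<le> a" "a < f" using ev[OF p] unfolding a_def by auto
 have zz: "k mod 2 ^ Suc d = ?z + ?\<beta> * 2 ^ d" by (rule mod_double)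
 have inj2: "z + \<beta> * 2 ^ d' = z' + \<beta>' * 2 ^ d' \<longleftrightarrow> z = z' \<and> \<beta> = \<beta>'" if "z < 2 ^ d'" "z' < 2 ^ d'" for z z' \<beta> \<beta>' d' :: nat
 proof -
  have "(z + \<beta> * 2 ^ d') mod 2 ^ d' = z" "(z' + \<beta>' * 2 ^ d') mod 2 ^ d' = z'" using that by simp_all
  hence "z + \<beta> * 2 ^ d' = z' + \<beta>' * 2 ^ d' ==> z = z'" by metis
  thus ?thesis by auto
 qed
 have child: "(M(a := f)) ((\<nu>(?q := f)) (d', z) + \<beta>) =
   (if (Suc d', z + \<beta> * 2 ^ d') \<in> insert ?q P then (\<nu>(?q := f)) (Suc d', z + \<beta> * 2 ^ d') else 0)"
  if "(d', z) \<in> insert ?q P" "d' < K" "\<beta> < 2" for d' z \<beta>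
 proof (cases "(d', z) = ?q")
  case True
  have "(Suc d', z + \<beta> * 2 ^ d') \<notin> P"
  proof
   assume "(Suc d', z + \<beta> * 2 ^ d') \<in> P"
   hence "(d', (z + \<beta> * 2 ^ d') mod 2 ^ d') \<in> P" by (rule cl)
   moreover have "z < 2 ^ d'" using True by auto
   ultimately show False using new True by auto
  qed
  moreover have "(Suc d', z + \<beta> * 2 ^ d') \<noteq> ?q" using True by auto
  moreover have "(M(a := f)) (f + \<beta>) = 0" using a(2) M(3)[of "f + \<beta>"] lim that(3) by simp
  moreover have "(\<nu>(?q := f)) (d', z) = f" unfolding True by simp
  ultimately show ?thesis by (simp only: insert_iff simp_thms if_False)
 next
  case False
  hence P': "(d', z) \<in> P" using that by auto
  hence z: "z < 2 ^ d'" using P by auto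
  have "\<nu> (d', z) + \<beta> = a \<longleftrightarrow> (Suc d', z + \<beta> * 2 ^ d') = ?q"
   unfolding a_def slot[OF P' p that(3) mod_less_divisor[OF zero_less_numeral]] zz
   using inj2[OF z, of ?z \<beta> ?\<beta>] by auto
  moreover have "(\<nu>(?q := f)) (d', z) = \<nu> (d', z)" using False by (rule fun_upd_other)
  moreover have "(Suc d', z + \<beta> * 2 ^ d') \<noteq> ?q ==> (\<nu>(?q := f)) (Suc d', z + \<beta> * 2 ^ d') = \<nu> (Suc d', z + \<beta> * 2 ^ d')"
   by (rule fun_upd_other)
  ultimately show ?thesis using ch[OF P' that(2,3)]
   by (cases "(Suc d', z + \<beta> * 2 ^ d') = ?q") (simp_all only: fun_upd_same fun_upd_other insert_iff simp_thms if_True)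
 qed
 have val: "V k' = (if (K, k') \<in> insert ?q P then (M(a := f)) ((\<nu>(?q := f)) (K, k')) else 0)" for k'
 proof (cases "(K, k') = ?q")
  case True
  hence "V k' = 0" using V new by auto
  moreover have "M f = 0" using M(3) lim by simp
  ultimately show ?thesis using True a by auto
 next
  case False
  have "\<nu> (K, k') \<noteq> a" if "(K, k') \<in> P"
   using slot[OF that p, of 0 ?\<beta>] d unfolding a_def by auto
  thus ?thesis using False V[of k'] by auto
 qed
 have "f = 2 + 2 * card P" by (rule f)
 hence f2: "f + 2 = 2 + 2 * card (insert ?q P)" using new fin by simp
 have inj': "inj_on (\<nu>(?q := f)) (insert ?q P)"
 proof (rule inj_onI)
  fix p p' assume "p \<in> insert ?q P" "p' \<in> insert ?q P" "(\<nu>(?q := f)) p = (\<nu>(?q := f)) p'"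
  thus "p = p'"
   using inj_onD[OF inj, of p p'] ev[of p] ev[of p'] by (cases "p = ?q"; cases "p' = ?q") auto
 qed
 show ?thesis unfolding trie_def
 proof (intro conjI)
  show "insert ?q P \<subseteq> Sigma {..K} (\<lambda>d. {..<2 ^ d})" using P d by auto
  show "\<forall>p\<in>insert ?q P. 2 \<le> (\<nu>(?q := f)) p \<and> even ((\<nu>(?q := f)) p) \<and> (\<nu>(?q := f)) p + 2 \<le> f + 2"
  proof
   fix p assume "p \<in> insert ?q P"
   thus "2 \<le> (\<nu>(?q := f)) p \<and> even ((\<nu>(?q := f)) p) \<and> (\<nu>(?q := f)) p + 2 \<le> f + 2"
    using ev[of p] f by (cases "p = ?q") auto
  qed
  show "\<forall>d' z. (Suc d', z) \<in> insert ?q P --> (d', z mod 2 ^ d') \<in> insert ?q P"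
  proof (intro allI impI)
   fix d' z assume "(Suc d', z) \<in> insert ?q P"
   then consider "(Suc d', z) \<in> P" | "d' = d" "z = k mod 2 ^ Suc d" by auto
   thus "(d', z mod 2 ^ d') \<in> insert ?q P"
   proof cases
    case 1
    thus ?thesis using cl by blast
   next
    case 2
    have "k mod 2 ^ Suc d mod 2 ^ d = k mod 2 ^ d" by (simp add: mod_mod_cancel le_imp_power_dvd)
    thus ?thesis using p 2 by simp
   qed
  qed
  show "\<forall>a'. f + 2 \<le> a' --> a' < 2 ^ (K + 3) --> (M(a := f)) a' = 0" using M(3) a(2) by simp
  show "\<forall>d' z \<beta>. (d', z) \<in> insert ?q P --> d' < K --> \<beta> < 2 -->
    (M(a := f)) ((\<nu>(?q := f)) (d', z) + \<beta>) =
    (if (Suc d', z + \<beta> * 2 ^ d') \<in> insert ?q P then (\<nu>(?q := f)) (Suc d', z + \<beta> * 2 ^ d') else 0)"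
   using child by blast
  show "\<forall>k'. V k' = (if (K, k') \<in> insert ?q P then (M(a := f)) ((\<nu>(?q := f)) (K, k')) else 0)"
   using val by blast
  show "(M(a := f)) 0 = 0" "(M(a := f)) 1 = 0" using M(1,2) a(1) by auto
  show "(\<nu>(?q := f)) (0, 0) = 2" using root by simp
 qed (use root f2 inj' in \<open>blast+\<close>)
qed

lemma trie_set:
 assumes t: "trie K M f P \<nu> V" and p: "(K, k) \<in> P"
 shows "trie K (M(\<nu> (K, k) := v)) f P \<nu> (V(k := v))"
proof -
 have ev: "\<And>p. p \<in> P ==> 2 \<le> \<nu> p \<and> even (\<nu> p) \<and> \<nu> p + 2 \<le> f" and inj: "inj_on \<nu> P"
  using t unfolding trie_def by blast+
 have slot: "\<nu> p' + \<beta> = \<nu> (K, k) \<longleftrightarrow> p' = (K, k) \<and> \<beta> = 0" if "p' \<in> P" "\<beta> < 2" for p' \<beta>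
  using even_slot[of "\<nu> p'" "\<nu> (K, k)" \<beta> 0] ev[OF that(1)] ev[OF p] that inj_on_eq_iff[OF inj that(1) p]
  by simp
 let ?a = "\<nu> (K, k)"
 have M: "(M(?a := v)) (\<nu> (d, z) + \<beta>) = M (\<nu> (d, z) + \<beta>)" if "(d, z) \<in> P" "d < K" "\<beta> < 2" for d z \<beta>
  using slot[OF that(1,3)] that(2) by auto
 have V: "V k' = (if (K, k') \<in> P then M (\<nu> (K, k')) else 0)" for k'
  using t unfolding trie_def by blast
 have V': "(V(k := v)) k' = (if (K, k') \<in> P then (M(?a := v)) (\<nu> (K, k')) else 0)" for k'
  using V[of k'] p slot[of "(K, k')" 0] by (cases "k' = k") auto
 have other: "(M(?a := v)) 0 = M 0" "(M(?a := v)) 1 = M 1" "\<And>a. f \<le> a ==> (M(?a := v)) a = M a"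
  using ev[OF p] by auto
 have t': "\<forall>d z \<beta>. (d, z) \<in> P --> d < K --> \<beta> < 2 -->
    M (\<nu> (d, z) + \<beta>) = (if (Suc d, z + \<beta> * 2 ^ d) \<in> P then \<nu> (Suc d, z + \<beta> * 2 ^ d) else 0)"
  "M 0 = 0" "M 1 = 0" "\<forall>a. f \<le> a --> a < 2 ^ (K + 3) --> M a = 0"
  using t unfolding trie_def by - (elim conjE, assumption)+
 show ?thesis unfolding trie_def
 proof (intro conjI)
  show "\<forall>d z \<beta>. (d, z) \<in> P --> d < K --> \<beta> < 2 --> (M(?a := v)) (\<nu> (d, z) + \<beta>) =
    (if (Suc d, z + \<beta> * 2 ^ d) \<in> P then \<nu> (Suc d, z + \<beta> * 2 ^ d) else 0)"
   using M t'(1) by metis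
  show "\<forall>k'. (V(k := v)) k' = (if (K, k') \<in> P then (M(?a := v)) (\<nu> (K, k')) else 0)" using V' by blast
  show "(M(?a := v)) 0 = 0" "(M(?a := v)) 1 = 0" "\<forall>a. f \<le> a --> a < 2 ^ (K + 3) --> (M(?a := v)) a = 0"
   using other t'(2-4) by metis+
 qed (insert t[unfolded trie_def], elim conjE, assumption)+
qed

subsection \<open>Programs for tries\<close>

abbreviation (input) "rBase \<equiv> 20 :: nat"
abbreviation (input) "rK \<equiv> 21 :: nat"
abbreviation (input) "rKey \<equiv> 40 :: nat"
abbreviation (input) "rRes \<equiv> 41 :: nat"
abbreviation (input) "rNode \<equiv> 42 :: nat"
abbreviation (input) "rRest \<equiv> 43 :: nat"
abbreviation (input) "rLvl \<equiv> 44 :: nat"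
abbreviation (input) "rVal \<equiv> 45 :: nat"
abbreviation (input) "rFree \<equiv> 46 :: nat"
abbreviation (input) "rAddr \<equiv> 47 :: nat"
abbreviation (input) "rChild \<equiv> 48 :: nat"

definition lookup :: com where
 "lookup =
  Set rNode (Cn 2) ;; Set rRest (Rg rKey) ;;
  For rLvl rK (
   Ld rNode (Rg rBase [+] Rg rNode [+] (Rg rRest [mod] Cn 2)) ;;
   Set rRest (Rg rRest [div] Cn 2)) ;;
  Ld rRes (Rg rBase [+] Rg rNode)"

definition insert_key :: com where
 "insert_key =
  Set rNode (Cn 2) ;; Set rRest (Rg rKey) ;;
  For rLvl rK (
   Set rAddr (Rg rBase [+] Rg rNode [+] (Rg rRest [mod] Cn 2)) ;;
   Ld rChild (Rg rAddr) ;;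
   Cond (Rg rChild) Skip
    (Set rChild (Rg rFree) ;; St (Rg rAddr) (Rg rFree) ;; Set rFree (Rg rFree [+] Cn 2)) ;;
   Set rNode (Rg rChild) ;;
   Set rRest (Rg rRest [div] Cn 2)) ;;
  St (Rg rBase [+] Rg rNode) (Rg rVal)"

lemma wr_lookup [simp]: "wr lookup = {rNode, rRest, rLvl, rRes}"
 by (auto simp: lookup_def)

lemma stores_lookup [simp]: "\<not> stores lookup"
 by (simp add: lookup_def)

lemma wr_insert_key [simp]: "wr insert_key = {rNode, rRest, rLvl, rAddr, rChild, rFree}"
 by (auto simp: insert_key_def)

locale trie_machine = word_machine +
 fixes K base :: nat
 assumes fits: "base + 2 ^ (K + 3) \<le> 2 ^ b"
begin

definition dict_at :: "st => nat => nat set => (nat => nat) => bool" where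
 "dict_at s f A V \<longleftrightarrow>
  fst s rBase = base \<and> fst s rK = K \<and> dict K (\<lambda>a. snd s (base + a)) f A V"

lemma div_exp_Suc: "k div 2 ^ d div 2 = k div 2 ^ Suc d" for k d :: nat
 by (simp add: div_mult2_eq[symmetric] mult.commute)

lemma lookup_correct:
 assumes d: "dict_at s f A V" and key: "fst s rKey < 2 ^ K"
 shows "fst (sem b lookup s) rRes = V (fst s rKey)"
proof -
 obtain P \<nu> where t: "trie K (\<lambda>a. snd s (base + a)) f P \<nu> V"
  using d by (auto simp: dict_at_def dict_def)
 let ?k = "fst s rKey"
 let ?body = "Ld rNode (Rg rBase [+] Rg rNode [+] (Rg rRest [mod] Cn 2)) ;; Set rRest (Rg rRest [div] Cn 2)"
 let ?s = "sem b (Set rNode (Cn 2) ;; Set rRest (Rg rKey)) s"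
 let ?n = "\<lambda>d. if (d, ?k mod 2 ^ d) \<in> P then \<nu> (d, ?k mod 2 ^ d) else 0"
 \<comment> \<open>The loop counts down: with \<open>i\<close> iterations left, the first
   \<open>K - i\<close> bits of the key have been read.\<close>
 define I where "I i ms \<longleftrightarrow> snd ms = snd s \<and> fst ms rBase = base \<and> fst ms rNode = ?n (K - i) \<and>
   fst ms rRest = ?k div 2 ^ (K - i)" for i and ms :: st
 have root: "(0, 0) \<in> P" "\<nu> (0, 0) = 2" and ev: "\<And>p. p \<in> P ==> \<nu> p + 2 \<le> f"
  using t unfolding trie_def by blast+
 have f: "f \<le> 2 ^ (K + 2)" by (rule trie_free_le[OF t])
 have lim: "base + (?n d + 2) \<le> 2 ^ b" for d
 proof -
  have "?n d + 2 \<le> f" using ev ev[OF root(1)] by auto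
  thus ?thesis using f fits by (simp add: power_add)
 qed
 have "I 0 (sem b (For rLvl rK ?body) ?s)"
 proof (rule sem_For_inv)
  show "I (fst ?s rK) (upd rLvl (fst ?s rK) ?s)"
   using d root by (simp add: I_def dict_at_def)
 next
  fix i ms assume i: "i < fst ?s rK" and inv: "I (Suc i) ms"
  have "i < K" using i d by (simp add: dict_at_def)
  let ?d = "K - Suc i"
  have d1: "Suc ?d = K - i" "?d < K" using \<open>i < K\<close> by auto
  have l: "base + ?n ?d + 1 < 2 ^ b" using lim[of ?d] by linarith
  have "fst ms rBase + fst ms rNode < 2 ^ b" "fst ms rBase + fst ms rNode + fst ms rRest mod 2 < 2 ^ b"
   using inv l unfolding I_def by (auto intro: le_less_trans[OF _ l] simp del: if_split)
  hence "sem b ?body (upd rLvl i ms) =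
    upd rRest (?k div 2 ^ Suc ?d) (upd rNode (snd s (base + (?n ?d + ?k div 2 ^ ?d mod 2))) (upd rLvl i ms))"
   using inv unfolding I_def by (simp add: alu_Plus div_exp_Suc del: power_Suc add: add.assoc)
  moreover have "snd s (base + (?n ?d + ?k div 2 ^ ?d mod 2)) = ?n (Suc ?d)"
   by (rule trie_step[OF t d1(2) refl])
  ultimately show "I i (sem b ?body (upd rLvl i ms))"
   using inv unfolding I_def d1(1) by simp
 qed
 hence fin: "I 0 (sem b (For rLvl rK ?body) ?s)" .
 have V: "V ?k = (if (K, ?k) \<in> P then snd s (base + \<nu> (K, ?k)) else 0)" and M0: "snd s base = 0"
  using t unfolding trie_def by auto
 let ?t = "sem b (For rLvl rK ?body) ?s"
 have "snd ?t = snd s" "fst ?t rBase = base" "fst ?t rNode = ?n K"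
  using fin unfolding I_def diff_zero by - (elim conjE, assumption)+
 moreover have "base + ?n K < 2 ^ b" using lim[of K] by linarith
 ultimately have "fst (sem b (Ld rRes (Rg rBase [+] Rg rNode)) ?t) rRes = snd s (base + ?n K)"
  unfolding sem.simps(3) eval.simps upd_simps fun_upd_same by (simp only: alu_Plus)
 moreover have "sem b lookup s = sem b (Ld rRes (Rg rBase [+] Rg rNode)) ?t"
  by (simp only: lookup_def sem.simps)
 ultimately have "fst (sem b lookup s) rRes = snd s (base + ?n K)" by simp
 thus ?thesis using V M0 key by simp
qed

lemma insert_correct:
 assumes d: "dict_at s (fst s rFree) A V" and key: "fst s rKey < 2 ^ K"
 defines "s' \<equiv> sem b insert_key s"
 shows "dict_at s' (fst s' rFree) (insert (fst s rKey) A) (V(fst s rKey := fst s rVal))"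
  and "\<And>a. a < base \<or> base + 2 ^ (K + 3) \<le> a ==> snd s' a = snd s a"
proof -
 obtain P0 \<nu>0 where t0: "trie K (\<lambda>a. snd s (base + a)) (fst s rFree) P0 \<nu>0 V" and P0: "P0 \<subseteq> prefixes K A"
  using d by (auto simp: dict_at_def dict_def)
 let ?k = "fst s rKey"
 let ?A = "insert ?k A"
 let ?new = "Set rChild (Rg rFree) ;; St (Rg rAddr) (Rg rFree) ;; Set rFree (Rg rFree [+] Cn 2)"
 let ?body = "Set rAddr (Rg rBase [+] Rg rNode [+] (Rg rRest [mod] Cn 2)) ;;
   Ld rChild (Rg rAddr) ;; Cond (Rg rChild) Skip ?new ;;
   Set rNode (Rg rChild) ;; Set rRest (Rg rRest [div] Cn 2)"
 let ?s = "sem b (Set rNode (Cn 2) ;; Set rRest (Rg rKey)) s"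
 let ?out = "\<lambda>a. a < base \<or> base + 2 ^ (K + 3) \<le> a"
 define I where "I i ms \<longleftrightarrow> (\<forall>a. ?out a --> snd ms a = snd s a) \<and> fst ms rBase = base \<and>
   fst ms rVal = fst s rVal \<and> fst ms rRest = ?k div 2 ^ (K - i) \<and>
   (\<exists>P \<nu>. trie K (\<lambda>a. snd ms (base + a)) (fst ms rFree) P \<nu> V \<and> P \<subseteq> prefixes K ?A \<and>
    (K - i, ?k mod 2 ^ (K - i)) \<in> P \<and> fst ms rNode = \<nu> (K - i, ?k mod 2 ^ (K - i)))" for i and ms :: st
 have "prefixes K A \<subseteq> prefixes K ?A" unfolding prefixes_def by auto
 hence P0': "P0 \<subseteq> prefixes K ?A" using P0 by blast
 have root: "(0, 0) \<in> P0" "\<nu>0 (0, 0) = 2" using t0 unfolding trie_def by blast+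
 have "I 0 (sem b (For rLvl rK ?body) ?s)"
 proof (rule sem_For_inv)
  show "I (fst ?s rK) (upd rLvl (fst ?s rK) ?s)"
   using d root t0 P0' by (auto simp: I_def dict_at_def)
 next
  fix i ms assume i: "i < fst ?s rK" and inv: "I (Suc i) ms"
  have "i < K" using i d by (simp add: dict_at_def)
  let ?d = "K - Suc i"
  have d1: "Suc ?d = K - i" "?d < K" using \<open>i < K\<close> by auto
  from inv obtain P \<nu> where t: "trie K (\<lambda>a. snd ms (base + a)) (fst ms rFree) P \<nu> V"
   and P: "P \<subseteq> prefixes K ?A" "(?d, ?k mod 2 ^ ?d) \<in> P" "fst ms rNode = \<nu> (?d, ?k mod 2 ^ ?d)"
   unfolding I_def by (elim exE conjE) (rule that)
  let ?p = "(?d, ?k mod 2 ^ ?d)" and ?q = "(Suc ?d, ?k mod 2 ^ Suc ?d)"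
  have ev: "2 \<le> \<nu> ?p" "\<nu> ?p + 2 \<le> fst ms rFree" using t P(2) unfolding trie_def by blast+
  have f: "fst ms rFree \<le> 2 ^ (K + 2)" by (rule trie_free_le[OF t])
  let ?a = "\<nu> ?p + ?k div 2 ^ ?d mod 2"
  have step: "snd ms (base + ?a) = (if ?q \<in> P then \<nu> ?q else 0)"
   by (rule trie_step[OF t d1(2)]) (use P in auto)
  have "(4::nat) * 1 \<le> 4 * 2 ^ K" by (intro mult_le_mono) auto
  hence four: "(4::nat) \<le> 2 ^ (K + 2)" by (simp add: power_add)
  have a: "base + \<nu> ?p + ?k div 2 ^ ?d mod 2 < 2 ^ b" "base + \<nu> ?p < 2 ^ b"
   "fst ms rFree + 2 < 2 ^ b" "?a < 2 ^ (K + 3)"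
   using ev f fits four by (auto simp: power_add)
  have q: "?q \<in> prefixes K ?A"
   using \<open>i < K\<close> unfolding prefixes_def d1(1) by (auto intro!: image_eqI[of _ _ "(?k, K - i)"])
  have inv': "\<forall>a. ?out a --> snd ms a = snd s a" "fst ms rBase = base" "fst ms rVal = fst s rVal"
   "fst ms rRest = ?k div 2 ^ ?d"
   using inv unfolding I_def by - (elim conjE, assumption)+
  have "base + \<nu> ?p + ?k div 2 ^ ?d mod 2 = base + ?a" by simp
  note sem_simps = inv'(2,4) P(3) alu_Plus[OF a(1)] alu_Plus[OF a(2)] this step div_exp_Suc
  show "I i (sem b ?body (upd rLvl i ms))"
  proof (cases "?q \<in> P")
   case True
   have "2 \<le> \<nu> ?q" using t True unfolding trie_def by blast
   let ?T = "upd rRest (?k div 2 ^ Suc ?d) (upd rNode (\<nu> ?q) (upd rChild (\<nu> ?q) (upd rAddr (base + ?a) (upd rLvl i ms))))"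
   have eq: "sem b ?body (upd rLvl i ms) = ?T"
    using \<open>2 \<le> \<nu> ?q\<close> True by (simp add: sem_simps del: power_Suc)
   have T: "snd ?T = snd ms" "fst ?T rBase = base" "fst ?T rVal = fst s rVal" "fst ?T rRest = ?k div 2 ^ (K - i)"
    "fst ?T rFree = fst ms rFree" "fst ?T rNode = \<nu> ?q"
    unfolding d1(1)[symmetric] by (simp_all add: inv' del: power_Suc)
   show ?thesis
    unfolding I_def eq unfolding T
    using inv'(1) t P(1) True unfolding d1(1)
    by - (intro conjI refl, assumption, rule exI[of _ P], rule exI[of _ \<nu>], intro conjI refl, assumption+)
  next
   case False
   let ?f = "fst ms rFree"
   let ?T = "upd rRest (?k div 2 ^ Suc ?d) (upd rNode ?f (upd rFree (?f + 2) (updm (base + ?a) ?f (upd rChild ?f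
     (upd rChild 0 (upd rAddr (base + ?a) (upd rLvl i ms)))))))"
   have eq: "sem b ?body (upd rLvl i ms) = ?T"
    using False by (simp add: sem_simps alu_Plus[OF a(3)] del: power_Suc)
   have T: "snd ?T = (snd ms)(base + ?a := ?f)" "fst ?T rBase = base" "fst ?T rVal = fst s rVal"
    "fst ?T rRest = ?k div 2 ^ (K - i)" "fst ?T rFree = ?f + 2" "fst ?T rNode = ?f"
    unfolding d1(1)[symmetric] by (simp_all add: inv' del: power_Suc)
   have "trie K (\<lambda>c. ((snd ms)(base + ?a := ?f)) (base + c)) (?f + 2) (insert ?q P) (\<nu>(?q := ?f)) V"
   proof -
    have "(\<lambda>c. ((snd ms)(base + ?a := ?f)) (base + c)) = (\<lambda>c. snd ms (base + c))(?a := ?f)"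
     by (auto simp: fun_eq_iff)
    thus ?thesis using trie_new[OF t d1(2) P(2) False] by simp
   qed
   moreover have "insert ?q P \<subseteq> prefixes K ?A" "?q \<in> insert ?q P" "?f = (\<nu>(?q := ?f)) ?q"
    using P(1) q by simp_all
   moreover have "\<forall>c. ?out c --> ((snd ms)(base + ?a := ?f)) c = snd s c"
    using inv'(1) a(4) by auto
   ultimately show ?thesis
    unfolding I_def eq unfolding T unfolding d1(1)
    by - (intro conjI refl, assumption, rule exI[of _ "insert (K - i, ?k mod 2 ^ (K - i)) P"],
      rule exI[of _ "\<nu>((K - i, ?k mod 2 ^ (K - i)) := ?f)"], intro conjI refl, assumption+)
  qed
 qed
 hence fin0: "I 0 (sem b (For rLvl rK ?body) ?s)" .
 let ?t = "sem b (For rLvl rK ?body) ?s"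
 from fin0[unfolded I_def diff_zero mod_less[OF key]]
 have fin: "\<forall>a. ?out a --> snd ?t a = snd s a" "fst ?t rBase = base" "fst ?t rVal = fst s rVal"
  and ex: "\<exists>P \<nu>. trie K (\<lambda>a. snd ?t (base + a)) (fst ?t rFree) P \<nu> V \<and> P \<subseteq> prefixes K ?A \<and>
    (K, ?k) \<in> P \<and> fst ?t rNode = \<nu> (K, ?k)"
  by - (elim conjE, assumption)+
 from ex obtain P \<nu> where t: "trie K (\<lambda>a. snd ?t (base + a)) (fst ?t rFree) P \<nu> V"
  and P: "P \<subseteq> prefixes K ?A" "(K, ?k) \<in> P" "fst ?t rNode = \<nu> (K, ?k)"
  by (elim exE conjE) (rule that)
 have ev: "\<nu> (K, ?k) + 2 \<le> fst ?t rFree" using t P(2) unfolding trie_def by blast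
 have f: "fst ?t rFree \<le> 2 ^ (K + 2)" by (rule trie_free_le[OF t])
 have a: "base + \<nu> (K, ?k) < 2 ^ b" "\<nu> (K, ?k) < 2 ^ (K + 3)"
  using ev f fits by (auto simp: power_add)
 have "s' = sem b (St (Rg rBase [+] Rg rNode) (Rg rVal)) ?t"
  by (simp only: s'_def insert_key_def sem.simps)
 hence s': "s' = updm (base + \<nu> (K, ?k)) (fst s rVal) ?t"
  unfolding sem.simps(4) eval.simps fin(2,3) P(3) using a by (simp only: alu_Plus)
 have eq: "(\<lambda>c. snd s' (base + c)) = (\<lambda>c. snd ?t (base + c))(\<nu> (K, ?k) := fst s rVal)"
  unfolding s' by (auto simp: fun_eq_iff)
 have "trie K (\<lambda>c. snd s' (base + c)) (fst s' rFree) P \<nu> (V(?k := fst s rVal))"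
  unfolding eq using trie_set[OF t P(2)] by (simp add: s')
 moreover have "fst s' rBase = base" "fst s' rK = K"
  using d unfolding s'_def by (simp_all add: dict_at_def)
 ultimately show "dict_at s' (fst s' rFree) ?A (V(?k := fst s rVal))"
  unfolding dict_at_def dict_def using P(1) by blast
 show "snd s' a = snd s a" if "?out a" for a
  using that fin(1) a(2) unfolding s' by auto
qed

text \<open>Marks and tallies are written outside the region of the trie, so they leave the
  dictionary intact.\<close>

lemma dict_at_cong:
 assumes "dict_at s f A V" "fst s' rBase = fst s rBase" "fst s' rK = fst s rK"
  and "\<And>a. base \<le> a ==> a < base + 2 ^ (K + 3) ==> snd s' a = snd s a"
 shows "dict_at s' f A V"
proof -
 have c: "trie K M' f P \<nu> V" if t: "trie K M f P \<nu> V" and eq: "\<And>a. a < 2 ^ (K + 3) ==> M' a = M a" for M M' P \<nu>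
 proof -
  have f: "f \<le> 2 ^ (K + 2)" by (rule trie_free_le[OF t])
  have ev: "\<And>p. p \<in> P ==> \<nu> p + 2 \<le> f" using t unfolding trie_def by blast
  have "M' (\<nu> p + \<beta>) = M (\<nu> p + \<beta>)" if "p \<in> P" "\<beta> < 2" for p \<beta>
  proof (rule eq)
   have "\<nu> p + \<beta> < f" using ev[OF that(1)] that(2) by linarith
   also have "f \<le> 2 ^ (K + 2)" by (rule f)
   also have "(2::nat) ^ (K + 2) \<le> 2 ^ (K + 3)" by (rule power_increasing) auto
   finally show "\<nu> p + \<beta> < 2 ^ (K + 3)" .
  qed
  note val = this
  have val0: "M' (\<nu> p) = M (\<nu> p)" if "p \<in> P" for p using val[OF that, of 0] by simp
  have zero: "M' 0 = M 0" "M' 1 = M 1" by (rule eq, simp, rule eq, rule one_less_power) auto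
  have t': "\<forall>d z \<beta>. (d, z) \<in> P --> d < K --> \<beta> < 2 -->
    M (\<nu> (d, z) + \<beta>) = (if (Suc d, z + \<beta> * 2 ^ d) \<in> P then \<nu> (Suc d, z + \<beta> * 2 ^ d) else 0)"
   "\<forall>k. V k = (if (K, k) \<in> P then M (\<nu> (K, k)) else 0)"
   "M 0 = 0" "M 1 = 0" "\<forall>a. f \<le> a --> a < 2 ^ (K + 3) --> M a = 0"
   using t unfolding trie_def by - (elim conjE, assumption)+
  show ?thesis unfolding trie_def
  proof (intro conjI)
   show "\<forall>d z \<beta>. (d, z) \<in> P --> d < K --> \<beta> < 2 --> M' (\<nu> (d, z) + \<beta>) =
     (if (Suc d, z + \<beta> * 2 ^ d) \<in> P then \<nu> (Suc d, z + \<beta> * 2 ^ d) else 0)"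
   proof (intro allI impI)
    fix d z \<beta> :: nat assume "(d, z) \<in> P" "d < K" "\<beta> < 2"
    thus "M' (\<nu> (d, z) + \<beta>) =
      (if (Suc d, z + \<beta> * 2 ^ d) \<in> P then \<nu> (Suc d, z + \<beta> * 2 ^ d) else 0)"
     using t'(1) by (simp only: val) 
   qed
   show "\<forall>k. V k = (if (K, k) \<in> P then M' (\<nu> (K, k)) else 0)"
   proof
    fix k show "V k = (if (K, k) \<in> P then M' (\<nu> (K, k)) else 0)"
     using t'(2)[rule_format, of k] val0[of "(K, k)"] by (cases "(K, k) \<in> P") simp_all
   qed
   show "M' 0 = 0" "M' 1 = 0" "\<forall>a. f \<le> a --> a < 2 ^ (K + 3) --> M' a = 0"
    using zero eq t'(3-5) by simp_all
  qed (insert t[unfolded trie_def], elim conjE, assumption)+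
 qed
 obtain P \<nu> where t: "trie K (\<lambda>a. snd s (base + a)) f P \<nu> V" "P \<subseteq> prefixes K A"
  using assms(1) unfolding dict_at_def dict_def by (elim conjE exE) (rule that)
 have "trie K (\<lambda>a. snd s' (base + a)) f P \<nu> V"
  by (rule c[OF t(1)]) (rule assms(4), simp_all)
 moreover have "fst s' rBase = base" "fst s' rK = K"
  using assms(1-3) by (simp_all add: dict_at_def)
 ultimately show ?thesis using t(2) unfolding dict_at_def dict_def
  by (intro conjI exI[of _ P] exI[of _ \<nu>])
qed

end

section \<open>Items as leaves of a binary tree, buckets as its topmost subtrees without a stored
  count\<close>

section \<open>Items and buckets\<close>

locale layout =
 fixes n w e A :: nat and px py :: "nat => nat"
 assumes n2: "2 \<le> n" and w1: "1 \<le> w" and A1: "1 \<le> A" and An: "A \<le> n"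
  and px_le: "\<And>i. px i \<le> 2 ^ w" and py_le: "\<And>i. py i \<le> 2 ^ w"
begin

text \<open>
 Points are numbered below \<open>NP\<close>. Their coordinates, increased by 1 so that 0 marks an unused number,
 have \<open>W\<close> bits and \<open>L\<close> levels. There are \<open>N\<close> items, \<open>nt\<close> tables with \<open>m\<close> chains of length \<open>s\<close>, and
 \<open>R\<close> random words. Twice an area has \<open>AB\<close> bits, and the order of the triples is on \<open>KB\<close> bits. Keys of
 the dictionary have \<open>K\<close> bits, machine words twice as many.
\<close>

definition "q0 = floorlog 2 n"
definition "Z = w + q0"
definition "K = (e + 40) * Z"
definition "b = 2 * K"
definition "W = w + 1"
definition "NP = (2::nat) ^ q0"

text \<open>Written as the loop that the machine executes. The number of levels is rounded up to a
  power of two because \<open>N\<close> has to divide \<open>2 ^ b\<close>.\<close>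

primrec Lfun :: "nat => nat" where
 "Lfun 0 = 1"
| "Lfun (Suc i) = (if Lfun i < W then 2 * Lfun i else Lfun i)"

definition "L = Lfun W"

text \<open>The result is the greatest power of two with \<open>s ^ 4 <= A\<close>, found by
  comparisons alone. It is within a factor 2 of the real fourth root of
  \<open>n powr \<alpha>\<close> when \<open>A\<close> is the floor of the latter.\<close>

primrec sfun :: "nat => nat" where
 "sfun 0 = 1"
| "sfun (Suc i) = (if (2 * sfun i) ^ 4 \<le> A then 2 * sfun i else sfun i)"

definition "s = sfun q0"
definition "N = NP ^ 3 * L ^ 6"
definition "nt = 16 * s * K * (e + 1)"
definition "m = N div (4 * s * s)"
definition "R = nt * (s * Suc K)"
definition "AB = 2 * w + 2"
definition "KB = AB + 3 * q0"

lemma q0_2: "2 \<le> q0" and n_less: "n < NP" and NP_le: "NP \<le> 2 * n"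
proof -
 have "0 < n" using n2 by simp
 have "2 ^ (q0 - 1) \<le> n" "n < 2 ^ q0"
  using floorlog_bounds[of n 2] \<open>0 < n\<close> unfolding q0_def by auto
 thus "n < NP" by (simp add: NP_def)
 show "2 \<le> q0"
 proof (rule ccontr)
  assume "\<not> 2 \<le> q0"
  hence "(2::nat) ^ q0 \<le> 2 ^ 1" by (intro power_increasing) auto
  thus False using \<open>n < 2 ^ q0\<close> n2 by simp
 qed
 hence "NP = 2 * 2 ^ (q0 - 1)" unfolding NP_def by (cases q0) auto
 thus "NP \<le> 2 * n" using \<open>2 ^ (q0 - 1) \<le> n\<close> by simp
qed

lemma Z3: "3 \<le> Z" using q0_2 w1 by (simp add: Z_def)

lemma L_pow: "\<exists>l. L = 2 ^ l" and W_le_L: "W \<le> L" and L_le: "L \<le> 2 * W"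
proof -
 have "(\<exists>l. Lfun i = 2 ^ l) \<and> Lfun i \<le> 2 * W \<and> (W \<le> Lfun i \<or> 2 ^ i \<le> Lfun i)" for i
 proof (induction i)
  case 0
  thus ?case by (auto intro: exI[of _ 0] simp: W_def)
 next
  case (Suc i)
  then obtain l where l: "Lfun i = 2 ^ l" by blast
  hence "\<exists>l. 2 * Lfun i = 2 ^ l" by (intro exI[of _ "Suc l"]) simp
  thus ?case using Suc by auto
 qed
 from this[of W] show "\<exists>l. L = 2 ^ l" "W \<le> L" "L \<le> 2 * W"
  using less_exp[of W] by (auto simp: L_def intro: less_imp_le order_trans)
qed

definition "lw = (SOME l. L = 2 ^ l)"

lemma L_eq: "L = 2 ^ lw"
 unfolding lw_def using L_pow by (rule someI_ex)

lemma lw_le: "lw \<le> w + 1"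
proof -
 have "2 ^ lw \<le> 2 * (w + 1)" using L_le L_eq by (simp add: W_def)
 also have "\<dots> \<le> 2 * 2 ^ w" using less_exp[of w] by (intro mult_le_mono2) linarith
 finally have "(2::nat) ^ lw \<le> 2 ^ (w + 1)" by simp
 thus ?thesis by (rule power_le_imp_le_exp[rotated]) simp
qed

lemma L_pos: "0 < L" using W_le_L by (simp add: W_def)

lemma s_props: "1 \<le> s" "s ^ 4 \<le> A" "A < (2 * s) ^ 4"
proof -
 have *: "1 \<le> sfun i \<and> sfun i ^ 4 \<le> A \<and> (A < (2 * sfun i) ^ 4 \<or> 2 ^ i \<le> sfun i)" for i
  by (induction i) (use A1 in auto)
 show "1 \<le> s" "s ^ 4 \<le> A" using *[of q0] by (auto simp: s_def)
 have "A < 2 ^ q0" using An n_less by (simp add: NP_def)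
 moreover have "A < (2 * s) ^ 4" if "2 ^ q0 \<le> s"
 proof -
  have "s ^ 1 \<le> s ^ 4" using \<open>1 \<le> s\<close> by (intro power_increasing) auto
  thus ?thesis using that \<open>s ^ 4 \<le> A\<close> \<open>A < 2 ^ q0\<close> by simp
 qed
 ultimately show "A < (2 * s) ^ 4" using *[of q0] by (auto simp: s_def)
qed

lemma s_less: "s < NP"
proof -
 have "s ^ 1 \<le> s ^ 4" using s_props(1) by (intro power_increasing) auto
 thus ?thesis using s_props(2) An n_less by simp
qed

definition "q = 3 * q0 + 6 * lw"

lemma N_eq: "N = 2 ^ q"
 unfolding N_def NP_def L_eq q_def by (simp add: power_add power_mult[symmetric] mult.commute)

lemma N_pos: "0 < N" by (simp add: N_eq)

text \<open>The bit length of \<open>full x\<close>: a leading 1, six node numbers of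
  \<open>W + 1\<close> bits, the area, and the item itself.\<close>

definition "FB = 1 + 6 * (W + 1) + AB + q"

lemma power_FB: "(2::nat) ^ FB = 2 * 2 ^ (FB - 1)"
 by (subst power_Suc[symmetric]) (simp add: FB_def)

lemma FB_le: "FB \<le> 21 * Z"
 using lw_le w1 q0_2 unfolding FB_def W_def AB_def q_def Z_def by simp

lemma nt_le: "nt \<le> 2 ^ (2 * Z + 2 * e + 10)" and K_le: "Suc K \<le> 2 ^ (e + 6 + Z)"
proof -
 have Z: "Z \<le> 2 ^ Z" using less_exp[of Z] by simp
 have "e + 41 \<le> (2::nat) ^ (e + 6)"
 proof (induction e)
  case (Suc e)
  have "Suc e + 41 \<le> 2 * (e + 41)" by simp
  also have "2 * (e + 41) \<le> 2 * 2 ^ (e + 6)" using Suc by (rule mult_le_mono2)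
  also have "2 * 2 ^ (e + 6) = (2::nat) ^ (Suc e + 6)" by (simp only: add_Suc power_Suc)
  finally show ?case .
 qed simp
 hence "(e + 41) * Z \<le> 2 ^ (e + 6) * 2 ^ Z" using Z by (rule mult_le_mono)
 moreover have "Suc K \<le> (e + 41) * Z" using Z3 by (simp add: K_def algebra_simps)
 ultimately show K: "Suc K \<le> 2 ^ (e + 6 + Z)" by (simp add: power_add)
 have "s \<le> 2 ^ Z"
 proof -
  have "s \<le> 2 ^ q0" using s_less by (simp add: NP_def)
  also have "(2::nat) ^ q0 \<le> 2 ^ Z" by (intro power_increasing) (auto simp: Z_def)
  finally show ?thesis .
 qed
 moreover have "e + 1 \<le> 2 ^ e" using less_exp[of e] by linarith
 moreover have "K \<le> 2 ^ (e + 6 + Z)" using K by simp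
 ultimately have "16 * s * K * (e + 1) \<le> 16 * 2 ^ Z * 2 ^ (e + 6 + Z) * 2 ^ e"
  by (intro mult_le_mono) auto
 also have "\<dots> = 2 ^ (2 * Z + 2 * e + 10)"
  by (simp only: power_add mult_2) simp
 finally show "nt \<le> 2 ^ (2 * Z + 2 * e + 10)" by (simp add: nt_def)
qed

lemma eZ: "3 * e \<le> e * Z" using Z3 by simp

lemma pow_le_K: "x \<le> 2 ^ i ==> i \<le> K ==> x \<le> (2::nat) ^ K"
 by (erule order_trans) (rule power_increasing, auto)

lemma K_eq: "K = e * Z + 40 * Z" by (simp add: K_def algebra_simps)

text \<open>Keys for chain ends combine a node with a table number and a tag modulo 8. That they
  have at most \<open>K\<close> bits amounts to \<open>23 * Z + 2 * e + 13 <= (e + 40) * Z\<close>,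
  one of the conditions behind the factor \<open>e + 40\<close> in \<open>K\<close>.\<close>

lemma nt_FB: "2 ^ FB * nt * 8 \<le> 2 ^ K"
proof -
 have "2 ^ FB * nt * 8 \<le> 2 ^ (21 * Z) * 2 ^ (2 * Z + 2 * e + 10) * 2 ^ 3"
  using nt_le FB_le by (intro mult_le_mono power_increasing) auto
 also have "\<dots> = 2 ^ (23 * Z + 2 * e + 13)"
  by (simp only: power_add[symmetric]) (rule arg_cong, simp)
 finally show ?thesis by (rule pow_le_K) (unfold K_eq, insert eZ Z3, linarith)
qed

lemma R_le: "(R + 1) * 8 \<le> 2 ^ K"
proof -
 have "s \<le> 2 ^ Z"
 proof -
  have "s \<le> 2 ^ q0" using s_less by (simp add: NP_def)
  also have "(2::nat) ^ q0 \<le> 2 ^ Z" by (intro power_increasing) (auto simp: Z_def)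
  finally show ?thesis .
 qed
 hence "R \<le> 2 ^ (2 * Z + 2 * e + 10) * (2 ^ Z * 2 ^ (e + 6 + Z))"
  unfolding R_def using nt_le K_le by (intro mult_le_mono) auto
 also have "\<dots> = 2 ^ (4 * Z + 3 * e + 16)" by (simp add: power_add[symmetric] algebra_simps)
 finally have "R + 1 \<le> 2 * 2 ^ (4 * Z + 3 * e + 16)"
  using one_le_power[of "2::nat" "4 * Z + 3 * e + 16"] by linarith
 hence "(R + 1) * 8 \<le> 2 * 2 ^ (4 * Z + 3 * e + 16) * 8" by (rule mult_le_mono1)
 also have "\<dots> = 2 ^ (4 * Z + 3 * e + 20)" by (simp add: power_add)
 finally show ?thesis by (rule pow_le_K) (unfold K_eq, insert eZ Z3, linarith)
qed

lemma nt_pos: "0 < nt"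
 using s_props(1) Z3 by (simp add: nt_def K_def)

lemma FB_K: "FB + 3 \<le> K"
 using FB_le Z3 by (simp add: K_eq)

subsection \<open>Items\<close>

text \<open>
 An item is a triple of points, encoded as \<open>y < NP ^ 3\<close>, with a level for each of the six
 coordinates. Together with the coordinates, the levels determine six dyadic intervals.
\<close>

definition pt :: "nat => nat => nat" where
 "pt y j = y div NP ^ (2 - j) mod NP"

definition cd :: "nat => nat => nat" where
 "cd y c = (if even c then px else py) (pt y (c div 2))"

definition area2 :: "nat => nat" where
 "area2 y = nat \<bar>(int (cd y 2) - int (cd y 0)) * (int (cd y 5) - int (cd y 1)) -
        (int (cd y 4) - int (cd y 0)) * (int (cd y 3) - int (cd y 1))\<bar>"

definition kap :: "nat => nat" where
 "kap y = area2 y * NP ^ 3 + y"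

definition lv :: "nat => nat => nat" where
 "lv x c = x div L ^ (5 - c) mod L"

text \<open>The heap number of the dyadic interval of length \<open>2 ^ lv x c\<close> around the
  coordinate, in the complete binary tree over \<open>2 ^ W\<close> values with root 1.\<close>

definition nd :: "nat => nat => nat" where
 "nd x c = (2 ^ W + cd (x div L ^ 6) c) div 2 ^ lv x c"

text \<open>Bit strings are represented by numbers with a leading 1, so that a prefix carries its
  own length.\<close>

primrec Tc :: "nat => nat => nat" where
 "Tc x 0 = 1"
| "Tc x (Suc c) = Tc x c * 2 ^ (W + 1) + nd x c"

text \<open>As \<open>x\<close> is the code of a triple followed by the levels, the bits behind
  \<open>Tc x 6\<close> are those of \<open>kap\<close> followed by the levels. Fixing six intervals
  and leading bits of \<open>kap\<close> thus means fixing a prefix. The levels come last since no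
  query restricts them further.\<close>

definition full :: "nat => nat" where
 "full x = (Tc x 6 * 2 ^ AB + area2 (x div L ^ 6)) * N + x"

lemma cd_le: "cd y c \<le> 2 ^ w"
 using px_le py_le by (simp add: cd_def)

lemma cd_less: "cd y c < 2 ^ W"
proof -
 have "(2::nat) ^ w < 2 ^ W" by (simp add: W_def)
 thus ?thesis using cd_le[of y c] by linarith
qed

lemma area2_less: "area2 y < 2 ^ AB"
proof -
 have d: "\<bar>int (cd y c) - int (cd y c')\<bar> \<le> 2 ^ w" for c c'
 proof -
  have "int (cd y c) \<le> 2 ^ w" "int (cd y c') \<le> 2 ^ w"
   using cd_le[of y c] cd_le[of y c'] by (simp_all flip: of_nat_le_iff)
  thus ?thesis by linarith
 qed
 have p: "\<bar>(int (cd y a) - int (cd y a')) * (int (cd y c) - int (cd y c'))\<bar> \<le> 2 ^ w * 2 ^ w" for a a' c c'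
  unfolding abs_mult by (intro mult_mono d) auto
 have "int (area2 y) \<le> 2 ^ w * 2 ^ w + 2 ^ w * 2 ^ w"
  unfolding area2_def using p[of 2 0 5 1] p[of 4 0 3 1] by (simp add: abs_le_iff)
 also have "(2::int) ^ w * 2 ^ w + 2 ^ w * 2 ^ w < 2 ^ AB"
 proof -
  have "(2::int) ^ AB = 4 * (2 ^ w * 2 ^ w)"
   by (simp only: AB_def mult_2 power_add power2_eq_square) simp
  moreover have "(0::int) < 2 ^ w * 2 ^ w" by simp
  ultimately show ?thesis by linarith
 qed
 finally show ?thesis by (simp flip: of_nat_less_iff)
qed

lemma nd_less: "nd x c < 2 ^ (W + 1)"
proof -
 have "nd x c \<le> 2 ^ W + cd (x div L ^ 6) c" by (simp add: nd_def)
 thus ?thesis using cd_less[of "x div L ^ 6" c] by simp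
qed

lemma Tc_bounds: "2 ^ (c * (W + 1)) \<le> Tc x c \<and> Tc x c < 2 ^ (c * (W + 1) + 1)"
proof (induction c)
 case (Suc c)
 have "Tc x c * 2 ^ (W + 1) + nd x c < (Tc x c + 1) * 2 ^ (W + 1)" using nd_less by simp
 also have "\<dots> \<le> 2 ^ (c * (W + 1) + 1) * 2 ^ (W + 1)" using Suc by (intro mult_le_mono1) auto
 finally have "Tc x (Suc c) < 2 ^ (Suc c * (W + 1) + 1)" by (simp add: power_add algebra_simps)
 moreover have "2 ^ (c * (W + 1)) * 2 ^ (W + 1) \<le> Tc x c * 2 ^ (W + 1)" using Suc by (intro mult_le_mono1) auto
 hence "2 ^ (Suc c * (W + 1)) \<le> Tc x (Suc c)"
  unfolding Tc.simps mult_Suc power_add[of 2 "W + 1"] by (simp only: mult.commute[of "2 ^ (W + 1)"])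
 ultimately show ?case by blast
qed simp

lemma full_bounds: 
 assumes "x < N"
 shows "2 ^ (FB - 1) \<le> full x" "full x < 2 ^ FB"
proof -
 let ?T = "Tc x 6" and ?a = "area2 (x div L ^ 6)"
 have T: "2 ^ (6 * (W + 1)) \<le> ?T" "?T < 2 ^ (6 * (W + 1) + 1)" using Tc_bounds[of 6 x] by auto
 have "2 ^ (FB - 1) = 2 ^ (6 * (W + 1)) * 2 ^ AB * N"
  unfolding N_eq FB_def by (simp add: power_add)
 also have "\<dots> \<le> ?T * 2 ^ AB * N" using T by (intro mult_le_mono1) auto
 also have "\<dots> \<le> full x" by (simp add: full_def algebra_simps)
 finally show "2 ^ (FB - 1) \<le> full x" .
 have "?T * 2 ^ AB + ?a < (?T + 1) * 2 ^ AB" using area2_less by simp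
 also have "\<dots> \<le> 2 ^ (6 * (W + 1) + 1) * 2 ^ AB" using T by (intro mult_le_mono1) auto
 finally have 1: "?T * 2 ^ AB + ?a < 2 ^ (6 * (W + 1) + 1) * 2 ^ AB" .
 have "full x < 2 ^ (6 * (W + 1) + 1) * 2 ^ AB * N"
  unfolding full_def by (rule digits_less[OF 1 assms])
 also have "\<dots> = 2 ^ FB" unfolding N_eq FB_def by (simp add: power_add)
 finally show "full x < 2 ^ FB" .
qed

lemma full_inj: "x < N ==> x' < N ==> full x = full x' ==> x = x'"
proof -
 assume "x < N" "x' < N" "full x = full x'"
 moreover have "full x mod N = x" "full x' mod N = x'" using calculation(1,2) unfolding full_def by simp_all
 ultimately show ?thesis by metis
qed

subsection \<open>Buckets\<close>

text \<open>The number of leaves below node \<open>v\<close>. The shift \<open>d\<close> need not be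
  specified, as the leading 1 of \<open>v\<close> determines it (\<open>cnt_shift\<close>).\<close>

definition cnt :: "nat => nat" where
 "cnt v = card {x. x < N \<and> (\<exists>d<K. full x div 2 ^ d = v)}"

definition internal :: "nat => bool" where
 "internal v \<longleftrightarrow> v \<noteq> 0 \<and> s < cnt v"

text \<open>Scans from the root towards \<open>v\<close> and keeps the deepest prefix whose parent
  is internal. For a leaf this is the highest prefix without a stored count; the start value 1 in
  \<open>bucket_of\<close> is the root.\<close>

primrec bkt :: "nat => nat => nat => nat" where
 "bkt v 0 u = u"
| "bkt v (Suc d) u = bkt v d (if internal (v div 2 ^ d div 2) then v div 2 ^ d else u)"

definition bucket_of :: "nat => nat" where
 "bucket_of v = bkt v K 1"

definition F :: "nat => nat" where
 "F x = bucket_of (full x)"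

lemma bkt_const: "(\<And>d. d < i ==> \<not> internal (v div 2 ^ d div 2)) ==> bkt v i u = u"
 by (induction i) auto

lemma bkt_hit:
 assumes "j < i" "internal (v div 2 ^ j div 2)" "\<And>d. d < j ==> \<not> internal (v div 2 ^ d div 2)"
 shows "bkt v i u = v div 2 ^ j"
 using assms(1)
proof (induction i arbitrary: u)
 case (Suc i)
 show ?case
 proof (cases "j = i")
  case True
  thus ?thesis using assms by (simp add: bkt_const)
 next
  case False
  thus ?thesis using Suc by simp
 qed
qed simp

lemma full_less_K: "x < N ==> full x < 2 ^ K"
proof -
 assume "x < N"
 hence "full x < 2 ^ FB" by (rule full_bounds)
 also have "(2::nat) ^ FB \<le> 2 ^ K" using FB_K by (intro power_increasing) auto
 finally show ?thesis .
qed

lemma small_d: "v < 2 ^ K ==> v div 2 ^ d \<noteq> 0 ==> d < K" for v d :: nat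
 by (metis div_less leI order_less_le_trans power_increasing one_le_numeral)

lemma cnt_mono: "v \<noteq> 0 ==> v = u div 2 ^ i ==> cnt u \<le> cnt v"
 unfolding cnt_def
proof (rule card_mono)
 assume v: "v \<noteq> 0" "v = u div 2 ^ i"
 show "{x. x < N \<and> (\<exists>d<K. full x div 2 ^ d = u)} \<subseteq> {x. x < N \<and> (\<exists>d<K. full x div 2 ^ d = v)}"
 proof safe
  fix x d assume x: "x < N" and u: "u = full x div 2 ^ d"
  have "full x div 2 ^ (d + i) = v" using v u by (simp add: power_add div_mult2_eq)
  thus "\<exists>d'<K. full x div 2 ^ d' = v"
   using small_d[OF full_less_K[OF x], of "d + i"] v by auto
 qed
qed simp

text \<open>A prefix has all leaves of its extensions, so internal nodes are closed under going
  up.\<close>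

lemma internal_mono: "internal u ==> v = u div 2 ^ i ==> v \<noteq> 0 ==> internal v"
 using cnt_mono[of v u i] unfolding internal_def by auto

text \<open>All \<open>full x\<close> have the same length and are distinct, so a leaf counts 1,
  which does not exceed \<open>s\<close>.\<close>

lemma not_internal_full: "x < N ==> \<not> internal (full x)"
proof
 assume x: "x < N" and "internal (full x)"
 have "{x'. x' < N \<and> (\<exists>d<K. full x' div 2 ^ d = full x)} \<subseteq> {x}"
 proof safe
  fix x' d assume x': "x' < N" and eq: "full x' div 2 ^ d = full x"
  have "d = 0"
  proof (rule ccontr)
   assume "d \<noteq> 0"
   hence "full x' div 2 ^ d \<le> full x' div 2 ^ 1"
    by (intro div_le_mono2 power_increasing) auto
   also have "\<dots> < 2 ^ (FB - 1)"
   proof -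
    have "(2::nat) ^ FB = 2 * 2 ^ (FB - 1)" by (rule power_FB)
    thus ?thesis using full_bounds(2)[OF x'] by simp
   qed
   finally show False using full_bounds(1)[OF x] eq by simp
  qed
  thus "x' = x" using full_inj x x' eq by simp
 qed
 hence "cnt (full x) \<le> card {x}" unfolding cnt_def by (intro card_mono) auto
 thus False using \<open>internal (full x)\<close> s_props(1) by (simp add: internal_def)
qed

lemma div_half: "v div 2 ^ d div 2 = v div 2 ^ Suc d" for v d :: nat
 by (simp add: div_mult2_eq[symmetric] mult.commute)

text \<open>Between \<open>v\<close> and the leaf no node is internal, so the scans for
  \<open>v\<close> and for the leaf stop at the same prefix. Hence the items below a node without a
  stored count all lie in one bucket, and inverting \<open>F\<close> there lists them.\<close>

lemma bucket_of_prefix: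
 assumes x: "x < N" and v: "full x div 2 ^ i = v" "v \<noteq> 0" "\<not> internal v"
 shows "bucket_of v = F x"
proof -
 let ?f = "full x"
 have nb: "\<not> internal (?f div 2 ^ d)" if "d \<le> i" for d
 proof
  assume "internal (?f div 2 ^ d)"
  moreover have "v = ?f div 2 ^ d div 2 ^ (i - d)"
   using v(1) that by (simp add: div_mult2_eq[symmetric] power_add[symmetric])
  ultimately show False using internal_mono v by blast
 qed
 have vd: "v div 2 ^ d div 2 = ?f div 2 ^ Suc (i + d)" for d
  unfolding v(1)[symmetric] div_half by (simp only: div_mult2_eq[symmetric] power_add[symmetric] add_Suc_right)
 show ?thesis
 proof (cases "\<exists>j<K. internal (?f div 2 ^ Suc j)")
  case True
  define j where "j = (LEAST j. j < K \<and> internal (?f div 2 ^ Suc j))"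
  have j: "j < K" "internal (?f div 2 ^ Suc j)"
   using LeastI_ex[OF True] unfolding j_def by auto
  have least: "\<not> internal (?f div 2 ^ Suc d)" if "d < j" for d
   using not_less_Least[OF that[unfolded j_def]] that j(1) by auto
  have ij: "i \<le> j" using nb[of "Suc j"] j(2) by (cases "i \<le> j") auto
  have "bkt ?f K 1 = ?f div 2 ^ j"
   using j least by (intro bkt_hit) (auto simp: div_half simp del: power_Suc)
  moreover have "bkt v K 1 = v div 2 ^ (j - i)"
   using j least ij by (intro bkt_hit) (auto simp: vd simp del: power_Suc)
  moreover have "v div 2 ^ (j - i) = ?f div 2 ^ j"
   unfolding v(1)[symmetric] using ij by (simp add: div_mult2_eq[symmetric] power_add[symmetric])
  ultimately show ?thesis by (simp add: F_def bucket_of_def)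
 next
  case False
  have z: "\<not> internal (?f div 2 ^ Suc d)" for d
  proof
   assume i: "internal (?f div 2 ^ Suc d)"
   hence "?f div 2 ^ Suc d \<noteq> 0" by (simp add: internal_def)
   hence "Suc d < K" using small_d[OF full_less_K[OF x]] by blast
   thus False using False i by auto
  qed
  have "bkt ?f K 1 = 1" by (rule bkt_const) (simp only: div_half z not_False_eq_True)
  moreover have "bkt v K 1 = 1" by (rule bkt_const) (simp only: vd z not_False_eq_True)
  ultimately show ?thesis by (simp add: F_def bucket_of_def)
 qed
qed

lemma F_props:
 assumes x: "x < N"
 shows "\<exists>d<K. F x = full x div 2 ^ d" "F x \<noteq> 0" "\<not> internal (F x)"
proof -
 let ?f = "full x"
 have f0: "?f \<noteq> 0" using full_bounds(1)[OF x] by (metis not_one_le_zero one_le_power one_le_numeral order_trans)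
 have "\<exists>d<K. F x = ?f div 2 ^ d \<and> F x \<noteq> 0 \<and> \<not> internal (F x)"
 proof (cases "\<exists>j<K. internal (?f div 2 ^ Suc j)")
  case True
  define j where "j = (LEAST j. j < K \<and> internal (?f div 2 ^ Suc j))"
  have j: "j < K" "internal (?f div 2 ^ Suc j)"
   using LeastI_ex[OF True] unfolding j_def by auto
  have least: "\<not> internal (?f div 2 ^ Suc d)" if "d < j" for d
   using not_less_Least[OF that[unfolded j_def]] that j(1) by auto
  have eq: "F x = ?f div 2 ^ j"
   unfolding F_def bucket_of_def
   using j least by (intro bkt_hit) (auto simp: div_half simp del: power_Suc)
  have "?f div 2 ^ j div 2 \<noteq> 0" using j(2) by (simp add: internal_def div_half del: power_Suc)
  hence "?f div 2 ^ j \<noteq> 0" by (metis div_0)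
  moreover have "\<not> internal (?f div 2 ^ j)"
   using least[of "j - 1"] not_internal_full[OF x] by (cases j) auto
  ultimately show ?thesis using eq j(1) by auto
 next
  case False
  have z: "\<not> internal (?f div 2 ^ Suc d)" for d
  proof
   assume i: "internal (?f div 2 ^ Suc d)"
   hence "?f div 2 ^ Suc d \<noteq> 0" by (simp add: internal_def)
   hence "Suc d < K" using small_d[OF full_less_K[OF x]] by blast
   thus False using False i by auto
  qed
  hence eq: "F x = 1"
   unfolding F_def bucket_of_def by (intro bkt_const) (simp add: div_half del: power_Suc)
  \<comment> \<open>Without internal nodes the only bucket is the root, the leading 1 of every
    \<open>full x\<close>.\<close>
  have "?f div 2 ^ (FB - 1) = 1"
  proof (rule div_nat_eqI)
   show "2 ^ (FB - 1) * 1 \<le> ?f" using full_bounds[OF x] by simp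
   have "?f < 2 ^ FB" by (rule full_bounds[OF x])
   also have "(2::nat) ^ FB = 2 ^ (FB - 1) * Suc 1" using power_FB by simp
   finally show "?f < 2 ^ (FB - 1) * Suc 1" .
  qed
  moreover have "FB - 1 < K" using FB_K by simp
  moreover have "\<not> internal 1"
   using z[of "FB - 2"] calculation by (simp add: FB_def Suc_diff_Suc numeral_eq_Suc)
  ultimately show ?thesis using eq by auto
 qed
 thus "\<exists>d<K. F x = full x div 2 ^ d" "F x \<noteq> 0" "\<not> internal (F x)" by auto
qed

text \<open>The bucket is a node that is not internal, and its items are among the leaves below this
  node.\<close>

lemma bucket_small:
 assumes x: "x < N"
 shows "card {x'. x' < N \<and> F x' = F x} \<le> s"
proof -
 have "{x'. x' < N \<and> F x' = F x} \<subseteq> {x'. x' < N \<and> (\<exists>d<K. full x' div 2 ^ d = F x)}"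
  using F_props(1) by fastforce
 hence "card {x'. x' < N \<and> F x' = F x} \<le> cnt (F x)"
  unfolding cnt_def by (intro card_mono) auto
 thus ?thesis using F_props[OF x] by (simp add: internal_def)
qed

lemma F_less_FB: "x < N ==> F x < 2 ^ FB"
proof -
 assume x: "x < N"
 then obtain d where "F x = full x div 2 ^ d" using F_props(1) by blast
 hence "F x \<le> full x" by simp
 thus ?thesis using full_bounds(2)[OF x] by linarith
qed

text \<open>All \<open>full x\<close> have exactly \<open>FB\<close> bits, so only the shift by
  \<open>FB - 1 - i\<close> leaves a number of \<open>i + 1\<close> bits.\<close>

lemma cnt_shift:
 assumes "v \<noteq> 0" "2 ^ i \<le> v" "v < 2 ^ Suc i" "i < FB"
 shows "cnt v = card {x. x < N \<and> full x div 2 ^ (FB - 1 - i) = v}"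
 unfolding cnt_def
proof (intro arg_cong[of _ _ card] Collect_cong conj_cong refl iffI)
 fix x assume x: "x < N" and "\<exists>d<K. full x div 2 ^ d = v"
 then obtain d where d: "full x div 2 ^ d = v" by blast
 have lo: "v * 2 ^ d \<le> full x" using d by (metis div_times_less_eq_dividend)
 have hi: "full x < (v + 1) * 2 ^ d"
  using d dividend_less_div_times[of "2 ^ d" "full x"] by (simp add: algebra_simps)
 have "2 ^ i * 2 ^ d \<le> full x" using mult_le_mono1[OF assms(2), of "2 ^ d"] lo by (rule order_trans)
 hence "2 ^ (i + d) \<le> full x" by (simp only: power_add)
 hence "(2::nat) ^ (i + d) < 2 ^ FB" using full_bounds(2)[OF x] by linarith
 hence 1: "i + d < FB" by (rule power_less_imp_less_exp[rotated]) simp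
 have "(v + 1) * 2 ^ d \<le> 2 ^ Suc i * 2 ^ d" using assms(3) by (intro mult_le_mono1) simp
 hence "(2::nat) ^ (FB - 1) < 2 ^ (Suc i + d)" using hi full_bounds(1)[OF x] by (simp add: power_add)
 hence 2: "FB - 1 < Suc i + d" by (rule power_less_imp_less_exp[rotated]) simp
 have "d = FB - 1 - i" using 1 2 by linarith
 thus "full x div 2 ^ (FB - 1 - i) = v" using d by simp
next
 fix x assume "full x div 2 ^ (FB - 1 - i) = v"
 moreover have "FB - 1 - i < K" using FB_K by simp
 ultimately show "\<exists>d<K. full x div 2 ^ d = v" by blast
qed

end

section \<open>Evaluating \<open>F\<close>, the hash functions and chains on the machine\<close>

section \<open>Programs for items, buckets and chains\<close>

abbreviation (input) "rW \<equiv> 22 :: nat"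
abbreviation (input) "rNP \<equiv> 23 :: nat"
abbreviation (input) "rL \<equiv> 24 :: nat"
abbreviation (input) "rN \<equiv> 25 :: nat"
abbreviation (input) "rS \<equiv> 26 :: nat"
abbreviation (input) "rNt \<equiv> 27 :: nat"
abbreviation (input) "rPW \<equiv> 28 :: nat"
abbreviation (input) "rPAB \<equiv> 29 :: nat"
abbreviation (input) "rL6 \<equiv> 30 :: nat"
abbreviation (input) "rKB \<equiv> 31 :: nat"
abbreviation (input) "rTwo \<equiv> 32 :: nat"
abbreviation (input) "rMB \<equiv> 33 :: nat"
abbreviation (input) "rX \<equiv> 50 :: nat"
abbreviation (input) "rFull \<equiv> 51 :: nat"
abbreviation (input) "rY \<equiv> 52 :: nat"
abbreviation (input) "rU \<equiv> 53 :: nat"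
abbreviation (input) "rT \<equiv> 66 :: nat"
abbreviation (input) "rP \<equiv> 67 :: nat"
abbreviation (input) "rQ \<equiv> 68 :: nat"
abbreviation (input) "rV \<equiv> 70 :: nat"
abbreviation (input) "rBkt \<equiv> 71 :: nat"
abbreviation (input) "rDep \<equiv> 72 :: nat"
abbreviation (input) "rHy \<equiv> 73 :: nat"
abbreviation (input) "rHi \<equiv> 74 :: nat"
abbreviation (input) "rHt \<equiv> 75 :: nat"
abbreviation (input) "rHb \<equiv> 76 :: nat"
abbreviation (input) "rHs \<equiv> 77 :: nat"
abbreviation (input) "rHk \<equiv> 78 :: nat"
abbreviation (input) "rHw \<equiv> 79 :: nat"
abbreviation (input) "rI \<equiv> 80 :: nat"

text \<open>
 The keys of the dictionary are \<open>8 * i + 1\<close> and \<open>8 * i + 2\<close> for the coordinates of point \<open>i\<close>,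
 \<open>8 * i + 3\<close> for the random word \<open>i\<close>, \<open>8 * v + 4\<close> for the count of node \<open>v\<close>, and
 \<open>8 * (y * nt + t) + 5\<close> for the start of a chain of table \<open>t\<close> that ends in \<open>y\<close>.
\<close>

definition fetch :: "exp => nat => com" where
 "fetch k x = Set rKey k ;; lookup ;; Set x (Rg rRes)"

definition coords :: com where
 "coords =
  Set rY (Rg rX [div] Rg rL6) ;;
  fetch (Cn 8 [*] (Rg rY [div] (Rg rNP [*] Rg rNP)) [+] Cn 1) 54 ;;
  fetch (Cn 8 [*] (Rg rY [div] (Rg rNP [*] Rg rNP)) [+] Cn 2) 55 ;;
  fetch (Cn 8 [*] (Rg rY [div] Rg rNP [mod] Rg rNP) [+] Cn 1) 56 ;;
  fetch (Cn 8 [*] (Rg rY [div] Rg rNP [mod] Rg rNP) [+] Cn 2) 57 ;;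
  fetch (Cn 8 [*] (Rg rY [mod] Rg rNP) [+] Cn 1) 58 ;;
  fetch (Cn 8 [*] (Rg rY [mod] Rg rNP) [+] Cn 2) 59"

definition levels :: com where
 "levels =
  Set rU (Rg rX) ;;
  Set 65 (Rg rU [mod] Rg rL) ;; Set rU (Rg rU [div] Rg rL) ;;
  Set 64 (Rg rU [mod] Rg rL) ;; Set rU (Rg rU [div] Rg rL) ;;
  Set 63 (Rg rU [mod] Rg rL) ;; Set rU (Rg rU [div] Rg rL) ;;
  Set 62 (Rg rU [mod] Rg rL) ;; Set rU (Rg rU [div] Rg rL) ;;
  Set 61 (Rg rU [mod] Rg rL) ;; Set rU (Rg rU [div] Rg rL) ;;
  Set 60 (Rg rU [mod] Rg rL)"

definition push_node :: "nat => com" where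
 "push_node c = Set rT (Rg rT [*] (Cn 2 [*] Rg rPW) [+] ((Rg rPW [+] Rg (54 + c)) [>>] Rg (60 + c)))"

text \<open>Expanding the determinant and summing its positive and negative terms separately avoids
  negative numbers.\<close>

definition area_com :: com where
 "area_com =
  Set rP (Rg 56 [*] Rg 59 [+] Rg 58 [*] Rg 55 [+] Rg 54 [*] Rg 57) ;;
  Set rQ (Rg 56 [*] Rg 55 [+] Rg 54 [*] Rg 59 [+] Rg 58 [*] Rg 57) ;;
  Cond (Rg rP [<] Rg rQ) (Set rP (Rg rQ [-] Rg rP)) (Set rP (Rg rP [-] Rg rQ))"

definition keyof :: com where
 "keyof =
  coords ;; levels ;;
  Set rT (Cn 1) ;; push_node 0 ;; push_node 1 ;; push_node 2 ;; push_node 3 ;; push_node 4 ;; push_node 5 ;;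
  area_com ;;
  Set rFull ((Rg rT [*] Rg rPAB [+] Rg rP) [*] Rg rN [+] Rg rX)"

definition bucket_com :: com where
 "bucket_com =
  Set rBkt (Cn 1) ;;
  For rDep rK (
   fetch (Cn 8 [*] ((Rg rV [>>] Rg rDep) [div] Cn 2) [+] Cn 4) rU ;;
   Cond (Rg rU) (Set rBkt (Rg rV [>>] Rg rDep)) Skip)"

text \<open>The sum may overflow. As \<open>N\<close> divides \<open>2 ^ b\<close>, reduction modulo
  \<open>2 ^ b\<close> does not affect the residue modulo \<open>N\<close>.\<close>

definition hash_com :: com where
 "hash_com =
  Set rHb ((Rg rHt [*] Rg rS [+] Rg rHi) [*] (Rg rK [+] Cn 1)) ;;
  fetch (Cn 8 [*] Rg rHb [+] Cn 3) rHs ;;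
  For rHk rK (
   Cond ((Rg rHy [>>] Rg rHk) [mod] Cn 2)
    (fetch (Cn 8 [*] (Rg rHb [+] (Rg rHk [+] Cn 1)) [+] Cn 3) rHw ;;
     Set rHs (Rg rHs [+] Rg rHw))
    Skip) ;;
  Set rX (Rg rHs [mod] Rg rN)"

definition step_com :: com where
 "step_com = hash_com ;; keyof ;; Set rV (Rg rFull) ;; bucket_com ;; Set rHy (Rg rBkt)"

definition walk_com :: "exp => com" where
 "walk_com cond = For rHi rS (Cond cond step_com Skip)"

lemma wr_fetch [simp]: "wr (fetch k x) = {40, 41, 42, 43, 44, x}"
 by (auto simp: fetch_def)

lemma wr_coords [simp]: "wr coords = {40..44} \<union> {52} \<union> {54..59}"
 by (auto simp: coords_def)

lemma wr_levels [simp]: "wr levels = {53} \<union> {60..65}"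
 by (auto simp: levels_def)

lemma wr_push_node [simp]: "wr (push_node c) = {66}"
 by (auto simp: push_node_def)

lemma wr_area_com [simp]: "wr area_com = {67, 68}"
 by (auto simp: area_com_def)

lemma wr_keyof [simp]: "wr keyof = {40..44} \<union> {51..68}"
 by (auto simp: keyof_def)

lemma wr_bucket_com [simp]: "wr bucket_com = {40..44} \<union> {53, 71, 72}"
 by (auto simp: bucket_com_def)

lemma wr_hash_com [simp]: "wr hash_com = {40..44} \<union> {50} \<union> {76..79}"
 by (auto simp: hash_com_def)

lemma wr_step_com [simp]: "wr step_com = {40..44} \<union> {50..68} \<union> {70..73} \<union> {76..79}"
 by (auto simp: step_com_def)

lemma wr_walk_com [simp]: "wr (walk_com c) = {40..44} \<union> {50..68} \<union> {70..74} \<union> {76..79}"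
 by (auto simp: walk_com_def)

lemma no_stores [simp]:
 "\<not> stores (fetch k x)" "\<not> stores coords" "\<not> stores levels" "\<not> stores (push_node c)"
 "\<not> stores area_com" "\<not> stores keyof" "\<not> stores bucket_com" "\<not> stores hash_com"
 "\<not> stores step_com" "\<not> stores (walk_com cond)"
 by (auto simp: fetch_def coords_def levels_def push_node_def area_com_def keyof_def bucket_com_def
   hash_com_def step_com_def walk_com_def)

locale layout_base = layout +
 fixes base :: nat
 assumes base_le: "base \<le> 2 ^ K"
begin

lemma K_120: "120 \<le> K"
proof -
 have "40 * 3 \<le> K" using Z3 unfolding K_eq by linarith
 thus ?thesis by simp
qed

lemma pow_b: "(2::nat) ^ b = 2 ^ K * 2 ^ K"
 by (simp add: b_def mult_2 power_add)

lemma big_K: "2 ^ 120 \<le> (2::nat) ^ K"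
 using K_120 by (intro power_increasing) auto

sublocale trie_machine b K base
proof
 show "20 \<le> b" using K_120 by (simp add: b_def)
 have "(9::nat) \<le> 2 ^ 120" by simp
 hence "(9::nat) \<le> 2 ^ K" using big_K by (rule order_trans)
 hence "9 * 2 ^ K \<le> 2 ^ K * (2::nat) ^ K" by (rule mult_le_mono1)
 moreover have "base + 2 ^ (K + 3) \<le> 9 * 2 ^ K" using base_le by (simp add: power_add)
 ultimately show "base + 2 ^ (K + 3) \<le> 2 ^ b" unfolding pow_b by linarith
qed

definition pars :: "st => bool" where
 "pars ms \<longleftrightarrow> fst ms rK = K \<and> fst ms rW = W \<and> fst ms rNP = NP \<and> fst ms rL = L \<and> fst ms rN = N \<and>
  fst ms rS = s \<and> fst ms rNt = nt \<and> fst ms rPW = 2 ^ W \<and> fst ms rPAB = 2 ^ AB \<and> fst ms rL6 = L ^ 6 \<and>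
  fst ms rKB = KB \<and> fst ms rTwo = 2 \<and> fst ms rMB = 2 ^ K * 64"

definition ready :: "st => nat => nat set => (nat => nat) => bool" where
 "ready ms f D V \<longleftrightarrow> dict_at ms f D V \<and> pars ms"

lemma ready_frame:
 assumes "ready ms f D V" "wr c \<inter> {20..39} = {}" "\<not> stores c"
 shows "ready (sem b c ms) f D V"
proof -
 have "fst (sem b c ms) x = fst ms x" if "20 \<le> x" "x \<le> 39" for x
  using assms(2) that by (intro sem_frame) auto
 thus ?thesis
  using assms(1,3) by (simp add: ready_def pars_def dict_at_def)
qed

lemma ready_cong:
 assumes "\<And>z. 20 \<le> z ==> z \<le> 39 ==> fst ms' z = fst ms z" "snd ms' = snd ms"
 shows "ready ms' f D V = ready ms f D V"
 using assms by (simp add: ready_def pars_def dict_at_def)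

lemma ready_upd: "x < 20 \<or> 39 < x ==> ready (upd x v ms) f D V = ready ms f D V"
 by (rule ready_cong) auto

lemma readyD: "ready ms f D V ==> pars ms" "ready ms f D V ==> dict_at ms f D V"
 by (auto simp: ready_def)

lemma fetch_correct:
 assumes "ready ms f D V" "eval b k (fst ms) = key" "key < 2 ^ K"
 shows "fst (sem b (fetch k x) ms) x = V key"
proof -
 have "dict_at (upd rKey key ms) f D V" using assms(1) by (auto simp: ready_def dict_at_def)
 from lookup_correct[OF this] show ?thesis using assms(2,3) by (simp add: fetch_def)
qed

definition pts_in :: "(nat => nat) => bool" where
 "pts_in V \<longleftrightarrow> (\<forall>i<NP. V (8 * i + 1) = px i \<and> V (8 * i + 2) = py i)"

definition words_in :: "(nat => nat) => (nat => nat) => bool" where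
 "words_in V \<rho> \<longleftrightarrow> (\<forall>i<R. V (8 * i + 3) = \<rho> i)"

definition counts_in :: "(nat => nat) => bool" where
 "counts_in V \<longleftrightarrow> (\<forall>v<2 ^ FB. V (8 * v + 4) = (if internal v then cnt v else 0))"

lemma less_b: "x < 2 ^ b" if "x \<le> 2 ^ K" for x :: nat
proof -
 note that
 also have "(2::nat) ^ K < 2 ^ b" using K_120 by (intro power_strict_increasing) (auto simp: b_def)
 finally show ?thesis .
qed

lemma N_FB: "N \<le> 2 ^ FB"
 unfolding N_eq FB_def by (intro power_increasing) auto

lemma FB8: "8 * 2 ^ FB \<le> (2::nat) ^ K"
proof -
 have "8 * 2 ^ FB = (2::nat) ^ (FB + 3)" by (simp add: power_add)
 also have "\<dots> \<le> 2 ^ K" using FB_K by (intro power_increasing) auto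
 finally show ?thesis .
qed

lemma NP3: "NP * NP * NP \<le> N"
proof -
 have "NP ^ 3 * 1 \<le> NP ^ 3 * L ^ 6" using L_pos by (intro mult_le_mono2) simp
 thus ?thesis by (simp add: N_def power3_eq_cube)
qed

lemma NP_pos: "0 < NP" by (simp add: NP_def)

lemma NP_N: "NP \<le> N" "NP * NP \<le> N"
proof -
 have "NP * NP * 1 \<le> NP * NP * NP" "NP * 1 \<le> NP * NP" using NP_pos by (intro mult_le_mono2; simp)+
 thus "NP \<le> N" "NP * NP \<le> N" using NP3 by linarith+
qed

lemma y_less: "x < N ==> x div L ^ 6 < NP * NP * NP"
 using L_pos by (simp add: N_def less_mult_imp_div_less power3_eq_cube)

lemma key_less: "i < NP ==> c \<le> 7 ==> 8 * i + c < 2 ^ K"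
 using NP_N(1) N_FB FB8 by linarith

lemma pt_less: "x < N ==> pt (x div L ^ 6) j < NP"
 using NP_pos by (simp add: pt_def)

lemma pt_simps:
 assumes "x < N"
 shows "pt (x div L ^ 6) 0 = x div L ^ 6 div (NP * NP)" "pt (x div L ^ 6) 1 = x div L ^ 6 div NP mod NP"
  "pt (x div L ^ 6) 2 = x div L ^ 6 mod NP"
 using y_less[OF assms] by (simp_all add: pt_def power2_eq_square less_mult_imp_div_less mult.assoc)

lemma N_less_b: "N < 2 ^ b" and NP_b: "NP * NP < 2 ^ b"
proof -
 have "N \<le> 2 ^ K" using N_FB FB8 by linarith
 thus "N < 2 ^ b" "NP * NP < 2 ^ b" using NP_N less_b by (auto intro: order_trans)
qed

lemma coords_correct:
 assumes r: "ready ms f D V" and V: "pts_in V" and x: "fst ms rX = x" "x < N"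
 shows "c < 6 ==> fst (sem b coords ms) (54 + c) = cd (x div L ^ 6) c"
  and "fst (sem b coords ms) rY = x div L ^ 6"
proof -
 let ?y = "x div L ^ 6"
 note pt = pt_simps[OF x(2)]
 have a: "alu b Plus (alu b Times 8 i) c = 8 * i + c" if "i < NP" "c \<le> 7" for i c
 proof -
  have "8 * i + c < 2 ^ b" using key_less[OF that] by (intro less_b) simp
  thus ?thesis by (simp add: alu_Times alu_Plus)
 qed
 have p: "?y div (NP * NP) < NP" "?y div NP mod NP < NP" "?y mod NP < NP"
  using pt_less[OF x(2)] by (simp_all flip: pt)
 have key: "8 * i + 1 < 2 ^ K" "8 * i + 2 < 2 ^ K" if "i < NP" for i
  using key_less[OF that, of 1] key_less[OF that, of 2] by simp_all
 define ms0 where "ms0 = sem b (Set rY (Rg rX [div] Rg rL6)) ms"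
 have r0: "ready ms0 f D V" and y0: "fst ms0 rY = ?y" and np0: "fst ms0 rNP = NP"
  using r x readyD(1)[OF r] by (simp_all add: ms0_def ready_upd pars_def)
 define ms1 where "ms1 = sem b (fetch (Cn 8 [*] (Rg rY [div] (Rg rNP [*] Rg rNP)) [+] Cn 1) 54) ms0"
 define ms2 where "ms2 = sem b (fetch (Cn 8 [*] (Rg rY [div] (Rg rNP [*] Rg rNP)) [+] Cn 2) 55) ms1"
 define ms3 where "ms3 = sem b (fetch (Cn 8 [*] (Rg rY [div] Rg rNP [mod] Rg rNP) [+] Cn 1) 56) ms2"
 define ms4 where "ms4 = sem b (fetch (Cn 8 [*] (Rg rY [div] Rg rNP [mod] Rg rNP) [+] Cn 2) 57) ms3"
 define ms5 where "ms5 = sem b (fetch (Cn 8 [*] (Rg rY [mod] Rg rNP) [+] Cn 1) 58) ms4"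
 define ms6 where "ms6 = sem b (fetch (Cn 8 [*] (Rg rY [mod] Rg rNP) [+] Cn 2) 59) ms5"
 have rr: "ready ms1 f D V" "ready ms2 f D V" "ready ms3 f D V" "ready ms4 f D V" "ready ms5 f D V"
  unfolding ms5_def ms4_def ms3_def ms2_def ms1_def by (intro ready_frame r0; simp)+
 have y: "fst ms1 rY = ?y" "fst ms2 rY = ?y" "fst ms3 rY = ?y" "fst ms4 rY = ?y" "fst ms5 rY = ?y" "fst ms6 rY = ?y"
  and np: "fst ms1 rNP = NP" "fst ms2 rNP = NP" "fst ms3 rNP = NP" "fst ms4 rNP = NP" "fst ms5 rNP = NP"
  unfolding ms6_def ms5_def ms4_def ms3_def ms2_def ms1_def using y0 np0 by simp_all
 have sq: "alu b Times NP NP = NP * NP" using NP_b by (rule alu_Times)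
 have vals: "fst ms1 54 = px (pt ?y 0)" "fst ms2 55 = py (pt ?y 0)" "fst ms3 56 = px (pt ?y 1)"
  "fst ms4 57 = py (pt ?y 1)" "fst ms5 58 = px (pt ?y 2)" "fst ms6 59 = py (pt ?y 2)"
 proof -
  have v: "V (8 * i + 1) = px i" "V (8 * i + 2) = py i" if "i < NP" for i
   using V that by (auto simp: pts_in_def)
  show "fst ms1 54 = px (pt ?y 0)"
   unfolding ms1_def pt v(1)[OF p(1), symmetric]
   by (rule fetch_correct[OF r0 _ key(1)[OF p(1)]]) (simp add: y0 np0 sq a[OF p(1)])
  show "fst ms2 55 = py (pt ?y 0)"
   unfolding ms2_def pt v(2)[OF p(1), symmetric]
   by (rule fetch_correct[OF rr(1) _ key(2)[OF p(1)]]) (simp add: y np sq a[OF p(1)])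
  show "fst ms3 56 = px (pt ?y 1)"
   unfolding ms3_def pt v(1)[OF p(2), symmetric]
   by (rule fetch_correct[OF rr(2) _ key(1)[OF p(2)]]) (simp add: y np a[OF p(2)])
  show "fst ms4 57 = py (pt ?y 1)"
   unfolding ms4_def pt v(2)[OF p(2), symmetric]
   by (rule fetch_correct[OF rr(3) _ key(2)[OF p(2)]]) (simp add: y np a[OF p(2)])
  show "fst ms5 58 = px (pt ?y 2)"
   unfolding ms5_def pt v(1)[OF p(3), symmetric]
   by (rule fetch_correct[OF rr(4) _ key(1)[OF p(3)]]) (simp add: y np a[OF p(3)])
  show "fst ms6 59 = py (pt ?y 2)"
   unfolding ms6_def pt v(2)[OF p(3), symmetric]
   by (rule fetch_correct[OF rr(5) _ key(2)[OF p(3)]]) (simp add: y np a[OF p(3)])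
 qed
 have out: "sem b coords ms = ms6"
  by (simp only: coords_def sem.simps(5) ms0_def ms1_def ms2_def ms3_def ms4_def ms5_def ms6_def)
 have keep: "fst ms6 54 = fst ms1 54" "fst ms6 55 = fst ms2 55" "fst ms6 56 = fst ms3 56"
  "fst ms6 57 = fst ms4 57" "fst ms6 58 = fst ms5 58"
  unfolding ms6_def ms5_def ms4_def ms3_def ms2_def by simp_all
 show "fst (sem b coords ms) rY = ?y" unfolding out by (rule y)
 assume "c < 6"
 then consider "c = 0" | "c = 1" | "c = 2" | "c = 3" | "c = 4" | "c = 5" by linarith
 thus "fst (sem b coords ms) (54 + c) = cd ?y c"
  unfolding out by cases (simp_all add: keep vals cd_def)
qed

lemma levels_correct:
 assumes "fst ms rL = L" "fst ms rX = x" "c < 6"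
 shows "fst (sem b levels ms) (60 + c) = lv x c"
proof -
 have pw: "L ^ 2 = L * L" "L ^ 3 = L * (L * L)" "L ^ 4 = L * (L * (L * L))" "L ^ 5 = L * (L * (L * (L * L)))"
  by (simp_all add: power_numeral_reduce)
 consider "c = 0" | "c = 1" | "c = 2" | "c = 3" | "c = 4" | "c = 5" using assms(3) by linarith
 thus ?thesis
  by cases (simp_all add: levels_def assms(1,2) lv_def div_mult2_eq pw)
qed

lemma Tc_less: "c \<le> 6 ==> Tc x c < 2 ^ FB"
proof -
 assume "c \<le> 6"
 have "Tc x c < 2 ^ (c * (W + 1) + 1)" using Tc_bounds by blast
 also have "(2::nat) ^ (c * (W + 1) + 1) \<le> 2 ^ FB"
 proof (rule power_increasing)
  have "c * (W + 1) \<le> 6 * (W + 1)" using \<open>c \<le> 6\<close> by (rule mult_le_mono1)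
  thus "c * (W + 1) + 1 \<le> FB" unfolding FB_def by linarith
 qed simp
 finally show ?thesis .
qed

lemma FB_less_b: "(2::nat) ^ FB < 2 ^ b"
 using FB8 by (intro less_b) linarith

lemma push_node_correct:
 assumes "fst ms rPW = 2 ^ W" "fst ms (54 + c) = cd (x div L ^ 6) c" "fst ms (60 + c) = lv x c"
  "fst ms rT = Tc x c" "c < 6"
 shows "fst (sem b (push_node c) ms) rT = Tc x (Suc c)"
proof -
 have T: "Tc x (Suc c) < 2 ^ b"
  using Tc_less[of "Suc c" x] assms(5) FB_less_b by linarith
 have "2 ^ W + cd (x div L ^ 6) c < 2 * 2 ^ W" using cd_less by simp
 moreover have "2 * 2 ^ W < (2::nat) ^ b"
 proof -
  have "2 * 2 ^ W = (2::nat) ^ (W + 1)" by simp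
  also have "\<dots> \<le> 2 ^ FB" unfolding FB_def by (intro power_increasing) auto
  finally show ?thesis using FB_less_b by linarith
 qed
 ultimately have 1: "alu b Plus (2 ^ W) (cd (x div L ^ 6) c) = 2 ^ W + cd (x div L ^ 6) c"
  "alu b Times 2 (2 ^ W) = 2 ^ (W + 1)"
  by (simp_all add: alu_Plus alu_Times)
 have "Tc x c * 2 ^ (W + 1) < 2 ^ b" using T by (simp del: power_Suc)
 hence 2: "alu b Times (Tc x c) (2 ^ (W + 1)) = Tc x c * 2 ^ (W + 1)" by (rule alu_Times)
 have 3: "alu b Plus (Tc x c * 2 ^ (W + 1)) (nd x c) = Tc x (Suc c)"
  using T unfolding Tc.simps by (rule alu_Plus)
 have 4: "alu b ShiftR (2 ^ W + cd (x div L ^ 6) c) (lv x c) = nd x c"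
  by (simp only: alu_ShiftR nd_def)
 have c2: "take_bit b (2::nat) = 2" by simp
 show ?thesis
  unfolding push_node_def sem.simps(2) upd_simps fun_upd_same eval.simps assms(1-4) c2 1 4 2 3 ..
qed

lemma nat_abs_diff: "nat \<bar>int i - int j\<bar> = (if i < j then j - i else i - j)"
 by auto

lemma area_correct:
 assumes c: "\<And>c. c < 6 ==> fst ms (54 + c) = cd y c"
 shows "fst (sem b area_com ms) rP = area2 y"
proof -
 let ?P = "cd y 2 * cd y 5 + cd y 4 * cd y 1 + cd y 0 * cd y 3"
 let ?Q = "cd y 2 * cd y 1 + cd y 0 * cd y 5 + cd y 4 * cd y 3"
 have cs: "fst ms 54 = cd y 0" "fst ms 55 = cd y 1" "fst ms 56 = cd y 2" "fst ms 57 = cd y 3"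
  "fst ms 58 = cd y 4" "fst ms 59 = cd y 5"
  using c[of 0] c[of 1] c[of 2] c[of 3] c[of 4] c[of 5] by simp_all
 have area: "area2 y = (if ?P < ?Q then ?Q - ?P else ?P - ?Q)"
 proof -
  have "(int (cd y 2) - int (cd y 0)) * (int (cd y 5) - int (cd y 1)) -
   (int (cd y 4) - int (cd y 0)) * (int (cd y 3) - int (cd y 1)) = int ?P - int ?Q"
   by (simp add: algebra_simps)
  thus ?thesis unfolding area2_def by (simp only: nat_abs_diff)
 qed
 have sq: "cd y i * cd y j \<le> 2 ^ w * 2 ^ w" for i j
  by (intro mult_le_mono cd_le)
 have w4: "4 * (2 ^ w * 2 ^ w) \<le> (2::nat) ^ K"
 proof -
  have "4 * (2 ^ w * 2 ^ w) = (2::nat) ^ AB" by (simp only: AB_def mult_2 power_add power2_eq_square) simp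
  also have "\<dots> \<le> 2 ^ FB" unfolding FB_def by (intro power_increasing) auto
  finally show ?thesis using FB8 by linarith
 qed
 have lt: "u < 2 ^ b" if "u \<le> 4 * (2 ^ w * 2 ^ w)" for u :: nat
  using that w4 by (intro less_b) linarith
 have mul: "alu b Times (cd y i) (cd y j) = cd y i * cd y j" for i j
  using sq[of i j] by (intro alu_Times lt) linarith
 have add2: "alu b Plus (cd y i * cd y j) (cd y k * cd y l) = cd y i * cd y j + cd y k * cd y l" for i j k l
  using sq[of i j] sq[of k l] by (intro alu_Plus lt) linarith
 have add3: "alu b Plus (cd y i * cd y j + cd y k * cd y l) (cd y i' * cd y j') =
  cd y i * cd y j + cd y k * cd y l + cd y i' * cd y j'" for i j k l i' j'
  using sq[of i j] sq[of k l] sq[of i' j'] by (intro alu_Plus lt) linarith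
 have PQ: "?P < 2 ^ b" "?Q < 2 ^ b"
  using sq[of 2 5] sq[of 4 1] sq[of 0 3] sq[of 2 1] sq[of 0 5] sq[of 4 3] by (intro lt, linarith)+
 define p where "p = ?P"
 define q' where "q' = ?Q"
 have 1: "sem b area_com ms =
  (if alu b Less p q' \<noteq> 0 then upd rP (alu b Minus q' p) (upd rQ q' (upd rP p ms))
   else upd rP (alu b Minus p q') (upd rQ q' (upd rP p ms)))"
  unfolding area_com_def p_def q'_def by (simp add: cs mul add2 add3)
 show ?thesis
 proof (cases "p < q'")
  case True
  thus ?thesis
   using PQ unfolding 1 area p_def[symmetric] q'_def[symmetric] by (simp add: alu_bool alu_Minus)
 next
  case False
  thus ?thesis
   using PQ unfolding 1 area p_def[symmetric] q'_def[symmetric] by (simp add: alu_bool alu_Minus)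
 qed
qed

lemma keyof_correct:
 assumes r: "ready ms f D V" and V: "pts_in V" and x: "fst ms rX = x" "x < N"
 shows "fst (sem b keyof ms) rFull = full x"
proof -
 let ?y = "x div L ^ 6"
 have p: "fst ms rL = L" "fst ms rPW = 2 ^ W" "fst ms rPAB = 2 ^ AB" "fst ms rN = N"
  using r by (auto simp: ready_def pars_def)
 define ms1 where "ms1 = sem b coords ms"
 define ms2 where "ms2 = sem b levels ms1"
 define ms3 where "ms3 = sem b (Set rT (Cn 1)) ms2"
 have c3: "fst ms3 (54 + c) = cd ?y c" "fst ms3 (60 + c) = lv x c" if "c < 6" for c
 proof -
  have "fst ms3 (54 + c) = fst ms1 (54 + c)" using that by (auto simp: ms3_def ms2_def)
  also have "\<dots> = cd ?y c" unfolding ms1_def by (rule coords_correct(1)[OF r V x that])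
  finally show "fst ms3 (54 + c) = cd ?y c" .
  have "fst ms3 (60 + c) = fst ms2 (60 + c)" using that by (auto simp: ms3_def)
  also have "\<dots> = lv x c" unfolding ms2_def
   by (rule levels_correct) (use that p x in \<open>auto simp: ms1_def\<close>)
  finally show "fst ms3 (60 + c) = lv x c" .
 qed
 define push where "push = rec_nat ms3 (\<lambda>c \<tau>. sem b (push_node c) \<tau>)"
 have push: "push 0 = ms3" "push (Suc c) = sem b (push_node c) (push c)" for c
  by (simp_all add: push_def)
 have keep: "fst (push c) z = fst ms3 z" if "z \<noteq> rT" for c z
  using that by (induction c) (simp_all add: push)
 have T: "fst (push c) rT = Tc x c" if "c \<le> 6" for c
  using that
 proof (induction c)
  case 0
  thus ?case by (simp add: push ms3_def)
 next
  case (Suc c)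
  show ?case unfolding push
  proof (rule push_node_correct)
   show "fst (push c) rPW = 2 ^ W" by (simp add: keep ms3_def ms2_def ms1_def p)
   show "fst (push c) (54 + c) = cd ?y c" "fst (push c) (60 + c) = lv x c"
    using Suc.prems by (simp_all add: keep c3)
  qed (use Suc in auto)
 qed
 define ms4 where "ms4 = sem b area_com (push 6)"
 have P4: "fst ms4 rP = area2 ?y"
  unfolding ms4_def by (rule area_correct) (simp add: keep c3)
 have T4: "fst ms4 rT = Tc x 6" by (simp add: ms4_def T)
 have o4: "fst ms4 rPAB = 2 ^ AB" "fst ms4 rN = N" "fst ms4 rX = x"
  by (simp_all add: ms4_def keep ms3_def ms2_def ms1_def p x)
 have six: "push 6 = sem b (push_node 5) (sem b (push_node 4) (sem b (push_node 3) (sem b (push_node 2)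
   (sem b (push_node 1) (sem b (push_node 0) ms3)))))"
  by (simp add: push_def numeral_eq_Suc)
 have out: "sem b keyof ms = sem b (Set rFull ((Rg rT [*] Rg rPAB [+] Rg rP) [*] Rg rN [+] Rg rX)) ms4"
  unfolding ms4_def six ms3_def ms2_def ms1_def keyof_def sem.simps(5) ..
 have f: "full x < 2 ^ b" using full_less_K[OF x(2)] by (intro less_b) simp
 let ?a = "Tc x 6 * 2 ^ AB + area2 ?y"
 have 1: "?a * N < 2 ^ b" using f unfolding full_def by (rule le_less_trans[rotated]) simp
 have 2: "?a < 2 ^ b" using 1 by (rule le_less_trans[rotated]) (use N_pos in simp)
 have 3: "Tc x 6 * 2 ^ AB < 2 ^ b" using 2 by (rule le_less_trans[rotated]) simp
 show ?thesis unfolding out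
  using f by (simp add: P4 T4 o4 alu_Times[OF 3] alu_Plus[OF 2] alu_Times[OF 1])
   (simp add: full_def alu_Plus)
qed

lemma bucket_correct:
 assumes r: "ready ms f D V" and V: "counts_in V" and v: "fst ms rV = v" "v < 2 ^ FB"
 shows "fst (sem b bucket_com ms) rBkt = bucket_of v"
proof -
 let ?body = "fetch (Cn 8 [*] ((Rg rV [>>] Rg rDep) [div] Cn 2) [+] Cn 4) rU ;;
   Cond (Rg rU) (Set rBkt (Rg rV [>>] Rg rDep)) Skip"
 let ?ms = "sem b (Set rBkt (Cn 1)) ms"
 \<comment> \<open>What the remaining iterations make of the current candidate stays constant,
   namely the final result.\<close>
 define I where "I i \<tau> \<longleftrightarrow> ready \<tau> f D V \<and> fst \<tau> rV = v \<and> bkt v i (fst \<tau> rBkt) = bucket_of v" for i \<tau>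
 have K: "fst ?ms rK = K" using r by (simp add: ready_def pars_def)
 have "I 0 (sem b (For rDep rK ?body) ?ms)"
 proof (rule sem_For_inv)
  show "I (fst ?ms rK) (upd rDep (fst ?ms rK) ?ms)"
   using r v by (simp add: I_def ready_upd bucket_of_def ready_def[of ms] pars_def)
 next
  fix i \<tau> assume i: "i < fst ?ms rK" and inv: "I (Suc i) \<tau>"
  let ?\<tau> = "upd rDep i \<tau>"
  let ?k = "8 * (v div 2 ^ i div 2) + 4"
  let ?\<tau>' = "sem b (fetch (Cn 8 [*] ((Rg rV [>>] Rg rDep) [div] Cn 2) [+] Cn 4) rU) ?\<tau>"
  have rt: "ready ?\<tau> f D V" using inv by (simp add: I_def ready_upd)
  have vv: "v div 2 ^ i div 2 < 2 ^ FB"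
   using v(2) by (meson div_le_dividend le_less_trans)
  hence k: "?k < 2 ^ K" using FB8 by linarith
  have ev: "alu b Plus (alu b Times 8 (v div 2 ^ i div 2)) 4 = ?k"
  proof -
   have "?k < 2 ^ b" using k by (intro less_b) simp
   thus ?thesis by (simp add: alu_Times alu_Plus)
  qed
  have "fst ?\<tau>' rU = V ?k"
   by (rule fetch_correct[OF rt _ k]) (use inv in \<open>simp add: I_def alu_ShiftR ev del: alu.simps(5-)\<close>)
  also have "\<dots> = (if internal (v div 2 ^ i div 2) then cnt (v div 2 ^ i div 2) else 0)"
   using V vv by (simp add: counts_in_def)
  finally have u: "fst ?\<tau>' rU \<noteq> 0 \<longleftrightarrow> internal (v div 2 ^ i div 2)"
   by (auto simp: internal_def)
  have r': "ready ?\<tau>' f D V" using rt by (rule ready_frame) simp_all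
  have v': "fst ?\<tau>' rV = v" "fst ?\<tau>' rDep = i" "fst ?\<tau>' rBkt = fst \<tau> rBkt"
   using inv by (simp_all add: I_def)
  have eq: "sem b ?body ?\<tau> = (if internal (v div 2 ^ i div 2) then upd rBkt (v div 2 ^ i) ?\<tau>' else ?\<tau>')"
   using u v' by (simp add: alu_ShiftR del: alu.simps)
  show "I i (sem b ?body ?\<tau>)"
   using inv r' v' unfolding I_def eq
   by (cases "internal (v div 2 ^ i div 2)") (simp_all add: ready_upd)
 qed
 thus ?thesis by (simp add: I_def bucket_com_def)
qed

lemma take_bit_mod_N: "take_bit b x mod N = x mod N"
proof -
 have "N dvd 2 ^ b"
  unfolding N_eq using N_FB[unfolded N_eq] FB_less_b
  by (intro le_imp_power_dvd) (meson less_imp_le order.strict_trans1 power_less_imp_less_exp one_less_numeral_iff semiring_norm(76))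
 thus ?thesis by (simp add: take_bit_eq_mod mod_mod_cancel)
qed

text \<open>The bucket size bound is the threshold \<open>s\<close> for stored counts, by
  \<open>bucket_small\<close>.\<close>

sublocale rainbow "2 ^ b" K N s F
proof
 show "N dvd 2 ^ b"
  unfolding N_eq using N_FB[unfolded N_eq] FB_less_b
  by (intro le_imp_power_dvd) (meson less_imp_le order.strict_trans1 power_less_imp_less_exp one_less_numeral_iff semiring_norm(76))
 show "F x < 2 ^ K" if "x < N" for x
  using F_less_FB[OF that] FB8 by linarith
qed (use bucket_small in auto)

lemma index_less:
 assumes "\<tau> < nt" "i < s" "k \<le> K"
 shows "(\<tau> * s + i) * Suc K + k < R"
proof -
 have 1: "\<tau> * s + i < nt * s" by (rule digits_less[OF assms(1,2)])
 have "(\<tau> * s + i) * Suc K + k < nt * s * Suc K"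
  by (rule digits_less[OF 1]) (use assms(3) in simp)
 thus ?thesis by (simp only: R_def mult.assoc)
qed

lemma hash_correct:
 assumes r: "ready ms f D V" and V: "words_in V \<rho>"
  and a: "fst ms rHt = \<tau>" "\<tau> < nt" "fst ms rHi = i" "i < s" "fst ms rHy = y"
 shows "fst (sem b hash_com ms) rX = col (table s \<rho> \<tau>) i y"
proof -
 let ?b = "(\<tau> * s + i) * Suc K"
 let ?g = "\<lambda>k. \<rho> (?b + k)"
 have idx: "?b + k < R" if "k \<le> K" for k using index_less[OF a(2,4) that] .
 have R8: "8 * j + 3 < 2 ^ K" if "j < R" for j
 proof -
  have "8 * j + 3 < (R + 1) * 8" using that by simp
  thus ?thesis using R_le by (rule less_le_trans)
 qed
 have key: "8 * (?b + k) + 3 < 2 ^ K" if "k \<le> K" for k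
  using idx[OF that] by (rule R8)
 have lt: "8 * (?b + k) + 3 < 2 ^ b" "?b + k < 2 ^ b" "8 * (?b + k) < 2 ^ b" if "k \<le> K" for k
 proof -
  have "8 * j + 3 < 2 ^ b" "j < 2 ^ b" "8 * j < 2 ^ b" if "j < R" for j
   using R8[OF that] less_b[of "8 * j + 3"] by linarith+
  from this[OF idx[OF that]] show "8 * (?b + k) + 3 < 2 ^ b" "?b + k < 2 ^ b" "8 * (?b + k) < 2 ^ b" .
 qed
 have "K + 1 \<le> b" using K_120 by (simp add: b_def)
 hence Kb: "K + 1 < 2 ^ b" using less_exp[of b] by (rule le_less_trans)
 have p: "fst ms rS = s" "fst ms rK = K" "fst ms rN = N" using r by (auto simp: ready_def pars_def)
 have e1: "alu b Times (alu b Plus (alu b Times \<tau> s) i) (alu b Plus K 1) = ?b"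
 proof -
  have "(\<tau> * s + i) * 1 \<le> ?b" by (intro mult_le_mono2) simp
  also have "?b < 2 ^ b" using lt(2)[of 0] by (simp only: add_0_right le0)
  finally have 1: "\<tau> * s + i < 2 ^ b" by (simp only: mult_1_right)
  have "\<tau> * s \<le> \<tau> * s + i" by simp
  also note 1
  finally have "\<tau> * s < 2 ^ b" .
  with 1 show ?thesis using lt(2)[of 0] Kb by (simp add: alu_Times alu_Plus del: mult_Suc_right)
 qed
 have e3: "alu b Plus (alu b Times 8 (alu b Plus ?b (alu b Plus k 1))) 3 = 8 * (?b + Suc k) + 3" if "k < K" for k
 proof -
  have "Suc k \<le> K" using that by simp
  note l = lt[OF this]
  have "alu b Plus k 1 = Suc k" using that Kb by (simp add: alu_Plus)
  thus ?thesis by (simp only: alu_Plus[OF l(2)] alu_Times[OF l(3)] alu_Plus[OF l(1)])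
 qed
 define ms1 where "ms1 = sem b (Set rHb ((Rg rHt [*] Rg rS [+] Rg rHi) [*] (Rg rK [+] Cn 1))) ms"
 have ms1: "ms1 = upd rHb ?b ms" unfolding ms1_def using e1 a p by (simp del: mult_Suc_right)
 have r1: "ready ms1 f D V" using r by (simp add: ms1 ready_upd)
 define ms2 where "ms2 = sem b (fetch (Cn 8 [*] Rg rHb [+] Cn 3) rHs) ms1"
 have r2: "ready ms2 f D V" unfolding ms2_def using r1 by (rule ready_frame) simp_all
 have s2: "fst ms2 rHs = ?g 0"
 proof -
  have "fst ms2 rHs = V (8 * (?b + 0) + 3)"
   unfolding ms2_def using lt[of 0]
   by (intro fetch_correct[OF r1 _ key]; simp add: ms1 alu_Times alu_Plus del: mult_Suc_right)
  also have "\<dots> = ?g 0" using V idx[of 0] unfolding words_in_def by blast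
  finally show ?thesis .
 qed
 let ?get = "fetch (Cn 8 [*] (Rg rHb [+] (Rg rHk [+] Cn 1)) [+] Cn 3) rHw"
 let ?body = "Cond ((Rg rHy [>>] Rg rHk) [mod] Cn 2) (?get ;; Set rHs (Rg rHs [+] Rg rHw)) Skip"
 define I where "I j \<tau>' \<longleftrightarrow> ready \<tau>' f D V \<and> fst \<tau>' rHb = ?b \<and> fst \<tau>' rHy = y \<and>
   fst \<tau>' rHs mod N = (?g 0 + (\<Sum>k\<in>{j..<K}. (y div 2 ^ k mod 2) * ?g (Suc k))) mod N" for j \<tau>'
 have o2: "fst ms2 rHb = ?b" "fst ms2 rHy = y" "fst ms2 rK = K" "fst ms2 rN = N"
  using a p by (simp_all add: ms2_def ms1 del: mult_Suc_right)
 have I: "I 0 (sem b (For rHk rK ?body) ms2)"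
 proof (rule sem_For_inv)
  show "I (fst ms2 rK) (upd rHk (fst ms2 rK) ms2)"
   using r2 o2 s2 by (simp add: I_def ready_upd del: mult_Suc_right)
 next
  fix j \<tau>' assume "j < fst ms2 rK" and inv: "I (Suc j) \<tau>'"
  hence j: "j < K" using o2 by simp
  let ?\<tau> = "upd rHk j \<tau>'"
  have rt: "ready ?\<tau> f D V" and b': "fst \<tau>' rHb = ?b" and y': "fst \<tau>' rHy = y"
   and sum: "fst \<tau>' rHs mod N = (?g 0 + (\<Sum>k\<in>{Suc j..<K}. (y div 2 ^ k mod 2) * ?g (Suc k))) mod N"
   using inv by (simp_all add: I_def ready_upd)
  have split: "(\<Sum>k\<in>{j..<K}. (y div 2 ^ k mod 2) * ?g (Suc k)) =
   (y div 2 ^ j mod 2) * ?g (Suc j) + (\<Sum>k\<in>{Suc j..<K}. (y div 2 ^ k mod 2) * ?g (Suc k))"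
   using j by (rule sum.atLeast_Suc_lessThan)
  have cond: "eval b ((Rg rHy [>>] Rg rHk) [mod] Cn 2) (fst ?\<tau>) = y div 2 ^ j mod 2"
   using y' by (simp add: alu_ShiftR)
  show "I j (sem b ?body ?\<tau>)"
  proof (cases "y div 2 ^ j mod 2 = 0")
   case True
   hence "sem b ?body ?\<tau> = ?\<tau>" unfolding sem.simps(6) cond by simp
   thus ?thesis using rt b' y' sum True unfolding I_def split by simp
  next
   case False
   hence one: "y div 2 ^ j mod 2 = 1" by simp
   let ?\<tau>2 = "sem b ?get ?\<tau>"
   have r2': "ready ?\<tau>2 f D V" using rt by (rule ready_frame) simp_all
   have "fst ?\<tau>2 rHw = V (8 * (?b + Suc j) + 3)"
    using b' j e3[OF j] by (intro fetch_correct[OF rt _ key]; simp del: mult_Suc_right add_Suc_right One_nat_def)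
   also have "\<dots> = ?g (Suc j)" using V idx[of "Suc j"] j unfolding words_in_def by (meson Suc_leI)
   finally have w': "fst ?\<tau>2 rHw = ?g (Suc j)" .
   have s': "fst ?\<tau>2 rHs = fst \<tau>' rHs" "fst ?\<tau>2 rHb = ?b" "fst ?\<tau>2 rHy = y"
    using b' y' by simp_all
   have "sem b ?body ?\<tau> = upd rHs (alu b Plus (fst \<tau>' rHs) (?g (Suc j))) ?\<tau>2"
    unfolding sem.simps(6) cond using one by (simp add: w' s' del: One_nat_def mult_Suc_right)
   moreover have "alu b Plus (fst \<tau>' rHs) (?g (Suc j)) mod N =
     (?g 0 + (\<Sum>k\<in>{j..<K}. (y div 2 ^ k mod 2) * ?g (Suc k))) mod N"
   proof -
    have "alu b Plus (fst \<tau>' rHs) (?g (Suc j)) mod N = (fst \<tau>' rHs + ?g (Suc j)) mod N"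
     by (simp only: alu.simps take_bit_mod_N)
    also have "\<dots> = (fst \<tau>' rHs mod N + ?g (Suc j)) mod N" by (simp add: mod_simps)
    also have "\<dots> = (?g 0 + (\<Sum>k\<in>{Suc j..<K}. (y div 2 ^ k mod 2) * ?g (Suc k)) + ?g (Suc j)) mod N"
     unfolding sum by (simp only: mod_simps)
    finally show ?thesis unfolding split one by (simp add: algebra_simps)
   qed
   ultimately show ?thesis using r2' s' unfolding I_def by (simp add: ready_upd del: mult_Suc_right)
  qed
 qed
 define ms3 where "ms3 = sem b (For rHk rK ?body) ms2"
 have fin: "fst ms3 rHs mod N = (?g 0 + (\<Sum>k\<in>{0..<K}. (y div 2 ^ k mod 2) * ?g (Suc k))) mod N"
  "fst ms3 rN = N"
  using I unfolding I_def ms3_def[symmetric] by (auto simp: ready_def pars_def)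
 have out: "sem b hash_com ms = sem b (Set rX (Rg rHs [mod] Rg rN)) ms3"
  unfolding ms3_def ms2_def ms1_def hash_com_def sem.simps(5) ..
 have "fst (sem b hash_com ms) rX = fst ms3 rHs mod N" unfolding out using fin by simp
 also have "\<dots> = col (table s \<rho> \<tau>) i y"
 proof -
  have "table s \<rho> \<tau> (i * Suc K + k) = ?g k" for k
   by (simp add: table_def algebra_simps)
  thus ?thesis unfolding fin(1) col_def hash_def by (simp only: lessThan_atLeast0)
 qed
 finally show ?thesis .
qed

lemma step_correct:
 assumes r: "ready ms f D V" and V: "pts_in V" "words_in V \<rho>" "counts_in V"
  and a: "fst ms rHt = \<tau>" "\<tau> < nt" "fst ms rHi = i" "i < s" "fst ms rHy = y"
 shows "fst (sem b step_com ms) rHy = F (col (table s \<rho> \<tau>) i y)"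
proof -
 let ?x = "col (table s \<rho> \<tau>) i y"
 have x: "?x < N" by (rule col_less)
 define ms1 where "ms1 = sem b hash_com ms"
 have r1: "ready ms1 f D V" unfolding ms1_def using r by (rule ready_frame) auto
 have x1: "fst ms1 rX = ?x" unfolding ms1_def by (rule hash_correct[OF r V(2) a])
 define ms2 where "ms2 = sem b (Set rV (Rg rFull)) (sem b keyof ms1)"
 have "ready (sem b keyof ms1) f D V" using r1 by (rule ready_frame) auto
 hence r2: "ready ms2 f D V" by (simp add: ms2_def ready_upd)
 have v2: "fst ms2 rV = full ?x" using keyof_correct[OF r1 V(1) x1 x] by (simp add: ms2_def)
 have "fst (sem b bucket_com ms2) rBkt = F ?x"
  unfolding F_def by (rule bucket_correct[OF r2 V(3) v2]) (use full_bounds(2)[OF x] in simp)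
 thus ?thesis by (simp add: step_com_def ms2_def ms1_def)
qed

lemma walk_correct:
 assumes r: "ready ms f D V" and V: "pts_in V" "words_in V \<rho>" "counts_in V"
  and a: "fst ms rHt = \<tau>" "\<tau> < nt" "fst ms rHy = y"
  and cond: "\<And>ms' :: st. fst ms' rI = fst ms rI ==> eval b cond (fst ms') \<noteq> 0 \<longleftrightarrow> P (fst ms' rHi)"
 shows "fst (sem b (walk_com cond) ms) rHy = walk (table s \<rho> \<tau>) P s y"
proof -
 let ?w = "walk (table s \<rho> \<tau>) P"
 define I where "I i ms' \<longleftrightarrow> ready ms' f D V \<and> fst ms' rHt = \<tau> \<and> fst ms' rI = fst ms rI \<and>
   ?w i (fst ms' rHy) = ?w s y" for i ms'
 have S: "fst ms rS = s" using r by (simp add: ready_def pars_def)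
 have "I 0 (sem b (For rHi rS (Cond cond step_com Skip)) ms)"
 proof (rule sem_For_inv)
  show "I (fst ms rS) (upd rHi (fst ms rS) ms)"
   using r a S by (simp add: I_def ready_upd)
 next
  fix i ms' assume "i < fst ms rS" and inv: "I (Suc i) ms'"
  hence i: "i < s" using S by simp
  let ?ms = "upd rHi i ms'"
  have r': "ready ?ms f D V" and t': "fst ?ms rHt = \<tau>" "fst ?ms rI = fst ms rI" "fst ?ms rHi = i"
   using inv by (simp_all add: I_def ready_upd)
  have c: "eval b cond (fst ?ms) \<noteq> 0 \<longleftrightarrow> P i" using cond[OF t'(2)] t'(3) by simp
  have st: "fst (sem b step_com ?ms) rHy = F (col (table s \<rho> \<tau>) i (fst ms' rHy))"
   using step_correct[OF r' V t'(1) a(2) t'(3) i refl] by simp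
  have rs: "ready (sem b step_com ?ms) f D V" using r' by (rule ready_frame) auto
  show "I i (sem b (Cond cond step_com Skip) ?ms)"
   using inv r' rs st c t' by (cases "P i") (simp_all add: I_def)
 qed
 thus ?thesis by (simp add: I_def walk_com_def)
qed

lemma walk_less_FB: "y < 2 ^ FB ==> walk \<rho> P i y < 2 ^ FB"
 by (induction i arbitrary: y) (auto simp: F_less_FB col_less)

end

section \<open>Dyadic decomposition of boxes, and selection of an element by rank\<close>

section \<open>Counting and selecting triples\<close>

text \<open>The dyadic decomposition of \<open>{..<X}\<close>: each bit of \<open>X\<close> that is
  set contributes the left sibling of the ancestor of \<open>X\<close> at that level, and
  \<open>d\<close> lies in at most one of these intervals. Halving both numbers gives the
  induction.\<close>

lemma dyadic_less:
 "d < 2 ^ w ==> X < 2 ^ w ==>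
  (\<Sum>i<w. of_bool (odd (X div 2 ^ i) \<and> d div 2 ^ i = X div 2 ^ i - 1)) = (of_bool (d < X) :: int)"
 for d X :: nat
proof (induction w arbitrary: d X)
 case (Suc w)
 have IH: "(\<Sum>i<w. of_bool (odd (X div 2 div 2 ^ i) \<and> d div 2 div 2 ^ i = X div 2 div 2 ^ i - 1)) =
   (of_bool (d div 2 < X div 2) :: int)"
  using Suc.prems by (intro Suc.IH) auto
 have "(\<Sum>i<Suc w. of_bool (odd (X div 2 ^ i) \<and> d div 2 ^ i = X div 2 ^ i - 1)) =
   (of_bool (odd X \<and> d = X - 1) :: int) + of_bool (d div 2 < X div 2)"
  unfolding sum.lessThan_Suc_shift IH[symmetric] by (simp add: div_mult2_eq)
 also have "\<dots> = of_bool (d < X)"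
 proof (cases "odd X \<and> d = X - 1")
  case True
  hence "odd X" "d = X - 1" by auto
  then obtain h where "X = 2 * h + 1" "d = 2 * h" by (auto elim: oddE)
  thus ?thesis by simp
 next
  case False
  hence "d div 2 < X div 2 \<longleftrightarrow> d < X"
   by (cases "odd X"; cases "odd d") (auto elim!: oddE evenE)
  thus ?thesis using False by auto
 qed
 finally show ?case .
qed simp

lemma digits_eq_iff:
 fixes a a' u u' P :: nat
 assumes "u < P" "u' < P"
 shows "a * P + u = a' * P + u' \<longleftrightarrow> a = a' \<and> u = u'"
proof
 assume eq: "a * P + u = a' * P + u'"
 have "(a * P + u) div P = a" "(a' * P + u') div P = a'" "(a * P + u) mod P = u" "(a' * P + u') mod P = u'"
  using assms by simp_all
 with eq show "a = a' \<and> u = u'" by metis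
qed simp

lemma sum_digits:
 fixes f :: "nat => 'a :: comm_monoid_add"
 assumes "0 < b"
 shows "(\<Sum>x<a * b. f x) = (\<Sum>y<a. \<Sum>z<b. f (y * b + z))"
proof -
 have "(\<Sum>x<a * b. f x) = (\<Sum>(y, z)\<in>{..<a} \<times> {..<b}. f (y * b + z))"
  by (rule sum.reindex_bij_witness[of _ "\<lambda>(y, z). y * b + z" "\<lambda>x. (x div b, x mod b)"])
   (use assms in \<open>auto simp: less_mult_imp_div_less intro: digits_less\<close>)
 thus ?thesis by (simp add: sum.cartesian_product)
qed

lemma sum_swap3:
 "(\<Sum>l\<in>A. \<Sum>i\<in>B. \<Sum>g\<in>C. t l i g) = (\<Sum>i\<in>B. \<Sum>g\<in>C. \<Sum>l\<in>A. t l i g)"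
proof -
 have "(\<Sum>l\<in>A. \<Sum>i\<in>B. \<Sum>g\<in>C. t l i g) = (\<Sum>i\<in>B. \<Sum>l\<in>A. \<Sum>g\<in>C. t l i g)" by (rule sum.swap)
 also have "\<dots> = (\<Sum>i\<in>B. \<Sum>g\<in>C. \<Sum>l\<in>A. t l i g)" by (intro sum.cong refl sum.swap)
 finally show ?thesis .
qed

text \<open>The digits of \<open>z\<close> run through all combinations, so the sum of products
  factors by distributivity.\<close>

lemma sum_prod_digits:
 fixes f :: "nat => nat => 'a :: comm_semiring_1"
 assumes "0 < L"
 shows "(\<Sum>z<L ^ k. \<Prod>c<k. f c (z div L ^ (k - 1 - c) mod L)) = (\<Prod>c<k. \<Sum>l<L. f c l)"
proof (induction k)
 case (Suc k)
 have "(\<Sum>z<L ^ Suc k. \<Prod>c<Suc k. f c (z div L ^ (Suc k - 1 - c) mod L)) =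
  (\<Sum>y<L ^ k. \<Sum>l<L. \<Prod>c<Suc k. f c ((y * L + l) div L ^ (Suc k - 1 - c) mod L))"
  unfolding power_Suc2 by (rule sum_digits[OF assms])
 also have "\<dots> = (\<Sum>y<L ^ k. \<Sum>l<L. (\<Prod>c<k. f c (y div L ^ (k - 1 - c) mod L)) * f k l)"
 proof (intro sum.cong refl)
  fix y l assume "l \<in> {..<L}"
  hence l: "l < L" by simp
  have "(y * L + l) div L ^ (k - c) = y div L ^ (k - 1 - c)" if "c < k" for c
  proof -
   have "L ^ (k - c) = L * L ^ (k - 1 - c)" using that by (simp add: power_Suc[symmetric] Suc_diff_Suc)
   thus ?thesis using l by (simp add: div_mult2_eq)
  qed
  thus "(\<Prod>c<Suc k. f c ((y * L + l) div L ^ (Suc k - 1 - c) mod L)) =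
    (\<Prod>c<k. f c (y div L ^ (k - 1 - c) mod L)) * f k l"
   using l by simp
 qed
 also have "\<dots> = (\<Sum>y<L ^ k. \<Prod>c<k. f c (y div L ^ (k - 1 - c) mod L)) * (\<Sum>l<L. f k l)"
  by (simp only: sum_product)
 finally show ?case by (simp only: Suc.IH prod.lessThan_Suc)
qed simp

context layout begin

text \<open>The heap number of the left sibling of the ancestor of \<open>X\<close> at level
  \<open>i\<close>, when \<open>X div 2 ^ i\<close> is odd.\<close>

definition node :: "nat => nat => nat" where
 "node X i = (2 ^ W + X) div 2 ^ i - 1"

lemma node_eq:
 assumes "X < 2 ^ W" "i < W" "odd (X div 2 ^ i)"
 shows "node X i = 2 ^ (W - i) + (X div 2 ^ i - 1)" "X div 2 ^ i - 1 < 2 ^ (W - i)"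
proof -
 have p: "(2::nat) ^ W = 2 ^ (W - i) * 2 ^ i" using assms(2) by (simp flip: power_add)
 have "0 < X div 2 ^ i" using assms(3) by (auto intro: Nat.gr0I)
 thus "node X i = 2 ^ (W - i) + (X div 2 ^ i - 1)"
  unfolding node_def p by simp
 have "X div 2 ^ i < 2 ^ (W - i)" using assms(1) unfolding p by (rule less_mult_imp_div_less)
 thus "X div 2 ^ i - 1 < 2 ^ (W - i)" by simp
qed

lemma node_less: "X < 2 ^ W ==> node X i < 2 ^ (W + 1)"
proof -
 assume "X < 2 ^ W"
 have "node X i \<le> 2 ^ W + X" unfolding node_def by (meson diff_le_self div_le_dividend order_trans)
 also have "\<dots> < 2 ^ (W + 1)" using \<open>X < 2 ^ W\<close> by simp
 finally show ?thesis .
qed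

text \<open>The leading 1 of a heap number fixes its level and the other bits its position, so a
  single comparison tests both.\<close>

lemma nd_eq_node:
 assumes "X < 2 ^ W" "i < W" "odd (X div 2 ^ i)"
 shows "nd x c = node X i \<longleftrightarrow> lv x c = i \<and> cd (x div L ^ 6) c div 2 ^ i = X div 2 ^ i - 1"
proof -
 let ?l = "lv x c" and ?d = "cd (x div L ^ 6) c"
 note n = node_eq[OF assms]
 have nd: "nd x c = 2 ^ (W - ?l) + ?d div 2 ^ ?l \<and> ?d div 2 ^ ?l < 2 ^ (W - ?l)" if "?l \<le> W"
 proof -
  have p: "(2::nat) ^ W = 2 ^ (W - ?l) * 2 ^ ?l" using that by (simp flip: power_add)
  have "?d div 2 ^ ?l < 2 ^ (W - ?l)" using cd_less[of "x div L ^ 6" c] unfolding p by (rule less_mult_imp_div_less)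
  thus ?thesis unfolding nd_def p by simp
 qed
 have size: "j = j'" if "(2::nat) ^ j + a = 2 ^ j' + a'" "a < 2 ^ j" "a' < 2 ^ j'" for j j' a a' :: nat
 proof (rule ccontr)
  have aux: False if "j < j'" "(2::nat) ^ j + a = 2 ^ j' + a'" "a < 2 ^ j" for j j' a a' :: nat
  proof -
   have "(2::nat) ^ Suc j \<le> 2 ^ j'" using that(1) by (intro power_increasing) auto
   thus False using that by simp
  qed
  assume "j \<noteq> j'"
  thus False using aux[of j j' a a'] aux[of j' j a' a] that by (cases "j < j'") auto
 qed
 show ?thesis
 proof (cases "?l \<le> W")
  case True
  show ?thesis
  proof
   assume "nd x c = node X i"
   hence eq: "2 ^ (W - ?l) + ?d div 2 ^ ?l = 2 ^ (W - i) + (X div 2 ^ i - 1)" using nd[OF True] n by simp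
   hence "W - ?l = W - i" using size[of "W - ?l"] nd[OF True] n by blast
   hence "?l = i" using True assms(2) by simp
   thus "?l = i \<and> ?d div 2 ^ i = X div 2 ^ i - 1" using eq by simp
  next
   assume "?l = i \<and> ?d div 2 ^ i = X div 2 ^ i - 1"
   thus "nd x c = node X i" using nd[OF True] n by simp
  qed
 next
  case False
  \<comment> \<open>Rounding up the number of levels may admit levels above \<open>W\<close>. They
    shift the heap number to 0, which is no interval of a query.\<close>
  hence "(2::nat) ^ (W + 1) \<le> 2 ^ ?l" by (intro power_increasing) auto
  hence "nd x c = 0" using cd_less[of "x div L ^ 6" c] unfolding nd_def by simp
  moreover have "node X i \<noteq> 0" using n by simp
  ultimately show ?thesis using False assms(2) by auto
 qed
qed

lemma kap_less: "y < NP ^ 3 ==> kap y < 2 ^ KB"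
proof -
 assume "y < NP ^ 3"
 hence "area2 y * NP ^ 3 + y < 2 ^ AB * NP ^ 3" by (rule digits_less[OF area2_less])
 also have "\<dots> = 2 ^ KB" by (simp add: NP_def KB_def power_add power_mult[symmetric] mult.commute)
 finally show ?thesis by (simp add: kap_def)
qed

lemma full_div: "full x div L ^ 6 = Tc x 6 * 2 ^ KB + kap (x div L ^ 6)"
proof -
 have N: "N = NP ^ 3 * L ^ 6" by (rule N_def)
 have NP3: "NP ^ 3 = 2 ^ (3 * q0)" by (simp add: NP_def power_mult[symmetric] mult.commute)
 have "full x = ((Tc x 6 * 2 ^ AB + area2 (x div L ^ 6)) * NP ^ 3) * L ^ 6 + x"
  by (simp add: full_def N mult.assoc)
 hence "full x div L ^ 6 = (Tc x 6 * 2 ^ AB + area2 (x div L ^ 6)) * NP ^ 3 + x div L ^ 6"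
  using L_pos by simp
 thus ?thesis by (simp add: kap_def KB_def power_add NP3 algebra_simps)
qed

lemma xdiv_less: "x < N ==> x div L ^ 6 < NP ^ 3"
 using L_pos by (simp add: N_def less_mult_imp_div_less)

text \<open>The divisor strips the levels and the last \<open>KB - len\<close> bits of
  \<open>kap\<close>.\<close>

lemma full_prefix:
 assumes "x < N" "len \<le> KB" "\<pi> < 2 ^ len"
 shows "full x div (2 ^ (KB - len) * L ^ 6) = T * 2 ^ len + \<pi> \<longleftrightarrow>
     Tc x 6 = T \<and> kap (x div L ^ 6) div 2 ^ (KB - len) = \<pi>"
proof -
 let ?k = "kap (x div L ^ 6)"
 have p: "(2::nat) ^ KB = 2 ^ len * 2 ^ (KB - len)" using assms(2) by (simp flip: power_add)
 have "full x div (2 ^ (KB - len) * L ^ 6) = (Tc x 6 * 2 ^ KB + ?k) div 2 ^ (KB - len)"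
  by (simp only: mult.commute[of _ "L ^ 6"] div_mult2_eq full_div)
 also have "\<dots> = Tc x 6 * 2 ^ len + ?k div 2 ^ (KB - len)"
  unfolding p by (simp add: mult.assoc[symmetric])
 finally have eq: "full x div (2 ^ (KB - len) * L ^ 6) = \<dots>" .
 have "?k div 2 ^ (KB - len) < 2 ^ len"
  using kap_less[OF xdiv_less[OF assms(1)]] unfolding p by (rule less_mult_imp_div_less)
 thus ?thesis unfolding eq using assms(3) by (rule digits_eq_iff)
qed

text \<open>
 \<open>X c 0\<close> and \<open>X c 1\<close> are the (exclusive) upper and the (inclusive) lower bound for coordinate
 \<open>c\<close>. The sum is over the dyadic decompositions of \<open>{..<X c 0}\<close> and, with negative sign,
 \<open>{..<X c 1}\<close> for the last \<open>k\<close> coordinates.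
\<close>

primrec nsum :: "(nat => nat => nat) => nat => nat => nat => nat => nat => int" where
 "nsum X len \<pi> 0 T sg =
  (-1) ^ sg * int (card {x. x < N \<and> full x div (2 ^ (KB - len) * L ^ 6) = T * 2 ^ len + \<pi>})"
| "nsum X len \<pi> (Suc k) T sg =
  (\<Sum>i<W. \<Sum>g<2. if odd (X (5 - k) g div 2 ^ i)
    then nsum X len \<pi> k (T * 2 ^ (W + 1) + node (X (5 - k) g) i) (sg + g) else 0)"

text \<open>The share that coordinate \<open>c\<close> has in the weight of an item: the intervals
  of its level that contain \<open>d\<close>, with the sign of the bound they come from.\<close>

definition contrib :: "(nat => nat => nat) => nat => nat => nat => int" where
 "contrib X c l d = (\<Sum>i<W. \<Sum>g<2. (-1) ^ g *
  of_bool (odd (X c g div 2 ^ i) \<and> l = i \<and> d div 2 ^ i = X c g div 2 ^ i - 1))"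

text \<open>Exchanging the sums over nodes and over items turns a signed sum of counts into a sum of
  weights of items, which are products over the coordinates.\<close>

lemma nsum_eq:
 assumes X: "\<And>c g. X c g < 2 ^ W" and len: "len \<le> KB" "\<pi> < 2 ^ len" and "k \<le> 6"
 shows "nsum X len \<pi> k T sg = (-1) ^ sg * (\<Sum>x<N.
     of_bool (Tc x (6 - k) = T \<and> kap (x div L ^ 6) div 2 ^ (KB - len) = \<pi>) *
     (\<Prod>c\<in>{6 - k..<6}. contrib X c (lv x c) (cd (x div L ^ 6) c)))"
 using assms(4)
proof (induction k arbitrary: T sg)
 case 0
 have "int (card {x. x < N \<and> full x div (2 ^ (KB - len) * L ^ 6) = T * 2 ^ len + \<pi>}) =
  (\<Sum>x<N. of_bool (full x div (2 ^ (KB - len) * L ^ 6) = T * 2 ^ len + \<pi>))"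
  by (subst of_bool_def, subst sum.If_cases) (auto intro!: arg_cong[of _ _ card])
 also have "\<dots> = (\<Sum>x<N. of_bool (Tc x 6 = T \<and> kap (x div L ^ 6) div 2 ^ (KB - len) = \<pi>))"
  by (intro sum.cong refl arg_cong[of _ _ of_bool] full_prefix[OF _ len]) simp
 finally show ?case by simp
next
 case (Suc k)
 let ?c = "5 - k"
 have c: "6 - k = Suc ?c" "6 - Suc k = ?c" using Suc.prems by auto
 let ?kc = "\<lambda>x. kap (x div L ^ 6) div 2 ^ (KB - len) = \<pi>"
 let ?pr = "\<lambda>x. \<Prod>c\<in>{Suc ?c..<6}. contrib X c (lv x c) (cd (x div L ^ 6) c)"
 have split: "(if odd (X ?c g div 2 ^ i) then nsum X len \<pi> k (T * 2 ^ (W + 1) + node (X ?c g) i) (sg + g) else 0) =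
  (-1) ^ sg * (\<Sum>x<N. of_bool (Tc x ?c = T \<and> ?kc x) * ?pr x * ((-1) ^ g *
    of_bool (odd (X ?c g div 2 ^ i) \<and> lv x ?c = i \<and> cd (x div L ^ 6) ?c div 2 ^ i = X ?c g div 2 ^ i - 1)))"
  if i: "i < W" for i g
 proof (cases "odd (X ?c g div 2 ^ i)")
  case True
  have eq: "Tc x (Suc ?c) = T * 2 ^ (W + 1) + node (X ?c g) i \<longleftrightarrow>
    Tc x ?c = T \<and> lv x ?c = i \<and> cd (x div L ^ 6) ?c div 2 ^ i = X ?c g div 2 ^ i - 1" for x
  proof -
   have "Tc x (Suc ?c) = T * 2 ^ (W + 1) + node (X ?c g) i \<longleftrightarrow> Tc x ?c = T \<and> nd x ?c = node (X ?c g) i"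
    unfolding Tc.simps by (rule digits_eq_iff[OF nd_less node_less[OF X]])
   thus ?thesis using nd_eq_node[OF X i True] by simp
  qed
  have "nsum X len \<pi> k (T * 2 ^ (W + 1) + node (X ?c g) i) (sg + g) =
   (-1) ^ (sg + g) * (\<Sum>x<N. of_bool (Tc x (Suc ?c) = T * 2 ^ (W + 1) + node (X ?c g) i \<and> ?kc x) * ?pr x)"
   using Suc.prems by (subst Suc.IH) (simp_all only: c)
  also have "\<dots> = (-1) ^ sg * (\<Sum>x<N. of_bool (Tc x ?c = T \<and> ?kc x) * ?pr x * ((-1) ^ g *
    of_bool (lv x ?c = i \<and> cd (x div L ^ 6) ?c div 2 ^ i = X ?c g div 2 ^ i - 1)))"
   unfolding eq unfolding power_add sum_distrib_left by (intro sum.cong refl) (auto simp: of_bool_conj)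
  finally show ?thesis using True by simp
 qed simp
 have "nsum X len \<pi> (Suc k) T sg =
  (\<Sum>i<W. \<Sum>g<2. (-1) ^ sg * (\<Sum>x<N. of_bool (Tc x ?c = T \<and> ?kc x) * ?pr x * ((-1) ^ g *
    of_bool (odd (X ?c g div 2 ^ i) \<and> lv x ?c = i \<and> cd (x div L ^ 6) ?c div 2 ^ i = X ?c g div 2 ^ i - 1))))"
  unfolding nsum.simps by (intro sum.cong refl split) simp
 also have "\<dots> = (-1) ^ sg * (\<Sum>i<W. \<Sum>g<2. \<Sum>x<N. of_bool (Tc x ?c = T \<and> ?kc x) * ?pr x * ((-1) ^ g *
    of_bool (odd (X ?c g div 2 ^ i) \<and> lv x ?c = i \<and> cd (x div L ^ 6) ?c div 2 ^ i = X ?c g div 2 ^ i - 1)))"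
  by (simp only: sum_distrib_left)
 also have "(\<Sum>i<W. \<Sum>g<2. \<Sum>x<N. of_bool (Tc x ?c = T \<and> ?kc x) * ?pr x * ((-1) ^ g *
    of_bool (odd (X ?c g div 2 ^ i) \<and> lv x ?c = i \<and> cd (x div L ^ 6) ?c div 2 ^ i = X ?c g div 2 ^ i - 1))) =
  (\<Sum>x<N. of_bool (Tc x ?c = T \<and> ?kc x) * ?pr x * contrib X ?c (lv x ?c) (cd (x div L ^ 6) ?c))"
 proof -
  have "(\<Sum>i<W. \<Sum>g<2. \<Sum>x<N. h x * t i g x) = (\<Sum>x<N. h x * (\<Sum>i<W. \<Sum>g<2. t i g x))"
   for h :: "nat => int" and t :: "nat => nat => nat => int"
   unfolding sum_distrib_left by (rule sum_swap3[symmetric])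
  thus ?thesis unfolding contrib_def .
 qed
 also have "\<dots> = (\<Sum>x<N. of_bool (Tc x ?c = T \<and> ?kc x) * (\<Prod>c\<in>{?c..<6}. contrib X c (lv x c) (cd (x div L ^ 6) c)))"
 proof (intro sum.cong refl)
  fix x
  have "{?c..<6} = insert ?c {Suc ?c..<6}" using Suc.prems by auto
  thus "of_bool (Tc x ?c = T \<and> ?kc x) * ?pr x * contrib X ?c (lv x ?c) (cd (x div L ^ 6) ?c) =
   of_bool (Tc x ?c = T \<and> ?kc x) * (\<Prod>c\<in>{?c..<6}. contrib X c (lv x c) (cd (x div L ^ 6) c))"
   by simp
 qed
 finally show ?case unfolding c(2) .
qed

text \<open>By \<open>dyadic_less\<close>, summing over the levels leaves the indicator of
  \<open>d < X c 0\<close> minus that of \<open>d < X c 1\<close>.\<close>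

lemma sum_contrib:
 assumes X: "\<And>g. X c g < 2 ^ W" and "X c 1 \<le> X c 0" and d: "d < 2 ^ W"
 shows "(\<Sum>l<L. contrib X c l d) = of_bool (X c 1 \<le> d \<and> d < X c 0)"
proof -
 have "(\<Sum>l<L. contrib X c l d) = (\<Sum>i<W. \<Sum>g<2. (-1) ^ g * (\<Sum>l<L. of_bool (l = i) *
  of_bool (odd (X c g div 2 ^ i) \<and> d div 2 ^ i = X c g div 2 ^ i - 1)))"
 proof -
  show ?thesis unfolding contrib_def sum_distrib_left sum_swap3[of _ "{..<2}" "{..<W}" "{..<L}"] by (intro sum.cong refl) auto
 qed
 also have "\<dots> = (\<Sum>i<W. \<Sum>g<2. (-1) ^ g * of_bool (odd (X c g div 2 ^ i) \<and> d div 2 ^ i = X c g div 2 ^ i - 1))"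
 proof (intro sum.cong refl arg_cong2[of _ _ _ _ "(*)"])
  fix i g assume "i \<in> {..<W}"
  hence "i \<in> {..<L}" using W_le_L by auto
  thus "(\<Sum>l<L. of_bool (l = i) * of_bool (odd (X c g div 2 ^ i) \<and> d div 2 ^ i = X c g div 2 ^ i - 1)) =
    (of_bool (odd (X c g div 2 ^ i) \<and> d div 2 ^ i = X c g div 2 ^ i - 1) :: int)"
   by (simp add: of_bool_def if_distrib[of "\<lambda>x. x * _"] cong: if_cong)
 qed
 also have "\<dots> = (\<Sum>g<2. (-1) ^ g * (\<Sum>i<W. of_bool (odd (X c g div 2 ^ i) \<and> d div 2 ^ i = X c g div 2 ^ i - 1)))"
  by (subst sum.swap) (simp only: sum_distrib_left)
 also have "\<dots> = (\<Sum>g<2. (-1) ^ g * of_bool (d < X c g))"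
  by (simp only: dyadic_less[OF d X])
 also have "\<dots> = of_bool (X c 1 \<le> d \<and> d < X c 0)"
  using assms(2) by (auto simp: numeral_2_eq_2)
 finally show ?thesis .
qed

text \<open>Every triple occurs with all \<open>L ^ 6\<close> combinations of levels. Summed over
  them, the products of weights factor into six indicators, so each triple in the boxes counts
  exactly once.\<close>

theorem nsum_total:
 assumes X: "\<And>c g. X c g < 2 ^ W" and X10: "\<And>c. c < 6 ==> X c 1 \<le> X c 0"
  and len: "len \<le> KB" "\<pi> < 2 ^ len"
 shows "nsum X len \<pi> 6 1 0 = int (card {y. y < NP ^ 3 \<and> (\<forall>c<6. X c 1 \<le> cd y c \<and> cd y c < X c 0) \<and>
     kap y div 2 ^ (KB - len) = \<pi>})"
proof -
 have lv: "lv (y * L ^ 6 + z) c = z div L ^ (5 - c) mod L" if "c < 6" for y z c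
 proof -
  have "Suc c + (5 - c) = 6" using that by simp
  hence "L ^ 6 = L ^ Suc c * L ^ (5 - c)" by (simp only: power_add[symmetric])
  hence "(y * L ^ 6 + z) div L ^ (5 - c) = y * L ^ Suc c + z div L ^ (5 - c)"
   using L_pos by (simp add: mult.assoc[symmetric])
  thus ?thesis unfolding lv_def by (simp add: mult.left_commute[of y])
 qed
 have "nsum X len \<pi> 6 1 0 = (\<Sum>x<N. of_bool (kap (x div L ^ 6) div 2 ^ (KB - len) = \<pi>) *
   (\<Prod>c<6. contrib X c (lv x c) (cd (x div L ^ 6) c)))"
  by (simp only: nsum_eq[OF X len order_refl]) (simp add: lessThan_atLeast0)
 also have "\<dots> = (\<Sum>y<NP ^ 3. \<Sum>z<L ^ 6. of_bool (kap y div 2 ^ (KB - len) = \<pi>) *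
   (\<Prod>c<6. contrib X c (z div L ^ (6 - 1 - c) mod L) (cd y c)))"
  unfolding N_def using L_pos
  by (subst sum_digits, simp, intro sum.cong refl arg_cong2[of _ _ _ _ "(*)"] prod.cong) (simp_all add: lv)
 also have "\<dots> = (\<Sum>y<NP ^ 3. of_bool (kap y div 2 ^ (KB - len) = \<pi>) * (\<Prod>c<6. \<Sum>l<L. contrib X c l (cd y c)))"
  unfolding sum_distrib_left[symmetric]
  by (intro sum.cong refl arg_cong2[of _ _ _ _ "(*)"]
    sum_prod_digits[OF L_pos, where f="\<lambda>c l. contrib X c l (cd y c)" for y])
 also have "\<dots> = (\<Sum>y<NP ^ 3. of_bool (kap y div 2 ^ (KB - len) = \<pi>) *
   (\<Prod>c<6. of_bool (X c 1 \<le> cd y c \<and> cd y c < X c 0)))"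
  by (intro sum.cong refl arg_cong2[of _ _ _ _ "(*)"] prod.cong sum_contrib X X10 cd_less) auto
 also have "\<dots> = (\<Sum>y<NP ^ 3. of_bool ((\<forall>c<6. X c 1 \<le> cd y c \<and> cd y c < X c 0) \<and> kap y div 2 ^ (KB - len) = \<pi>))"
 proof (intro sum.cong refl)
  fix y
  have pr: "(\<Prod>c<(6::nat). of_bool (P c)) = (of_bool (\<forall>c<6. P c) :: int)" for P
  proof (cases "\<forall>c<6. P c")
   case False
   then obtain c where "c < 6" "\<not> P c" by blast
   hence "(\<Prod>c<(6::nat). of_bool (P c)) = (0::int)" by (intro prod_zero) auto
   thus ?thesis using False by simp
  qed simp
  show "of_bool (kap y div 2 ^ (KB - len) = \<pi>) * (\<Prod>c<6. of_bool (X c 1 \<le> cd y c \<and> cd y c < X c 0)) =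
   (of_bool ((\<forall>c<6. X c 1 \<le> cd y c \<and> cd y c < X c 0) \<and> kap y div 2 ^ (KB - len) = \<pi>) :: int)"
   unfolding pr by (simp add: of_bool_def)
 qed
 also have "\<dots> = int (card {y. y < NP ^ 3 \<and> (\<forall>c<6. X c 1 \<le> cd y c \<and> cd y c < X c 0) \<and>
     kap y div 2 ^ (KB - len) = \<pi>})"
  by (subst of_bool_def, subst sum.If_cases) (auto intro!: arg_cong[of _ _ card])
 finally show ?thesis .
qed

end

subsection \<open>Selection bit by bit\<close>

definition sel_inv :: "nat set => nat => nat => nat => nat => bool" where
 "sel_inv A k0 j \<pi> k \<longleftrightarrow> 1 \<le> k \<and> k \<le> card {a \<in> A. a div 2 ^ j = \<pi>} \<and>
  k + card {a \<in> A. \<pi> < a div 2 ^ j} = k0"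

lemma sel_inv_init:
 "finite A ==> A \<subseteq> {..<2 ^ l} ==> 1 \<le> k ==> k \<le> card A ==> sel_inv A k l 0 k"
proof -
 assume A: "A \<subseteq> {..<2 ^ l}" and k: "1 \<le> k" "k \<le> card A"
 have e: "{a \<in> A. a div 2 ^ l = 0} = A" "{a \<in> A. 0 < a div 2 ^ l} = {}" using A by auto
 show ?thesis using k unfolding sel_inv_def e by simp
qed

text \<open>Ranks are counted from the top, so the elements whose next bit is 1 come first. If there
  are fewer than \<open>k\<close> of them, they are skipped and their number is subtracted from the
  rank.\<close>

lemma sel_inv_step:
 assumes "finite A" "sel_inv A k0 (Suc j) \<pi> k"
 defines "c \<equiv> card {a \<in> A. a div 2 ^ j = 2 * \<pi> + 1}"
 shows "if c < k then sel_inv A k0 j (2 * \<pi>) (k - c) else sel_inv A k0 j (2 * \<pi> + 1) k"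
proof -
 have h: "a div 2 ^ Suc j = a div 2 ^ j div 2" for a :: nat
  by (simp add: div_mult2_eq[symmetric] mult.commute)
 let ?e = "\<lambda>v. {a \<in> A. a div 2 ^ j = v}" and ?g = "\<lambda>v. {a \<in> A. v < a div 2 ^ j}"
 have "{a \<in> A. a div 2 ^ Suc j = \<pi>} = ?e (2 * \<pi>) \<union> ?e (2 * \<pi> + 1)" unfolding h by auto
 hence 1: "card {a \<in> A. a div 2 ^ Suc j = \<pi>} = card (?e (2 * \<pi>)) + c"
  unfolding c_def using assms(1) by (simp add: card_Un_disjoint disjoint_iff)
 have 2: "{a \<in> A. \<pi> < a div 2 ^ Suc j} = ?g (2 * \<pi> + 1)" unfolding h by auto
 have "?g (2 * \<pi>) = ?g (2 * \<pi> + 1) \<union> ?e (2 * \<pi> + 1)" by auto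
 hence 3: "card (?g (2 * \<pi>)) = card (?g (2 * \<pi> + 1)) + c"
  unfolding c_def using assms(1) by (simp add: card_Un_disjoint disjoint_iff)
 show ?thesis
  using assms(2) 1 3 unfolding sel_inv_def 2 c_def[symmetric] by auto
qed

lemma sel_inv_end: "finite A ==> sel_inv A k0 0 \<pi> k ==> \<pi> \<in> A \<and> card {a \<in> A. \<pi> < a} + 1 = k0"
proof -
 assume "finite A" "sel_inv A k0 0 \<pi> k"
 hence k: "1 \<le> k" "k \<le> card {a \<in> A. a = \<pi>}" "k + card {a \<in> A. \<pi> < a} = k0" by (auto simp: sel_inv_def)
 have e: "{a \<in> A. a = \<pi>} = (if \<pi> \<in> A then {\<pi>} else {})" by auto
 show ?thesis using k unfolding e by (auto split: if_splits)
qed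

text \<open>An injective \<open>h\<close> that refines \<open>f\<close> breaks the ties. Sorting by
  decreasing \<open>h\<close> gives the list, and the index of \<open>x\<close> in it is the number
  of elements above \<open>x\<close>.\<close>

lemma kth_largestI:
 fixes f :: "'a => real" and h :: "'a => nat"
 assumes "finite S" "inj_on h S" "\<And>x y. x \<in> S ==> y \<in> S ==> h y \<le> h x ==> f y \<le> f x"
  and x: "x \<in> S" "card {y \<in> S. h x < h y} + 1 = k"
 shows "kth_largest f S k x"
proof -
 define ks where "ks = rev (sorted_list_of_set (h ` S))"
 define xs where "xs = map (inv_into S h) ks"
 have ks: "set ks = h ` S" "distinct ks" "sorted_wrt (\<ge>) ks"
  using assms(1) by (simp_all add: ks_def sorted_wrt_rev)
 have inv: "h (inv_into S h z) = z" "inv_into S h z \<in> S" if "z \<in> h ` S" for z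
  using that by (simp_all add: f_inv_into_f inv_into_into)
 have xs: "set xs = S" unfolding xs_def using ks(1) assms(2) by (simp add: inv_into_image_cancel)
 have dist: "distinct xs" unfolding xs_def
  using ks inj_on_inv_into[of "h ` S" h S] by (simp add: distinct_map)
 have sort: "sorted_wrt (\<lambda>y z. f y \<ge> f z) xs"
  unfolding xs_def sorted_wrt_map
  by (rule sorted_wrt_mono_rel[OF _ ks(3)]) (use assms(3) inv ks(1) in auto)
 have "h x \<in> set ks" using x ks by simp
 then obtain i where i: "i < length ks" "ks ! i = h x" by (auto simp: in_set_conv_nth)
 have sw: "sorted_wrt (>) ks"
  using ks(2,3) by (auto simp: sorted_wrt_iff_nth_less nth_eq_iff_index_eq order.order_iff_strict)
 have "{y \<in> S. h x < h y} = inv_into S h ` (set (take i ks))"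
 proof -
  have "set (take i ks) = {z \<in> h ` S. h x < z}"
  proof safe
   fix z assume z: "z \<in> set (take i ks)"
   then obtain j where j: "j < i" "z = ks ! j" using i(1) by (auto simp: in_set_conv_nth)
   have "ks ! i < ks ! j" using sw j(1) i(1) unfolding sorted_wrt_iff_nth_less by blast
   thus "h x < z" using i(2) j(2) by simp
   show "z \<in> h ` S" using z ks(1) in_set_takeD by fastforce
  next
   fix y assume y: "y \<in> S" "h x < h y"
   hence "h y \<in> set ks" using ks by simp
   then obtain j where j: "j < length ks" "ks ! j = h y" by (auto simp: in_set_conv_nth)
   have "j < i"
   proof (rule ccontr)
    assume "\<not> j < i"
    hence "ks ! j \<le> ks ! i" using ks(3) j(1) by (cases "i = j") (auto simp: sorted_wrt_iff_nth_less)
    thus False using y j i by simp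
   qed
   thus "h y \<in> set (take i ks)" using j i(1) by (auto simp: in_set_conv_nth intro!: exI[of _ j])
  qed
  thus ?thesis using assms(2) by (auto simp: image_iff) (metis inv_into_f_f inj_onD image_eqI)+
 qed
 moreover have "inj_on (inv_into S h) (set (take i ks))"
  using inj_on_inv_into[of "h ` S" h S] ks(1) set_take_subset[of i ks] by (metis inj_on_subset order_refl)
 ultimately have "card {y \<in> S. h x < h y} = card (set (take i ks))" by (simp add: card_image)
 also have "\<dots> = i" using ks(2) i(1) by (simp add: distinct_card)
 finally have k: "k = Suc i" using x by simp
 have "xs ! i = x" using i x(1) assms(2) by (simp add: xs_def)
 thus ?thesis unfolding kth_largest_def using xs dist sort k i
  by (intro exI[of _ xs]) (auto simp: xs_def)
qed

section \<open>Counting by inversion, and the search for the answer\<close>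

section \<open>The query program\<close>

text \<open>Tries column \<open>Rg rI\<close> of table \<open>Rg rHt\<close> for items of bucket
  \<open>Rg 93\<close>. The candidate may be arbitrary, so its bucket and its prefix are checked;
  the comparison with the stamp \<open>Rg 94\<close> keeps it from being counted twice.\<close>

definition probe_com :: com where
 "probe_com =
  Set rHy (Rg 93) ;; walk_com (Rg rHi [<] Rg rI) ;;
  fetch (Cn 8 [*] (Rg rHy [*] Rg rNt [+] Rg rHt) [+] Cn 5) rHy ;;
  walk_com (Rg rI [<] Rg rHi) ;;
  Set rHi (Rg rI) ;; hash_com ;; keyof ;; Set rV (Rg rFull) ;; bucket_com ;;
  Ld 95 (Rg rMB [+] Rg rX) ;;
  Cond ((Rg rBkt [=] Rg 93) [*] ((Rg rFull [div] Rg 91) [=] Rg 90) [*] (Cn 1 [-] (Rg 95 [=] Rg 94)))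
   (St (Rg rMB [+] Rg rX) (Rg 94) ;; Set 92 (Rg 92 [+] Cn 1)) Skip"

text \<open>Stored counts are positive, so 0 means that none is stored. Incrementing the stamp
  invalidates all earlier marks at once.\<close>

definition count_com :: com where
 "count_com =
  fetch (Cn 8 [*] Rg 90 [+] Cn 4) 92 ;;
  Cond (Rg 92) Skip (
   Set rV (Rg 90) ;; bucket_com ;; Set 93 (Rg rBkt) ;;
   Set 94 (Rg 94 [+] Cn 1) ;; Set 92 (Cn 0) ;;
   For rHt rNt (For rI rS probe_com))"

definition leaf_com :: com where
 "leaf_com =
  Set 90 (Rg 146 [*] Rg 172 [+] Rg 171) ;; count_com ;;
  Cond (Rg 156 [mod] Cn 2) (Set 170 (Rg 170 [-] Rg 92)) (Set 170 (Rg 170 [+] Rg 92))"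

text \<open>The language has no recursion, so every coordinate has its own registers:
  \<open>120 + c\<close> for the level, \<open>130 + c\<close> for the choice of bound,
  \<open>140 + c\<close> for the prefix built from the earlier coordinates and
  \<open>150 + c\<close> for the exponent of the sign.\<close>

definition level_com :: "nat => com => com" where
 "level_com c B =
  For (120 + c) rW (For (130 + c) rTwo (
   Cond (Rg (130 + c)) (Set (160 + c) (Rg (100 + c))) (Set (160 + c) (Rg (110 + c))) ;;
   Cond ((Rg (160 + c) [>>] Rg (120 + c)) [mod] Cn 2)
    (Set (141 + c) (Rg (140 + c) [*] (Cn 2 [*] Rg rPW) [+]
      (((Rg rPW [+] Rg (160 + c)) [>>] Rg (120 + c)) [-] Cn 1)) ;;
     Set (151 + c) (Rg (150 + c) [+] Rg (130 + c)) ;; B)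
    Skip))"

primrec nest_com :: "nat => com" where
 "nest_com 0 = leaf_com"
| "nest_com (Suc k) = level_com (5 - k) (nest_com k)"

text \<open>\<open>Rg 173\<close> holds the bits found so far, \<open>Rg 12\<close> the rank among
  the triples with these bits, and \<open>Rg 175\<close> the number of bits left open after this
  step.\<close>

definition search_body :: com where
 "search_body =
  Set 172 (Cn 1 [<<] (Rg rKB [-] Rg 175)) ;;
  Set 91 ((Cn 1 [<<] Rg 175) [*] Rg rL6) ;;
  Set 171 (Cn 2 [*] Rg 173 [+] Cn 1) ;;
  Set 170 (Cn 0) ;; Set 140 (Cn 1) ;; Set 150 (Cn 0) ;;
  nest_com 6 ;;
  Cond (Rg 170 [<] Rg 12)
   (Set 12 (Rg 12 [-] Rg 170) ;; Set 173 (Cn 2 [*] Rg 173))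
   (Set 173 (Rg 171))"

definition load_pars :: com where
 "load_pars =
  Ld 20 (Cn 0) ;; Ld 21 (Cn 1) ;; Ld 22 (Cn 2) ;; Ld 23 (Cn 3) ;; Ld 24 (Cn 4) ;; Ld 25 (Cn 5) ;;
  Ld 26 (Cn 6) ;; Ld 27 (Cn 7) ;; Ld 28 (Cn 8) ;; Ld 29 (Cn 9) ;; Ld 30 (Cn 10) ;; Ld 31 (Cn 11) ;;
  Ld 32 (Cn 12) ;; Ld 33 (Cn 13)"

text \<open>Coordinates are stored increased by 1. An inclusive lower bound therefore becomes
  \<open>+ 1\<close>, an upper bound, made exclusive, \<open>+ 2\<close>.\<close>

definition bounds_com :: com where
 "bounds_com =
  Set 100 (Rg 0 [+] Cn 1) ;; Set 101 (Rg 1 [+] Cn 1) ;; Set 110 (Rg 2 [+] Cn 2) ;; Set 111 (Rg 3 [+] Cn 2) ;;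
  Set 102 (Rg 4 [+] Cn 1) ;; Set 103 (Rg 5 [+] Cn 1) ;; Set 112 (Rg 6 [+] Cn 2) ;; Set 113 (Rg 7 [+] Cn 2) ;;
  Set 104 (Rg 8 [+] Cn 1) ;; Set 105 (Rg 9 [+] Cn 1) ;; Set 114 (Rg 10 [+] Cn 2) ;; Set 115 (Rg 11 [+] Cn 2) ;;
  Set 94 (Cn 0) ;; Set 173 (Cn 0)"

text \<open>The low digits of \<open>kap\<close> are the code of the triple. Multiplied by
  \<open>L ^ 6\<close> it becomes an item with all levels 0, from which \<open>coords\<close> can
  read the points.\<close>

definition output_com :: com where
 "output_com =
  Set rX ((Rg 173 [mod] (Rg rNP [*] Rg rNP [*] Rg rNP)) [*] Rg rL6) ;; coords ;;
  Set 0 (Rg 54 [-] Cn 1) ;; Set 1 (Rg 55 [-] Cn 1) ;; Set 2 (Rg 56 [-] Cn 1) ;;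
  Set 3 (Rg 57 [-] Cn 1) ;; Set 4 (Rg 58 [-] Cn 1) ;; Set 5 (Rg 59 [-] Cn 1)"

definition query_com :: com where
 "query_com = load_pars ;; bounds_com ;; For 175 rKB search_body ;; output_com"

lemma wr_probe_com [simp]: "wr probe_com = {40..44} \<union> {50..68} \<union> {70..74} \<union> {76..79} \<union> {92, 95}"
 by (auto simp: probe_com_def)

lemma wr_count_com [simp]: "wr count_com = {40..44} \<union> {50..68} \<union> {70..80} \<union> {92..95}"
 by (auto simp: count_com_def)

definition nest_regs :: "nat => nat set" where
 "nest_regs c = {40..44} \<union> {50..68} \<union> {70..80} \<union> {90} \<union> {92..95} \<union> {170} \<union>
  {120 + c..<126} \<union> {130 + c..<136} \<union> {141 + c..<147} \<union> {151 + c..<157} \<union> {160 + c..<166}"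

lemma wr_nest_com: "k \<le> 6 ==> wr (nest_com k) \<subseteq> nest_regs (6 - k)"
proof (induction k)
 case 0
 show ?case by (auto simp: leaf_com_def nest_regs_def)
next
 case (Suc k)
 let ?c = "5 - k"
 have c: "6 - k = Suc ?c" "6 - Suc k = ?c" "?c \<le> 5" using Suc.prems by auto
 have 1: "wr (nest_com k) \<subseteq> nest_regs (Suc ?c)" using Suc c(1) by simp
 have 2: "nest_regs (Suc ?c) \<subseteq> nest_regs ?c" by (auto simp: nest_regs_def)
 have 3: "{120 + ?c, 130 + ?c, 160 + ?c, 141 + ?c, 151 + ?c} \<subseteq> nest_regs ?c"
  using c(3) by (auto simp: nest_regs_def)
 show ?case unfolding c(2) using 1 2 3 by (auto simp: level_com_def)
qed

text \<open>Partial signed sums may be negative, so they are followed as integers modulo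
  \<open>2 ^ b\<close>. The final sum is a count below \<open>2 ^ b\<close> and hence
  determined.\<close>

lemma (in word_machine) alu_Plus_int: "int (alu b Plus x y) = (int x + int y) mod 2 ^ b"
 by (simp add: alu.simps take_bit_eq_mod of_nat_mod)

lemma (in word_machine) alu_Minus_int:
 assumes "y \<le> 2 ^ b"
 shows "int (alu b Minus x y) = (int x - int y) mod 2 ^ b"
proof -
 have "int (x + 2 ^ b - y) = (int x - int y) + 2 ^ b" using assms by (simp add: of_nat_diff)
 hence "int (alu b Minus x y) = ((int x - int y) + 2 ^ b) mod 2 ^ b"
  by (simp only: alu.simps take_bit_eq_mod of_nat_mod of_nat_power of_nat_numeral)
 thus ?thesis by simp
qed

lemma (in word_machine) alu_less: "alu b Plus x y < 2 ^ b" "alu b Minus x y < 2 ^ b"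
 by (simp_all only: alu.simps take_bit_nat_less_exp)

context layout_base begin

text \<open>The marks lie beyond the trie, where the memory of a query starts out as 0.\<close>

definition MB :: nat where "MB = 2 ^ K * 64"

lemma MB_far: "base + 2 ^ (K + 3) \<le> MB" and MB_b: "x \<le> 2 ^ K ==> MB + x < 2 ^ b"
proof -
 show "base + 2 ^ (K + 3) \<le> MB" using base_le by (simp add: MB_def power_add)
 have "(66::nat) \<le> 2 ^ 120" by simp
 hence "(66::nat) \<le> 2 ^ K" using big_K by (rule order_trans)
 hence "66 * 2 ^ K \<le> (2::nat) ^ b" unfolding pow_b by (rule mult_le_mono1)
 moreover have "(0::nat) < 2 ^ K" by simp
 ultimately show "x \<le> 2 ^ K ==> MB + x < 2 ^ b" unfolding MB_def by linarith
qed

lemma ready_MB: "ready ms f D V ==> fst ms rMB = MB"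
 by (simp add: ready_def pars_def MB_def)

lemma ready_mem:
 assumes "ready ms f D V" "\<And>z. 20 \<le> z ==> z \<le> 39 ==> fst ms' z = fst ms z"
  and "\<And>a. a < MB ==> snd ms' a = snd ms a"
 shows "ready ms' f D V"
proof -
 have "dict_at ms' f D V"
 proof (rule dict_at_cong)
  show "dict_at ms f D V" using assms(1) by (simp add: ready_def)
  show "snd ms' a = snd ms a" if "a < base + 2 ^ (K + 3)" for a
   using that MB_far by (intro assms(3)) linarith
 qed (simp_all add: assms(2))
 thus ?thesis using assms(1,2) by (simp add: ready_def pars_def)
qed

text \<open>Says something only about chains with a unique end, the ones that \<open>good\<close>
  speaks of.\<close>

definition ends_in :: "(nat => nat) => (nat => nat) => bool" where
 "ends_in V \<rho> \<longleftrightarrow> (\<forall>\<tau><nt. \<forall>j<m.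
  (\<forall>j'<m. j' \<noteq> j --> chain_end (table s \<rho> \<tau>) s j' \<noteq> chain_end (table s \<rho> \<tau>) s j) -->
  V (8 * (chain_end (table s \<rho> \<tau>) s j * nt + \<tau>) + 5) = j)"

text \<open>The item found in bucket \<open>u\<close> with column \<open>i\<close> of table \<open>\<tau>\<close>, if any.\<close>

definition found :: "(nat => nat) => (nat => nat) => nat => nat => nat => nat" where
 "found V \<rho> u \<tau> i = col (table s \<rho> \<tau>) i (walk (table s \<rho> \<tau>) (\<lambda>i'. i < i') s
  (V (8 * (walk (table s \<rho> \<tau>) (\<lambda>i'. i' < i) s u * nt + \<tau>) + 5)))"

text \<open>A good chain for \<open>x\<close> has its start stored by \<open>ends_in\<close>, and
  \<open>hits_witness\<close> recovers \<open>x\<close> from it, given only the bucket.\<close>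

lemma found_all:
 assumes "covers \<rho> nt s m" "ends_in V \<rho>" "x < N"
 shows "\<exists>\<tau><nt. \<exists>i<s. found V \<rho> (F x) \<tau> i = x"
proof -
 obtain \<tau> where \<tau>: "\<tau> < nt" "good (table s \<rho> \<tau>) s m x" using assms by (auto simp: covers_def)
 let ?r = "table s \<rho> \<tau>"
 obtain j where j: "j < m" "0 < hits ?r s x j" "\<forall>j'<m. j' \<noteq> j --> chain_end ?r s j' \<noteq> chain_end ?r s j"
  using \<tau>(2) unfolding good_def by blast
 obtain i where i: "i < s" "col ?r i (walk ?r (\<lambda>i'. i < i') s j) = x"
  "chain_end ?r s j = walk ?r (\<lambda>i'. i' < i) s (F x)"
  using hits_witness[OF j(2)] by blast
 have "V (8 * (chain_end ?r s j * nt + \<tau>) + 5) = j" using assms(2) \<tau>(1) j unfolding ends_in_def by blast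
 hence "found V \<rho> (F x) \<tau> i = x" unfolding found_def i(3)[symmetric] using i(2) by simp
 thus ?thesis using \<tau>(1) i(1) by blast
qed

end

locale query_data = layout_base +
 fixes f :: nat and D :: "nat set" and V \<rho> :: "nat => nat"
 assumes pts: "pts_in V" and wds: "words_in V \<rho>" and cts: "counts_in V" and ends: "ends_in V \<rho>"
  and cov: "covers \<rho> nt s m"
begin

lemma probe_correct:
 assumes r: "ready ms f D V" and reg: "fst ms 93 = u" "u < 2 ^ FB" "fst ms rHt = \<tau>" "\<tau> < nt" "fst ms rI = i" "i < s"
  and small: "fst ms 92 + 1 < 2 ^ b"
 defines "x \<equiv> found V \<rho> u \<tau> i" and "ms' \<equiv> sem b probe_com ms"
 defines "hit \<equiv> F x = u \<and> full x div fst ms 91 = fst ms 90 \<and> snd ms (MB + x) \<noteq> fst ms 94"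
 shows "x < N" "snd ms' = (if hit then (snd ms)(MB + x := fst ms 94) else snd ms)"
  "fst ms' 92 = fst ms 92 + of_bool hit" "ready ms' f D V"
proof -
 let ?r = "table s \<rho> \<tau>"
 have lt: "eval b (Rg rHi [<] Rg rI) (fst ms') \<noteq> 0 \<longleftrightarrow> fst ms' rHi < i"
  "eval b (Rg rI [<] Rg rHi) (fst ms') \<noteq> 0 \<longleftrightarrow> i < fst ms' rHi" if "fst ms' rI = i" for ms' :: st
  using that by (simp_all add: alu_bool)
 define ms1 where "ms1 = sem b (Set rHy (Rg 93)) ms"
 define ms2 where "ms2 = sem b (walk_com (Rg rHi [<] Rg rI)) ms1"
 define ms3 where "ms3 = sem b (fetch (Cn 8 [*] (Rg rHy [*] Rg rNt [+] Rg rHt) [+] Cn 5) rHy) ms2"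
 define ms4 where "ms4 = sem b (walk_com (Rg rI [<] Rg rHi)) ms3"
 define ms5 where "ms5 = sem b (Set rHi (Rg rI)) ms4"
 define ms6 where "ms6 = sem b hash_com ms5"
 define ms7 where "ms7 = sem b keyof ms6"
 define ms8 where "ms8 = sem b (Set rV (Rg rFull)) ms7"
 define ms9 where "ms9 = sem b bucket_com ms8"
 let ?e = "walk ?r (\<lambda>i'. i' < i) s u"
 have r1: "ready ms1 f D V" using r by (simp add: ms1_def ready_upd)
 have r2: "ready ms2 f D V" unfolding ms2_def using r1 by (rule ready_frame) auto
 have r3: "ready ms3 f D V" unfolding ms3_def using r2 by (rule ready_frame) auto
 have r4: "ready ms4 f D V" unfolding ms4_def using r3 by (rule ready_frame) auto
 have r5: "ready ms5 f D V" using r4 by (simp add: ms5_def ready_upd)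
 have r6: "ready ms6 f D V" unfolding ms6_def using r5 by (rule ready_frame) auto
 have r7: "ready ms7 f D V" unfolding ms7_def using r6 by (rule ready_frame) auto
 have r8: "ready ms8 f D V" using r7 by (simp add: ms8_def ready_upd)
 have r9: "ready ms9 f D V" unfolding ms9_def using r8 by (rule ready_frame) auto
 have k1: "fst ms1 z = fst ms z" if "z \<noteq> rHy" for z using that by (simp add: ms1_def)
 have k2: "fst ms2 z = fst ms1 z" if "z \<in> {69, 75} \<union> {80..}" for z using that unfolding ms2_def by (intro sem_frame) auto
 have k3: "fst ms3 z = fst ms2 z" if "z \<in> {69, 75} \<union> {80..}" for z using that unfolding ms3_def by (intro sem_frame) auto
 have k4: "fst ms4 z = fst ms3 z" if "z \<in> {69, 75} \<union> {80..}" for z using that unfolding ms4_def by (intro sem_frame) auto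
 have k5: "fst ms5 z = fst ms4 z" if "z \<noteq> rHi" for z using that by (simp add: ms5_def)
 have k6: "fst ms6 z = fst ms5 z" if "z \<in> {69, 75} \<union> {80..}" for z using that unfolding ms6_def by (intro sem_frame) auto
 have k7: "fst ms7 z = fst ms6 z" if "z \<in> {50, 69, 75} \<union> {80..}" for z using that unfolding ms7_def by (intro sem_frame) auto
 have k8: "fst ms8 z = fst ms7 z" if "z \<noteq> rV" for z using that by (simp add: ms8_def)
 have k9: "fst ms9 z = fst ms8 z" if "z \<in> {50, 51, 69, 75} \<union> {80..}" for z using that unfolding ms9_def by (intro sem_frame) auto
 have keep: "fst ms9 z = fst ms z" if "z \<in> {75} \<union> {80..}" for z
  using that by (auto simp: k1 k2 k3 k4 k5 k6 k7 k8 k9)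
 have t: "fst ms1 75 = \<tau>" "fst ms2 75 = \<tau>" "fst ms3 75 = \<tau>" "fst ms5 75 = \<tau>"
  and ii: "fst ms1 80 = i" "fst ms3 80 = i" "fst ms4 80 = i"
  using reg by (simp_all add: k1 k2 k3 k4 k5)
 have e2: "fst ms2 rHy = ?e" unfolding ms2_def
  by (rule walk_correct[OF r1 pts wds cts t(1) reg(4)]) (use reg ii lt in \<open>simp_all add: ms1_def\<close>)
 have "?e < 2 ^ FB" by (rule walk_less_FB[OF reg(2)])
 hence "?e * nt + \<tau> < 2 ^ FB * nt" using reg(4) by (rule digits_less)
 hence "8 * (?e * nt + \<tau>) + 5 < 2 ^ FB * nt * 8" by simp
 hence key: "8 * (?e * nt + \<tau>) + 5 < 2 ^ K" using nt_FB by (rule less_le_trans)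
 have e3: "fst ms3 rHy = V (8 * (?e * nt + \<tau>) + 5)"
  unfolding ms3_def
 proof (rule fetch_correct[OF r2 _ key])
  have "8 * (?e * nt + \<tau>) + 5 < 2 ^ b" using key by (intro less_b) simp
  moreover have "8 * j < 2 ^ b \<and> j < 2 ^ b" if "8 * j + 5 < 2 ^ b" for j :: nat using that by linarith
  ultimately have "8 * (?e * nt + \<tau>) + 5 < 2 ^ b" "8 * (?e * nt + \<tau>) < 2 ^ b" "?e * nt + \<tau> < 2 ^ b" "?e * nt < 2 ^ b"
   by (blast dest: add_lessD1)+
  moreover have "fst ms2 rNt = nt" using r2 by (simp add: ready_def pars_def)
  ultimately show "eval b (Cn 8 [*] (Rg rHy [*] Rg rNt [+] Rg rHt) [+] Cn 5) (fst ms2) = 8 * (?e * nt + \<tau>) + 5"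
   using e2 t(2) by (simp add: alu_Times alu_Plus)
 qed
 have e4: "fst ms4 rHy = walk ?r (\<lambda>i'. i < i') s (V (8 * (?e * nt + \<tau>) + 5))" unfolding ms4_def
  by (rule walk_correct[OF r3 pts wds cts t(3) reg(4) e3]) (use ii lt in simp)
 have x6: "fst ms6 rX = x" unfolding ms6_def x_def found_def
  by (rule hash_correct[OF r5 wds t(4) reg(4) _ reg(6)]) (simp_all add: ms5_def ii e4)
 show xN: "x < N" unfolding x_def found_def by (rule col_less)
 have f7: "fst ms7 rFull = full x" unfolding ms7_def by (rule keyof_correct[OF r6 pts x6 xN])
 have b9: "fst ms9 rBkt = F x" unfolding ms9_def F_def
  by (rule bucket_correct[OF r8 cts]) (use f7 full_bounds(2)[OF xN] in \<open>simp_all add: ms8_def\<close>)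
 have x9: "fst ms9 rX = x" "fst ms9 rFull = full x" using x6 f7 by (simp_all add: k7 k8 k9)
 have m9: "snd ms9 = snd ms"
  by (simp add: ms9_def ms8_def ms7_def ms6_def ms5_def ms4_def ms3_def ms2_def ms1_def)
 have addr: "alu b Plus (fst ms9 rMB) x = MB + x"
  using MB_b[of x] xN N_FB FB8 unfolding ready_MB[OF r9] by (intro alu_Plus) linarith
 let ?c = "(Rg rBkt [=] Rg 93) [*] ((Rg rFull [div] Rg 91) [=] Rg 90) [*] (Cn 1 [-] (Rg 95 [=] Rg 94))"
 let ?u = "upd 95 (snd ms (MB + x)) ms9"
 have r90: "fst ms9 93 = u" "fst ms9 91 = fst ms 91" "fst ms9 90 = fst ms 90" "fst ms9 94 = fst ms 94" "fst ms9 92 = fst ms 92"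
  using reg by (simp_all add: keep)
 have of1: "alu b Times (of_bool P) (of_bool Q) = of_bool (P \<and> Q)" for P Q
  using less_b[of 1] by (cases P; cases Q) (simp_all add: alu_Times)
 have of2: "alu b Minus (take_bit b 1) (of_bool P) = of_bool (\<not> P)" for P
  using less_b[of 1] by (cases P) (simp_all add: alu_Minus)
 have u: "fst ?u rBkt = F x" "fst ?u 93 = u" "fst ?u rFull = full x" "fst ?u 91 = fst ms 91" "fst ?u 90 = fst ms 90"
  "fst ?u 95 = snd ms (MB + x)" "fst ?u 94 = fst ms 94"
  by (simp_all add: b9 r90 x9)
 have cond: "eval b ?c (fst ?u) = of_bool hit"
  by (simp only: eval.simps u alu_bool alu.simps(4) of1 of2 hit_def conj_assoc)
 have "ms' = sem b (Cond ?c (St (Rg rMB [+] Rg rX) (Rg 94) ;; Set 92 (Rg 92 [+] Cn 1)) Skip)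
   (sem b (Ld 95 (Rg rMB [+] Rg rX)) ms9)"
  unfolding ms'_def probe_com_def ms9_def ms8_def ms7_def ms6_def ms5_def ms4_def ms3_def ms2_def ms1_def sem.simps(5) ..
 also have "sem b (Ld 95 (Rg rMB [+] Rg rX)) ms9 = ?u" by (simp add: addr x9 m9)
 finally have out: "ms' = sem b (Cond ?c (St (Rg rMB [+] Rg rX) (Rg 94) ;; Set 92 (Rg 92 [+] Cn 1)) Skip) ?u" .
 have out': "ms' = (if hit then upd 92 (fst ms 92 + 1) (updm (MB + x) (fst ms 94) ?u) else ?u)"
  unfolding out sem.simps(6) cond using small by (simp add: r90 x9 addr alu_Plus)
 show "snd ms' = (if hit then (snd ms)(MB + x := fst ms 94) else snd ms)"
  "fst ms' 92 = fst ms 92 + of_bool hit"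
  unfolding out' by (simp_all add: m9 r90)
 show "ready ms' f D V"
  by (rule ready_mem[OF r9]) (auto simp: out')
qed

text \<open>Makes a stamp fresh after incrementing: no item carries it yet.\<close>

definition marks :: "st => bool" where
 "marks ms \<longleftrightarrow> (\<forall>x<N. snd ms (MB + x) \<le> fst ms 94)"

lemma count_correct:
 assumes r: "ready ms f D V" and mk: "marks ms" and st: "fst ms 94 + 1 < 2 ^ b"
  and v: "fst ms 90 = v" "v \<noteq> 0" "v < 2 ^ FB" and dv: "fst ms 91 = 2 ^ i"
  and cnt: "cnt v = card {x. x < N \<and> full x div 2 ^ i = v}"
 defines "ms' \<equiv> sem b count_com ms"
 shows "fst ms' 92 = cnt v" "ready ms' f D V" "marks ms'" "fst ms' 94 \<le> fst ms 94 + 1"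
proof -
 define ms1 where "ms1 = sem b (fetch (Cn 8 [*] Rg 90 [+] Cn 4) 92) ms"
 have key: "8 * v + 4 < 2 ^ K" using v FB8 by linarith
 have "8 * v + 4 < 2 ^ b" using key by (intro less_b) simp
 hence ev: "eval b (Cn 8 [*] Rg 90 [+] Cn 4) (fst ms) = 8 * v + 4" using v by (simp add: alu_Times alu_Plus)
 have c1: "fst ms1 92 = (if internal v then cnt v else 0)"
  unfolding ms1_def using fetch_correct[OF r ev key] cts v by (simp add: counts_in_def)
 have r1: "ready ms1 f D V" unfolding ms1_def using r by (rule ready_frame) auto
 have m1: "snd ms1 = snd ms" by (simp add: ms1_def)
 have k1: "fst ms1 z = fst ms z" if "z \<in> {90, 91, 93, 94}" for z
  unfolding ms1_def using that by (intro sem_frame) auto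
 let ?E = "Set rV (Rg 90) ;; bucket_com ;; Set 93 (Rg rBkt) ;; Set 94 (Rg 94 [+] Cn 1) ;; Set 92 (Cn 0) ;;
   For rHt rNt (For rI rS probe_com)"
 have out: "ms' = (if internal v then ms1 else sem b ?E ms1)"
  using c1 unfolding ms'_def count_com_def ms1_def by (auto simp: internal_def)
 have "fst ms' 92 = cnt v \<and> ready ms' f D V \<and> marks ms' \<and> fst ms' 94 \<le> fst ms 94 + 1"
 proof (cases "internal v")
  case True
  thus ?thesis unfolding out using c1 r1 mk m1 k1[of 94] by (simp add: marks_def)
 next
  case False
  define u where "u = bucket_of v"
  define st' where "st' = fst ms 94 + 1"
  define G where "G = {x. x < N \<and> F x = u \<and> full x div 2 ^ i = v}"
  \<comment> \<open>A node without a stored count lies within one bucket, so the test for the bucket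
    excludes none of its items.\<close>
  have G: "G = {x. x < N \<and> full x div 2 ^ i = v}"
   unfolding G_def u_def using bucket_of_prefix v(2) False by auto
  define ms2 where "ms2 = sem b bucket_com (upd rV v ms1)"
  have r2: "ready ms2 f D V"
   unfolding ms2_def by (rule ready_frame) (use r1 in \<open>auto simp: ready_upd\<close>)
  have u2: "fst ms2 rBkt = u"
   unfolding ms2_def u_def by (rule bucket_correct[OF _ cts _ v(3)]) (use r1 in \<open>simp_all add: ready_upd\<close>)
  have k2: "fst ms2 z = fst ms z" if "z \<in> {90, 91, 94}" for z
   using k1[of z] that unfolding ms2_def by auto
  define ms3 where "ms3 = upd 92 0 (upd 94 st' (upd 93 u ms2))"
  have r3: "ready ms3 f D V" using r2 by (simp add: ms3_def ready_upd)
  have m3: "snd ms3 = snd ms" using m1 by (simp add: ms3_def ms2_def)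
  have E: "sem b ?E ms1 = sem b (For rHt rNt (For rI rS probe_com)) ms3"
   using st v by (simp add: ms3_def k1 k2 u2 ms2_def[symmetric] st'_def alu_Plus del: sem.simps(7))
  have uF: "u < 2 ^ FB"
  proof (cases "G = {}")
   case False
   then obtain x where "x < N" "F x = u" by (auto simp: G_def)
   thus ?thesis using F_less_FB by blast
  next
   \<comment> \<open>Without items below \<open>v\<close> no item bounds the bucket, but the scan
     returns only prefixes of \<open>v\<close> or its start value.\<close>
   case True
   have "bkt v j u0 \<le> max v u0" for j u0
   proof (induction j arbitrary: u0)
    case (Suc j)
    have "max v (v div 2 ^ j) = v" by (simp add: max_absorb1)
    thus ?case using Suc[of "v div 2 ^ j"] Suc[of u0] by (auto intro: max.coboundedI1)
   qed simp
   from this[of K 1] have "u \<le> max v 1" by (simp add: u_def bucket_of_def)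
   thus ?thesis using v by (simp add: max_def split: if_splits)
  qed
  define S where "S \<tau> = {x. x < N \<and> snd \<tau> (MB + x) = st'}" for \<tau> :: st
  define J where "J P \<tau> \<longleftrightarrow> ready \<tau> f D V \<and> fst \<tau> 90 = v \<and> fst \<tau> 91 = 2 ^ i \<and> fst \<tau> 93 = u \<and> fst \<tau> 94 = st' \<and>
    fst \<tau> 92 = card (S \<tau>) \<and> S \<tau> \<subseteq> G \<and> marks \<tau> \<and>
    (\<forall>(t, j)\<in>P. found V \<rho> u t j \<in> G --> found V \<rho> u t j \<in> S \<tau>)" for P and \<tau> :: st
  have finS: "finite (S \<tau>)" for \<tau> by (simp add: S_def)
  have cardS: "card (S \<tau>) \<le> N" for \<tau>
  proof -
   have "card (S \<tau>) \<le> card {..<N}" by (rule card_mono) (auto simp: S_def)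
   thus ?thesis by simp
  qed
  have step: "J (insert (t, j) P) (sem b probe_com \<tau>)"
   if J: "J P \<tau>" and t: "fst \<tau> rHt = t" "t < nt" and j: "fst \<tau> rI = j" "j < s" for P \<tau> t j
  proof -
   have r': "ready \<tau> f D V" and g: "fst \<tau> 90 = v" "fst \<tau> 91 = 2 ^ i" "fst \<tau> 93 = u" "fst \<tau> 94 = st'"
    "fst \<tau> 92 = card (S \<tau>)" "S \<tau> \<subseteq> G" "marks \<tau>"
    and old: "\<forall>(t, j)\<in>P. found V \<rho> u t j \<in> G --> found V \<rho> u t j \<in> S \<tau>"
    using J unfolding J_def by blast+
   have small: "fst \<tau> 92 + 1 < 2 ^ b"
    using cardS[of \<tau>] N_FB FB8 less_b[of "N + 1"] big_K unfolding g by fastforce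
   let ?x = "found V \<rho> u t j"
   let ?hit = "F ?x = u \<and> full ?x div fst \<tau> 91 = fst \<tau> 90 \<and> snd \<tau> (MB + ?x) \<noteq> fst \<tau> 94"
   note p = probe_correct[OF r' g(3) uF t j small]
   have hit: "?hit \<longleftrightarrow> ?x \<in> G \<and> ?x \<notin> S \<tau>" using p(1) by (auto simp: G_def S_def g)
   let ?\<tau> = "sem b probe_com \<tau>"
   have reg: "fst ?\<tau> 90 = v" "fst ?\<tau> 91 = 2 ^ i" "fst ?\<tau> 93 = u" "fst ?\<tau> 94 = st'" using g by simp_all
   have S': "S ?\<tau> = (if ?hit then insert ?x (S \<tau>) else S \<tau>)"
    unfolding S_def p(2) using p(1) g(4) by auto
   have mk': "marks ?\<tau>" unfolding marks_def p(2) reg using g(7) g(4) by (auto simp: marks_def)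
   have "fst ?\<tau> 92 = card (S ?\<tau>)"
    unfolding p(3) S' g(5) using hit finS[of \<tau>] by auto
   moreover have "S ?\<tau> \<subseteq> G" unfolding S' using g(6) hit by auto
   moreover have "S \<tau> \<subseteq> S ?\<tau>" unfolding S' by auto
   moreover have "?x \<in> G ==> ?x \<in> S ?\<tau>" unfolding S' using hit by auto
   ultimately show ?thesis unfolding J_def using p(4) reg mk' old by blast
  qed
  have "J ({..<nt} \<times> {..<s}) (sem b (For rHt rNt (For rI rS probe_com)) ms3)"
  proof (rule sem_For_For)
   have "S ms3 = {}" using mk unfolding S_def m3 marks_def st'_def by fastforce
   moreover have "marks ms3" using mk unfolding marks_def m3 by (auto simp: ms3_def st'_def intro: le_SucI)
   ultimately show "J {} ms3" using r3 dv v unfolding J_def by (simp add: ms3_def k2)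
   show "fst \<tau> rNt = nt \<and> fst \<tau> rS = s" if "J P \<tau>" for P \<tau> using that by (simp add: J_def ready_def pars_def)
   show "J P (upd z y \<tau>)" if "J P \<tau>" "z \<in> {rHt, rI}" for P \<tau> z y
    using that unfolding J_def S_def marks_def by (auto simp: ready_upd)
  qed (use step in simp_all)
  hence fin: "J ({..<nt} \<times> {..<s}) ms'" unfolding out E using False by simp
  \<comment> \<open>Coverage enters here: each item of the bucket is found by some table and column,
    and was stamped then at the latest.\<close>
  have "G \<subseteq> S ms'"
  proof
   fix x assume x: "x \<in> G"
   hence "x < N" "F x = u" by (auto simp: G_def)
   then obtain t j where "t < nt" "j < s" "found V \<rho> u t j = x" using found_all[OF cov ends] by blast
   thus "x \<in> S ms'" using fin x unfolding J_def by blast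
  qed
  hence "fst ms' 92 = card G" using fin unfolding J_def by (metis subset_antisym)
  thus ?thesis using fin unfolding J_def G cnt st'_def by simp
 qed
 thus "fst ms' 92 = cnt v" "ready ms' f D V" "marks ms'" "fst ms' 94 \<le> fst ms 94 + 1" by auto
qed

end

lemma seq_step: "sem b (c ;; d) s = sem b d (sem b c s)" by simp

lemma cond_step: "sem b (c ;; Cond x d1 d2) s =
 (if eval b x (fst (sem b c s)) = 0 then sem b d2 (sem b c s) else sem b d1 (sem b c s))"
 by simp

context query_data begin

definition setting :: "(nat => nat => nat) => nat => nat => st => bool" where
 "setting X len \<pi> \<tau> \<longleftrightarrow> ready \<tau> f D V \<and> marks \<tau> \<and>
  (\<forall>c<6. fst \<tau> (100 + c) = X c 1 \<and> fst \<tau> (110 + c) = X c 0) \<and>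
  fst \<tau> 171 = \<pi> \<and> fst \<tau> 172 = 2 ^ len \<and> fst \<tau> 91 = 2 ^ (KB - len) * L ^ 6 \<and> fst \<tau> 170 < 2 ^ b"

definition static :: "nat set" where
 "static = {20..39} \<union> {91, 94, 170, 171, 172} \<union> {100..105} \<union> {110..115}"

lemma setting_cong:
 assumes "\<And>z. z \<in> static ==> fst \<tau>' z = fst \<tau> z" "snd \<tau>' = snd \<tau>"
 shows "setting X len \<pi> \<tau>' = setting X len \<pi> \<tau>"
proof -
 have "ready \<tau>' f D V = ready \<tau> f D V" using assms by (intro ready_cong) (auto simp: static_def)
 moreover have "fst \<tau>' (100 + c) = fst \<tau> (100 + c)" "fst \<tau>' (110 + c) = fst \<tau> (110 + c)" if "c < 6" for c
  using that by (auto intro!: assms(1) simp: static_def)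
 moreover have "fst \<tau>' 171 = fst \<tau> 171" "fst \<tau>' 172 = fst \<tau> 172" "fst \<tau>' 91 = fst \<tau> 91"
  "fst \<tau>' 170 = fst \<tau> 170" "fst \<tau>' 94 = fst \<tau> 94"
  by (auto intro!: assms(1) simp: static_def)
 ultimately show ?thesis using assms(2) by (auto simp: setting_def marks_def)
qed

lemma settingD:
 assumes "setting X len \<pi> \<tau>"
 shows "ready \<tau> f D V" "marks \<tau>" "\<And>c. c < 6 ==> fst \<tau> (100 + c) = X c 1" "\<And>c. c < 6 ==> fst \<tau> (110 + c) = X c 0"
  "fst \<tau> 171 = \<pi>" "fst \<tau> 172 = 2 ^ len" "fst \<tau> 91 = 2 ^ (KB - len) * L ^ 6" "fst \<tau> 170 < 2 ^ b"
 using assms by (auto simp: setting_def)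

lemma mod_add_cong: "(x + a) mod m = (y + a) mod m" if "x mod m = y mod m" for x y a m :: int
 using that by (rule mod_add_cong) simp

lemma leaf_correct:
 assumes set: "setting X len \<pi> \<tau>" and len: "len \<le> KB" "\<pi> < 2 ^ len"
  and T: "fst \<tau> 146 = T" "2 ^ (6 * (W + 1)) \<le> T" "T < 2 ^ (6 * (W + 1) + 1)" and sg: "fst \<tau> 156 = sg"
  and st: "fst \<tau> 94 + 1 \<le> 2 ^ K"
 defines "\<tau>' \<equiv> sem b leaf_com \<tau>"
 shows "setting X len \<pi> \<tau>' \<and> fst \<tau>' 94 \<le> fst \<tau> 94 + 1 \<and>
  int (fst \<tau>' 170) mod 2 ^ b = (int (fst \<tau> 170) + nsum X len \<pi> 0 T sg) mod 2 ^ b"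
proof -
 note S = settingD[OF set]
 define v where "v = T * 2 ^ len + \<pi>"
 \<comment> \<open>The number of bits of \<open>v\<close> behind its leading 1: six nodes and the
   prefix of \<open>kap\<close>.\<close>
 define i where "i = 6 * (W + 1) + len"
 have lo: "2 ^ i \<le> v"
 proof -
  have "2 ^ (6 * (W + 1)) * 2 ^ len \<le> T * 2 ^ len" using T(2) by (rule mult_le_mono1)
  thus ?thesis unfolding v_def i_def power_add by linarith
 qed
 have hi: "v < 2 ^ Suc i"
 proof -
  have "v < 2 ^ (6 * (W + 1) + 1) * 2 ^ len" unfolding v_def by (rule digits_less[OF T(3) len(2)])
  also have "\<dots> = 2 ^ Suc i" by (simp only: i_def power_add[symmetric]) (rule arg_cong, simp)
  finally show ?thesis .
 qed
 have iFB: "i < FB" using len(1) by (simp add: i_def FB_def KB_def q_def)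
 have vFB: "v < 2 ^ FB"
 proof -
  note hi
  also have "(2::nat) ^ Suc i \<le> 2 ^ FB" using iFB by (intro power_increasing) auto
  finally show ?thesis .
 qed
 have "0 < (2::nat) ^ i" by simp
 hence v0: "v \<noteq> 0" using lo by linarith
 have L6: "L ^ 6 = 2 ^ (6 * lw)" by (simp add: L_eq power_mult[symmetric] mult.commute)
 \<comment> \<open>The shift prescribed by \<open>cnt_shift\<close>; \<open>2 ^ j\<close> turns out
   to be the divisor prepared in register 91.\<close>
 define j where "j = FB - 1 - i"
 have j: "j = KB - len + 6 * lw" using len(1) by (simp add: j_def i_def FB_def KB_def q_def)
 have dv: "2 ^ (KB - len) * L ^ 6 = 2 ^ j" by (simp add: j L6 power_add)
 have cnt: "cnt v = card {x. x < N \<and> full x div 2 ^ j = v}"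
  unfolding j_def by (rule cnt_shift[OF v0 lo hi iFB])
 have v_b: "v < 2 ^ b" using vFB FB_less_b by linarith
 define \<tau>1 where "\<tau>1 = upd 90 v \<tau>"
 have e1: "sem b (Set 90 (Rg 146 [*] Rg 172 [+] Rg 171)) \<tau> = \<tau>1"
 proof -
  have "T * 2 ^ len < 2 ^ b" using v_b unfolding v_def by (rule add_lessD1)
  thus ?thesis using v_b by (simp add: \<tau>1_def v_def T(1) S(5,6) alu_Times alu_Plus)
 qed
 have r1: "ready \<tau>1 f D V" using S(1) by (simp add: \<tau>1_def ready_upd)
 have m1: "marks \<tau>1" using S(2) by (simp add: marks_def \<tau>1_def)
 have st1: "fst \<tau>1 94 + 1 < 2 ^ b" using st by (intro less_b) (simp add: \<tau>1_def)
 define \<tau>2 where "\<tau>2 = sem b count_com \<tau>1"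
 have c2: "fst \<tau>2 92 = cnt v" "ready \<tau>2 f D V" "marks \<tau>2" "fst \<tau>2 94 \<le> fst \<tau>1 94 + 1"
  unfolding \<tau>2_def
  by (rule count_correct[OF r1 m1 st1 _ v0 vFB _ cnt]; simp add: \<tau>1_def S(7) dv)+
 have k2: "fst \<tau>2 z = fst \<tau> z" if "z \<in> static - {94} \<union> {156}" for z
 proof -
  have "fst \<tau>2 z = fst \<tau>1 z" unfolding \<tau>2_def using that by (intro sem_frame) (auto simp: static_def)
  also have "\<dots> = fst \<tau> z" using that by (auto simp: \<tau>1_def static_def)
  finally show ?thesis .
 qed
 have cb: "cnt v \<le> 2 ^ b"
 proof -
  have "cnt v \<le> card {..<N}" unfolding cnt by (rule card_mono) auto
  thus ?thesis using N_less_b by simp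
 qed
 define y where "y = (if odd sg then alu b Minus (fst \<tau> 170) (cnt v) else alu b Plus (fst \<tau> 170) (cnt v))"
 have "fst \<tau>2 156 = sg" "fst \<tau>2 170 = fst \<tau> 170" using k2[of 156] k2[of 170] sg by (simp_all add: static_def)
 hence out: "\<tau>' = upd 170 y \<tau>2"
  unfolding \<tau>'_def leaf_com_def sem.simps(5) e1 \<tau>2_def[symmetric]
  by (simp add: c2(1) y_def odd_iff_mod_2_eq_one)
 have k3: "fst \<tau>' z = fst \<tau> z" if "z \<in> static - {94, 170}" for z
  using k2[of z] that by (simp add: out)
 have "ready \<tau>' f D V" using c2(2) by (simp add: out ready_upd)
 moreover have "marks \<tau>'" using c2(3) by (simp add: out marks_def)
 moreover have "fst \<tau>' 170 < 2 ^ b" by (simp add: out y_def alu_less)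
 moreover have "fst \<tau>' (100 + c) = X c 1" "fst \<tau>' (110 + c) = X c 0" if "c < 6" for c
  using k3[of "100 + c"] k3[of "110 + c"] that S(3,4) by (auto simp: static_def)
 moreover have "fst \<tau>' 171 = \<pi>" "fst \<tau>' 172 = 2 ^ len" "fst \<tau>' 91 = 2 ^ (KB - len) * L ^ 6"
  using k3[of 171] k3[of 172] k3[of 91] S by (simp_all add: static_def)
 ultimately have 1: "setting X len \<pi> \<tau>'" by (simp add: setting_def)
 have "nsum X len \<pi> 0 T sg = (-1) ^ sg * int (cnt v)"
  unfolding nsum.simps dv v_def[symmetric] cnt[symmetric] by simp
 hence "int y mod 2 ^ b = (int (fst \<tau> 170) + nsum X len \<pi> 0 T sg) mod 2 ^ b"
  using cb by (simp add: y_def alu_Minus_int alu_Plus_int)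
 moreover have "fst \<tau>' 170 = y" "fst \<tau>' 94 \<le> fst \<tau> 94 + 1" using c2(4) by (simp_all add: out \<tau>1_def)
 ultimately show ?thesis using 1 by simp
qed

text \<open>\<open>M\<close> bounds the stamps consumed by one run of \<open>B\<close>, which is run
  at most \<open>2 * W\<close> times. The total has to stay below the word size for marks to be
  meaningful.\<close>

lemma level_correct:
 assumes X: "\<And>c g. X c g < 2 ^ W" and c: "c < 6" and k: "k = 5 - c"
  and wrB: "wr B \<subseteq> nest_regs (Suc c)"
  and B: "\<And>\<tau> T sg. setting X len \<pi> \<tau> ==> fst \<tau> (140 + Suc c) = T ==> 2 ^ (Suc c * (W + 1)) \<le> T ==>
    T < 2 ^ (Suc c * (W + 1) + 1) ==> fst \<tau> (150 + Suc c) = sg ==> sg \<le> Suc c ==> fst \<tau> 94 + M \<le> 2 ^ K ==>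
    setting X len \<pi> (sem b B \<tau>) \<and> fst (sem b B \<tau>) 94 \<le> fst \<tau> 94 + M \<and>
    int (fst (sem b B \<tau>) 170) mod 2 ^ b = (int (fst \<tau> 170) + nsum X len \<pi> k T sg) mod 2 ^ b"
  and set: "setting X len \<pi> \<tau>" and T: "fst \<tau> (140 + c) = T" "2 ^ (c * (W + 1)) \<le> T" "T < 2 ^ (c * (W + 1) + 1)"
  and sg: "fst \<tau> (150 + c) = sg" "sg \<le> c" and st: "fst \<tau> 94 + W * (2 * M) \<le> 2 ^ K"
 defines "\<tau>' \<equiv> sem b (level_com c B) \<tau>"
 shows "setting X len \<pi> \<tau>' \<and> fst \<tau>' 94 \<le> fst \<tau> 94 + W * (2 * M) \<and>
  int (fst \<tau>' 170) mod 2 ^ b = (int (fst \<tau> 170) + nsum X len \<pi> (Suc k) T sg) mod 2 ^ b"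
proof -
 let ?pre = "Cond (Rg (130 + c)) (Set (160 + c) (Rg (100 + c))) (Set (160 + c) (Rg (110 + c)))"
 let ?mid = "Set (141 + c) (Rg (140 + c) [*] (Cn 2 [*] Rg rPW) [+]
      (((Rg rPW [+] Rg (160 + c)) [>>] Rg (120 + c)) [-] Cn 1)) ;;
     Set (151 + c) (Rg (150 + c) [+] Rg (130 + c)) ;; B"
 let ?body = "?pre ;; Cond ((Rg (160 + c) [>>] Rg (120 + c)) [mod] Cn 2) ?mid Skip"
 let ?inner = "For (130 + c) rTwo ?body"
 define tm where "tm i g = (if odd (X c g div 2 ^ i) then nsum X len \<pi> k (T * 2 ^ (W + 1) + node (X c g) i) (sg + g) else 0)" for i g
 \<comment> \<open>\<open>a\<close> is the number of pairs of a level and a bound dealt with so far,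
   and \<open>s0\<close> the part of the signed sum due to them.\<close>
 define J where "J a s0 \<tau>1 \<longleftrightarrow> setting X len \<pi> \<tau>1 \<and> fst \<tau>1 (140 + c) = T \<and> fst \<tau>1 (150 + c) = sg \<and>
   fst \<tau>1 94 \<le> fst \<tau> 94 + a * M \<and> int (fst \<tau>1 170) mod 2 ^ b = (int (fst \<tau> 170) + s0) mod 2 ^ b"
  for a s0 \<tau>1
 have stat: "z \<noteq> 120 + c \<and> z \<noteq> 130 + c \<and> z \<noteq> 160 + c \<and> z \<noteq> 141 + c \<and> z \<noteq> 151 + c \<and> z \<noteq> 140 + c" if "z \<in> static" for z
  using that c by (auto simp: static_def)
 have J_upd: "J a s0 (upd z y \<tau>1)" if "J a s0 \<tau>1" "z = 120 + c \<or> z = 130 + c" for a s0 z y \<tau>1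
 proof -
  have "setting X len \<pi> (upd z y \<tau>1)"
   using that stat by (subst setting_cong[of _ \<tau>1]) (auto simp: J_def)
  moreover have "z \<noteq> 94" "z \<noteq> 170" using that(2) c by auto
  ultimately show ?thesis using that c by (auto simp: J_def)
 qed
 have body: "J (Suc a) (s0 + tm i g) (sem b ?body \<tau>1) \<and> fst (sem b ?body \<tau>1) (120 + c) = i"
  if J: "J a s0 \<tau>1" and g: "fst \<tau>1 (130 + c) = g" "g < 2" and i: "fst \<tau>1 (120 + c) = i" "i < W" and a: "Suc a \<le> W * 2"
  for a s0 g i \<tau>1
 proof -
  have set1: "setting X len \<pi> \<tau>1" and T1: "fst \<tau>1 (140 + c) = T" and sg1: "fst \<tau>1 (150 + c) = sg"
   and st1: "fst \<tau>1 94 \<le> fst \<tau> 94 + a * M" and v1: "int (fst \<tau>1 170) mod 2 ^ b = (int (fst \<tau> 170) + s0) mod 2 ^ b"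
   using J unfolding J_def by blast+
  note S1 = settingD[OF set1]
  define x where "x = X c g"
  have xW: "x < 2 ^ W" unfolding x_def by (rule X)
  have pre: "sem b ?pre \<tau>1 = upd (160 + c) x \<tau>1"
   using g S1(3)[OF c] S1(4)[OF c] by (auto simp: x_def less_2_cases_iff)
  let ?\<tau>2 = "upd (160 + c) x \<tau>1"
  have set2: "setting X len \<pi> ?\<tau>2" using set1 stat by (subst setting_cong[of _ \<tau>1]) auto
  have cond: "eval b ((Rg (160 + c) [>>] Rg (120 + c)) [mod] Cn 2) (fst ?\<tau>2) = x div 2 ^ i mod 2"
   using i by (simp add: alu_ShiftR)
  have neq: "(94::nat) \<noteq> 160 + c" "(170::nat) \<noteq> 160 + c" using c by auto
  show ?thesis
  proof (cases "odd (x div 2 ^ i)")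
   case False
   hence z: "x div 2 ^ i mod 2 = 0" by (simp add: even_iff_mod_2_eq_zero)
   have "sem b ?body \<tau>1 = ?\<tau>2"
    unfolding cond_step pre cond z by simp
   moreover have "tm i g = 0" using False by (simp add: tm_def x_def)
   moreover have "fst \<tau>1 94 \<le> fst \<tau> 94 + Suc a * M" using st1 by simp
   ultimately show ?thesis using set2 T1 sg1 v1 i neq unfolding J_def by simp
  next
   case True
   define T' where "T' = T * 2 ^ (W + 1) + node x i"
   have nl: "node x i < 2 ^ (W + 1)" by (rule node_less[OF xW])
   have T'hi: "T' < 2 ^ (Suc c * (W + 1) + 1)"
   proof -
    have "T' < 2 ^ (c * (W + 1) + 1) * 2 ^ (W + 1)" unfolding T'_def by (rule digits_less[OF T(3) nl])
    also have "\<dots> = 2 ^ (Suc c * (W + 1) + 1)" by (simp only: power_add[symmetric]) (rule arg_cong, simp)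
    finally show ?thesis .
   qed
   have T'lo: "2 ^ (Suc c * (W + 1)) \<le> T'"
   proof -
    have "2 ^ (c * (W + 1)) * 2 ^ (W + 1) \<le> T * 2 ^ (W + 1)" using T(2) by (rule mult_le_mono1)
    thus ?thesis unfolding T'_def mult_Suc power_add[of 2 "W + 1"] by (simp only: mult.commute)
   qed
   have T'b: "T' < 2 ^ b"
   proof -
    have "Suc c * (W + 1) \<le> 6 * (W + 1)" using c by (intro mult_le_mono1) simp
    hence "Suc c * (W + 1) + 1 \<le> FB" unfolding FB_def by linarith
    hence "(2::nat) ^ (Suc c * (W + 1) + 1) \<le> 2 ^ FB" by (intro power_increasing) auto
    thus ?thesis using T'hi FB_less_b by linarith
   qed
   have Wb: "2 ^ (W + 1) < (2::nat) ^ b"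
   proof -
    have "(2::nat) ^ (W + 1) \<le> 2 ^ FB" by (intro power_increasing) (auto simp: FB_def)
    thus ?thesis using FB_less_b by linarith
   qed
   have nd: "(2 ^ W + x) div 2 ^ i \<ge> 1"
   proof -
    have "(2::nat) ^ i \<le> 2 ^ W" using i(2) by (intro power_increasing) auto
    hence "(2::nat) ^ i \<le> 2 ^ W + x" by linarith
    hence "2 ^ i div 2 ^ i \<le> (2 ^ W + x) div 2 ^ i" by (rule div_le_mono)
    thus ?thesis by simp
   qed
   have PW: "fst \<tau>1 rPW = 2 ^ W" using S1(1) by (simp add: ready_def pars_def)
   have e1: "alu b Times 2 (2 ^ W) = 2 ^ (W + 1)" using Wb by (simp add: alu_Times)
   have e2: "alu b Plus (2 ^ W) x = 2 ^ W + x" using Wb xW by (intro alu_Plus) simp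
   have e3: "alu b Minus ((2 ^ W + x) div 2 ^ i) 1 = node x i"
   proof -
    have "(2 ^ W + x) div 2 ^ i \<le> 2 ^ W + x" by simp
    also have "\<dots> < 2 ^ b" using Wb xW by simp
    finally show ?thesis unfolding node_def using nd by (intro alu_Minus) auto
   qed
   have e4: "alu b Times T (2 ^ (W + 1)) = T * 2 ^ (W + 1)"
    using T'b unfolding T'_def by (intro alu_Times) (rule add_lessD1)
   have e5: "alu b Plus (T * 2 ^ (W + 1)) (node x i) = T'" using T'b unfolding T'_def by (rule alu_Plus)
   have e6: "alu b Plus sg g = sg + g" using sg(2) c g(2) less_b[of "sg + g"] big_K by (intro alu_Plus) simp
   have c1: "take_bit b (1::nat) = 1" "take_bit b (2::nat) = 2" by simp_all
   let ?\<tau>3 = "upd (151 + c) (sg + g) (upd (141 + c) T' ?\<tau>2)"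
   have z: "x div 2 ^ i mod 2 = 1" using True by (simp add: odd_iff_mod_2_eq_one)
   have "sem b ?body \<tau>1 = sem b ?mid ?\<tau>2"
    unfolding cond_step pre cond z by (simp del: sem.simps)
   also have "sem b (Set (141 + c) (Rg (140 + c) [*] (Cn 2 [*] Rg rPW) [+]
      (((Rg rPW [+] Rg (160 + c)) [>>] Rg (120 + c)) [-] Cn 1))) ?\<tau>2 = upd (141 + c) T' ?\<tau>2"
   proof -
    have "fst ?\<tau>2 rPW = 2 ^ W" "fst ?\<tau>2 (140 + c) = T" "fst ?\<tau>2 (120 + c) = i" "fst ?\<tau>2 (160 + c) = x"
     using PW T1 i c by auto
    thus ?thesis unfolding sem.simps(2) eval.simps
     by (simp only: c1 e1 e2 alu_ShiftR e3 e4 e5)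
   qed
   hence "sem b ?mid ?\<tau>2 = sem b B (sem b (Set (151 + c) (Rg (150 + c) [+] Rg (130 + c))) (upd (141 + c) T' ?\<tau>2))"
    by (simp only: sem.simps(5))
   also have "sem b (Set (151 + c) (Rg (150 + c) [+] Rg (130 + c))) (upd (141 + c) T' ?\<tau>2) = ?\<tau>3"
   proof -
    have "fst (upd (141 + c) T' ?\<tau>2) (150 + c) = sg" "fst (upd (141 + c) T' ?\<tau>2) (130 + c) = g"
     using sg1 g c by auto
    thus ?thesis unfolding sem.simps(2) eval.simps by (simp only: e6)
   qed
   finally have out: "sem b ?body \<tau>1 = sem b B ?\<tau>3" .
   have set3: "setting X len \<pi> ?\<tau>3" using set2 stat by (subst setting_cong[of _ ?\<tau>2]) auto
   have n3: "(94::nat) \<noteq> 151 + c" "(94::nat) \<noteq> 141 + c" "(170::nat) \<noteq> 151 + c" "(170::nat) \<noteq> 141 + c"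
    using c by auto
   have r3: "fst ?\<tau>3 (140 + Suc c) = T'" "fst ?\<tau>3 (150 + Suc c) = sg + g" "fst ?\<tau>3 94 = fst \<tau>1 94" "fst ?\<tau>3 170 = fst \<tau>1 170"
    using n3 neq by simp_all
   have aM: "fst \<tau>1 94 + M \<le> 2 ^ K"
   proof -
    have "Suc a * M \<le> W * 2 * M" using a by (rule mult_le_mono1)
    thus ?thesis using st1 st by (simp add: mult.assoc)
   qed
   have IH: "setting X len \<pi> (sem b B ?\<tau>3) \<and> fst (sem b B ?\<tau>3) 94 \<le> fst ?\<tau>3 94 + M \<and>
    int (fst (sem b B ?\<tau>3) 170) mod 2 ^ b = (int (fst ?\<tau>3 170) + nsum X len \<pi> k T' (sg + g)) mod 2 ^ b"
    by (rule B[OF set3 r3(1) T'lo T'hi r3(2)]) (use sg(2) g(2) aM r3 in simp_all)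
   have fr: "z \<notin> wr B" if "z = 120 + c \<or> z = 140 + c \<or> z = 150 + c" for z
    using wrB that c by (auto simp: nest_regs_def)
   have keep: "fst (sem b B ?\<tau>3) (140 + c) = T" "fst (sem b B ?\<tau>3) (150 + c) = sg" "fst (sem b B ?\<tau>3) (120 + c) = i"
    using fr T1 sg1 i c by auto
   have "int (fst (sem b B ?\<tau>3) 170) mod 2 ^ b = (int (fst \<tau> 170) + (s0 + tm i g)) mod 2 ^ b"
   proof -
    have "tm i g = nsum X len \<pi> k T' (sg + g)" using True by (simp add: tm_def x_def T'_def)
    moreover have "(int (fst \<tau>1 170) + nsum X len \<pi> k T' (sg + g)) mod 2 ^ b =
      (int (fst \<tau> 170) + s0 + nsum X len \<pi> k T' (sg + g)) mod 2 ^ b"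
     by (rule mod_add_cong[OF v1])
    ultimately show ?thesis using IH r3(4) by (simp add: add.assoc)
   qed
   moreover have "fst (sem b B ?\<tau>3) 94 \<le> fst \<tau> 94 + Suc a * M" using IH r3(3) st1 by simp
   ultimately show ?thesis unfolding out J_def using IH keep by simp
  qed
 qed
 have J0: "J 0 0 \<tau>" using set T sg by (simp add: J_def)
 let ?JP = "\<lambda>P. J (card P) (\<Sum>(i, g)\<in>P. tm i g)"
 have "?JP ({..<W} \<times> {..<2}) (sem b (For (120 + c) rW ?inner) \<tau>)"
 proof (rule sem_For_For)
  show "?JP {} \<tau>" using J0 by simp
  show "fst \<tau>1 rW = W \<and> fst \<tau>1 rTwo = 2" if "?JP P \<tau>1" for P \<tau>1
  proof -
   have "ready \<tau>1 f D V" using that settingD(1) unfolding J_def by blast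
   thus ?thesis by (simp add: ready_def pars_def)
  qed
  show "?JP P (upd z y \<tau>1)" if "?JP P \<tau>1" "z \<in> {120 + c, 130 + c}" for P \<tau>1 z y
   using that by (intro J_upd) auto
  show "120 + c \<notin> wr ?body" using wrB c by (auto simp: nest_regs_def)
  show "?JP (insert (i, g) P) (sem b ?body \<tau>1)"
   if P: "?JP P \<tau>1" "(i, g) \<notin> P" "P \<subseteq> {..<W} \<times> {..<2}" and r: "fst \<tau>1 (120 + c) = i" "fst \<tau>1 (130 + c) = g" "i < W" "g < 2"
   for P \<tau>1 i g
  proof -
   have fin: "finite P" by (rule finite_subset[OF P(3)]) simp
   have "card (insert (i, g) P) \<le> card ({..<W} \<times> {..<2::nat})" using P(3) r by (intro card_mono) auto
   hence "Suc (card P) \<le> W * 2" using fin P(2) by simp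
   from body[OF P(1) r(2,4,1,3) this] show ?thesis using fin P(2) by (simp add: add.commute del: sem.simps)
  qed
 qed (use c in simp)
 hence "J (W * 2) (\<Sum>i<W. \<Sum>g<2. tm i g) (sem b (For (120 + c) rW ?inner) \<tau>)"
  by (simp add: sum.cartesian_product)
 moreover have "(\<Sum>i<W. \<Sum>g<2. tm i g) = nsum X len \<pi> (Suc k) T sg"
 proof -
  have "5 - k = c" using k c by simp
  thus ?thesis unfolding nsum.simps tm_def by (simp only:)
 qed
 ultimately show ?thesis
  unfolding \<tau>'_def level_com_def J_def by (simp add: algebra_simps)
qed

lemma nest_correct:
 assumes X: "\<And>c g. X c g < 2 ^ W" and len: "len \<le> KB" "\<pi> < 2 ^ len"
 shows "k \<le> 6 ==> setting X len \<pi> \<tau> ==> fst \<tau> (140 + (6 - k)) = T ==> 2 ^ ((6 - k) * (W + 1)) \<le> T ==>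
  T < 2 ^ ((6 - k) * (W + 1) + 1) ==> fst \<tau> (150 + (6 - k)) = sg ==> sg \<le> 6 - k ==> fst \<tau> 94 + (2 * W) ^ k \<le> 2 ^ K ==>
  setting X len \<pi> (sem b (nest_com k) \<tau>) \<and> fst (sem b (nest_com k) \<tau>) 94 \<le> fst \<tau> 94 + (2 * W) ^ k \<and>
  int (fst (sem b (nest_com k) \<tau>) 170) mod 2 ^ b = (int (fst \<tau> 170) + nsum X len \<pi> k T sg) mod 2 ^ b"
proof (induction k arbitrary: \<tau> T sg)
 case 0
 thus ?case using leaf_correct[OF 0(2) len, of T sg] by simp
next
 case (Suc k)
 define c where "c = 5 - k"
 have c: "c < 6" "k = 5 - c" "6 - Suc k = c" "6 - k = Suc c" using Suc.prems(1) by (auto simp: c_def)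
 have M: "W * (2 * (2 * W) ^ k) = (2 * W) ^ Suc k" by simp
 have wrB: "wr (nest_com k) \<subseteq> nest_regs (Suc c)" using wr_nest_com[of k] c(4) Suc.prems(1) by simp
 note prems = Suc.prems(2-)[unfolded c(3)]
 have com: "nest_com (Suc k) = level_com c (nest_com k)" by (simp add: c_def)
 show ?case unfolding com M[symmetric]
 proof (rule level_correct[OF X c(1,2) wrB])
  show "setting X len \<pi> (sem b (nest_com k) \<tau>) \<and> fst (sem b (nest_com k) \<tau>) 94 \<le> fst \<tau> 94 + (2 * W) ^ k \<and>
    int (fst (sem b (nest_com k) \<tau>) 170) mod 2 ^ b = (int (fst \<tau> 170) + nsum X len \<pi> k T sg) mod 2 ^ b"
   if "setting X len \<pi> \<tau>" "fst \<tau> (140 + Suc c) = T" "2 ^ (Suc c * (W + 1)) \<le> T" "T < 2 ^ (Suc c * (W + 1) + 1)"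
    "fst \<tau> (150 + Suc c) = sg" "sg \<le> Suc c" "fst \<tau> 94 + (2 * W) ^ k \<le> 2 ^ K" for \<tau> T sg
   using Suc.IH[unfolded c(4), of \<tau> T sg] Suc.prems(1) that by simp
 qed (use prems M in simp_all)
qed

end

text \<open>\<open>r\<close> are the registers of a query, four per box; even \<open>c\<close>
  belong to abscissas. The value 0 from 6 on makes the bound by \<open>2 ^ W\<close> hold for all
  \<open>c\<close>.\<close>

definition box_bounds :: "(nat => nat) => nat => nat => nat" where
 "box_bounds r c g = (if 6 \<le> c then 0
  else if g = 1 then r (4 * (c div 2) + c mod 2) + 1 else r (4 * (c div 2) + 2 + c mod 2) + 2)"

context layout
begin

definition in_box :: "(nat => nat => nat) => nat set" where
 "in_box X = {y. y < NP ^ 3 \<and> (\<forall>c<6. X c 1 \<le> cd y c \<and> cd y c < X c 0)}"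

lemma finite_in_box [simp]: "finite (in_box X)"
 by (rule finite_subset[of _ "{..<NP ^ 3}"]) (auto simp: in_box_def)

lemma kap_mod: "y < NP ^ 3 ==> kap y mod NP ^ 3 = y"
 by (simp add: kap_def)

lemma inj_on_kap: "inj_on kap (in_box X)"
 by (rule inj_on_inverseI[where g="\<lambda>a. a mod NP ^ 3"]) (simp add: kap_mod in_box_def)

lemma card_kap: "card {a \<in> kap ` in_box X. P a} = card {y \<in> in_box X. P (kap y)}"
proof -
 have e: "{a \<in> kap ` in_box X. P a} = kap ` {y \<in> in_box X. P (kap y)}" by auto
 show ?thesis unfolding e by (intro card_image inj_on_subset[OF inj_on_kap]) auto
qed

text \<open>A query has \<open>KB\<close> steps of at most \<open>(2 * W) ^ 6\<close> counts, each
  with at most one stamp.\<close>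

lemma stamps_le: "KB * (2 * W) ^ 6 \<le> 2 ^ K"
proof -
 have Zl: "Z + 1 \<le> 2 ^ Z" using less_exp[of Z] by linarith
 have "KB \<le> 4 * Z" using Z3 w1 by (simp add: KB_def AB_def Z_def)
 also have "\<dots> \<le> 4 * 2 ^ Z" using Zl by simp
 finally have 1: "KB \<le> 4 * 2 ^ Z" .
 have "2 * W \<le> 2 * 2 ^ Z" using Zl by (simp add: W_def Z_def)
 hence "(2 * W) ^ 6 \<le> (2 * 2 ^ Z) ^ 6" by (rule power_mono) simp
 with 1 have "KB * (2 * W) ^ 6 \<le> 4 * 2 ^ Z * (2 * 2 ^ Z) ^ 6" by (rule mult_le_mono)
 also have "\<dots> = 2 ^ (8 + 7 * Z)"
 proof -
  have "(2::nat) ^ (8 + 7 * Z) = 2 ^ 8 * (2 ^ Z) ^ 7" by (simp add: power_add power_mult[symmetric] mult.commute)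
  thus ?thesis by (simp add: power_mult_distrib power_numeral_reduce mult.assoc)
 qed
 also have "\<dots> \<le> 2 ^ K"
 proof (rule power_increasing)
  show "8 + 7 * Z \<le> K" using Z3 unfolding K_eq by linarith
 qed simp
 finally show ?thesis .
qed

end

context layout_base
begin

text \<open>Word \<open>r - 20\<close> of the structure keeps parameter register \<open>r\<close>,
  since a query inherits memory only.\<close>

definition header :: "(nat => nat) => bool" where
 "header M \<longleftrightarrow> pars (\<lambda>r. M (r - 20), M)"

lemma load_pars_regs: "fst (sem b load_pars ms) 20 = snd ms 0" "fst (sem b load_pars ms) 21 = snd ms (Suc 0)" "fst (sem b load_pars ms) 22 = snd ms 2" "fst (sem b load_pars ms) 23 = snd ms 3" "fst (sem b load_pars ms) 24 = snd ms 4" "fst (sem b load_pars ms) 25 = snd ms 5" "fst (sem b load_pars ms) 26 = snd ms 6" "fst (sem b load_pars ms) 27 = snd ms 7" "fst (sem b load_pars ms) 28 = snd ms 8" "fst (sem b load_pars ms) 29 = snd ms 9" "fst (sem b load_pars ms) 30 = snd ms 10" "fst (sem b load_pars ms) 31 = snd ms 11" "fst (sem b load_pars ms) 32 = snd ms 12" "fst (sem b load_pars ms) 33 = snd ms 13"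
proof -
 have c20: "take_bit b c = c" if "c < 20" for c :: nat using that small[of c] by (simp add: take_bit_nat_eq_self)
 show "fst (sem b load_pars ms) 20 = snd ms 0" "fst (sem b load_pars ms) 21 = snd ms (Suc 0)" "fst (sem b load_pars ms) 22 = snd ms 2" "fst (sem b load_pars ms) 23 = snd ms 3" "fst (sem b load_pars ms) 24 = snd ms 4" "fst (sem b load_pars ms) 25 = snd ms 5" "fst (sem b load_pars ms) 26 = snd ms 6" "fst (sem b load_pars ms) 27 = snd ms 7" "fst (sem b load_pars ms) 28 = snd ms 8" "fst (sem b load_pars ms) 29 = snd ms 9" "fst (sem b load_pars ms) 30 = snd ms 10" "fst (sem b load_pars ms) 31 = snd ms 11" "fst (sem b load_pars ms) 32 = snd ms 12" "fst (sem b load_pars ms) 33 = snd ms 13"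
  by (simp_all add: load_pars_def c20)
qed

lemma load_pars_correct: "header (snd ms) ==> pars (sem b load_pars ms)"
 by (simp add: header_def pars_def load_pars_regs)

end

context query_data
begin

definition search_inv :: "(nat => nat => nat) => nat => nat => st => bool" where
 "search_inv X k0 j ms \<longleftrightarrow> ready ms f D V \<and> marks ms \<and>
  (\<forall>c<6. fst ms (100 + c) = X c 1 \<and> fst ms (110 + c) = X c 0) \<and>
  sel_inv (kap ` in_box X) k0 j (fst ms 173) (fst ms 12) \<and> fst ms 173 < 2 ^ (KB - j) \<and>
  fst ms 94 \<le> (KB - j) * (2 * W) ^ 6 \<and> fst ms 12 < 2 ^ b"

lemma search_inv_cong:
 assumes "\<And>z. z \<in> {20..39} \<union> {100..115} \<union> {12, 94, 173} ==> fst ms' z = fst ms z" "snd ms' = snd ms"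
 shows "search_inv X k0 j ms' = search_inv X k0 j ms"
proof -
 have "ready ms' f D V = ready ms f D V" using assms by (intro ready_cong) auto
 moreover have "fst ms' (100 + c) = fst ms (100 + c)" "fst ms' (110 + c) = fst ms (110 + c)" if "c < 6" for c
  using that by (auto intro!: assms(1))
 moreover have "fst ms' 12 = fst ms 12" "fst ms' 94 = fst ms 94" "fst ms' 173 = fst ms 173"
  by (auto intro!: assms(1))
 ultimately show ?thesis using assms(2) by (simp add: search_inv_def marks_def)
qed

lemma search_step:
 assumes X: "\<And>c g. X c g < 2 ^ W" "\<And>c. c < 6 ==> X c 1 \<le> X c 0"
  and inv: "search_inv X k0 (Suc j) ms" and j: "j < KB" "fst ms 175 = j"
 shows "search_inv X k0 j (sem b search_body ms)"
proof -
 define len where "len = KB - j"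
 define \<pi> where "\<pi> = fst ms 173"
 define c where "c = card {a \<in> kap ` in_box X. a div 2 ^ j = 2 * \<pi> + 1}"
 have rd: "ready ms f D V" "marks ms" and rX: "\<And>c. c < 6 ==> fst ms (100 + c) = X c 1" "\<And>c. c < 6 ==> fst ms (110 + c) = X c 0"
  and sel: "sel_inv (kap ` in_box X) k0 (Suc j) \<pi> (fst ms 12)" and pi: "\<pi> < 2 ^ (KB - Suc j)"
  and st: "fst ms 94 \<le> (KB - Suc j) * (2 * W) ^ 6" and k12: "fst ms 12 < 2 ^ b"
  using inv by (auto simp: search_inv_def \<pi>_def)
 have regs: "fst ms rKB = KB" "fst ms rL6 = L ^ 6" using rd(1) by (simp_all add: ready_def pars_def)
 have len: "len \<le> KB" "2 * \<pi> + 1 < 2 ^ len" "KB - len = j"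
 proof -
  have "KB - j = Suc (KB - Suc j)" using j(1) by simp
  thus "2 * \<pi> + 1 < 2 ^ len" using pi by (simp add: len_def)
 qed (use j(1) in \<open>simp_all add: len_def\<close>)
 have KF: "KB + 6 * lw \<le> FB" by (simp add: FB_def KB_def q_def)
 have lenb: "2 ^ len < (2::nat) ^ b"
 proof -
  have "(2::nat) ^ len \<le> 2 ^ FB" using len(1) KF by (intro power_increasing) auto
  thus ?thesis using FB_less_b by linarith
 qed
 have L6: "L ^ 6 = 2 ^ (6 * lw)" by (simp add: L_eq power_mult[symmetric] mult.commute)
 have jb: "2 ^ j * L ^ 6 < 2 ^ b" "2 ^ j < (2::nat) ^ b"
 proof -
  have "2 ^ j * L ^ 6 \<le> 2 ^ FB" unfolding L6 power_add[symmetric] using j(1) KF by (intro power_increasing) auto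
  thus "2 ^ j * L ^ 6 < 2 ^ b" using FB_less_b by linarith
  have "(2::nat) ^ j \<le> 2 ^ FB" using j(1) KF by (intro power_increasing) auto
  thus "2 ^ j < (2::nat) ^ b" using FB_less_b by linarith
 qed
 let ?pre = "Set 172 (Cn 1 [<<] (Rg rKB [-] Rg 175)) ;;
  Set 91 ((Cn 1 [<<] Rg 175) [*] Rg rL6) ;;
  Set 171 (Cn 2 [*] Rg 173 [+] Cn 1) ;;
  Set 170 (Cn 0) ;; Set 140 (Cn 1) ;; Set 150 (Cn 0)"
 define ms1 where "ms1 = upd 150 0 (upd 140 1 (upd 170 0 (upd 171 (2 * \<pi> + 1) (upd 91 (2 ^ j * L ^ 6) (upd 172 (2 ^ len) ms)))))"
 define ms2 where "ms2 = sem b (nest_com 6) ms1"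
 have pre: "sem b (?pre ;; c) ms = sem b c ms1" for c
 proof -
  have kb: "KB < 2 ^ b" using less_exp[of FB] KF FB_less_b by linarith
  have "alu b Minus KB j = len" unfolding len_def using j(1) kb by (intro alu_Minus) auto
  moreover have "alu b ShiftL 1 len = 2 ^ len" "alu b ShiftL 1 j = 2 ^ j" using lenb jb by (simp_all add: alu_ShiftL)
  moreover have "alu b Times (2 ^ j) (L ^ 6) = 2 ^ j * L ^ 6" using jb by (simp add: alu_Times)
  moreover have "alu b Plus (alu b Times 2 \<pi>) 1 = 2 * \<pi> + 1"
  proof -
   have l: "2 * \<pi> + 1 < 2 ^ b" using len(2) lenb by (rule less_trans)
   hence "alu b Times 2 \<pi> = 2 * \<pi>" by (intro alu_Times) linarith
   thus ?thesis using alu_Plus[OF l] by (simp only:)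
  qed
  moreover have "take_bit b (1::nat) = 1" "take_bit b (2::nat) = 2" by simp_all
  ultimately show ?thesis unfolding sem.simps(2,5) eval.simps ms1_def
   by (simp add: regs j(2) \<pi>_def[symmetric] del: alu.simps One_nat_def)
 qed
 have set1: "setting X len (2 * \<pi> + 1) ms1"
  unfolding setting_def using rd rX len(3)
  by (auto simp: ms1_def ready_upd marks_def)
 have "KB - j = Suc (KB - Suc j)" using j(1) by simp
 hence st2: "fst ms 94 + (2 * W) ^ 6 \<le> (KB - j) * (2 * W) ^ 6" using st by simp
 have "(KB - j) * (2 * W) ^ 6 \<le> KB * (2 * W) ^ 6" by (rule mult_le_mono1) simp
 hence "fst ms 94 + (2 * W) ^ 6 \<le> 2 ^ K" using st2 stamps_le by linarith
 hence st1: "fst ms1 94 + (2 * W) ^ 6 \<le> 2 ^ K" by (simp add: ms1_def)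
 have nest: "setting X len (2 * \<pi> + 1) ms2 \<and> fst ms2 94 \<le> fst ms1 94 + (2 * W) ^ 6 \<and>
  int (fst ms2 170) mod 2 ^ b = (int (fst ms1 170) + nsum X len (2 * \<pi> + 1) 6 1 0) mod 2 ^ b"
  unfolding ms2_def
  by (rule nest_correct[OF X(1) len(1,2) _ set1]) (use st1 in \<open>simp_all add: ms1_def\<close>)
 have "nsum X len (2 * \<pi> + 1) 6 1 0 = int c"
 proof -
  have "nsum X len (2 * \<pi> + 1) 6 1 0 = int (card {y. y < NP ^ 3 \<and> (\<forall>c<6. X c 1 \<le> cd y c \<and> cd y c < X c 0) \<and>
     kap y div 2 ^ (KB - len) = 2 * \<pi> + 1})"
   by (rule nsum_total[OF X len(1,2)])
  thus ?thesis unfolding c_def len(3) card_kap unfolding in_box_def mem_Collect_eq conj_assoc .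
 qed
 moreover have "c < 2 ^ b"
 proof -
  have "c \<le> card {..<NP ^ 3}"
   unfolding c_def card_kap by (rule card_mono) (auto simp: in_box_def)
  moreover have "NP ^ 3 \<le> N" using NP3 by (simp add: power3_eq_cube)
  ultimately show ?thesis using N_less_b by simp
 qed
 \<comment> \<open>Both numbers are below \<open>2 ^ b\<close>, so the congruence is an
   equality.\<close>
 ultimately have c170: "fst ms2 170 = c"
 proof -
  assume a: "nsum X len (2 * \<pi> + 1) 6 1 0 = int c" "c < 2 ^ b"
  have "int (fst ms2 170) mod 2 ^ b = int c mod 2 ^ b" using nest a(1) by (simp add: ms1_def)
  moreover have "fst ms2 170 < 2 ^ b" using nest by (simp add: setting_def)
  hence "int (fst ms2 170) < 2 ^ b" by (simp flip: of_nat_less_iff)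
  moreover have "int c < 2 ^ b" using a(2) by (simp flip: of_nat_less_iff)
  ultimately show ?thesis by simp
 qed
 note S2 = settingD[OF conjunct1[OF nest]]
 have fr: "z \<notin> wr (nest_com 6)" if "z = 12 \<or> z = 173" for z
  using wr_nest_com[of 6] that by (auto simp: nest_regs_def)
 have "fst ms2 12 = fst ms1 12" "fst ms2 173 = fst ms1 173"
  unfolding ms2_def by (intro sem_frame fr; simp)+
 hence k2: "fst ms2 12 = fst ms 12" "fst ms2 173 = \<pi>" by (simp_all add: ms1_def \<pi>_def)
 have st': "fst ms2 94 \<le> (KB - j) * (2 * W) ^ 6" using nest st2 by (simp add: ms1_def)
 have pi2: "2 * \<pi> < 2 ^ b" using len(2) lenb by linarith
 have body: "sem b search_body ms = (if c < fst ms 12 then upd 173 (2 * \<pi>) (upd 12 (fst ms 12 - c) ms2) else upd 173 (2 * \<pi> + 1) ms2)"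
 proof -
  have "sem b search_body ms = sem b (Cond (Rg 170 [<] Rg 12)
   (Set 12 (Rg 12 [-] Rg 170) ;; Set 173 (Cn 2 [*] Rg 173)) (Set 173 (Rg 171))) ms2"
   unfolding search_body_def ms2_def using pre by (simp only: sem.simps(5))
  also have "\<dots> = (if c < fst ms 12 then upd 173 (2 * \<pi>) (upd 12 (fst ms 12 - c) ms2) else upd 173 (2 * \<pi> + 1) ms2)"
  proof -
   have "alu b Times 2 \<pi> = 2 * \<pi>" using pi2 by (simp add: alu_Times)
   moreover have "alu b Minus (fst ms 12) c = fst ms 12 - c" if "c < fst ms 12" using that k12 by (simp add: alu_Minus)
   ultimately show ?thesis by (simp add: c170 k2 S2(5) alu_bool del: alu.simps)
  qed
  finally show ?thesis .
 qed
 have sel': "if c < fst ms 12 then sel_inv (kap ` in_box X) k0 j (2 * \<pi>) (fst ms 12 - c)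
   else sel_inv (kap ` in_box X) k0 j (2 * \<pi> + 1) (fst ms 12)"
  unfolding c_def by (rule sel_inv_step[OF _ sel]) simp
 have pl: "2 * \<pi> + 1 < 2 ^ (KB - j)" using len(2) by (simp add: len_def)
 show ?thesis
 proof (cases "c < fst ms 12")
  case True
  hence "sel_inv (kap ` in_box X) k0 j (2 * \<pi>) (fst ms 12 - c)" using sel' by simp
  thus ?thesis unfolding body search_inv_def using True S2 st' pl k12
   by (auto simp: ready_upd marks_def)
 next
  case False
  hence "sel_inv (kap ` in_box X) k0 j (2 * \<pi> + 1) (fst ms 12)" using sel' by simp
  thus ?thesis unfolding body search_inv_def using False S2 st' pl k12 k2
   by (auto simp: ready_upd marks_def)
 qed
qed

lemma search_correct:
 assumes X: "\<And>c g. X c g < 2 ^ W" "\<And>c. c < 6 ==> X c 1 \<le> X c 0"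
  and inv: "search_inv X k0 KB ms"
 shows "search_inv X k0 0 (sem b (For 175 rKB search_body) ms)"
proof -
 have KB: "fst ms rKB = KB" using inv by (simp add: search_inv_def ready_def pars_def)
 show ?thesis
 proof (rule sem_For_inv[where I="search_inv X k0"])
  show "search_inv X k0 (fst ms rKB) (upd 175 (fst ms rKB) ms)"
   unfolding KB using inv by (subst search_inv_cong[of _ ms]) auto
  fix i \<tau> assume i: "i < fst ms rKB" and \<tau>: "search_inv X k0 (Suc i) \<tau>"
  have "search_inv X k0 (Suc i) (upd 175 i \<tau>)" using \<tau> by (subst search_inv_cong[of _ \<tau>]) auto
  thus "search_inv X k0 i (sem b search_body (upd 175 i \<tau>))"
   using i by (intro search_step X) (simp_all add: KB)
 qed
qed

lemma query_correct:
 assumes mem: "header (snd ms)" "snd ms 0 = base" "dict K (\<lambda>a. snd ms (base + a)) f D V" "\<And>x. x < N ==> snd ms (MB + x) = 0"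
  and box: "\<And>i. i < 12 ==> fst ms i < 2 ^ w"
 defines "X \<equiv> box_bounds (fst ms)" and "ms' \<equiv> sem b query_com ms"
 assumes k: "fst ms 12 = k" "1 \<le> k" "k \<le> card (in_box X)"
 shows "\<exists>y\<in>in_box X. card {z \<in> in_box X. kap y < kap z} + 1 = k \<and> (\<forall>c<6. fst ms' c = cd y c - 1)"
proof -
 have w2: "(2::nat) ^ w + 2 \<le> 2 ^ W"
 proof -
  have "(2::nat) ^ 1 \<le> 2 ^ w" using w1 by (intro power_increasing) auto
  thus ?thesis by (simp add: W_def)
 qed
 have X: "X c g < 2 ^ W" for c g
 proof -
  have "r < 2 ^ w ==> r + 2 < 2 ^ W \<and> r + 1 < 2 ^ W" for r :: nat using w2 by linarith
  moreover have "fst ms (4 * (c div 2) + c mod 2) < 2 ^ w" "fst ms (4 * (c div 2) + 2 + c mod 2) < 2 ^ w" if "c < 6"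
  proof -
   have "c div 2 < 3" "c mod 2 < 2" using that by auto
   hence "4 * (c div 2) + c mod 2 < 12" "4 * (c div 2) + 2 + c mod 2 < 12" by linarith+
   thus "fst ms (4 * (c div 2) + c mod 2) < 2 ^ w" "fst ms (4 * (c div 2) + 2 + c mod 2) < 2 ^ w"
    by (simp_all only: box)
  qed
  ultimately show ?thesis unfolding X_def box_bounds_def using not_less by auto
 qed
 \<comment> \<open>Nonempty boxes have lower bounds not above the upper ones, as the signed
   decomposition requires; the range of \<open>k\<close> guarantees nonemptiness.\<close>
 have "card (in_box X) \<noteq> 0" using k(2,3) by linarith
 hence "in_box X \<noteq> {}" by force
 then obtain y0 where y0: "y0 \<in> in_box X" by blast
 have X10: "X c 1 \<le> X c 0" if "c < 6" for c
 proof -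
  have "X c 1 \<le> cd y0 c" "cd y0 c < X c 0" using y0 that by (simp_all add: in_box_def)
  thus ?thesis by linarith
 qed
 have Wb: "2 ^ W \<le> (2::nat) ^ b"
 proof -
  have "(2::nat) ^ W \<le> 2 ^ FB" by (intro power_increasing) (auto simp: FB_def)
  thus ?thesis using FB_less_b by linarith
 qed
 define ms1 where "ms1 = sem b load_pars ms"
 define ms2 where "ms2 = sem b bounds_com ms1"
 define ms3 where "ms3 = sem b (For 175 rKB search_body) ms2"
 have out: "ms' = sem b output_com ms3"
  by (simp only: ms'_def query_com_def sem.simps(5) ms1_def ms2_def ms3_def)
 have c20: "take_bit b c = c" if "c < 20" for c :: nat using that small[of c] by (simp add: take_bit_nat_eq_self)
 note 0 = load_pars_regs[of ms, folded ms1_def]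
 have fr1: "fst ms1 r = fst ms r" if "r < 20" for r
  using that unfolding ms1_def by (intro sem_frame) (auto simp: load_pars_def)
 note 1 = 0 fr1
 have m1: "snd ms1 = snd ms" by (simp add: ms1_def load_pars_def)
 have r1: "ready ms1 f D V"
  using mem(1-3) by (simp add: ready_def dict_at_def header_def pars_def 1 m1)
 have r2: "ready ms2 f D V" unfolding ms2_def using r1 by (rule ready_frame) (auto simp: bounds_com_def)
 have bx: "alu b Plus (fst ms i) 1 = fst ms i + 1" "alu b Plus (fst ms i) 2 = fst ms i + 2" if "i < 12" for i
 proof -
  have "fst ms i + 2 < 2 ^ b" using box[OF that] w2 Wb by linarith
  thus "alu b Plus (fst ms i) 1 = fst ms i + 1" "alu b Plus (fst ms i) 2 = fst ms i + 2"
   by (intro alu_Plus; linarith)+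
 qed
 have "search_inv X k KB ms2"
 proof -
  have e2: "fst ms2 12 = k" "fst ms2 94 = 0" "fst ms2 173 = 0" "snd ms2 = snd ms"
   by (simp_all add: ms2_def bounds_com_def 1 k m1)
  have mk: "marks ms2" using mem(4) by (simp add: marks_def e2)
  have sel: "sel_inv (kap ` in_box X) k KB 0 k"
  proof (rule sel_inv_init)
   show "kap ` in_box X \<subseteq> {..<2 ^ KB}" using kap_less by (auto simp: in_box_def)
   show "k \<le> card (kap ` in_box X)" using k(3) by (simp add: card_image inj_on_kap)
  qed (use k(2) in auto)
  have "k < 2 ^ b"
  proof -
   note k(3)
   also have "card (in_box X) \<le> card {..<NP ^ 3}" by (rule card_mono) (auto simp: in_box_def)
   also have "\<dots> \<le> N" using NP3 by (simp add: power3_eq_cube)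
   also have "\<dots> < 2 ^ b" by (rule N_less_b)
   finally show ?thesis .
  qed
  moreover have "fst ms2 (100 + c) = X c 1 \<and> fst ms2 (110 + c) = X c 0" if "c < 6" for c
  proof -
   from that consider "c = 0" | "c = 1" | "c = 2" | "c = 3" | "c = 4" | "c = 5" by linarith
   thus ?thesis
    unfolding ms2_def bounds_com_def X_def box_bounds_def
    by cases (simp_all add: 1 bx numeral_2_eq_2[symmetric] del: alu.simps One_nat_def)
  qed
  ultimately show ?thesis unfolding search_inv_def using r2 mk sel by (simp add: e2)
 qed
 hence inv: "search_inv X k 0 ms3" unfolding ms3_def by (intro search_correct X X10)
 define \<pi> where "\<pi> = fst ms3 173"
 have r3: "ready ms3 f D V" and sel: "sel_inv (kap ` in_box X) k 0 \<pi> (fst ms3 12)"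
  using inv by (auto simp: search_inv_def \<pi>_def)
 have pA: "\<pi> \<in> kap ` in_box X" "card {a \<in> kap ` in_box X. \<pi> < a} + 1 = k"
  using sel_inv_end[OF _ sel] by simp_all
 then obtain y where y: "y \<in> in_box X" "\<pi> = kap y" by auto
 have yN: "y < NP ^ 3" using y by (simp add: in_box_def)
 have ycd: "1 \<le> cd y c" if "c < 6" for c
 proof -
  have "X c 1 \<le> cd y c" using y(1) that by (auto simp: in_box_def)
  moreover have "1 \<le> X c 1" using that by (simp add: X_def box_bounds_def)
  ultimately show ?thesis by linarith
 qed
 have ym: "\<pi> mod (NP * NP * NP) = y" using kap_mod[OF yN] y(2) by (simp add: power3_eq_cube)
 have xN: "y * L ^ 6 < N" using yN L_pos by (simp add: N_def)
 define ms4 where "ms4 = upd rX (y * L ^ 6) ms3"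
 define ms5 where "ms5 = sem b coords ms4"
 have r4: "ready ms4 f D V" using r3 by (simp add: ms4_def ready_upd)
 have e4: "sem b (Set rX ((Rg 173 [mod] (Rg rNP [*] Rg rNP [*] Rg rNP)) [*] Rg rL6)) ms3 = ms4"
 proof -
  have rg: "fst ms3 rNP = NP" "fst ms3 rL6 = L ^ 6" using r3 by (simp_all add: ready_def pars_def)
  have "alu b Times (alu b Times NP NP) NP = NP * NP * NP"
   using NP_b NP3 N_less_b by (simp add: alu_Times del: alu.simps)
  moreover have "alu b Times y (L ^ 6) = y * L ^ 6" using xN N_less_b by (intro alu_Times) linarith
  ultimately show ?thesis
   by (simp add: ms4_def rg \<pi>_def[symmetric] ym del: alu.simps(3))
 qed
 have e5: "fst ms5 (54 + c) = cd y c" if "c < 6" for c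
  using coords_correct(1)[OF r4 pts _ xN that] L_pos by (simp add: ms5_def ms4_def)
 have mn: "alu b Minus (cd y c) 1 = cd y c - 1" if "c < 6" for c
  using ycd[OF that] cd_less[of y c] Wb by (intro alu_Minus) linarith+
 have "fst ms' c = cd y c - 1" if "c < 6" for c
 proof -
  have e: "fst ms5 54 = cd y 0" "fst ms5 55 = cd y 1" "fst ms5 56 = cd y 2" "fst ms5 57 = cd y 3" "fst ms5 58 = cd y 4" "fst ms5 59 = cd y 5"
   using e5[of 0] e5[of 1] e5[of 2] e5[of 3] e5[of 4] e5[of 5] by simp_all
  have m: "alu b Minus (cd y 0) 1 = cd y 0 - 1" "alu b Minus (cd y 1) 1 = cd y 1 - 1" "alu b Minus (cd y 2) 1 = cd y 2 - 1"
   "alu b Minus (cd y 3) 1 = cd y 3 - 1" "alu b Minus (cd y 4) 1 = cd y 4 - 1" "alu b Minus (cd y 5) 1 = cd y 5 - 1"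
   using mn by simp_all
  have t1: "take_bit b (1::nat) = 1" by simp
  from that consider "c = 0" | "c = 1" | "c = 2" | "c = 3" | "c = 4" | "c = 5" by linarith
  thus ?thesis
   unfolding out output_com_def sem.simps(5) e4 ms5_def[symmetric] unfolding sem.simps(2) eval.simps t1
   by cases (simp_all add: e m del: alu.simps One_nat_def)
 qed
 moreover have "card {z \<in> in_box X. kap y < kap z} + 1 = k"
  using pA(2) unfolding y(2) card_kap .
 ultimately show ?thesis using y(1) by blast
qed

end

section \<open>Filling the dictionary, and computing the parameters\<close>

section \<open>The construction program\<close>

definition put :: "exp => com" where
 "put k = Set rKey k ;; insert_key"

definition pts_com :: "nat => com" where
 "pts_com c = For 81 36 (
  Ld rVal (Cn 2 [*] Rg 81 [+] Cn c) ;; Set rVal (Rg rVal [+] Cn 1) ;; put (Cn 8 [*] Rg 81 [+] Cn (c + 1)))"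

definition wds_com :: com where
 "wds_com = For 81 37 (Ld rVal (Rg 38 [+] Rg 81) ;; put (Cn 8 [*] Rg 81 [+] Cn 3))"

definition each_pair :: "com => com" where
 "each_pair B = For rX rN (keyof ;; For 81 rK B)"

text \<open>All counts are collected in a directly addressed array outside the part of memory that
  is kept; only time limits its use.\<close>

definition tally_body :: com where
 "tally_body =
  Set 82 (Rg 39 [+] (Rg rFull [>>] Rg 81)) ;; Ld 83 (Rg 82) ;; St (Rg 82) (Rg 83 [+] Cn 1)"

text \<open>The test \<open>0 <\<close> discards shifts that remove the whole of
  \<open>full x\<close>. A count is inserted again for every leaf below its node, with the same
  value.\<close>

definition cts_body :: com where
 "cts_body =
  Set 82 (Rg rFull [>>] Rg 81) ;; Ld rVal (Rg 39 [+] Rg 82) ;;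
  Cond ((Rg rS [<] Rg rVal) [*] (Cn 0 [<] Rg 82)) (put (Cn 8 [*] Rg 82 [+] Cn 4)) Skip"

text \<open>Of several chains with the same end, the one treated last prevails.\<close>

definition ends_com :: com where
 "ends_com = For rHt rNt (For 84 35 (
  Set rHy (Rg 84) ;; walk_com (Cn 1) ;; Set rVal (Rg 84) ;;
  put (Cn 8 [*] (Rg rHy [*] Rg rNt [+] Rg rHt) [+] Cn 5)))"

text \<open>Overwrites the beginning of the input, which is in the dictionary by now. Register 0
  receives the end of the trie, the length of the structure.\<close>

definition header_com :: com where
 "header_com =
  St (Cn 0) (Rg 20) ;; St (Cn 1) (Rg 21) ;; St (Cn 2) (Rg 22) ;; St (Cn 3) (Rg 23) ;;
  St (Cn 4) (Rg 24) ;; St (Cn 5) (Rg 25) ;; St (Cn 6) (Rg 26) ;; St (Cn 7) (Rg 27) ;;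
  St (Cn 8) (Rg 28) ;; St (Cn 9) (Rg 29) ;; St (Cn 10) (Rg 30) ;; St (Cn 11) (Rg 31) ;;
  St (Cn 12) (Rg 32) ;; St (Cn 13) (Rg 33) ;; Set 0 (Rg rBase [+] Rg rFree)"

definition fill_com :: com where
 "fill_com = pts_com 0 ;; pts_com 1 ;; wds_com ;; each_pair tally_body ;; each_pair cts_body ;; ends_com ;; header_com"

lemma wr_put [simp]: "wr (put k) = {rKey, rNode, rRest, rLvl, rAddr, rChild, rFree}"
 by (auto simp: put_def)

locale build_data = layout_base n w e A px py "2 * n + 32" for n w e A px py +
 fixes \<rho> :: "nat => nat"
 assumes px_out: "\<And>i. n \<le> i ==> px i = 0" and py_out: "\<And>i. n \<le> i ==> py i = 0"
begin

text \<open>Regions of memory: input and header, the trie from \<open>2 * n + 32\<close> on, tallies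
  from \<open>CB\<close>, random words from \<open>RB\<close>. The factors 16 and 32 leave room for
  the \<open>2 ^ (K + 3)\<close> words of the trie and keep all addresses within \<open>b\<close>
  bits.\<close>

definition CB :: nat where "CB = 2 ^ K * 16"
definition RB :: nat where "RB = 2 ^ K * 32"

definition bst :: "nat set => (nat => nat) => (nat => nat) => st => bool" where
 "bst D V M ms \<longleftrightarrow> ready ms (fst ms rFree) D V \<and> fst ms 35 = m \<and> fst ms 36 = n \<and> fst ms 37 = R \<and>
  fst ms 38 = RB \<and> fst ms 39 = CB \<and>
  (\<forall>a. a < 2 * n + 32 \<or> 2 * n + 32 + 2 ^ (K + 3) \<le> a --> snd ms a = M a)"

lemma bst_cong:
 assumes "\<And>z. z \<in> {20..39} \<union> {rFree} ==> fst ms' z = fst ms z" "snd ms' = snd ms"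
 shows "bst D V M ms' = bst D V M ms"
proof -
 have "ready ms' f D V = ready ms f D V" for f using assms by (intro ready_cong) auto
 moreover have "fst ms' z = fst ms z" if "z \<in> {35, 36, 37, 38, 39, 46}" for z using that by (intro assms) auto
 ultimately show ?thesis using assms(2) by (simp add: bst_def)
qed

lemma bst_upd: "x \<notin> {20..39} \<union> {rFree} ==> bst D V M (upd x v ms) = bst D V M ms"
 by (rule bst_cong) auto

lemma bst_frame:
 assumes "bst D V M ms" "wr c \<inter> ({20..39} \<union> {rFree}) = {}" "\<not> stores c"
 shows "bst D V M (sem b c ms)"
proof -
 have "fst (sem b c ms) z = fst ms z" if "z \<in> {20..39} \<union> {rFree}" for z
  using assms(2) that by (intro sem_frame) auto
 thus ?thesis using assms(1,3) by (subst bst_cong[of _ ms]) simp_all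
qed

lemma bstD: "bst D V M ms ==> ready ms (fst ms rFree) D V" "bst D V M ms ==> pars ms"
 by (auto simp: bst_def ready_def)

lemma put_correct:
 assumes s: "bst D V M ms" and k: "eval b ke (fst ms) = key" "key < 2 ^ K" "key \<in> D" and v: "fst ms rVal = v"
 shows "bst D (V(key := v)) M (sem b (put ke) ms)"
proof -
 let ?ms = "upd rKey key ms"
 have s1: "bst D V M ?ms" using s by (simp add: bst_upd)
 have e: "sem b (put ke) ms = sem b insert_key ?ms" by (simp add: put_def k)
 have d: "dict_at ?ms (fst ?ms rFree) D V" and kk: "fst ?ms rKey < 2 ^ K"
  using s1 k by (simp_all add: bst_def ready_def)
 have "dict_at (sem b insert_key ?ms) (fst (sem b insert_key ?ms) rFree) (insert key D) (V(key := v))"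
  using insert_correct(1)[OF d kk] v by simp
 moreover have "insert key D = D" using k by auto
 moreover have "fst (sem b insert_key ?ms) z = fst ?ms z" if "z \<in> {20..39}" for z
  using that by (intro sem_frame) auto
 hence keep: "fst (sem b insert_key ?ms) z = fst ms z" if "z \<in> {20..39}" for z using that by auto
 ultimately show ?thesis
  using s1 insert_correct(2)[OF d kk] unfolding e bst_def ready_def pars_def
  by (simp add: keep)
qed

lemma far: "2 * n + 32 + 2 ^ (K + 3) \<le> CB" "CB + 2 ^ K \<le> RB" "RB + 2 ^ K < 2 ^ b"
proof -
 show "2 * n + 32 + 2 ^ (K + 3) \<le> CB" using base_le by (simp add: CB_def power_add)
 show "CB + 2 ^ K \<le> RB" by (simp add: CB_def RB_def)
 have "(34::nat) \<le> 2 ^ 120" by simp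
 hence "(34::nat) \<le> 2 ^ K" using big_K by (rule order_trans)
 hence "34 * 2 ^ K \<le> (2::nat) ^ b" unfolding pow_b by (rule mult_le_mono1)
 moreover have "(0::nat) < 2 ^ K" by simp
 ultimately show "RB + 2 ^ K < 2 ^ b" unfolding RB_def by linarith
qed

lemma key_eval: "alu b Plus (alu b Times 8 x) c = 8 * x + c" if "8 * x + c < 2 ^ K"
proof -
 have "8 * x + c < 2 ^ b" using that by (intro less_b) simp
 thus ?thesis by (simp add: alu_Plus alu_Times)
qed

text \<open>The intended contents for each kind of key, told apart by the residue modulo 8. Chain
  ends, residue 5, have no entry here because their value depends on the order of insertion.\<close>

definition stored :: "nat set => nat => nat" where
 "stored D key = (if key \<in> D then
  (let i = key div 8 in
   if key mod 8 = 1 then px i else if key mod 8 = 2 then py i else if key mod 8 = 3 then \<rho> i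
   else if key mod 8 = 4 then cnt i else 0) else 0)"

lemma stored_insert:
 "(stored D)(8 * i + 1 := px i) = stored (insert (8 * i + 1) D)"
 "(stored D)(8 * i + 2 := py i) = stored (insert (8 * i + 2) D)"
 "(stored D)(8 * i + 3 := \<rho> i) = stored (insert (8 * i + 3) D)"
 "(stored D)(8 * i + 4 := cnt i) = stored (insert (8 * i + 4) D)"
proof -
 have d: "(8 * i + 1) div 8 = i" "(8 * i + 1) mod 8 = 1" "(8 * i + 2) div 8 = i" "(8 * i + 2) mod 8 = 2"
  "(8 * i + 3) div 8 = i" "(8 * i + 3) mod 8 = 3" "(8 * i + 4) div 8 = i" "(8 * i + 4) mod 8 = 4"
  by presburger+
 show "(stored D)(8 * i + 1 := px i) = stored (insert (8 * i + 1) D)"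
  "(stored D)(8 * i + 2 := py i) = stored (insert (8 * i + 2) D)"
  "(stored D)(8 * i + 3 := \<rho> i) = stored (insert (8 * i + 3) D)"
  "(stored D)(8 * i + 4 := cnt i) = stored (insert (8 * i + 4) D)"
  by (auto simp: fun_eq_iff stored_def Let_def d simp del: add_2_eq_Suc add_2_eq_Suc' One_nat_def)
qed

definition crd_keys :: "nat => nat => nat set" where
 "crd_keys c i = (\<lambda>j. 8 * j + (c + 1)) ` {i..<n}"

abbreviation pts_keys :: "nat set" where
 "pts_keys \<equiv> crd_keys 0 0 \<union> crd_keys 1 0"

definition wds_keys :: "nat => nat set" where
 "wds_keys i = (\<lambda>j. 8 * j + 3) ` {i..<R}"

definition cts_keys :: "(nat \<times> nat) set => nat set" where
 "cts_keys P = (\<lambda>v. 8 * v + 4) ` {v. internal v \<and> (\<exists>(x, d)\<in>P. full x div 2 ^ d = v)}"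

definition pairs_set :: "(nat \<times> nat) set" where
 "pairs_set = {..<N} \<times> {..<K}"

definition ends_keys :: "nat set" where
 "ends_keys = (\<lambda>(\<tau>, j). 8 * (chain_end (table s \<rho> \<tau>) s j * nt + \<tau>) + 5) ` ({..<nt} \<times> {..<m})"

definition all_keys :: "nat set" where
 "all_keys = pts_keys \<union> wds_keys 0 \<union> cts_keys pairs_set \<union> ends_keys"

lemma pts_correct:
 assumes s: "bst all_keys (stored D) M ms" and c: "c < 2"
  and M: "\<And>i. i < n ==> M (2 * i + c) + 1 = (if c = 0 then px i else py i)"
 shows "bst all_keys (stored (D \<union> crd_keys c 0)) M (sem b (pts_com c) ms)"
proof -
 let ?c1 = "Ld rVal (Cn 2 [*] Rg 81 [+] Cn c) ;; Set rVal (Rg rVal [+] Cn 1)" and ?k = "Cn 8 [*] Rg 81 [+] Cn (c + 1)"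
 have n: "fst ms 36 = n" using s by (simp add: bst_def)
 show ?thesis
  unfolding pts_com_def
 proof (rule sem_For_inv[where I="\<lambda>i. bst all_keys (stored (D \<union> crd_keys c i)) M"], goal_cases)
  case 1
  show ?case using s by (simp add: bst_upd n crd_keys_def)
 next
  case (2 i \<tau>)
  hence i: "i < n" using n by simp
  let ?p = "if c = 0 then px i else py i" and ?\<tau> = "upd 81 i \<tau>"
  have k: "8 * i + (c + 1) < 2 ^ K" using i c n_less key_less[of i "c + 1"] by simp
  have ib: "2 * i + c < 2 ^ b" using k by (intro less_b) linarith
  have mm: "snd \<tau> (2 * i + c) + 1 = ?p" using 2(2) M[OF i] i c by (simp add: bst_def)
  have "?p < 2 ^ b"
  proof (rule less_b)
   have "(2::nat) ^ w \<le> 2 ^ FB" by (intro power_increasing) (auto simp: FB_def W_def)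
   moreover have "?p \<le> 2 ^ w" using px_le[of i] py_le[of i] by simp
   ultimately show "?p \<le> 2 ^ K" using FB8 by linarith
  qed
  hence ap: "alu b Plus (snd \<tau> (2 * i + c)) 1 = ?p" using alu_Plus[of "snd \<tau> (2 * i + c)" 1] mm by simp
  have "2 * i < 2 ^ b" using ib by (rule add_lessD1)
  hence ti: "alu b Plus (alu b Times 2 i) c = 2 * i + c" using alu_Plus[OF ib] by (simp add: alu_Times del: alu.simps)
  have ts: "take_bit b (2::nat) = 2" "take_bit b (1::nat) = 1" "take_bit b (8::nat) = 8" "take_bit b c = c" "take_bit b (c + 1) = c + 1"
   using c by simp_all
  have e1: "sem b ?c1 ?\<tau> = upd rVal ?p ?\<tau>"
   using ap by (simp add: ts ti upd_def del: alu.simps One_nat_def)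
  have s1: "bst all_keys (stored (D \<union> crd_keys c (Suc i))) M (upd rVal ?p ?\<tau>)" using 2(2) by (simp add: bst_upd)
  have mem: "8 * i + (c + 1) \<in> all_keys"
   using i c unfolding all_keys_def crd_keys_def by (auto simp: less_2_cases_iff)
  have s2: "bst all_keys ((stored (D \<union> crd_keys c (Suc i)))(8 * i + (c + 1) := ?p)) M (sem b (put ?k) (upd rVal ?p ?\<tau>))"
   by (rule put_correct[OF s1 _ k mem]) (simp_all add: ts key_eval[OF k] del: alu.simps One_nat_def add_Suc_right)
  have "(stored D')(8 * i + (c + 1) := ?p) = stored (insert (8 * i + (c + 1)) D')" for D'
   using c stored_insert(1,2)[of D' i] by (auto simp: less_2_cases_iff numeral_2_eq_2[symmetric])
  moreover have "insert (8 * i + (c + 1)) (D \<union> crd_keys c (Suc i)) = D \<union> crd_keys c i"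
  proof -
   have "{i..<n} = insert i {Suc i..<n}" using i by auto
   thus ?thesis unfolding crd_keys_def by auto
  qed
  moreover have "sem b (Ld rVal (Cn 2 [*] Rg 81 [+] Cn c) ;; Set rVal (Rg rVal [+] Cn 1) ;; put ?k) ?\<tau> =
    sem b (put ?k) (upd rVal ?p ?\<tau>)"
   unfolding e1[symmetric] by (simp only: seq_step)
  ultimately show ?case using s2 by (simp only:)
 qed
qed

lemma wds_correct:
 assumes s: "bst all_keys (stored pts_keys) M ms"
  and M: "\<And>i. i < R ==> M (RB + i) = \<rho> i"
 shows "bst all_keys (stored (pts_keys \<union> wds_keys 0)) M (sem b wds_com ms)"
proof -
 have R: "fst ms 37 = R" using s by (simp add: bst_def)
 show ?thesis
  unfolding wds_com_def
 proof (rule sem_For_inv[where I="\<lambda>i. bst all_keys (stored (pts_keys \<union> wds_keys i)) M"])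
  show "bst all_keys (stored (pts_keys \<union> wds_keys (fst ms 37))) M (upd 81 (fst ms 37) ms)"
   using s by (simp add: bst_upd R wds_keys_def)
 next
  fix i \<tau> assume "i < fst ms 37" and \<tau>: "bst all_keys (stored (pts_keys \<union> wds_keys (Suc i))) M \<tau>"
  hence i: "i < R" using R by simp
  have k: "8 * i + 3 < 2 ^ K"
  proof -
   have "8 * i + 3 < (R + 1) * 8" using i by simp
   thus ?thesis using R_le by (rule less_le_trans)
  qed
  have RBi: "RB + i < 2 ^ b" using k far(3) by linarith
  have mi: "snd \<tau> (RB + i) = \<rho> i"
   using \<tau> M[OF i] far(1,2) by (simp add: bst_def)
  have t: "take_bit b (8::nat) = 8" "take_bit b (3::nat) = 3" by simp_all
  have a: "alu b Plus RB i = RB + i" by (rule alu_Plus[OF RBi])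
  have r38: "fst \<tau> 38 = RB" using \<tau> by (simp add: bst_def)
  have e1: "sem b (Ld rVal (Rg 38 [+] Rg 81)) (upd 81 i \<tau>) = upd rVal (\<rho> i) (upd 81 i \<tau>)"
   by (simp add: r38 a mi del: alu.simps)
  have s1: "bst all_keys (stored (pts_keys \<union> wds_keys (Suc i))) M (upd rVal (\<rho> i) (upd 81 i \<tau>))"
   using \<tau> by (simp add: bst_upd)
  have in1: "8 * i + 3 \<in> all_keys" using i by (auto simp: all_keys_def wds_keys_def)
  have s2: "bst all_keys ((stored (pts_keys \<union> wds_keys (Suc i)))(8 * i + 3 := \<rho> i)) M
    (sem b (put (Cn 8 [*] Rg 81 [+] Cn 3)) (upd rVal (\<rho> i) (upd 81 i \<tau>)))"
   by (rule put_correct[OF s1 _ k in1]) (simp_all add: t key_eval[OF k] del: alu.simps)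
  have ki: "insert (8 * i + 3) (pts_keys \<union> wds_keys (Suc i)) = pts_keys \<union> wds_keys i"
  proof -
   have "{i..<R} = insert i {Suc i..<R}" using i by auto
   thus ?thesis unfolding wds_keys_def by auto
  qed
  show "bst all_keys (stored (pts_keys \<union> wds_keys i)) M
   (sem b (Ld rVal (Rg 38 [+] Rg 81) ;; put (Cn 8 [*] Rg 81 [+] Cn 3)) (upd 81 i \<tau>))"
   using s2 unfolding seq_step e1 stored_insert ki .
 qed
qed

text \<open>Common to the two passes over items and shifts. By \<open>cong\<close> the invariant
  survives \<open>keyof\<close> and the counters, so each pass has to treat only its own
  body.\<close>

lemma pairs_loop:
 assumes start: "J {} ms"
  and rdy: "\<And>P \<tau>. J P \<tau> ==> \<exists>f D V. ready \<tau> f D V \<and> pts_in V"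
  and cong: "\<And>P \<tau> \<tau>'. J P \<tau> ==> (\<And>z. z \<notin> {40..44} \<union> {50..68} \<union> {81} ==> fst \<tau>' z = fst \<tau> z) ==>
    snd \<tau>' = snd \<tau> ==> J P \<tau>'"
  and wr: "wr B \<inter> {21, 25, 50, 51} = {}"
  and step: "\<And>P \<tau> x d. J P \<tau> ==> fst \<tau> rFull = full x ==> fst \<tau> 81 = d ==> x < N ==> d < K ==>
    (x, d) \<notin> P ==> J (insert (x, d) P) (sem b B \<tau>)"
 shows "J pairs_set (sem b (each_pair B) ms)"
proof -
 show ?thesis unfolding each_pair_def pairs_set_def
 proof (rule sem_For_pairs[where H="\<lambda>x \<tau>. fst \<tau> rFull = full x"])
  show "fst \<tau> rN = N \<and> fst \<tau> rK = K" if "J P \<tau>" for P \<tau>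
   using rdy[OF that] by (auto simp: ready_def pars_def)
  show "J P (upd z v \<tau>)" if "J P \<tau>" "z \<in> {rX, 81}" for P \<tau> z v
   using that(2) by (intro cong[OF that(1)]) auto
  show "J P (sem b keyof \<tau>) \<and> fst (sem b keyof \<tau>) rFull = full x"
   if "J P \<tau>" "fst \<tau> rX = x" "x < N" for P \<tau> x
  proof
   show "J P (sem b keyof \<tau>)" by (rule cong[OF that(1)]) auto
   show "fst (sem b keyof \<tau>) rFull = full x" using rdy[OF that(1)] keyof_correct that(2,3) by blast
  qed
  show "J (insert (x, d) P) (sem b B \<tau>) \<and> fst (sem b B \<tau>) rFull = full x"
   if "J P \<tau>" "fst \<tau> rFull = full x" "fst \<tau> 81 = d" "x < N" "d < K" "(x, d) \<notin> P" for P \<tau> x d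
   using step[OF that] wr that(2) by (simp add: Int_insert_right split: if_splits)
 qed (use start in simp_all)
qed

lemma pts_in_stored: "pts_keys \<subseteq> D ==> D \<subseteq> all_keys ==> pts_in (stored D)"
proof -
 assume D: "pts_keys \<subseteq> D" "D \<subseteq> all_keys"
 have d: "(8 * i + 1) div 8 = i" "(8 * i + 1) mod 8 = 1" "(8 * i + 2) div 8 = i" "(8 * i + 2) mod 8 = 2" for i :: nat
  by presburger+
 have "stored D (8 * i + 1) = px i" "stored D (8 * i + 2) = py i" for i
 proof -
  have "8 * i + 1 \<in> D" "8 * i + 2 \<in> D" if "i < n" using that D(1) by (auto simp: crd_keys_def)
  thus "stored D (8 * i + 1) = px i" "stored D (8 * i + 2) = py i"
   using px_out[of i] py_out[of i] by (cases "i < n"; simp add: stored_def Let_def d del: One_nat_def add_2_eq_Suc')+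
 qed
 thus ?thesis by (simp add: pts_in_def)
qed

definition tally :: "(nat => nat) => (nat \<times> nat) set => nat => nat" where
 "tally M P a = (if CB \<le> a \<and> a < CB + 2 ^ FB then card {(x, d) \<in> P. full x div 2 ^ d = a - CB} else M a)"

lemma prefix_less: "x < N ==> full x div 2 ^ d < 2 ^ FB"
 using full_bounds(2) div_le_dividend le_less_trans by blast

lemma tally_correct:
 assumes s: "bst all_keys (stored D) M ms" and D: "pts_keys \<subseteq> D" "D \<subseteq> all_keys"
  and M: "\<And>v. v < 2 ^ FB ==> M (CB + v) = 0"
 shows "bst all_keys (stored D) (tally M pairs_set) (sem b (each_pair tally_body) ms)"
proof -
 have "bst all_keys (stored D) (tally M pairs_set) (sem b (each_pair tally_body) ms) \<and> pairs_set \<subseteq> pairs_set"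
 proof (rule pairs_loop[where J="\<lambda>P \<tau>. bst all_keys (stored D) (tally M P) \<tau> \<and> P \<subseteq> pairs_set"])
  have "tally M {} = M"
  proof
   fix a show "tally M {} a = M a"
   proof (cases "CB \<le> a \<and> a < CB + 2 ^ FB")
    case True
    hence "a - CB < 2 ^ FB" by linarith
    from M[OF this] True show ?thesis by (simp add: tally_def)
   qed (auto simp: tally_def)
  qed
  thus "bst all_keys (stored D) (tally M {}) ms \<and> {} \<subseteq> pairs_set" using s by simp
  show "\<exists>f Da V. ready \<tau> f Da V \<and> pts_in V" if "bst all_keys (stored D) (tally M P) \<tau> \<and> P \<subseteq> pairs_set" for P \<tau>
   using that pts_in_stored[OF D] by (auto simp: bst_def)
  show "bst all_keys (stored D) (tally M P) \<tau>' \<and> P \<subseteq> pairs_set"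
   if "bst all_keys (stored D) (tally M P) \<tau> \<and> P \<subseteq> pairs_set" "\<And>z. z \<notin> {40..44} \<union> {50..68} \<union> {81} ==> fst \<tau>' z = fst \<tau> z"
    "snd \<tau>' = snd \<tau>" for P \<tau> \<tau>'
   using that by (subst bst_cong[of _ \<tau>]) auto
  show "wr tally_body \<inter> {21, 25, 50, 51} = {}" by (auto simp: tally_body_def)
 next
  fix P \<tau> x d
  assume J: "bst all_keys (stored D) (tally M P) \<tau> \<and> P \<subseteq> pairs_set" and reg: "fst \<tau> rFull = full x" "fst \<tau> 81 = d"
   and x: "x < N" "d < K" and new: "(x, d) \<notin> P"
  define v where "v = full x div 2 ^ d"
  have v: "v < 2 ^ FB" unfolding v_def by (rule prefix_less[OF x(1)])
  have FK: "(2::nat) ^ FB \<le> 2 ^ K" using FB8 by linarith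
  have ab: "CB + v < 2 ^ b" using v FK far(2,3) by linarith
  have Cv: "snd \<tau> (CB + v) = tally M P (CB + v)" using J far(1) by (simp add: bst_def)
  define k where "k = card {(x', d') \<in> P. full x' div 2 ^ d' = v}"
  have kv: "tally M P (CB + v) = k" using v by (simp add: tally_def k_def)
  have "{(x', d') \<in> insert (x, d) P. full x' div 2 ^ d' = v} = insert (x, d) {(x', d') \<in> P. full x' div 2 ^ d' = v}"
   by (auto simp: v_def)
  hence ck: "card {(x', d') \<in> insert (x, d) P. full x' div 2 ^ d' = v} = Suc k"
  proof -
   assume e: "{(x', d') \<in> insert (x, d) P. full x' div 2 ^ d' = v} = insert (x, d) {(x', d') \<in> P. full x' div 2 ^ d' = v}"
   have "finite P" using J finite_subset[of P pairs_set] by (simp add: pairs_set_def)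
   hence "finite {(x', d') \<in> P. full x' div 2 ^ d' = v}" by (rule rev_finite_subset) auto
   thus ?thesis unfolding e k_def using new by simp
  qed
  have other: "{(x', d') \<in> insert (x, d) P. full x' div 2 ^ d' = u} = {(x', d') \<in> P. full x' div 2 ^ d' = u}" if "u \<noteq> v" for u
   using that by (auto simp: v_def)
  have tl: "tally M (insert (x, d) P) = (tally M P)(CB + v := Suc k)"
  proof
   fix a
   show "tally M (insert (x, d) P) a = ((tally M P)(CB + v := Suc k)) a"
   proof (cases "a = CB + v")
    case True
    thus ?thesis using ck v by (simp add: tally_def)
   next
    case False
    hence "CB \<le> a ==> a - CB \<noteq> v" by auto
    thus ?thesis using False other[of "a - CB"] by (simp add: tally_def)
   qed
  qed
  \<comment> \<open>The entry for prefix 0 can receive several units per item, so the bound is the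
    number of all pairs.\<close>
  have "k + 1 < 2 ^ b"
  proof -
   have "k \<le> card pairs_set" unfolding k_def using J by (intro card_mono) (auto simp: pairs_set_def)
   also have "\<dots> = N * K" by (simp add: pairs_set_def)
   also have "N * K \<le> N * 2 ^ K" by (simp add: less_imp_le)
   finally have "k \<le> N * 2 ^ K" .
   moreover have "1 \<le> (2::nat) ^ K" by simp
   ultimately have "k + 1 \<le> (N + 1) * 2 ^ K" unfolding add_mult_distrib by linarith
   also have "(N + 1) * 2 ^ K < 2 ^ K * 2 ^ K"
   proof -
    have "1 \<le> (2::nat) ^ FB" by simp
    hence "N + 1 < 2 ^ K" using N_FB FB8 by linarith
    thus ?thesis by (rule mult_less_mono1) simp
   qed
   finally show ?thesis by (simp add: pow_b)
  qed
  hence kb: "alu b Plus k 1 = Suc k" using alu_Plus[of k 1] by simp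
  have "sem b tally_body \<tau> = updm (CB + v) (Suc k) (upd 83 k (upd 82 (CB + v) \<tau>))"
  proof -
   have "fst \<tau> 39 = CB" using J by (simp add: bst_def)
   moreover have "alu b Plus CB v = CB + v" by (rule alu_Plus[OF ab])
   ultimately show ?thesis
    by (simp add: tally_body_def reg alu_ShiftR v_def[symmetric] Cv kv kb del: alu.simps One_nat_def)
  qed
  moreover have "bst all_keys (stored D) (tally M (insert (x, d) P)) (updm (CB + v) (Suc k) (upd 83 k (upd 82 (CB + v) \<tau>)))"
  proof -
   let ?\<tau> = "upd 83 k (upd 82 (CB + v) \<tau>)"
   have "bst all_keys (stored D) (tally M P) ?\<tau>" using J by (simp add: bst_upd)
   moreover have "ready (updm (CB + v) (Suc k) ?\<tau>) (fst ?\<tau> rFree) all_keys (stored D)"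
   proof -
    have r: "ready ?\<tau> (fst ?\<tau> rFree) all_keys (stored D)" using bstD(1)[OF conjunct1[OF J]] by (simp add: ready_upd)
    have "dict_at (updm (CB + v) (Suc k) ?\<tau>) (fst ?\<tau> rFree) all_keys (stored D)"
    proof (rule dict_at_cong)
     show "dict_at ?\<tau> (fst ?\<tau> rFree) all_keys (stored D)" using readyD(2)[OF r] .
     show "snd (updm (CB + v) (Suc k) ?\<tau>) a = snd ?\<tau> a" if "a < 2 * n + 32 + 2 ^ (K + 3)" for a
      using that far(1) by simp
    qed simp_all
    thus ?thesis using r by (simp add: ready_def pars_def)
   qed
   ultimately show ?thesis unfolding bst_def tl by simp
  qed
  ultimately show "bst all_keys (stored D) (tally M (insert (x, d) P)) (sem b tally_body \<tau>) \<and> insert (x, d) P \<subseteq> pairs_set"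
   using J x by (simp add: pairs_set_def)
 qed
 thus ?thesis by simp
qed

text \<open>Larger shifts strictly decrease a nonzero prefix, so an item reaches \<open>v\<close>
  with one shift at most and pairs can be counted instead of items.\<close>

lemma cnt_pairs: "v \<noteq> 0 ==> card {(x, d) \<in> pairs_set. full x div 2 ^ d = v} = cnt v"
proof -
 assume v: "v \<noteq> 0"
 let ?S = "{(x, d) \<in> pairs_set. full x div 2 ^ d = v}"
 have less: "full x div 2 ^ d' < full x div 2 ^ d" if "d < d'" "full x div 2 ^ d \<noteq> 0" for x d d'
 proof -
  have "(2::nat) ^ d' = 2 ^ d * 2 ^ (d' - d)" using that(1) by (simp flip: power_add)
  hence "full x div 2 ^ d' = full x div 2 ^ d div 2 ^ (d' - d)" by (simp add: div_mult2_eq)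
  also have "\<dots> < full x div 2 ^ d" using that by (intro div_less_dividend one_less_power) auto
  finally show ?thesis .
 qed
 have "inj_on fst ?S"
 proof (rule inj_onI)
  fix a a' assume a: "a \<in> ?S" "a' \<in> ?S" "fst a = fst a'"
  obtain x d d' where e: "a = (x, d)" "a' = (x, d')" using a(3) by (metis prod.collapse)
  have "full x div 2 ^ d = v" "full x div 2 ^ d' = v" using a e by auto
  hence "d = d'" using less[of d d' x] less[of d' d x] v by (cases d d' rule: linorder_cases) auto
  thus "a = a'" using e by simp
 qed
 hence "card ?S = card (fst ` ?S)" by (simp add: card_image)
 also have "fst ` ?S = {x. x < N \<and> (\<exists>d<K. full x div 2 ^ d = v)}" by (force simp: pairs_set_def)
 finally show ?thesis by (simp add: cnt_def)
qed

lemma internal_witness: "internal v ==> \<exists>(x, d)\<in>pairs_set. full x div 2 ^ d = v"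
proof -
 assume v: "internal v"
 hence "card {(x, d) \<in> pairs_set. full x div 2 ^ d = v} \<noteq> 0" by (simp add: cnt_pairs internal_def)
 hence "{(x, d) \<in> pairs_set. full x div 2 ^ d = v} \<noteq> {}" by force
 thus ?thesis by auto
qed

lemma internal_less: "internal v ==> v < 2 ^ FB"
 using internal_witness[of v] prefix_less by (auto simp: pairs_set_def)

lemma cts_correct:
 assumes s: "bst all_keys (stored D) M ms" and D: "pts_keys \<subseteq> D" "D \<subseteq> all_keys"
  and M: "\<And>v. v < 2 ^ FB ==> v \<noteq> 0 ==> M (CB + v) = cnt v"
 shows "bst all_keys (stored (D \<union> cts_keys pairs_set)) M (sem b (each_pair cts_body) ms)"
proof -
 have "bst all_keys (stored (D \<union> cts_keys pairs_set)) M (sem b (each_pair cts_body) ms) \<and> pairs_set \<subseteq> pairs_set"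
 proof (rule pairs_loop[where J="\<lambda>P \<tau>. bst all_keys (stored (D \<union> cts_keys P)) M \<tau> \<and> P \<subseteq> pairs_set"])
  show "bst all_keys (stored (D \<union> cts_keys {})) M ms \<and> {} \<subseteq> pairs_set" using s by (simp add: cts_keys_def)
  show "\<exists>f Da V. ready \<tau> f Da V \<and> pts_in V"
   if "bst all_keys (stored (D \<union> cts_keys P)) M \<tau> \<and> P \<subseteq> pairs_set" for P \<tau>
  proof -
   have "cts_keys P \<subseteq> all_keys" using that by (auto simp: all_keys_def cts_keys_def)
   hence "pts_in (stored (D \<union> cts_keys P))" using D by (intro pts_in_stored) auto
   thus ?thesis using that by (auto simp: bst_def)
  qed
  show "bst all_keys (stored (D \<union> cts_keys P)) M \<tau>' \<and> P \<subseteq> pairs_set"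
   if "bst all_keys (stored (D \<union> cts_keys P)) M \<tau> \<and> P \<subseteq> pairs_set" "\<And>z. z \<notin> {40..44} \<union> {50..68} \<union> {81} ==> fst \<tau>' z = fst \<tau> z"
    "snd \<tau>' = snd \<tau>" for P \<tau> \<tau>'
   using that by (subst bst_cong[of _ \<tau>]) auto
  show "wr cts_body \<inter> {21, 25, 50, 51} = {}" by (auto simp: cts_body_def)
 next
  fix P \<tau> x d
  assume J: "bst all_keys (stored (D \<union> cts_keys P)) M \<tau> \<and> P \<subseteq> pairs_set" and reg: "fst \<tau> rFull = full x" "fst \<tau> 81 = d"
   and x: "x < N" "d < K" and new: "(x, d) \<notin> P"
  define v where "v = full x div 2 ^ d"
  have v: "v < 2 ^ FB" unfolding v_def by (rule prefix_less[OF x(1)])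
  have FK: "(2::nat) ^ FB \<le> 2 ^ K" using FB8 by linarith
  have ab: "CB + v < 2 ^ b" using v FK far(2,3) by linarith
  let ?\<tau> = "upd rVal (M (CB + v)) (upd 82 v \<tau>)"
  let ?put = "put (Cn 8 [*] Rg 82 [+] Cn 4)"
  have pre: "sem b (Set 82 (Rg rFull [>>] Rg 81) ;; Ld rVal (Rg 39 [+] Rg 82)) \<tau> = ?\<tau>"
  proof -
   have "fst \<tau> 39 = CB" using J by (simp add: bst_def)
   moreover have "alu b Plus CB v = CB + v" by (rule alu_Plus[OF ab])
   moreover have "snd \<tau> (CB + v) = M (CB + v)" using J far(1) by (simp add: bst_def)
   ultimately show ?thesis by (simp add: reg alu_ShiftR v_def[symmetric] del: alu.simps)
  qed
  have s1: "bst all_keys (stored (D \<union> cts_keys P)) M ?\<tau>" using J by (simp add: bst_upd)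
  have cond: "eval b ((Rg rS [<] Rg rVal) [*] (Cn 0 [<] Rg 82)) (fst ?\<tau>) \<noteq> 0 \<longleftrightarrow> internal v"
  proof -
   have "fst \<tau> rS = s" using bstD(2)[OF conjunct1[OF J]] by (simp add: pars_def)
   hence "eval b ((Rg rS [<] Rg rVal) [*] (Cn 0 [<] Rg 82)) (fst ?\<tau>) =
     alu b Times (of_bool (s < M (CB + v))) (of_bool (0 < v))"
    by (simp add: alu_bool del: alu.simps)
   moreover have "alu b Times (of_bool p) (of_bool q) \<noteq> 0 \<longleftrightarrow> p \<and> q" for p q
    using small[of 1] by (cases p; cases q) (simp_all add: alu_Times)
   moreover have "s < M (CB + v) \<and> 0 < v \<longleftrightarrow> internal v"
    using M[OF v] by (cases "v = 0") (simp_all add: internal_def)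
   ultimately show ?thesis by (simp only:)
  qed
  have body: "sem b cts_body \<tau> = (if internal v then sem b ?put ?\<tau> else ?\<tau>)"
  proof -
   have "sem b cts_body \<tau> = sem b (Cond ((Rg rS [<] Rg rVal) [*] (Cn 0 [<] Rg 82)) ?put Skip) ?\<tau>"
    unfolding pre[symmetric] cts_body_def by (simp only: seq_step)
   thus ?thesis unfolding sem.simps(1,6) by (simp only: cond)
  qed
  have xs: "insert (x, d) P \<subseteq> pairs_set" using J x by (simp add: pairs_set_def)
  have "bst all_keys (stored (D \<union> cts_keys (insert (x, d) P))) M (sem b cts_body \<tau>)"
  proof (cases "internal v")
   case True
   have k: "8 * v + 4 < 2 ^ K" using v FB8 by linarith
   have "v \<in> {v. internal v \<and> (\<exists>(x, d)\<in>pairs_set. full x div 2 ^ d = v)}"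
    using True internal_witness by blast
   hence mem: "8 * v + 4 \<in> all_keys" unfolding all_keys_def cts_keys_def by blast
   have "bst all_keys ((stored (D \<union> cts_keys P))(8 * v + 4 := M (CB + v))) M (sem b ?put ?\<tau>)"
    by (rule put_correct[OF s1 _ k mem]) (simp_all add: key_eval[OF k] del: alu.simps)
   moreover have "M (CB + v) = cnt v" using True M[OF v] by (simp add: internal_def)
   moreover have "insert (8 * v + 4) (D \<union> cts_keys P) = D \<union> cts_keys (insert (x, d) P)"
    using True by (auto simp: cts_keys_def v_def)
   ultimately show ?thesis using True by (simp add: body stored_insert)
  next
   case False
   hence "cts_keys (insert (x, d) P) = cts_keys P" by (auto simp: cts_keys_def v_def)
   thus ?thesis using False s1 by (simp add: body)
  qed
  thus "bst all_keys (stored (D \<union> cts_keys (insert (x, d) P))) M (sem b cts_body \<tau>) \<and> insert (x, d) P \<subseteq> pairs_set"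
   using xs by simp
 qed
 thus ?thesis by simp
qed

definition ends_ok :: "(nat \<times> nat) set => (nat => nat) => bool" where
 "ends_ok P V \<longleftrightarrow> (\<forall>(\<tau>, j)\<in>P.
  (\<forall>j'<m. j' \<noteq> j --> chain_end (table s \<rho> \<tau>) s j' \<noteq> chain_end (table s \<rho> \<tau>) s j) -->
  V (8 * (chain_end (table s \<rho> \<tau>) s j * nt + \<tau>) + 5) = j)"

text \<open>Equal keys mean equal tables and equal ends, so a chain with a unique end is never
  overwritten.\<close>

lemma ends_ok_step:
 assumes P: "ends_ok P V" "P \<subseteq> {..<nt} \<times> {..<m}" and \<tau>: "\<tau> < nt" and j: "j < m" "(\<tau>, j) \<notin> P"
 shows "ends_ok (insert (\<tau>, j) P) (V(8 * (chain_end (table s \<rho> \<tau>) s j * nt + \<tau>) + 5 := j))"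
proof -
 let ?e = "\<lambda>\<tau> j. chain_end (table s \<rho> \<tau>) s j"
 have old: "(V(8 * (?e \<tau> j * nt + \<tau>) + 5 := j)) (8 * (?e \<tau>' j' * nt + \<tau>') + 5) = j'"
  if m: "(\<tau>', j') \<in> P" and u: "\<forall>j''<m. j'' \<noteq> j' --> ?e \<tau>' j'' \<noteq> ?e \<tau>' j'" for \<tau>' j'
 proof -
  have b: "\<tau>' < nt" "j' < m" using m P(2) by auto
  have "?e \<tau> j * nt + \<tau> \<noteq> ?e \<tau>' j' * nt + \<tau>'"
  proof
   assume eq: "?e \<tau> j * nt + \<tau> = ?e \<tau>' j' * nt + \<tau>'"
   have "\<tau> = (?e \<tau> j * nt + \<tau>) mod nt" "\<tau>' = (?e \<tau>' j' * nt + \<tau>') mod nt" using \<tau> b by simp_all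
   hence t: "\<tau> = \<tau>'" using eq by simp
   hence "?e \<tau>' j = ?e \<tau>' j'" using eq nt_pos by simp
   moreover have "j \<noteq> j'" using t m j(2) by auto
   ultimately show False using u j(1) by blast
  qed
  hence "8 * (?e \<tau>' j' * nt + \<tau>') + 5 \<noteq> 8 * (?e \<tau> j * nt + \<tau>) + 5" by simp
  moreover have "V (8 * (?e \<tau>' j' * nt + \<tau>') + 5) = j'"
   using P(1) m u unfolding ends_ok_def by blast
  ultimately show ?thesis by simp
 qed
 show ?thesis unfolding ends_ok_def
 proof (intro ballI, clarify)
  fix \<tau>' j'
  assume m: "(\<tau>', j') \<in> insert (\<tau>, j) P" and u: "\<forall>j''<m. j'' \<noteq> j' --> ?e \<tau>' j'' \<noteq> ?e \<tau>' j'"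
  show "(V(8 * (?e \<tau> j * nt + \<tau>) + 5 := j)) (8 * (?e \<tau>' j' * nt + \<tau>') + 5) = j'"
  proof (cases "(\<tau>', j') \<in> P")
   case True
   thus ?thesis by (rule old[OF _ u])
  next
   case False
   hence "\<tau>' = \<tau>" "j' = j" using m by auto
   thus ?thesis by simp
  qed
 qed
qed

lemma ends_correct:
 assumes s: "bst all_keys V0 M ms" and V0: "pts_in V0" "words_in V0 \<rho>" "counts_in V0"
 shows "\<exists>V. bst all_keys V M (sem b ends_com ms) \<and> pts_in V \<and> words_in V \<rho> \<and> counts_in V \<and> ends_in V \<rho>"
proof -
 \<comment> \<open>The stored function is existential: only its values outside residue 5 and those
   for unique ends are pinned down.\<close>
 define G where "G P \<tau>1 \<longleftrightarrow> (\<exists>V. bst all_keys V M \<tau>1 \<and> (\<forall>k. k mod 8 \<noteq> 5 --> V k = V0 k) \<and> ends_ok P V)" for P \<tau>1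
 have keep: "pts_in V \<and> words_in V \<rho> \<and> counts_in V" if "\<forall>k. k mod 8 \<noteq> 5 --> V k = V0 k" for V
 proof -
  have "(8 * i + 1) mod 8 \<noteq> 5" "(8 * i + 2) mod 8 \<noteq> 5" "(8 * i + 3) mod 8 \<noteq> 5" "(8 * i + 4) mod 8 \<noteq> 5" for i :: nat
   by presburger+
  hence "V (8 * i + 1) = V0 (8 * i + 1)" "V (8 * i + 2) = V0 (8 * i + 2)" "V (8 * i + 3) = V0 (8 * i + 3)"
   "V (8 * i + 4) = V0 (8 * i + 4)" for i using that by blast+
  thus ?thesis using V0 unfolding pts_in_def words_in_def counts_in_def by simp
 qed
 have cong: "G P \<tau>'" if "G P \<tau>1" "\<And>z. z \<in> {20..39} \<union> {rFree} ==> fst \<tau>' z = fst \<tau>1 z" "snd \<tau>' = snd \<tau>1" for P \<tau>1 \<tau>'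
  using that bst_cong[of \<tau>' \<tau>1] unfolding G_def by simp
 have reg: "fst \<tau>1 rNt = nt" "fst \<tau>1 35 = m" if "G P \<tau>1" for P \<tau>1
 proof -
  obtain V where "bst all_keys V M \<tau>1" using \<open>G P \<tau>1\<close> unfolding G_def by blast
  thus "fst \<tau>1 rNt = nt" "fst \<tau>1 35 = m" by (auto simp: bst_def ready_def pars_def)
 qed
 let ?B = "Set rHy (Rg 84) ;; walk_com (Cn 1) ;; Set rVal (Rg 84) ;;
  put (Cn 8 [*] (Rg rHy [*] Rg rNt [+] Rg rHt) [+] Cn 5)"
 have step: "G (insert (\<tau>, j) P) (sem b ?B \<tau>1)"
  if "G P \<tau>1" and P: "P \<subseteq> {..<nt} \<times> {..<m}" "(\<tau>, j) \<notin> P" and \<tau>: "fst \<tau>1 rHt = \<tau>" "\<tau> < nt" and j: "fst \<tau>1 84 = j" "j < m" for P \<tau>1 \<tau> j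
 proof -
  obtain V where s1: "bst all_keys V M \<tau>1" and V: "\<forall>k. k mod 8 \<noteq> 5 --> V k = V0 k" and ok: "ends_ok P V"
   using \<open>G P \<tau>1\<close> unfolding G_def by blast
  note kV = keep[OF V]
  let ?e = "chain_end (table s \<rho> \<tau>) s j"
  define \<tau>2 where "\<tau>2 = upd rHy j \<tau>1"
  define \<tau>3 where "\<tau>3 = sem b (walk_com (Cn 1)) \<tau>2"
  define \<tau>4 where "\<tau>4 = upd rVal j \<tau>3"
  have s2: "bst all_keys V M \<tau>2" using s1 by (simp add: \<tau>2_def bst_upd)
  have s3: "bst all_keys V M \<tau>3" unfolding \<tau>3_def using s2 by (rule bst_frame) auto
  have s4: "bst all_keys V M \<tau>4" using s3 by (simp add: \<tau>4_def bst_upd)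
  have y3: "fst \<tau>3 rHy = ?e" unfolding \<tau>3_def
   by (rule walk_correct[OF bstD(1)[OF s2]]) (use kV \<tau> in \<open>simp_all add: \<tau>2_def\<close>)
  have k3: "fst \<tau>3 rHt = \<tau>" "fst \<tau>3 84 = j" unfolding \<tau>3_def by (simp_all add: \<tau>2_def \<tau> j)
  have "?e < 2 ^ FB"
  proof (rule walk_less_FB)
   have "m \<le> N" by (simp add: m_def)
   thus "j < 2 ^ FB" using j(2) N_FB by linarith
  qed
  hence "?e * nt + \<tau> < 2 ^ FB * nt" using \<tau>(2) by (rule digits_less)
  hence "8 * (?e * nt + \<tau>) + 5 < 2 ^ FB * nt * 8" by simp
  hence k: "8 * (?e * nt + \<tau>) + 5 < 2 ^ K" using nt_FB by (rule less_le_trans)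
  have mem: "8 * (?e * nt + \<tau>) + 5 \<in> all_keys"
   using \<tau>(2) j(2) unfolding all_keys_def ends_keys_def by (intro UnI2 image_eqI[of _ _ "(\<tau>, j)"]) auto
  have kb: "?e * nt + \<tau> < 2 ^ b"
  proof (rule less_b)
   have "x \<le> 8 * x + 5" for x :: nat by simp
   thus "?e * nt + \<tau> \<le> 2 ^ K" using k by (meson le_trans less_imp_le)
  qed
  have nt4: "fst \<tau>4 rNt = nt" using bstD(2)[OF s4] by (simp add: pars_def)
  have ev: "alu b Plus (alu b Times ?e nt) \<tau> = ?e * nt + \<tau>"
  proof -
   have "?e * nt < 2 ^ b" using kb by (rule add_lessD1)
   thus ?thesis using alu_Times alu_Plus[OF kb] by simp
  qed
  have s5: "bst all_keys (V(8 * (?e * nt + \<tau>) + 5 := j)) M (sem b (put (Cn 8 [*] (Rg rHy [*] Rg rNt [+] Rg rHt) [+] Cn 5)) \<tau>4)"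
  proof (rule put_correct[OF s4 _ k mem])
   have c: "take_bit b (8::nat) = 8" "take_bit b (5::nat) = 5" by simp_all
   have r4: "fst \<tau>4 rHy = ?e" "fst \<tau>4 rHt = \<tau>" by (simp_all add: \<tau>4_def y3 k3)
   show "eval b (Cn 8 [*] (Rg rHy [*] Rg rNt [+] Rg rHt) [+] Cn 5) (fst \<tau>4) = 8 * (?e * nt + \<tau>) + 5"
    unfolding eval.simps r4 nt4 c ev by (rule key_eval[OF k])
  qed (simp add: \<tau>4_def)
  have e: "sem b ?B \<tau>1 = sem b (put (Cn 8 [*] (Rg rHy [*] Rg rNt [+] Rg rHt) [+] Cn 5)) \<tau>4"
  proof -
   have "sem b (Set rHy (Rg 84)) \<tau>1 = \<tau>2" by (simp add: \<tau>2_def j)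
   moreover have "sem b (Set rVal (Rg 84)) \<tau>3 = \<tau>4" by (simp add: \<tau>4_def k3)
   ultimately show ?thesis unfolding seq_step \<tau>3_def by simp
  qed
  have "(V(8 * (?e * nt + \<tau>) + 5 := j)) k = V0 k" if "k mod 8 \<noteq> 5" for k
  proof -
   have "(8 * (?e * nt + \<tau>) + 5) mod 8 = 5" by presburger
   hence "k \<noteq> 8 * (?e * nt + \<tau>) + 5" using that by metis
   thus ?thesis using V that by simp
  qed
  thus ?thesis unfolding G_def e
   using s5 ends_ok_step[OF ok P(1) \<tau>(2) j(2) P(2)] by blast
 qed
 have G0: "G {} ms" unfolding G_def using s by (auto simp: ends_ok_def)
 have "G ({..<nt} \<times> {..<m}) (sem b ends_com ms)"
  unfolding ends_com_def
 proof (rule sem_For_For)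
  show "G P (upd z v \<tau>1)" if "G P \<tau>1" "z \<in> {rHt, 84}" for P \<tau>1 z v
   using that(2) by (intro cong[OF that(1)]) auto
  show "G (insert (\<tau>, j) P) (sem b ?B \<tau>1)"
   if "G P \<tau>1" "fst \<tau>1 rHt = \<tau>" "fst \<tau>1 84 = j" "\<tau> < nt" "j < m" "(\<tau>, j) \<notin> P" "P \<subseteq> {..<nt} \<times> {..<m}" for P \<tau>1 \<tau> j
   using step[OF that(1,7,6,2,4,3,5)] .
 qed (use G0 reg in auto)
 then obtain V where V: "bst all_keys V M (sem b ends_com ms)" "\<forall>k. k mod 8 \<noteq> 5 --> V k = V0 k"
  "ends_ok ({..<nt} \<times> {..<m}) V" unfolding G_def by blast
 have "ends_in V \<rho>" using V(3) unfolding ends_ok_def ends_in_def by auto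
 thus ?thesis using V(1) keep[OF V(2)] by blast
qed

text \<open>Every internal node receives more than \<open>s\<close> of the \<open>N * K\<close>
  pairs of an item and a shift, and different nodes receive different pairs. Hence there are at most
  \<open>N * K div s\<close> stored counts.\<close>

lemma all_keys_card: "finite all_keys" "card all_keys \<le> 2 * n + R + N * K div s + nt * m"
proof -
 have fin: "finite {v. internal v}" by (rule finite_subset[of _ "{..<2 ^ FB}"]) (auto dest: internal_less)
 have "card {v. internal v} * s \<le> card pairs_set"
 proof -
  have fp: "finite pairs_set" by (simp add: pairs_set_def)
  let ?g = "\<lambda>v. {(x, d) \<in> pairs_set. full x div 2 ^ d = v}"
  have "card {v. internal v} * s = (\<Sum>v | internal v. s)" by simp
  also have "\<dots> \<le> (\<Sum>v | internal v. card (?g v))"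
   by (rule sum_mono) (auto simp: internal_def cnt_pairs)
  also have "\<dots> = card (\<Union>v\<in>{v. internal v}. ?g v)"
   using fin fp by (intro card_UN_disjoint[symmetric]) (auto intro: finite_subset[OF _ fp])
  also have "\<dots> \<le> card pairs_set" using fp by (intro card_mono) auto
  finally show ?thesis .
 qed
 hence int: "card {v. internal v} \<le> N * K div s"
  using s_props(1) by (simp add: pairs_set_def less_eq_div_iff_mult_less_eq)
 have f: "finite pts_keys" "finite (wds_keys 0)" "finite (cts_keys pairs_set)" "finite ends_keys"
  using fin by (auto simp: crd_keys_def wds_keys_def cts_keys_def ends_keys_def)
 thus "finite all_keys" by (simp add: all_keys_def)
 have "card pts_keys \<le> 2 * n"
 proof -
  have "card (crd_keys c 0) \<le> n" for c unfolding crd_keys_def using card_image_le[of "{0..<n}"] by simp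
  from this[of 0] this[of 1] show ?thesis using card_Un_le[of "crd_keys 0 0" "crd_keys 1 0"] by linarith
 qed
 moreover have "card (wds_keys 0) \<le> R"
  unfolding wds_keys_def using card_image_le[of "{0..<R}"] by simp
 moreover have "card (cts_keys pairs_set) \<le> card {v. internal v}"
 proof -
  have "card (cts_keys pairs_set) \<le> card {v. internal v \<and> (\<exists>(x, d)\<in>pairs_set. full x div 2 ^ d = v)}"
   unfolding cts_keys_def using fin by (intro card_image_le) simp
  also have "\<dots> \<le> card {v. internal v}" using fin by (intro card_mono) auto
  finally show ?thesis .
 qed
 moreover have "card ends_keys \<le> nt * m"
  unfolding ends_keys_def using card_image_le[of "{..<nt} \<times> {..<m}"] by simp
 moreover have "card all_keys \<le> card pts_keys + card (wds_keys 0) + card (cts_keys pairs_set) + card ends_keys"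
  unfolding all_keys_def
  using card_Un_le[of "pts_keys \<union> wds_keys 0 \<union> cts_keys pairs_set" ends_keys]
   card_Un_le[of "pts_keys \<union> wds_keys 0" "cts_keys pairs_set"] card_Un_le[of "pts_keys" "wds_keys 0"]
  by linarith
 ultimately show "card all_keys \<le> 2 * n + R + N * K div s + nt * m" using int by linarith
qed

lemma header_correct:
 assumes s: "bst D V M ms"
 defines "ms' \<equiv> sem b header_com ms"
 shows "fst ms' 0 = 2 * n + 32 + fst ms rFree" "snd ms' 0 = 2 * n + 32" "header (snd ms')"
  and "dict K (\<lambda>a. snd ms' (2 * n + 32 + a)) (fst ms rFree) D V"
proof -
 have d: "dict_at ms (fst ms rFree) D V" using bstD(1)[OF s] by (simp add: ready_def)
 have p: "pars ms" by (rule bstD(2)[OF s])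
 have "fst ms rFree \<le> 2 ^ (K + 2)" using d dict_free_le unfolding dict_at_def by blast
 also have "(2::nat) ^ (K + 2) \<le> 2 ^ (K + 3)" by (rule power_increasing) auto
 finally have fb: "2 * n + 32 + fst ms rFree < 2 ^ b" using far by linarith
 have base: "fst ms rBase = 2 * n + 32" "fst ms rK = K" using d by (simp_all add: dict_at_def)
 have c20: "take_bit b c = c" if "c < 20" for c :: nat using that small[of c] by (simp add: take_bit_nat_eq_self)
 show "fst ms' 0 = 2 * n + 32 + fst ms rFree"
  using alu_Plus[OF fb] by (simp add: ms'_def header_com_def base del: alu.simps)
 show "snd ms' 0 = 2 * n + 32" by (simp add: ms'_def header_com_def c20 base)
 show "header (snd ms')" using p unfolding header_def pars_def by (simp add: ms'_def header_com_def c20 base)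
 have hi: "snd ms' a = snd ms a" if "14 \<le> a" for a using that by (simp add: ms'_def header_com_def c20)
 show "dict K (\<lambda>a. snd ms' (2 * n + 32 + a)) (fst ms rFree) D V" using d by (simp add: dict_at_def hi)
qed

theorem fill_correct:
 assumes s: "bst all_keys (\<lambda>_. 0) M ms"
  and M: "\<And>i. i < n ==> M (2 * i) + 1 = px i \<and> M (2 * i + 1) + 1 = py i" "\<And>i. i < R ==> M (RB + i) = \<rho> i"
   "\<And>v. v < 2 ^ FB ==> M (CB + v) = 0"
 defines "ms' \<equiv> sem b fill_com ms"
 shows "\<exists>f V. dict K (\<lambda>a. snd ms' (2 * n + 32 + a)) f all_keys V \<and> fst ms' 0 = 2 * n + 32 + f \<and>
  snd ms' 0 = 2 * n + 32 \<and> header (snd ms') \<and> pts_in V \<and> words_in V \<rho> \<and> counts_in V \<and> ends_in V \<rho>"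
proof -
 define ms1 where "ms1 = sem b (pts_com 0 ;; pts_com 1) ms"
 define ms2 where "ms2 = sem b wds_com ms1"
 define ms3 where "ms3 = sem b (each_pair tally_body) ms2"
 define ms4 where "ms4 = sem b (each_pair cts_body) ms3"
 define ms5 where "ms5 = sem b ends_com ms4"
 let ?D = "pts_keys \<union> wds_keys 0" and ?M = "tally M pairs_set"
 let ?E = "?D \<union> cts_keys pairs_set"
 have "stored {} = (\<lambda>_. 0)" by (simp add: fun_eq_iff stored_def)
 hence "bst all_keys (stored ({} \<union> crd_keys 0 0)) M (sem b (pts_com 0) ms)"
  using s M(1) by (intro pts_correct) simp_all
 hence "bst all_keys (stored pts_keys) M ms1"
  unfolding ms1_def using pts_correct[of "crd_keys 0 0" M "sem b (pts_com 0) ms" 1] M(1) by simp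
 hence s2: "bst all_keys (stored ?D) M ms2" unfolding ms2_def using M(2) by (intro wds_correct)
 have D: "pts_keys \<subseteq> ?D" "?D \<subseteq> all_keys" by (auto simp: all_keys_def)
 have s3: "bst all_keys (stored ?D) ?M ms3" unfolding ms3_def by (rule tally_correct[OF s2 D M(3)])
 have s4: "bst all_keys (stored ?E) ?M ms4" unfolding ms4_def
  by (rule cts_correct[OF s3 D]) (simp add: tally_def cnt_pairs)
 have pts: "pts_in (stored ?E)" by (rule pts_in_stored) (auto simp: all_keys_def)
 have d: "(8 * i + 3) div 8 = i" "(8 * i + 3) mod 8 = 3" "(8 * i + 4) div 8 = i" "(8 * i + 4) mod 8 = 4" for i :: nat
  by presburger+
 have wds: "words_in (stored ?E) \<rho>"
 proof -
  have "8 * i + 3 \<in> ?E" if "i < R" for i using that by (auto simp: wds_keys_def)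
  thus ?thesis by (simp add: words_in_def stored_def Let_def d)
 qed
 have cts: "counts_in (stored ?E)"
 proof -
  have "8 * v + 4 \<in> ?E \<longleftrightarrow> internal v" for v
  proof
   assume "8 * v + 4 \<in> ?E"
   moreover have "8 * v + 4 \<noteq> 8 * i + 1" "8 * v + 4 \<noteq> 8 * i + 2" "8 * v + 4 \<noteq> 8 * i + 3" for i by presburger+
   ultimately show "internal v" by (auto simp: crd_keys_def wds_keys_def cts_keys_def)
  next
   assume "internal v"
   thus "8 * v + 4 \<in> ?E" using internal_witness unfolding cts_keys_def by blast
  qed
  thus ?thesis by (simp add: counts_in_def stored_def Let_def d)
 qed
 obtain V where V: "bst all_keys V ?M ms5" "pts_in V" "words_in V \<rho>" "counts_in V" "ends_in V \<rho>"
  using ends_correct[OF s4 pts wds cts] unfolding ms5_def by blast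
 have "ms' = sem b header_com ms5"
  by (simp only: ms'_def fill_com_def seq_step ms1_def ms2_def ms3_def ms4_def ms5_def)
 thus ?thesis using header_correct[OF V(1)] V(2-5) by blast
qed

end

text \<open>Halving until 0 gives the binary length. The loop runs \<open>n\<close> times because
  \<open>n\<close> is a bound at hand, which is negligible for the construction.\<close>

definition bits_com :: com where
 "bits_com = Set 10 (Rg 0) ;; Set 3 (Cn 0) ;;
  For 9 0 (Cond (Rg 10) (Set 3 (Rg 3 [+] Cn 1) ;; Set 10 (Rg 10 [div] Cn 2)) Skip)"

definition sizes_com :: "nat => com" where
 "sizes_com e = Set 21 (Cn (e + 40) [*] (Rg 1 [+] Rg 3)) ;; Set rW (Rg 1 [+] Cn 1) ;;
  Set rNP (Cn 1 [<<] Rg 3) ;; Set rL (Cn 1) ;; Set rS (Cn 1)"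

definition round_com :: com where
 "round_com = For 9 rW (Cond (Rg rL [<] Rg rW) (Set rL (Cn 2 [*] Rg rL)) Skip)"

definition root_com :: com where
 "root_com = For 9 3 (Set 5 (Cn 2 [*] Rg rS) ;;
  Cond (Rg 2 [<] (Rg 5 [*] Rg 5 [*] Rg 5 [*] Rg 5)) Skip (Set rS (Rg 5)))"

definition params_com :: "nat => com" where
 "params_com e =
  Set rL6 (Rg rL [*] Rg rL [*] Rg rL [*] Rg rL [*] Rg rL [*] Rg rL) ;;
  Set rN (Rg rNP [*] Rg rNP [*] Rg rNP [*] Rg rL6) ;;
  Set rNt (Cn 16 [*] Rg rS [*] Rg rK [*] Cn (e + 1)) ;;
  Set rPW (Cn 1 [<<] Rg rW) ;; Set rPAB (Cn 1 [<<] (Cn 2 [*] Rg 1 [+] Cn 2)) ;;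
  Set rKB (Cn 2 [*] Rg 1 [+] Cn 2 [+] Cn 3 [*] Rg 3) ;; Set rTwo (Cn 2) ;;
  Set rMB ((Cn 1 [<<] Rg rK) [*] Cn 64) ;;
  Set 35 (Rg rN [div] (Cn 4 [*] Rg rS [*] Rg rS)) ;; Set 36 (Rg 0) ;;
  Set 37 (Rg rNt [*] (Rg rS [*] (Rg rK [+] Cn 1))) ;;
  Set 38 ((Cn 1 [<<] Rg rK) [*] Cn 32) ;; Set 39 ((Cn 1 [<<] Rg rK) [*] Cn 16) ;;
  Set rBase (Cn 2 [*] Rg 0 [+] Cn 32) ;; Set rFree (Cn 4)"

definition init_com :: "nat => com" where
 "init_com e = bits_com ;; sizes_com e ;; round_com ;; root_com ;; params_com e"

lemma wr_init [simp]: "wr bits_com = {3, 9, 10}" "wr (sizes_com e) = {21, 22, 23, 24, 26}" "wr round_com = {9, 24}"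
 "wr root_com = {5, 9, 26}" "wr (params_com e) = {20} \<union> {25} \<union> {27..33} \<union> {35..39} \<union> {46}"
 by (auto simp: bits_com_def sizes_com_def round_com_def root_com_def params_com_def)

lemma stores_init [simp]: "\<not> stores bits_com" "\<not> stores (sizes_com e)" "\<not> stores round_com"
 "\<not> stores root_com" "\<not> stores (params_com e)"
 by (auto simp: bits_com_def sizes_com_def round_com_def root_com_def params_com_def)

context build_data
begin

lemma bits_correct:
 assumes "fst ms 0 = n"
 shows "fst (sem b bits_com ms) 3 = q0"
proof -
 have n0: "n \<noteq> 0" using n2 by simp
 have q: "2 ^ (q0 - 1) \<le> n" "n < 2 ^ q0" using floorlog_bounds[of n 2] n0 unfolding q0_def by auto
 have z: "n div 2 ^ j = 0 \<longleftrightarrow> q0 \<le> j" for j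
 proof
  assume "n div 2 ^ j = 0"
  hence "n < 2 ^ j" by (simp add: div_eq_0_iff)
  hence "(2::nat) ^ (q0 - 1) < 2 ^ j" using q(1) by linarith
  hence "q0 - 1 < j" by simp
  thus "q0 \<le> j" by simp
 next
  assume "q0 \<le> j"
  hence "(2::nat) ^ q0 \<le> 2 ^ j" by (intro power_increasing) auto
  hence "n < 2 ^ j" using q(2) by linarith
  thus "n div 2 ^ j = 0" by simp
 qed
 have qn: "q0 \<le> n" using z[of n] less_exp[of n] by simp
 have qb: "q0 + 1 < 2 ^ b"
 proof -
  have "q0 + 1 \<le> 40 * Z" "40 * Z \<le> K" using w1 by (simp_all add: Z_def K_eq)
  hence "q0 + 1 \<le> K" by linarith
  thus ?thesis using less_exp[of K] by (intro less_b) linarith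
 qed
 define I where "I i \<tau> \<longleftrightarrow> fst \<tau> 10 = n div 2 ^ (n - i) \<and> fst \<tau> 3 = min (n - i) q0" for i and \<tau> :: st
 let ?B = "Cond (Rg 10) (Set 3 (Rg 3 [+] Cn 1) ;; Set 10 (Rg 10 [div] Cn 2)) Skip"
 let ?ms = "sem b (Set 10 (Rg 0) ;; Set 3 (Cn 0)) ms"
 have f: "fst ?ms 0 = n" using assms by simp
 have "I 0 (sem b (For 9 0 ?B) ?ms)"
 proof (rule sem_For_inv)
  show "I (fst ?ms 0) (upd 9 (fst ?ms 0) ?ms)" unfolding f using assms by (simp add: I_def)
 next
  fix i \<tau> assume "i < fst ?ms 0" and \<tau>: "I (Suc i) \<tau>"
  hence i: "n - i = Suc (n - Suc i)" using f by simp
  let ?j = "n - Suc i"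
  have h: "n div 2 ^ ?j div 2 = n div 2 ^ Suc ?j" by (rule div_exp_Suc)
  show "I i (sem b ?B (upd 9 i \<tau>))"
  proof (cases "q0 \<le> ?j")
   case True
   hence 1: "n div 2 ^ ?j = 0" "n div 2 ^ Suc ?j = 0" using z[of ?j] z[of "Suc ?j"] by (blast, simp)
   thus ?thesis using \<tau> True unfolding I_def i by simp
  next
   case False
   hence 1: "n div 2 ^ ?j \<noteq> 0" using z by blast
   have 2: "alu b Plus ?j 1 = Suc ?j" using alu_Plus[of ?j 1] qb False by simp
   have t2: "take_bit b (2::nat) = 2" "take_bit b (1::nat) = 1" by simp_all
   have r: "fst (upd 9 i \<tau>) 10 = n div 2 ^ ?j" "fst (upd 9 i \<tau>) 3 = ?j" using \<tau> False by (simp_all add: I_def)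
   have "sem b ?B (upd 9 i \<tau>) = upd 10 (n div 2 ^ Suc ?j) (upd 3 (Suc ?j) (upd 9 i \<tau>))"
   proof -
    have "sem b ?B (upd 9 i \<tau>) = sem b (Set 3 (Rg 3 [+] Cn 1) ;; Set 10 (Rg 10 [div] Cn 2)) (upd 9 i \<tau>)"
     unfolding sem.simps(6) eval.simps r using 1 by (simp del: sem.simps)
    also have "\<dots> = upd 10 (n div 2 ^ ?j div 2) (upd 3 (Suc ?j) (upd 9 i \<tau>))"
     unfolding sem.simps(2,5) eval.simps r t2 2 using r(1) by simp
    finally show ?thesis unfolding h .
   qed
   thus ?thesis using False unfolding I_def i by simp
  qed
 qed
 thus ?thesis using qn by (simp add: I_def bits_com_def)
qed

lemma round_correct:
 assumes "fst ms rW = W" "fst ms rL = 1"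
 shows "fst (sem b round_com ms) rL = L"
proof -
 define I where "I i \<tau> \<longleftrightarrow> fst \<tau> rL = Lfun (W - i) \<and> fst \<tau> rW = W" for i and \<tau> :: st
 have "2 * W < 2 ^ b"
 proof (rule less_b)
  have "2 * W \<le> 40 * Z" "40 * Z \<le> K" using Z3 by (simp_all add: W_def Z_def K_eq)
  hence "2 * W \<le> K" by linarith
  thus "2 * W \<le> 2 ^ K" using less_exp[of K] by linarith
 qed
 hence tw: "alu b Times 2 y = 2 * y" if "y < W" for y using that by (intro alu_Times) linarith
 have t2: "take_bit b (2::nat) = 2" by simp
 have "I 0 (sem b round_com ms)"
  unfolding round_com_def
 proof (rule sem_For_inv)
  show "I (fst ms rW) (upd 9 (fst ms rW) ms)" using assms by (simp add: I_def)
 next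
  fix i \<tau> assume "i < fst ms rW" and \<tau>: "I (Suc i) \<tau>"
  hence i: "W - i = Suc (W - Suc i)" using assms by simp
  show "I i (sem b (Cond (Rg rL [<] Rg rW) (Set rL (Cn 2 [*] Rg rL)) Skip) (upd 9 i \<tau>))"
   using \<tau> tw unfolding I_def i by (simp add: alu_bool t2 del: alu.simps)
 qed
 thus ?thesis by (simp add: I_def L_def)
qed

lemma sfun_le: "(sfun i) ^ 4 \<le> A"
 using A1 by (induction i) auto

lemma root_correct:
 assumes "fst ms 2 = A" "fst ms 3 = q0" "fst ms rS = 1"
 shows "fst (sem b root_com ms) rS = s"
proof -
 define I where "I i \<tau> \<longleftrightarrow> fst \<tau> rS = sfun (q0 - i) \<and> fst \<tau> 2 = A" for i and \<tau> :: st
 have nb: "16 * n < 2 ^ b"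
 proof -
  have "16 * n \<le> 16 * 2 ^ K" using n_less NP_N(1) N_FB FB8 by linarith
  also have "\<dots> < 2 ^ b" using far by (simp add: RB_def)
  finally show ?thesis .
 qed
 have "I 0 (sem b root_com ms)"
  unfolding root_com_def
 proof (rule sem_For_inv)
  show "I (fst ms 3) (upd 9 (fst ms 3) ms)" using assms by (simp add: I_def)
 next
  fix i \<tau> assume "i < fst ms 3" and \<tau>: "I (Suc i) \<tau>"
  hence i: "q0 - i = Suc (q0 - Suc i)" using assms by simp
  let ?t = "sfun (q0 - Suc i)"
  \<comment> \<open>A candidate exceeds the last accepted value by a factor 2, so its fourth power
    is at most \<open>16 * A\<close> and causes no overflow.\<close>
  have t4: "(2 * ?t) ^ 4 \<le> 16 * n" using sfun_le[of "q0 - Suc i"] An by (simp add: power_mult_distrib)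
  have p: "2 * ?t \<le> 16 * n" "2 * ?t * (2 * ?t) \<le> 16 * n" "2 * ?t * (2 * ?t) * (2 * ?t) \<le> 16 * n"
   "2 * ?t * (2 * ?t) * (2 * ?t) * (2 * ?t) = (2 * ?t) ^ 4"
  proof -
   show e: "2 * ?t * (2 * ?t) * (2 * ?t) * (2 * ?t) = (2 * ?t) ^ 4" by (simp add: power_numeral_reduce)
   show "2 * ?t \<le> 16 * n" "2 * ?t * (2 * ?t) \<le> 16 * n" "2 * ?t * (2 * ?t) * (2 * ?t) \<le> 16 * n"
    by (cases "?t = 0", simp, rule order_trans[OF _ t4], unfold e[symmetric], simp)+
  qed
  have ev: "alu b Times 2 ?t = 2 * ?t" "alu b Times (2 * ?t) (2 * ?t) = 2 * ?t * (2 * ?t)"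
   "alu b Times (2 * ?t * (2 * ?t)) (2 * ?t) = 2 * ?t * (2 * ?t) * (2 * ?t)"
   "alu b Times (2 * ?t * (2 * ?t) * (2 * ?t)) (2 * ?t) = (2 * ?t) ^ 4"
   using alu_Times[OF le_less_trans[OF p(1) nb]] alu_Times[OF le_less_trans[OF p(2) nb]] alu_Times[OF le_less_trans[OF p(3) nb]]
    alu_Times[of "2 * ?t * (2 * ?t) * (2 * ?t)" "2 * ?t", unfolded p(4), OF le_less_trans[OF t4 nb]]
   by (simp_all only:)
  have t2: "take_bit b (2::nat) = 2" by simp
  have r: "fst (upd 9 i \<tau>) rS = ?t" "fst (upd 9 i \<tau>) 2 = A" using \<tau> by (simp_all add: I_def)
  have "sem b (Set 5 (Cn 2 [*] Rg rS)) (upd 9 i \<tau>) = upd 5 (2 * ?t) (upd 9 i \<tau>)"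
   unfolding sem.simps(2) eval.simps r t2 ev ..
  moreover have "eval b (Rg 2 [<] (Rg 5 [*] Rg 5 [*] Rg 5 [*] Rg 5)) (fst (upd 5 (2 * ?t) (upd 9 i \<tau>))) = of_bool (A < (2 * ?t) ^ 4)"
  proof -
   have r': "fst (upd 5 (2 * ?t) (upd 9 i \<tau>)) 5 = 2 * ?t" "fst (upd 5 (2 * ?t) (upd 9 i \<tau>)) 2 = A" using r by simp_all
   show ?thesis unfolding eval.simps r' ev by (rule alu_bool)
  qed
  ultimately have E: "sem b (Set 5 (Cn 2 [*] Rg rS) ;; Cond (Rg 2 [<] (Rg 5 [*] Rg 5 [*] Rg 5 [*] Rg 5)) Skip (Set rS (Rg 5))) (upd 9 i \<tau>) =
    (if A < (2 * ?t) ^ 4 then upd 5 (2 * ?t) (upd 9 i \<tau>) else upd rS (2 * ?t) (upd 5 (2 * ?t) (upd 9 i \<tau>)))"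
   unfolding cond_step by (simp del: eval.simps(3))
  thus "I i (sem b (Set 5 (Cn 2 [*] Rg rS) ;; Cond (Rg 2 [<] (Rg 5 [*] Rg 5 [*] Rg 5 [*] Rg 5)) Skip (Set rS (Rg 5))) (upd 9 i \<tau>))"
   unfolding E I_def i sfun.simps using r by (simp add: not_less)
 qed
 thus ?thesis by (simp add: I_def s_def)
qed

lemma pow_bounds: "c \<le> 66 ==> c * 2 ^ K < (2::nat) ^ b" "n \<le> 2 ^ K" "q0 + 1 \<le> K" "w + 2 \<le> K" "e + 40 \<le> K"
 "W < b" "AB < b" "K < b" "q0 < b"
proof -
 show "c * 2 ^ K < (2::nat) ^ b" if "c \<le> 66"
 proof -
  have "(67::nat) \<le> 2 ^ 120" by simp
  hence "67 \<le> (2::nat) ^ K" using big_K by (rule order_trans)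
  hence "67 * 2 ^ K \<le> (2::nat) ^ b" unfolding pow_b by (rule mult_le_mono1)
  moreover have "c * 2 ^ K \<le> 66 * (2::nat) ^ K" using that by (rule mult_le_mono1)
  moreover have "(0::nat) < 2 ^ K" by simp
  ultimately show ?thesis by linarith
 qed
 show "n \<le> 2 ^ K" using n_less NP_N(1) N_FB FB8 by linarith
 have Z: "40 * Z \<le> K" by (simp add: K_eq)
 have Zd: "Z = w + q0" by (rule Z_def)
 show q: "q0 + 1 \<le> K" using Z w1 Zd by linarith
 show w: "w + 2 \<le> K" using Z w1 q0_2 Zd by linarith
 have "(e + 40) * 1 \<le> K" unfolding K_def using Z3 by (intro mult_le_mono2) simp
 thus "e + 40 \<le> K" by simp
 show "W < b" "K < b" "q0 < b" using q w K_120 by (simp_all add: b_def W_def)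
 show "AB < b" using Z q0_2 w1 Zd unfolding AB_def b_def by linarith
qed

lemma params_correct:
 assumes r: "fst ms 0 = n" "fst ms 1 = w" "fst ms 3 = q0" "fst ms 21 = K" "fst ms rW = W" "fst ms rNP = NP"
  "fst ms rL = L" "fst ms rS = s"
 defines "ms' \<equiv> sem b (params_com e) ms"
 shows "pars ms'" "fst ms' 35 = m" "fst ms' 36 = n" "fst ms' 37 = R" "fst ms' 38 = RB" "fst ms' 39 = CB"
  "fst ms' rBase = 2 * n + 32" "fst ms' rFree = 4" "snd ms' = snd ms"
proof -
 have T: "alu b Times x y = x * y" if "x * y \<le> 2 ^ K" for x y using that by (intro alu_Times less_b)
 have NK: "N \<le> 2 ^ K" using N_FB FB8 by linarith
 have L1: "1 \<le> L" using L_pos by simp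
 have s1: "1 \<le> s" by (rule s_props)
 have L6: "L ^ 6 \<le> N"
 proof -
  have "1 * L ^ 6 \<le> NP ^ 3 * L ^ 6" using NP_pos by (intro mult_le_mono1) simp
  thus ?thesis by (simp add: N_def)
 qed
 have pl: "L ^ i \<le> 2 ^ K" if "i \<le> 6" for i
 proof -
  have "L ^ i \<le> L ^ 6" using that L1 by (rule power_increasing)
  thus ?thesis using L6 NK by linarith
 qed
 have l: "alu b Times (L ^ i) L = L ^ Suc i" if "i < 6" for i
  using T[of "L ^ i" L] pl[of "Suc i"] that by (simp add: mult.commute)
 have l6: "alu b Times (alu b Times (alu b Times (alu b Times (alu b Times L L) L) L) L) L = L ^ 6"
  using l[of 1] l[of 2] l[of 3] l[of 4] l[of 5] by (simp add: eval_nat_numeral del: alu.simps)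
 have np: "alu b Times NP NP = NP * NP" "alu b Times (NP * NP) NP = NP * NP * NP"
  using T NP_N NP3 NK by (simp_all del: alu.simps add: mult.assoc)
 have N: "alu b Times (NP * NP * NP) (L ^ 6) = N"
  using T[of "NP * NP * NP" "L ^ 6"] NK by (simp add: N_def power3_eq_cube del: alu.simps)
 have ntK: "nt * 8 \<le> 2 ^ K"
 proof -
  have "1 * (nt * 8) \<le> 2 ^ FB * (nt * 8)" by (rule mult_le_mono1) simp
  also have "\<dots> \<le> 2 ^ K" using nt_FB by (simp only: mult.assoc)
  finally show ?thesis by simp
 qed
 have nt1: "16 * s \<le> nt" "16 * s * K \<le> nt"
 proof -
  have "16 * s * K * 1 \<le> nt" unfolding nt_def by (rule mult_le_mono2) simp
  thus "16 * s * K \<le> nt" by simp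
  have "16 * s * 1 \<le> 16 * s * K" using K_120 by (intro mult_le_mono2) simp
  thus "16 * s \<le> nt" using \<open>16 * s * K \<le> nt\<close> by linarith
 qed
 have t16: "alu b Times 16 s = 16 * s" using T nt1 ntK by (simp del: alu.simps)
 have t16K: "alu b Times (16 * s) K = 16 * s * K" using T nt1 ntK by (simp del: alu.simps)
 have nt: "alu b Times (16 * s * K) (e + 1) = nt" using T[of "16 * s * K" "e + 1"] ntK by (simp add: nt_def del: alu.simps)
 have "nt * 1 \<le> nt * (s * Suc K)" using s1 by (intro mult_le_mono2) simp
 hence ntR: "nt \<le> R" by (simp add: R_def)
 have RK: "R + 1 \<le> 2 ^ K" using R_le by simp
 have sk: "s * Suc K \<le> R" using nt_pos unfolding R_def by simp
 have R: "alu b Times nt (alu b Times s (alu b Plus K 1)) = R"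
 proof -
  have "alu b Plus K 1 = K + 1" using less_exp[of K] by (intro alu_Plus less_b) linarith
  moreover have "alu b Times s (K + 1) = s * (K + 1)" using sk RK by (intro T) simp
  moreover have "alu b Times nt (s * (K + 1)) = R" using RK T[of nt "s * (K + 1)"] by (simp add: R_def del: alu.simps)
  ultimately show ?thesis by simp
 qed
 have sh: "alu b ShiftL 1 W = 2 ^ W" "alu b ShiftL 1 AB = 2 ^ AB" "alu b ShiftL 1 K = 2 ^ K"
  using pow_bounds(6-8) by (simp_all add: alu_ShiftL)
 have w2: "alu b Times 2 w = 2 * w" "alu b Plus (2 * w) 2 = AB" "alu b Times 3 q0 = 3 * q0" "alu b Plus AB (3 * q0) = KB"
 proof -
  have "K < 2 ^ K" by (rule less_exp)
  moreover have "KB \<le> 40 * Z" "40 * Z \<le> K" using w1 by (simp_all add: KB_def AB_def Z_def K_eq)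
  ultimately have KB: "KB < 2 ^ b" by (intro less_b) linarith
  thus "alu b Times 2 w = 2 * w" "alu b Plus (2 * w) 2 = AB" "alu b Times 3 q0 = 3 * q0" "alu b Plus AB (3 * q0) = KB"
   by (simp_all add: alu_Times alu_Plus KB_def AB_def del: alu.simps)
 qed
 have mk: "alu b Times (2 ^ K) 64 = 2 ^ K * 64" "alu b Times (2 ^ K) 32 = RB" "alu b Times (2 ^ K) 16 = CB"
  using pow_bounds(1)[of 64] pow_bounds(1)[of 32] pow_bounds(1)[of 16]
  by (simp_all add: alu_Times RB_def CB_def mult.commute)
 have s4: "alu b Times 4 s = 4 * s" "alu b Times (4 * s) s = 4 * s * s"
 proof -
  have "s * s \<le> NP * NP" using s_less by (intro mult_le_mono) auto
  hence "4 * s * s \<le> 4 * 2 ^ K" using NP_N NK by linarith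
  hence 1: "4 * s * s < 2 ^ b" using pow_bounds(1)[of 4] by linarith
  thus "alu b Times (4 * s) s = 4 * s * s" by (rule alu_Times)
  have "4 * s * 1 \<le> 4 * s * s" using s1 by (intro mult_le_mono2) simp
  thus "alu b Times 4 s = 4 * s" using 1 by (intro alu_Times) linarith
 qed
 have bs: "alu b Times 2 n = 2 * n" "alu b Plus (2 * n) 32 = 2 * n + 32"
 proof -
  have "(32::nat) \<le> 2 ^ 120" by simp
  hence "(32::nat) \<le> 2 ^ K" using big_K by (rule order_trans)
  hence "2 * n + 32 \<le> 3 * 2 ^ K" using pow_bounds(2) by linarith
  hence "2 * n + 32 < 2 ^ b" using pow_bounds(1)[of 3] by linarith
  thus "alu b Times 2 n = 2 * n" "alu b Plus (2 * n) 32 = 2 * n + 32" by (simp_all add: alu_Times alu_Plus del: alu.simps)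
 qed
 have cs: "take_bit b c = c" if "c \<le> 64" for c :: nat using that small[of c] by (simp add: take_bit_nat_eq_self)
 have e1: "take_bit b (e + 1) = e + 1"
 proof -
  have "e + 1 < 2 ^ b" using pow_bounds(5) less_exp[of K] by (intro less_b) linarith
  thus ?thesis by (simp add: take_bit_nat_eq_self)
 qed
 note simps = r l6 np N t16 t16K nt R sh w2 mk s4 bs cs e1
 show "pars ms'" "fst ms' 35 = m" "fst ms' 36 = n" "fst ms' 37 = R" "fst ms' 38 = RB" "fst ms' 39 = CB"
  "fst ms' rBase = 2 * n + 32" "fst ms' rFree = 4" "snd ms' = snd ms"
  unfolding pars_def m_def ms'_def params_com_def
  by (simp_all add: simps del: alu.simps(1-3,9-12) One_nat_def add_Suc_right add_2_eq_Suc')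
qed

theorem init_correct:
 assumes r: "fst ms 0 = n" "fst ms 1 = w" "fst ms 2 = A"
 defines "ms' \<equiv> sem b (init_com e) ms"
 shows "pars ms'" "fst ms' 35 = m" "fst ms' 36 = n" "fst ms' 37 = R" "fst ms' 38 = RB" "fst ms' 39 = CB"
  "fst ms' rBase = 2 * n + 32" "fst ms' rFree = 4" "snd ms' = snd ms"
  and "fst (sem b bits_com ms) 3 = q0" "fst (sem b (sizes_com e) (sem b bits_com ms)) 3 = q0"
  "fst (sem b (sizes_com e) (sem b bits_com ms)) rW = W"
proof -
 define ms1 where "ms1 = sem b bits_com ms"
 define ms2 where "ms2 = sem b (sizes_com e) ms1"
 define ms3 where "ms3 = sem b round_com ms2"
 define ms4 where "ms4 = sem b root_com ms3"
 have q1: "fst ms1 3 = q0" unfolding ms1_def by (rule bits_correct[OF r(1)])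
 have r1: "fst ms1 0 = n" "fst ms1 1 = w" "fst ms1 2 = A" unfolding ms1_def using r by simp_all
 have ev: "alu b Plus w q0 = w + q0" "alu b Times (e + 40) (w + q0) = K" "alu b Plus w 1 = W" "alu b ShiftL 1 q0 = NP"
 proof -
  have KK: "K < 2 ^ b" using less_exp[of K] by (intro less_b) simp
  have ZK: "40 * Z \<le> K" by (simp add: K_eq)
  have Zd: "Z = w + q0" by (rule Z_def)
  show "alu b Plus w q0 = w + q0" using ZK KK Zd by (intro alu_Plus) linarith
  show "alu b Times (e + 40) (w + q0) = K" using KK by (simp add: alu_Times K_def Z_def)
  show "alu b Plus w 1 = W" using ZK KK q0_2 Zd unfolding W_def by (intro alu_Plus) linarith
  show "alu b ShiftL 1 q0 = NP" using pow_bounds(9) by (simp add: alu_ShiftL NP_def)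
 qed
 have e40: "take_bit b (e + 40) = e + 40"
 proof -
  have "e + 40 < 2 ^ b" using pow_bounds(5) less_exp[of K] by (intro less_b) linarith
  thus ?thesis by (simp add: take_bit_nat_eq_self)
 qed
 have t1: "take_bit b (1::nat) = 1" by simp
 have s2: "ms2 = upd rS 1 (upd rL 1 (upd rNP NP (upd rW W (upd 21 K ms1))))"
  unfolding ms2_def sizes_com_def sem.simps(2,5) eval.simps e40 t1
  by (simp add: q1 r1 ev del: alu.simps One_nat_def)
 have L3: "fst ms3 rL = L" unfolding ms3_def by (rule round_correct) (simp_all add: s2)
 have s4: "fst ms4 rS = s" unfolding ms4_def
 proof (rule root_correct)
  show "fst ms3 2 = A" "fst ms3 3 = q0" "fst ms3 rS = 1"
   unfolding ms3_def by (simp_all add: s2 r1 q1)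
 qed
 have k: "fst ms4 0 = n" "fst ms4 1 = w" "fst ms4 3 = q0" "fst ms4 21 = K" "fst ms4 rW = W" "fst ms4 rNP = NP" "fst ms4 rL = L"
  unfolding ms4_def using L3 by (simp_all add: ms3_def s2 r1 q1 del: One_nat_def)
 have m: "snd ms4 = snd ms"
  by (simp add: ms4_def ms3_def ms2_def ms1_def)
 have out: "ms' = sem b (params_com e) ms4"
  by (simp only: ms'_def init_com_def seq_step ms1_def ms2_def ms3_def ms4_def)
 show "pars ms'" "fst ms' 35 = m" "fst ms' 36 = n" "fst ms' 37 = R" "fst ms' 38 = RB" "fst ms' 39 = CB"
  "fst ms' rBase = 2 * n + 32" "fst ms' rFree = 4" "snd ms' = snd ms"
  using params_correct[OF k s4] unfolding out m by simp_all
 show "fst (sem b bits_com ms) 3 = q0" "fst (sem b (sizes_com e) (sem b bits_com ms)) 3 = q0"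
  "fst (sem b (sizes_com e) (sem b bits_com ms)) rW = W"
  using q1 s2 unfolding ms2_def ms1_def by (simp_all add: sizes_com_def)
qed

end

section \<open>The probability that the tables cover all items\<close>

section \<open>Success probability\<close>

context layout_base
begin

lemma m_bounds: "real N / (8 * real s * real s) \<le> real m" "real m \<le> real N / (4 * real s * real s)"
proof -
 let ?q = "4 * s * s"
 have s1: "1 \<le> s" by (rule s_props)
 hence q0: "0 < ?q" by simp
 \<comment> \<open>Hence \<open>m\<close> is at least 1, and rounding down loses at most a factor
   2.\<close>
 have "?q \<le> N"
 proof -
  have "s * s \<le> NP * NP" using s_less by (intro mult_le_mono) (auto intro: less_imp_le)
  moreover have "(2::nat) ^ 2 \<le> NP" unfolding NP_def using q0_2 by (rule power_increasing) simp
  hence "4 \<le> NP" by simp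
  ultimately have "s * s * 4 \<le> NP * NP * NP" by (rule mult_le_mono)
  thus ?thesis using NP3 by linarith
 qed
 hence m1: "1 \<le> m" unfolding m_def using q0 by (simp add: Suc_le_eq div_greater_zero_iff)
 have "N < (m + 1) * ?q" unfolding m_def using q0 dividend_less_times_div[of ?q N] by (simp add: mult.commute)
 also have "\<dots> \<le> (2 * m) * ?q" using m1 by (intro mult_le_mono1) linarith
 finally have "real N \<le> real ((2 * m) * ?q)" by (simp only: of_nat_le_iff less_imp_le)
 thus "real N / (8 * real s * real s) \<le> real m" using s1 by (simp add: divide_le_eq mult.assoc mult.commute mult.left_commute)
 have "m * ?q \<le> N" unfolding m_def by (rule div_times_less_eq_dividend)
 hence "real (m * ?q) \<le> real N" by (simp only: of_nat_le_iff)
 thus "real m \<le> real N / (4 * real s * real s)" using s1 by (simp add: le_divide_eq mult.assoc mult.commute mult.left_commute)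
qed

text \<open>With \<open>a = m * s / N\<close> and chains and buckets of size \<open>s\<close>,
  \<open>avg_good\<close> gives \<open>a - a^2 * s - a^2 / 2\<close>. The 4 in \<open>m\<close>
  yields \<open>a * s <= 1 / 4\<close>, so the losses are at most \<open>3 / 8\<close> of
  \<open>a\<close>, and \<open>a >= 1 / (8 * s)\<close>.\<close>

lemma avg_good_bound:
 assumes "x < N"
 shows "1 / (16 * real s) \<le> avg (2 ^ b) (s * Suc K) (\<lambda>\<rho>. of_bool (good \<rho> s m x))"
proof -
 have s1: "1 \<le> real s" using s_props by simp
 have N0: "0 < real N" using N_pos by simp
 define a where "a = real m * real s / real N"
 have a1: "1 / (8 * real s) \<le> a"
 proof -
  have "1 / (8 * real s) = real N / (8 * real s * real s) * real s / real N" using s1 N0 by (simp add: field_simps)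
  also have "\<dots> \<le> a" unfolding a_def using m_bounds(1) s1 N0 by (intro divide_right_mono mult_right_mono) auto
  finally show ?thesis .
 qed
 have a2: "a \<le> 1 / (4 * real s)"
 proof -
  have "a \<le> real N / (4 * real s * real s) * real s / real N"
   unfolding a_def using m_bounds(2) s1 N0 by (intro divide_right_mono mult_right_mono) auto
  also have "\<dots> = 1 / (4 * real s)" using s1 N0 by (simp add: field_simps)
  finally show ?thesis .
 qed
 have a0: "0 \<le> a" by (simp add: a_def)
 have as: "a * real s \<le> 1 / 4" using a2 s1 by (simp add: field_simps)
 have "a\<^sup>2 * real s \<le> a * (1 / 4)" using mult_left_mono[OF as a0] by (simp add: power2_eq_square mult.assoc)
 moreover have "a\<^sup>2 / 2 \<le> a\<^sup>2 * real s / 2" using s1 by (intro divide_right_mono) (simp_all add: mult_left_le mult_le_cancel_left1)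
 ultimately have "1 / (16 * real s) \<le> a - a\<^sup>2 * real s - a\<^sup>2 / 2" using a1 a0 by (simp add: field_simps)
 also have "\<dots> = real m * real s / real N - (real m)\<^sup>2 * (real s)\<^sup>2 * real s / (real N)\<^sup>2 - (real m)\<^sup>2 * (real s)\<^sup>2 / (2 * (real N)\<^sup>2)"
  by (simp add: a_def power_divide power_mult_distrib mult.assoc)
 also have "\<dots> \<le> avg (2 ^ b) (s * Suc K) (\<lambda>\<rho>. of_bool (good \<rho> s m x))"
 proof (rule avg_good[OF assms])
  have "m \<le> N" by (simp add: m_def)
  thus "m \<le> 2 ^ K" using N_FB FB8 by linarith
 qed
 finally show ?thesis .
qed

text \<open>The origin of \<open>nt\<close>: an item is missed by all tables with probability at
  most \<open>exp (- nt / (16 * s))\<close>, which is \<open>exp (- K * (e + 1))\<close>. As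
  \<open>N\<close> and \<open>n\<close> are at most \<open>2 ^ K\<close>, the \<open>N\<close> items
  together contribute at most \<open>1 / n ^ e\<close>.\<close>

theorem covers_probability:
 "1 - 1 / real n ^ e \<le> measure_pmf.prob (words b R) {\<rho>. covers \<rho> nt s m}"
proof -
 let ?d = "1 / (16 * real s)"
 have s1: "1 \<le> real s" using s_props by simp
 have d: "0 \<le> ?d" "?d \<le> 1" using s1 by (simp_all add: field_simps)
 have "real N * (1 - ?d) ^ nt \<le> 1 / real n ^ e"
 proof -
  have "(1 - ?d) ^ nt \<le> (exp (- ?d)) ^ nt"
   using d exp_ge_add_one_self[of "- ?d"] by (intro power_mono) auto
  also have "\<dots> = exp (- (real nt * ?d))" by (simp flip: exp_of_nat_mult)
  also have "real nt * ?d = real (K * (e + 1))"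
  proof -
   have "real nt = 16 * real s * real (K * (e + 1))" by (simp add: nt_def algebra_simps)
   thus ?thesis using s1 by (simp del: of_nat_mult of_nat_add)
  qed
  also have "exp (- real (K * (e + 1))) = 1 / exp 1 ^ (K * (e + 1))"
   by (simp add: exp_minus exp_of_nat_mult[symmetric] divide_inverse del: of_nat_mult of_nat_add)
  also have "\<dots> \<le> 1 / 2 ^ (K * (e + 1))"
   using exp_ge_add_one_self[of 1] by (intro divide_left_mono power_mono) auto
  finally have 1: "(1 - ?d) ^ nt \<le> 1 / 2 ^ (K * (e + 1))" .
  have "N * n ^ e \<le> 2 ^ K * (2 ^ K) ^ e"
  proof (rule mult_le_mono)
   show "N \<le> 2 ^ K" using N_FB FB8 by linarith
   show "n ^ e \<le> (2 ^ K) ^ e" using n_less NP_N(1) N_FB FB8 by (intro power_mono) linarith+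
  qed
  also have "\<dots> = 2 ^ (K * (e + 1))" by (simp add: power_add power_mult)
  finally have "real (N * n ^ e) \<le> real (2 ^ (K * (e + 1)))" by (simp only: of_nat_le_iff)
  hence 2: "real N * real n ^ e \<le> 2 ^ (K * (e + 1))" by simp
  have "real N * (1 - ?d) ^ nt \<le> real N * (1 / 2 ^ (K * (e + 1)))" using 1 by (rule mult_left_mono) simp
  also have "\<dots> \<le> 1 / real n ^ e" using 2 n2 by (simp add: field_simps)
  finally show ?thesis .
 qed
 hence "1 - 1 / real n ^ e \<le> 1 - real N * (1 - ?d) ^ nt" by simp
 also have "\<dots> \<le> avg (2 ^ b) (nt * (s * Suc K)) (\<lambda>\<rho>. of_bool (covers \<rho> nt s m))"
  by (rule avg_covers[OF d(1) avg_good_bound])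
 also have "\<dots> = measure_pmf.prob (words b R) {\<rho>. covers \<rho> nt s m}"
  unfolding prob_words R_def by (rule arg_cong[of _ _ "avg _ _"]) (auto simp: fun_eq_iff)
 finally show ?thesis .
qed

end

section \<open>Triples of points and areas of triangles\<close>

section \<open>Triangles\<close>

locale points =
 fixes pts :: "point list" and w e A :: nat
 assumes two: "2 \<le> length pts" and dist: "distinct pts" and grid: "set pts \<subseteq> grid w"
  and A: "1 \<le> A" "A \<le> length pts"
begin

definition px :: "nat => nat" where "px i = (if i < length pts then fst (pts ! i) + 1 else 0)"
definition py :: "nat => nat" where "py i = (if i < length pts then snd (pts ! i) + 1 else 0)"

lemma pts_less: "i < length pts ==> fst (pts ! i) < 2 ^ w \<and> snd (pts ! i) < 2 ^ w"
 using grid nth_mem[of i pts] unfolding grid_def by (metis lessThan_iff mem_Times_iff subsetD)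

sublocale layout "length pts" w e A px py
proof
 show "1 \<le> w"
 proof (rule ccontr)
  assume "\<not> 1 \<le> w"
  hence "w = 0" by simp
  \<comment> \<open>Without bits the grid is a single point, too small for two distinct
    points.\<close>
  hence "grid w = {(0, 0)}" by (auto simp: grid_def)
  hence "card (set pts) \<le> card {(0::nat, 0::nat)}" using grid by (intro card_mono) auto
  thus False using two by (simp add: distinct_card[OF dist])
 qed
 show "px i \<le> 2 ^ w" "py i \<le> 2 ^ w" for i using pts_less[of i] by (auto simp: px_def py_def Suc_le_eq)
qed (use two A in auto)

lemma base_less: "2 * length pts + 32 \<le> 2 ^ K"
proof -
 have 1: "2 * length pts \<le> 2 * 2 ^ q0" using n_less by (simp add: NP_def)
 have "2 * 2 ^ q0 + (2::nat) ^ 5 \<le> 2 ^ (Z + 5) + 2 ^ (Z + 5)"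
  unfolding power_Suc[symmetric] using w1 by (intro add_mono power_increasing) (auto simp: Z_def)
 also have "\<dots> = 2 ^ (Z + 6)" by (simp add: power_add)
 also have "(2::nat) ^ (Z + 6) \<le> 2 ^ K"
 proof (rule power_increasing)
  have "40 * Z \<le> K" by (simp add: K_eq)
  thus "Z + 6 \<le> K" using Z3 by linarith
 qed simp
 finally show ?thesis using 1 by simp
qed

sublocale layout_base "length pts" w e A px py "2 * length pts + 32"
 by unfold_locales (rule base_less)

definition tri :: "nat => point \<times> point \<times> point" where
 "tri y = (pts ! pt y 0, pts ! pt y 1, pts ! pt y 2)"

lemma pt_digits: "y < NP ^ 3 ==> y = (pt y 0 * NP + pt y 1) * NP + pt y 2"
proof -
 assume y: "y < NP ^ 3"
 have "y div NP div NP < NP" using y by (intro less_mult_imp_div_less) (simp add: power3_eq_cube)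
 hence "y div NP div NP mod NP = y div NP div NP" by simp
 thus ?thesis by (simp add: pt_def power2_eq_square div_mult2_eq)
qed

lemma pt_of:
 assumes "i < NP" "j < NP" "k < NP"
 defines "y \<equiv> (i * NP + j) * NP + k"
 shows "y < NP ^ 3" "pt y 0 = i" "pt y 1 = j" "pt y 2 = k"
proof -
 have "i * NP + j < NP * NP" using assms by (intro digits_less)
 thus "y < NP ^ 3" unfolding y_def power3_eq_cube using assms by (intro digits_less)
 have 1: "y div NP = i * NP + j" "y mod NP = k" using assms by (simp_all add: y_def)
 show "pt y 0 = i" "pt y 1 = j" "pt y 2 = k"
  using assms 1 by (simp_all add: pt_def power2_eq_square div_mult2_eq)
qed

lemma all6: "(\<forall>c<6. P c) \<longleftrightarrow> P 0 \<and> P 1 \<and> P 2 \<and> P 3 \<and> P 4 \<and> P (5::nat)"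
proof -
 have "{..<6} = {0, 1, 2, 3, 4, 5 :: nat}" by auto
 hence "(\<forall>c\<in>{..<6}. P c) \<longleftrightarrow> (\<forall>c\<in>{0, 1, 2, 3, 4, 5}. P c)" by (simp only:)
 thus ?thesis by (simp only: ball_simps lessThan_iff Ball_def insert_iff empty_iff) blast
qed

lemma in_box_iff:
 assumes B: "B1 = ((r 0, r 1), (r 2, r 3))" "B2 = ((r 4, r 5), (r 6, r 7))" "B3 = ((r 8, r 9), (r 10, r 11))"
 shows "y \<in> in_box (box_bounds r) \<longleftrightarrow> y < NP ^ 3 \<and>
  (pt y 0 < length pts \<and> pts ! pt y 0 \<in> rect_set B1) \<and>
  (pt y 1 < length pts \<and> pts ! pt y 1 \<in> rect_set B2) \<and>
  (pt y 2 < length pts \<and> pts ! pt y 2 \<in> rect_set B3)"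
proof -
 have p: "(r a + 1 \<le> px i \<and> px i < r c + 2) \<and> (r a' + 1 \<le> py i \<and> py i < r c' + 2) \<longleftrightarrow>
   i < length pts \<and> pts ! i \<in> rect_set ((r a, r a'), (r c, r c'))" for a c a' c' i
  by (cases "pts ! i") (auto simp: px_def py_def)
 have cdv: "cd y 0 = px (pt y 0)" "cd y 1 = py (pt y 0)" "cd y 2 = px (pt y 1)" "cd y 3 = py (pt y 1)"
  "cd y 4 = px (pt y 2)" "cd y 5 = py (pt y 2)" by (simp_all add: cd_def)
 have bb: "box_bounds r 0 1 = r 0 + 1" "box_bounds r 0 0 = r 2 + 2" "box_bounds r 1 1 = r 1 + 1" "box_bounds r 1 0 = r 3 + 2"
  "box_bounds r 2 1 = r 4 + 1" "box_bounds r 2 0 = r 6 + 2" "box_bounds r 3 1 = r 5 + 1" "box_bounds r 3 0 = r 7 + 2"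
  "box_bounds r 4 1 = r 8 + 1" "box_bounds r 4 0 = r 10 + 2" "box_bounds r 5 1 = r 9 + 1" "box_bounds r 5 0 = r 11 + 2"
  by (simp_all add: box_bounds_def numeral_2_eq_2[symmetric] numeral_3_eq_3[symmetric])
 show ?thesis
  unfolding in_box_def mem_Collect_eq all6 cdv bb B p[symmetric] by blast
qed

lemma candidates_tri:
 assumes B: "B1 = ((r 0, r 1), (r 2, r 3))" "B2 = ((r 4, r 5), (r 6, r 7))" "B3 = ((r 8, r 9), (r 10, r 11))"
 shows "inj_on tri (in_box (box_bounds r))" "tri ` in_box (box_bounds r) = candidates (set pts) B1 B2 B3"
proof -
 note iff = in_box_iff[OF B]
 show "inj_on tri (in_box (box_bounds r))"
 proof (rule inj_onI)
  fix y y' assume y: "y \<in> in_box (box_bounds r)" "y' \<in> in_box (box_bounds r)" "tri y = tri y'"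
  have "pts ! pt y 0 = pts ! pt y' 0" "pts ! pt y 1 = pts ! pt y' 1" "pts ! pt y 2 = pts ! pt y' 2"
   using y(3) by (simp_all add: tri_def)
  hence "pt y 0 = pt y' 0" "pt y 1 = pt y' 1" "pt y 2 = pt y' 2"
   using y(1,2) unfolding iff by (simp_all add: nth_eq_iff_index_eq[OF dist])
  thus "y = y'" using pt_digits[of y] pt_digits[of y'] y unfolding iff by simp
 qed
 show "tri ` in_box (box_bounds r) = candidates (set pts) B1 B2 B3"
 proof
  show "tri ` in_box (box_bounds r) \<subseteq> candidates (set pts) B1 B2 B3"
   unfolding candidates_def using iff by (simp add: tri_def image_subset_iff)
  show "candidates (set pts) B1 B2 B3 \<subseteq> tri ` in_box (box_bounds r)"
  proof
   fix t assume "t \<in> candidates (set pts) B1 B2 B3"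
   then obtain p q u where pq: "t = (p, q, u)" "p \<in> set pts" "q \<in> set pts" "u \<in> set pts"
    "p \<in> rect_set B1" "q \<in> rect_set B2" "u \<in> rect_set B3"
    by (cases t) (simp add: candidates_def)
   moreover obtain i j k where "i < length pts" "pts ! i = p" "j < length pts" "pts ! j = q" "k < length pts" "pts ! k = u"
    using pq(2-4) by (metis in_set_conv_nth)
   ultimately have t: "t = (pts ! i, pts ! j, pts ! k)" "i < length pts" "j < length pts" "k < length pts"
    "pts ! i \<in> rect_set B1" "pts ! j \<in> rect_set B2" "pts ! k \<in> rect_set B3" by simp_all
   define y where "y = (i * NP + j) * NP + k"
   have l: "i < NP" "j < NP" "k < NP" using t n_less by linarith+
   note y = pt_of[OF l, folded y_def]
   have "y \<in> in_box (box_bounds r)" unfolding iff y using t y(1) by simp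
   moreover have "t = tri y" unfolding tri_def y t(1) ..
   ultimately show "t \<in> tri ` in_box (box_bounds r)" by blast
  qed
 qed
qed

text \<open>The area is half the absolute determinant of two edges
  (\<open>content_triangle\<close>); the shift of the coordinates by 1 cancels in the
  differences.\<close>

lemma triangle_area_tri:
 assumes "pt y 0 < length pts" "pt y 1 < length pts" "pt y 2 < length pts"
 shows "triangle_area (tri y) = real (area2 y) / 2"
proof -
 have c: "int (cd y 0) = int (fst (pts ! pt y 0)) + 1" "int (cd y 1) = int (snd (pts ! pt y 0)) + 1"
  "int (cd y 2) = int (fst (pts ! pt y 1)) + 1" "int (cd y 3) = int (snd (pts ! pt y 1)) + 1"
  "int (cd y 4) = int (fst (pts ! pt y 2)) + 1" "int (cd y 5) = int (snd (pts ! pt y 2)) + 1"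
  using assms by (simp_all add: cd_def px_def py_def)
 have v: "in_plane p $ 1 = real (fst p)" "in_plane p $ 2 = real (snd p)" for p by (simp_all add: in_plane_def)
 let ?i = "\<lambda>f j. int (f (pts ! pt y j))"
 have "real (area2 y) = \<bar>of_int ((?i fst 1 - ?i fst 0) * (?i snd 2 - ?i snd 0) - (?i fst 2 - ?i fst 0) * (?i snd 1 - ?i snd 0))\<bar>"
  unfolding area2_def c by simp
 also have "\<dots> / 2 = triangle_area (tri y)"
  unfolding tri_def triangle_area.simps content_triangle v
  by (simp add: abs_minus_commute)
 finally show ?thesis by simp
qed

text \<open>\<open>kap\<close> has the area as its leading digits and the code of the triple below,
  so it refines the order by area and is injective. Transported along \<open>tri\<close> it serves
  in \<open>kth_largestI\<close>.\<close>

lemma kth_triangle: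
 assumes B: "B1 = ((r 0, r 1), (r 2, r 3))" "B2 = ((r 4, r 5), (r 6, r 7))" "B3 = ((r 8, r 9), (r 10, r 11))"
  and y: "y \<in> in_box (box_bounds r)" "card {z \<in> in_box (box_bounds r). kap y < kap z} + 1 = k"
 shows "kth_largest triangle_area (candidates (set pts) B1 B2 B3) k (tri y)"
proof -
 let ?X = "in_box (box_bounds r)"
 note C = candidates_tri[OF B]
 define h where "h = kap \<circ> inv_into ?X tri"
 have inv: "inv_into ?X tri (tri z) = z" if "z \<in> ?X" for z using C(1) that by (rule inv_into_f_f)
 have hz: "h (tri z) = kap z" if "z \<in> ?X" for z using inv[OF that] by (simp add: h_def)
 show ?thesis unfolding C(2)[symmetric]
 proof (rule kth_largestI)
  show "finite (tri ` ?X)" by simp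
  show "inj_on h (tri ` ?X)"
  proof (rule inj_onI)
   fix a a' assume "a \<in> tri ` ?X" "a' \<in> tri ` ?X" "h a = h a'"
   then obtain z z' where z: "a = tri z" "z \<in> ?X" "a' = tri z'" "z' \<in> ?X" by blast
   hence "kap z = kap z'" using \<open>h a = h a'\<close> hz by simp
   thus "a = a'" using inj_onD[OF inj_on_kap _ z(2,4)] z by simp
  qed
  show "triangle_area a' \<le> triangle_area a" if a: "a \<in> tri ` ?X" "a' \<in> tri ` ?X" "h a' \<le> h a" for a a'
  proof -
   obtain z z' where z: "a = tri z" "z \<in> ?X" "a' = tri z'" "z' \<in> ?X" using a(1,2) by blast
   hence k: "kap z' \<le> kap z" using a(3) hz by simp
   have zN: "z < NP ^ 3" "z' < NP ^ 3" using z by (simp_all add: in_box_def)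
   have "area2 z' \<le> area2 z"
   proof -
    have "kap z' div NP ^ 3 \<le> kap z div NP ^ 3" using k by (rule div_le_mono)
    moreover have "kap z' div NP ^ 3 = area2 z'" "kap z div NP ^ 3 = area2 z"
     using zN NP_pos by (simp_all add: kap_def)
    ultimately show ?thesis by (simp only:)
   qed
   moreover have "triangle_area a = real (area2 z) / 2" "triangle_area a' = real (area2 z') / 2"
    using triangle_area_tri z in_box_iff[OF B] by blast+
   ultimately show ?thesis by simp
  qed
  show "tri y \<in> tri ` ?X" using y by simp
  have "{b \<in> tri ` ?X. h (tri y) < h b} = tri ` {z \<in> ?X. kap y < kap z}"
   using hz y(1) by auto
  moreover have "card (tri ` {z \<in> ?X. kap y < kap z}) = card {z \<in> ?X. kap y < kap z}"
   by (intro card_image inj_on_subset[OF C(1)]) auto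
  ultimately show "card {b \<in> tri ` ?X. h (tri y) < h b} + 1 = k" using y(2) by simp
 qed
qed

end

section \<open>Explicit bounds on time and space\<close>

section \<open>Resources\<close>

definition build_program :: "nat => program" where
 "build_program e = rand_program (init_com e) 81 37 38 fill_com"

definition query_program :: program where
 "query_program = ccom 0 query_com"

lemmas walk_coms = walk_com_def step_com_def hash_com_def bucket_com_def keyof_def area_com_def push_node_def
 levels_def coords_def fetch_def lookup_def

lemma lp_walk: "lp (fetch k x) = {21}" "lp keyof = {21}" "lp bucket_com = {21}" "lp hash_com = {21}"
 "lp (walk_com y) = {21, 26}" "lp coords = {21}"
 by (auto simp: walk_coms)

lemma steady_walk: "steady (fetch k x)" "steady keyof" "steady bucket_com" "steady hash_com" "steady (walk_com y)" "steady coords"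
 by (auto simp: walk_coms)

lemma wfc_walk: "x < 1000 ==> eregs k \<subseteq> {..<1000} ==> wfc (fetch k x)" "wfc keyof" "wfc bucket_com" "wfc hash_com"
 "eregs y \<subseteq> {..<1000} ==> wfc (walk_com y)" "wfc coords"
 by (auto simp: walk_coms)

lemma put_props: "steady (put k)" "lp (put k) = {21}" "eregs k \<subseteq> {..<1000} ==> wfc (put k)"
 by (auto simp: put_def insert_key_def)

lemmas walk_props = lp_walk steady_walk wfc_walk put_props

lemma fill_props: "steady fill_com" "wfc fill_com" "lp fill_com = {21, 25, 26, 27, 35, 36, 37}"
 by (auto simp: fill_com_def pts_com_def wds_com_def each_pair_def tally_body_def cts_body_def ends_com_def
   header_com_def walk_props)

lemma init_props: "wfc (init_com e)" "steady bits_com" "steady (sizes_com e)" "steady round_com" "steady root_com"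
 "steady (params_com e)" "lp bits_com = {0}" "lp (sizes_com e) = {}" "lp round_com = {22}" "lp root_com = {3}"
 "lp (params_com e) = {}"
 by (auto simp: init_com_def bits_com_def sizes_com_def round_com_def root_com_def params_com_def)

text \<open>\<open>load_pars\<close> sets the loop bounds, so \<open>steady\<close> can hold only
  for the two parts of the query separately.\<close>

definition query_rest :: com where
 "query_rest = bounds_com ;; For 175 rKB search_body ;; output_com"

lemma query_com_rest: "query_com = load_pars ;; query_rest"
 by (simp add: query_com_def query_rest_def)

lemma leaf_props: "steady leaf_com" "wfc leaf_com" "lp leaf_com = {21, 26, 27}"
 "wr leaf_com = {40..44} \<union> {50..68} \<union> {70..80} \<union> {90} \<union> {92..95} \<union> {170}"
 by (auto simp: leaf_com_def count_com_def probe_com_def walk_props)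

lemma nest_com_6: "nest_com 6 =
  level_com 0 (level_com 1 (level_com 2 (level_com 3 (level_com 4 (level_com 5 leaf_com)))))"
 by (simp add: numeral_eq_Suc)

lemma nest_props: "steady (nest_com 6)" "wfc (nest_com 6)" "lp (nest_com 6) = {21, 22, 26, 27, 32}"
 "z \<in> {20..39} \<union> {175} --> z \<notin> wr (nest_com 6)"
 by (auto simp: nest_com_6 level_com_def leaf_props)

lemma query_props: "wfc query_com" "steady load_pars" "lp load_pars = {}" "steady query_rest"
 "lp query_rest = {21, 22, 26, 27, 31, 32}"
 by (auto simp: query_com_def query_rest_def load_pars_def bounds_com_def search_body_def output_com_def
   nest_props walk_props simp del: nest_com.simps)

context layout
begin

text \<open>The values of all registers that bound loops after initialisation, so that running times
  depend on the parameters alone.\<close>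

definition regs :: "nat => nat" where
 "regs z = (if z = 21 then K else if z = 22 then W else if z = 25 then N else if z = 26 then s else
  if z = 27 then nt else if z = 31 then KB else if z = 32 then 2 else if z = 35 then m else
  if z = 36 then n else if z = 37 then R else 0)"

definition build_bound :: nat where
 "build_bound = tm bits_com (\<lambda>_. n) + (tm (sizes_com e) (\<lambda>_. 0) + (tm round_com (\<lambda>_. W) +
  (tm root_com (\<lambda>_. q0) + tm (params_com e) (\<lambda>_. 0)))) + (2 + 7 * R) + tm fill_com regs"

text \<open>The \<open>2 * n + 32\<close> words in front of the trie plus the bound of
  \<open>dict_free_le_card\<close> for \<open>all_keys_card\<close>.\<close>

definition space_bound :: nat where
 "space_bound = 2 * n + 36 + 2 * (K * (2 * n + R + N * K div s + nt * m))"

definition query_bound :: nat where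
 "query_bound = tm load_pars (\<lambda>_. 0) + tm query_rest regs"

end

context build_data
begin

text \<open>Initialisation computes its own loop bounds and is not \<open>steady\<close> as a whole.
  Its parts are bounded one by one, with the values known to be reached in between.\<close>

lemma init_time:
 assumes r: "fst ms 0 = n" "fst ms 1 = w" "fst ms 2 = A"
 shows "tim b (init_com e) ms \<le> tm bits_com (\<lambda>_. n) + (tm (sizes_com e) (\<lambda>_. 0) + (tm round_com (\<lambda>_. W) +
  (tm root_com (\<lambda>_. q0) + tm (params_com e) (\<lambda>_. 0))))"
proof -
 let ?s1 = "sem b bits_com ms"
 let ?s2 = "sem b (sizes_com e) ?s1"
 let ?s3 = "sem b round_com ?s2"
 let ?s4 = "sem b root_com ?s3"
 note I = init_correct(11,12)[OF r]
 have "tim b bits_com ms \<le> tm bits_com (\<lambda>_. n)"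
  using tim_le_tm[OF init_props(2), of b ms] tm_cong[of bits_com "fst ms" "\<lambda>_. n"] init_props(7) r by simp
 moreover have "tim b (sizes_com e) ?s1 \<le> tm (sizes_com e) (\<lambda>_. 0)"
  using tim_le_tm[OF init_props(3), of b e ?s1] tm_cong[of "sizes_com e" "fst ?s1" "\<lambda>_. 0"] init_props(8) by simp
 moreover have "tim b round_com ?s2 \<le> tm round_com (\<lambda>_. W)"
  using tim_le_tm[OF init_props(4), of b ?s2] tm_cong[of round_com "fst ?s2" "\<lambda>_. W"] init_props(9) I(2) by simp
 moreover have "fst ?s3 3 = q0" using I(1) by (subst sem_frame) simp_all
 hence "tim b root_com ?s3 \<le> tm root_com (\<lambda>_. q0)"
  using tim_le_tm[OF init_props(5), of b ?s3] tm_cong[of root_com "fst ?s3" "\<lambda>_. q0"] init_props(10) by simp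
 moreover have "tim b (params_com e) ?s4 \<le> tm (params_com e) (\<lambda>_. 0)"
  using tim_le_tm[OF init_props(6), of b e ?s4] tm_cong[of "params_com e" "fst ?s4" "\<lambda>_. 0"] init_props(11) by simp
 ultimately show ?thesis unfolding init_com_def tim.simps(5) by (intro add_mono)
qed

lemma fill_time:
 assumes "pars ms" "fst ms 35 = m" "fst ms 36 = n" "fst ms 37 = R"
 shows "tim b fill_com ms \<le> tm fill_com regs"
proof -
 have "tm fill_com (fst ms) = tm fill_com regs"
  using assms unfolding pars_def by (intro tm_cong) (auto simp: fill_props(3) regs_def)
 thus ?thesis using tim_le_tm[OF fill_props(1), of b ms] by simp
qed

end

context layout_base
begin

lemma query_time:
 assumes "pars (sem b load_pars ms)"
 shows "tim b query_com ms \<le> query_bound"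
proof -
 let ?s = "sem b load_pars ms"
 have "tm query_rest (fst ?s) = tm query_rest regs"
  by (rule tm_cong) (use assms query_props(5) in \<open>auto simp: pars_def regs_def\<close>)
 moreover have "tim b load_pars ms \<le> tm load_pars (\<lambda>_. 0)"
  using tim_le_tm[OF query_props(2), of b ms] tm_cong[of load_pars "fst ms" "\<lambda>_. 0"] query_props(3) by simp
 ultimately show ?thesis
  using tim_le_tm[OF query_props(4), of b ?s] by (simp add: query_com_rest query_bound_def)
qed

end

section \<open>From the input to a correct structure, for fixed and for random words\<close>

section \<open>The construction and the queries\<close>

lemma concat_pairs:
 "length (concat (map (\<lambda>(x, y). [x, y]) ps)) = 2 * length ps"
 "i < length ps ==> concat (map (\<lambda>(x, y). [x, y]) ps) ! (2 * i) = fst (ps ! i)"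
 "i < length ps ==> concat (map (\<lambda>(x, y). [x, y]) ps) ! (2 * i + 1) = snd (ps ! i)"
proof (induction ps arbitrary: i)
 case (Cons p ps)
 {
  case 1
  show ?case using Cons(1) by (cases p) simp
 next
  case 2
  thus ?case using Cons(2)[of "i - 1"] by (cases p; cases i) simp_all
 next
  case 3
  thus ?case using Cons(3)[of "i - 1"] by (cases p; cases i) simp_all
 }
qed simp_all

definition start :: "config => st" where
 "start ms = (reg ms, mem ms)"

lemma agree_start: "agree ms (start ms)"
 by (simp add: agree_def start_def)

locale points_run = points +
 fixes \<rho> :: "nat => nat"
begin

sublocale build_data "length pts" w e A px py \<rho>
 by unfold_locales (simp_all add: px_def py_def)

definition input :: config where
 "input = init_config [length pts, w, A] (concat (map (\<lambda>(x, y). [x, y]) pts))"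

definition mem0 :: "nat => nat" where
 "mem0 = mem input"

lemma input_props: "pc input = 0" "bounded_st b (start input)"
 "reg input 0 = length pts" "reg input 1 = w" "reg input 2 = A"
 "i < length pts ==> mem0 (2 * i) + 1 = px i \<and> mem0 (2 * i + 1) + 1 = py i"
 "2 * length pts \<le> a ==> mem0 a = 0"
proof -
 let ?c = "concat (map (\<lambda>(x, y). [x, y]) pts)"
 show "pc input = 0" "reg input 0 = length pts" "reg input 1 = w" "reg input 2 = A"
  by (simp_all add: input_def init_config_def)
 show m: "mem0 (2 * i) + 1 = px i \<and> mem0 (2 * i + 1) + 1 = py i" if "i < length pts" for i
  using that concat_pairs(2,3)[OF that] by (simp add: mem0_def input_def init_config_def concat_pairs(1) px_def py_def)
 show z: "mem0 a = 0" if "2 * length pts \<le> a" for a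
  using that by (simp add: mem0_def input_def init_config_def concat_pairs(1))
 have K: "x < 2 ^ b" if "x \<le> 2 ^ K" for x :: nat using that by (rule less_b)
 have "reg input x < 2 ^ b" for x
 proof -
  have "w \<le> 2 ^ K" using pow_bounds(4) less_exp[of K] by linarith
  moreover have "A \<le> 2 ^ K" using pow_bounds(2) A by linarith
  ultimately have "\<forall>y\<in>set [length pts, w, A]. y < 2 ^ b" using pow_bounds(2) K by simp
  thus ?thesis unfolding input_def init_config_def by (auto simp: nth_mem simp del: list.set)
 qed
 moreover have "mem0 a < 2 ^ b" for a
 proof (cases "a < 2 * length pts")
  case True
  define i where "i = a div 2"
  have i: "i < length pts" using True by (simp add: i_def)
  have wb: "2 ^ w < (2::nat) ^ b"
  proof -
   have "(2::nat) ^ w \<le> 2 ^ K" using pow_bounds(4) by (intro power_increasing) auto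
   thus ?thesis by (rule K)
  qed
  have "mem0 (2 * i) < 2 ^ b" "mem0 (2 * i + 1) < 2 ^ b"
   using m[OF i] px_le[of i] py_le[of i] wb by linarith+
  moreover have "a = 2 * i \<or> a = 2 * i + 1" by (simp add: i_def) presburger
  ultimately show ?thesis by blast
 qed (simp add: z)
 ultimately show "bounded_st b (start input)" by (simp add: bounded_st_def start_def mem0_def)
qed

definition mid :: st where "mid = sem b (init_com e) (start input)"

lemma mid_props: "pars mid" "fst mid 35 = m" "fst mid 36 = length pts" "fst mid 37 = R" "fst mid 38 = RB" "fst mid 39 = CB"
 "fst mid rBase = 2 * length pts + 32" "fst mid rFree = 4" "snd mid = mem0"
proof -
 have "fst (start input) 0 = length pts" "fst (start input) 1 = w" "fst (start input) 2 = A"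
  using input_props(3-5) by (simp_all only: start_def fst_conv)
 note I = init_correct[OF this]
 show "pars mid" "fst mid 35 = m" "fst mid 36 = length pts" "fst mid 37 = R" "fst mid 38 = RB" "fst mid 39 = CB"
  "fst mid rBase = 2 * length pts + 32" "fst mid rFree = 4" "snd mid = mem0"
  using I(1-9) unfolding mid_def by (simp_all only: mem0_def start_def snd_conv)
qed

definition filled :: st where
 "filled = ((fst mid)(81 := 0), overlay RB R \<rho> mem0)"

lemma filled_bst: "bst all_keys (\<lambda>_. 0) (snd filled) filled"
proof -
 have "dict K (\<lambda>a. snd filled (2 * length pts + 32 + a)) 4 {} (\<lambda>_. 0)"
 proof (rule dict_empty)
  fix a :: nat assume "a < 2 ^ (K + 3)"
  hence "2 * length pts + 32 + a < RB" using far(1,2) by linarith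
  thus "snd filled (2 * length pts + 32 + a) = 0" by (simp add: filled_def overlay_def input_props(7))
 qed
 hence "dict K (\<lambda>a. snd filled (2 * length pts + 32 + a)) 4 all_keys (\<lambda>_. 0)"
  by (rule dict_mono) simp
 thus ?thesis using mid_props
  by (simp add: bst_def ready_def dict_at_def pars_def filled_def)
qed

lemma structure_correct:
 assumes cov: "covers \<rho> nt s m" and \<rho>: "\<And>i. \<rho> i < 2 ^ b" and ag: "agree ms' (sem b fill_com filled)"
 shows "length (built_structure ms') \<le> space_bound \<and>
  answers_queries b query_program query_bound w (set pts) (built_structure ms')"
proof -
 let ?n = "length pts"
 let ?t = "sem b fill_com filled"
 have M: "\<And>i. i < ?n ==> snd filled (2 * i) + 1 = px i \<and> snd filled (2 * i + 1) + 1 = py i"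
  "\<And>i. i < R ==> snd filled (RB + i) = \<rho> i" "\<And>v. v < 2 ^ FB ==> snd filled (CB + v) = 0"
 proof -
  show "snd filled (2 * i) + 1 = px i \<and> snd filled (2 * i + 1) + 1 = py i" if "i < ?n" for i
   using that far(1,2) input_props(6)[OF that] by (simp add: filled_def overlay_def)
  show "snd filled (RB + i) = \<rho> i" if "i < R" for i using that by (simp add: filled_def overlay_def)
  show "snd filled (CB + v) = 0" if "v < 2 ^ FB" for v
  proof -
   have "v < 2 ^ K" using that FB8 by linarith
   hence "CB + v < RB" "2 * ?n \<le> CB + v" using far(1,2) by linarith+
   thus ?thesis by (simp add: filled_def overlay_def input_props(7))
  qed
 qed
 obtain f V where fV: "dict K (\<lambda>a. snd ?t (2 * ?n + 32 + a)) f all_keys V" "fst ?t 0 = 2 * ?n + 32 + f"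
  "snd ?t 0 = 2 * ?n + 32" "header (snd ?t)" "pts_in V" "words_in V \<rho>" "counts_in V" "ends_in V \<rho>"
  using fill_correct[OF filled_bst M] by blast
 define D where "D = built_structure ms'"
 have Dt: "D = map (snd ?t) [0..<2 * ?n + 32 + f]"
  using ag fV(2) by (simp add: D_def built_structure_def agree_def)
 have lenD: "length D = 2 * ?n + 32 + f" by (simp add: Dt)
 have "f \<le> 4 + 2 * (K * card all_keys)" by (rule dict_free_le_card[OF fV(1) all_keys_card(1)])
 also have "\<dots> \<le> 4 + 2 * (K * (2 * ?n + R + N * K div s + nt * m))"
  using all_keys_card(2) by (intro add_left_mono mult_le_mono2)
 finally have space: "length D \<le> space_bound" by (simp add: lenD space_bound_def)
 have f_le: "f \<le> 2 ^ (K + 3)"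
 proof -
  note dict_free_le[OF fV(1)]
  also have "(2::nat) ^ (K + 2) \<le> 2 ^ (K + 3)" by (rule power_increasing) auto
  finally show ?thesis .
 qed
 \<comment> \<open>The memory of a query: the built one cut off behind the trie. Within the trie's
   region this removes only zeros, and it also erases tallies and random words.\<close>
 define M' where "M' a = (if a < length D then D ! a else 0)" for a
 have M't: "M' a = (if a < 2 * ?n + 32 + f then snd ?t a else 0)" for a by (simp add: M'_def lenD) (simp add: Dt)
 have dM: "dict K (\<lambda>a. M' (2 * ?n + 32 + a)) f all_keys V"
 proof -
  have z: "snd ?t (2 * ?n + 32 + a) = 0" if "f \<le> a" "a < 2 ^ (K + 3)" for a
  proof -
   obtain P \<nu> where "trie K (\<lambda>a. snd ?t (2 * ?n + 32 + a)) f P \<nu> V" using fV(1) unfolding dict_def by blast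
   hence "\<forall>a. f \<le> a --> a < 2 ^ (K + 3) --> snd ?t (2 * ?n + 32 + a) = 0" unfolding trie_def by - (elim conjE, assumption)
   thus ?thesis using that by blast
  qed
  let ?r = "(\<lambda>_. 0)(rBase := 2 * ?n + 32, rK := K)"
  have "dict_at (?r, snd ?t) f all_keys V" using fV(1) by (simp add: dict_at_def)
  hence "dict_at (?r, M') f all_keys V"
  proof (rule dict_at_cong)
   fix a assume a: "2 * ?n + 32 \<le> a" "a < 2 * ?n + 32 + 2 ^ (K + 3)"
   then obtain c where "a = 2 * ?n + 32 + c" using le_Suc_ex by blast
   thus "snd (?r, M') a = snd (?r, snd ?t) a" using z[of c] a by (auto simp: M't)
  qed simp_all
  thus ?thesis by (simp add: dict_at_def)
 qed
 have hM: "header M'"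
 proof -
  have "M' c = snd ?t c" if "c < 20" for c using that by (simp add: M't)
  thus ?thesis using fV(4) by (simp add: header_def pars_def)
 qed
 have M0: "M' 0 = 2 * ?n + 32" using fV(3) by (simp add: M't)
 have Mfar: "M' (MB + x) = 0" for x using MB_far f_le by (simp add: M't)
 have tb: "bounded_st b ?t"
 proof (rule sem_bounded)
  have "bounded_st b mid" unfolding mid_def by (rule sem_bounded[OF input_props(2)])
  thus "bounded_st b filled" using \<rho> mid_props(9) by (simp add: bounded_st_def filled_def overlay_def)
 qed
 interpret qd: query_data "length pts" w e A px py "2 * length pts + 32" f all_keys V \<rho>
  by unfold_locales (use fV cov in simp_all)
 have "\<forall>ms \<in> set_pmf (run b query_program query_bound (query_config D B1 B2 B3 k)).
   halted query_program ms \<and> kth_largest triangle_area (candidates (set pts) B1 B2 B3) k (query_answer ms)"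
  if B: "B1 \<in> grid w \<times> grid w" "B2 \<in> grid w \<times> grid w" "B3 \<in> grid w \<times> grid w"
   and k: "1 \<le> k" "k \<le> card (candidates (set pts) B1 B2 B3)" for B1 B2 B3 k
 proof -
  define q where "q = query_config D B1 B2 B3 k"
  define r where "r = reg q"
  let ?rs = "rect_words B1 @ rect_words B2 @ rect_words B3"
  obtain a0 a1 a2 a3 a4 a5 a6 a7 a8 a9 a10 a11 where a: "B1 = ((a0, a1), (a2, a3))" "B2 = ((a4, a5), (a6, a7))" "B3 = ((a8, a9), (a10, a11))"
   by (metis surj_pair)
  have rs: "?rs = [a0, a1, a2, a3, a4, a5, a6, a7, a8, a9, a10, a11]" using a by simp
  have rq: "r i = (if i < 13 then ([a0, a1, a2, a3, a4, a5, a6, a7, a8, a9, a10, a11, k]) ! i else 0)" for i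
   using a by (simp add: r_def q_def query_config_def init_config_def)
  have rB: "B1 = ((r 0, r 1), (r 2, r 3))" "B2 = ((r 4, r 5), (r 6, r 7))" "B3 = ((r 8, r 9), (r 10, r 11))"
   by (simp_all add: rq a)
  have r12: "r 12 = k" by (simp add: rq)
  have mq: "mem q = M'" by (simp add: q_def query_config_def init_config_def M'_def fun_eq_iff)
  have rw: "r i < 2 ^ w" if "i < 12" for i
  proof -
   let ?l = "[a0, a1, a2, a3, a4, a5, a6, a7, a8, a9, a10, a11]"
   have len: "i < length ?l" using that by simp
   have "?l ! i \<in> set ?l" using len by (rule nth_mem)
   moreover have "\<forall>x\<in>set ?l. x < 2 ^ w" using B unfolding a by (simp add: grid_def)
   moreover have "r i = (?l @ [k]) ! i" using that by (simp add: rq)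
   hence "r i = ?l ! i" using nth_append_left[OF len, of "[k]"] by (simp only:)
   ultimately show ?thesis by (simp only:)
  qed
  let ?X = "box_bounds r"
  have cX: "k \<le> card (in_box ?X)"
   using k(2) unfolding candidates_tri(2)[OF rB, symmetric] by (simp add: card_image[OF candidates_tri(1)[OF rB]])
  have kb: "k < 2 ^ b"
  proof -
   note cX
   also have "card (in_box ?X) \<le> card {..<NP ^ 3}" by (rule card_mono) (auto simp: in_box_def)
   also have "\<dots> \<le> N" using NP3 by (simp add: power3_eq_cube)
   also have "\<dots> < 2 ^ b" by (rule N_less_b)
   finally show ?thesis .
  qed
  have bd: "bounded_st b (start q)"
  proof -
   have wb: "2 ^ w < (2::nat) ^ b"
   proof (rule less_b)
    show "(2::nat) ^ w \<le> 2 ^ K" using pow_bounds(4) by (intro power_increasing) auto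
   qed
   have "r i < 2 ^ b" for i
   proof -
    consider "i < 12" | "i = 12" | "12 < i" by linarith
    thus ?thesis
    proof cases
     case 1
     thus ?thesis using rw[OF 1] wb by linarith
    next
     case 2
     thus ?thesis using kb r12 by simp
    next
     case 3
     thus ?thesis by (simp add: rq)
    qed
   qed
   moreover have "M' a < 2 ^ b" for a using tb by (simp add: M't bounded_st_def)
   ultimately show ?thesis by (simp add: bounded_st_def start_def mq r_def[symmetric])
  qed
  have mem4: "header (snd (start q))" "snd (start q) 0 = 2 * ?n + 32"
   "dict K (\<lambda>a. snd (start q) (2 * ?n + 32 + a)) f all_keys V" "\<And>x. x < N ==> snd (start q) (MB + x) = 0"
   using hM M0 dM Mfar by (simp_all add: start_def mq)
  have fr: "fst (start q) = r" by (simp add: start_def r_def)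
  have "\<exists>y\<in>in_box ?X. card {z \<in> in_box ?X. kap y < kap z} + 1 = k \<and> (\<forall>c<6. fst (sem b query_com (start q)) c = cd y c - 1)"
   using qd.query_correct[OF mem4, of k] rw r12 k(1) cX unfolding fr by blast
  then obtain y where y: "y \<in> in_box ?X" "card {z \<in> in_box ?X. kap y < kap z} + 1 = k"
   "\<forall>c<6. fst (sem b query_com (start q)) c = cd y c - 1" by blast
  have parsq: "pars (sem b load_pars (start q))" by (rule load_pars_correct[OF mem4(1)])
  obtain ms where ms: "run b query_program query_bound q = return_pmf ms" "halted query_program ms"
   "agree ms (sem b query_com (start q))"
  proof -
   have "pc q = 0" by (simp add: q_def query_config_def init_config_def)
   thus thesis
    using com_program_correct[OF query_props(1) _ agree_start bd query_time[OF parsq]] that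
    unfolding query_program_def by blast
  qed
  have "query_answer ms = tri y"
  proof -
   have "reg ms c = cd y c - 1" if "c < 6" for c using ms(3) y(3) that by (simp add: agree_def)
   hence e: "reg ms 0 = cd y 0 - 1" "reg ms 1 = cd y 1 - 1" "reg ms 2 = cd y 2 - 1" "reg ms 3 = cd y 3 - 1"
    "reg ms 4 = cd y 4 - 1" "reg ms 5 = cd y 5 - 1" by simp_all
   have "pt y 0 < ?n" "pt y 1 < ?n" "pt y 2 < ?n" using y(1) unfolding in_box_iff[OF rB] by simp_all
   thus ?thesis unfolding query_answer_def e tri_def by (simp add: cd_def px_def py_def)
  qed
  thus ?thesis using ms(1,2) kth_triangle[OF rB y(1,2)] by (simp add: q_def)
 qed
 thus ?thesis using space unfolding answers_queries_def D_def[symmetric] by blast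
qed

end

context points
begin

theorem build_correct:
 "1 - 1 / real (length pts) ^ e \<le> measure_pmf.prob
  (run b (build_program e) build_bound (init_config [length pts, w, A] (concat (map (\<lambda>(x, y). [x, y]) pts))))
  {ms. halted (build_program e) ms \<and> length (built_structure ms) \<le> space_bound \<and>
    answers_queries b query_program query_bound w (set pts) (built_structure ms)}"
proof -
 \<comment> \<open>Everything up to the drawing of the words is the same for all outcomes, so any
   outcome can stand in here.\<close>
 interpret r0: points_run pts w e A "\<lambda>_. 0" by unfold_locales
 let ?s = "start r0.input"
 have init: "fst ?s 0 = length pts" "fst ?s 1 = w" "fst ?s 2 = A"
  using r0.input_props(3-5) by (simp_all only: start_def fst_conv)
 have T: "tim b (init_com e) ?s + (2 + 7 * fst r0.mid 37) +
   tim b fill_com ((fst r0.mid)(81 := 0), overlay (fst r0.mid 38) (fst r0.mid 37) \<rho> (snd r0.mid)) \<le> build_bound" for \<rho>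
 proof -
  have "tim b fill_com ((fst r0.mid)(81 := 0), overlay (fst r0.mid 38) (fst r0.mid 37) \<rho> (snd r0.mid)) \<le> tm fill_com regs"
   by (rule r0.fill_time) (use r0.mid_props in \<open>simp_all add: pars_def\<close>)
  thus ?thesis unfolding build_bound_def r0.mid_props(4) using r0.init_time[OF init] by linarith
 qed
 have rel: "rel_pmf (\<lambda>\<rho> ms'. halted (build_program e) ms' \<and>
   agree ms' (sem b fill_com ((fst r0.mid)(81 := 0), overlay (fst r0.mid 38) (fst r0.mid 37) \<rho> (snd r0.mid))))
   (words b (fst r0.mid 37)) (run b (build_program e) build_bound r0.input)"
  unfolding build_program_def r0.mid_def
 proof (rule rand_program_correct)
  show "wfc (init_com e)" "wfc fill_com" by (rule init_props fill_props)+
  show "pc r0.input = 0" "agree r0.input ?s" "bounded_st b ?s"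
   by (rule r0.input_props agree_start)+
  have "r0.RB + R \<le> 2 ^ b"
  proof -
   have "R \<le> (R + 1) * 8" by simp
   hence "R \<le> 2 ^ K" using R_le by (rule le_trans)
   thus ?thesis using r0.far(3) by linarith
  qed
  thus "fst (sem b (init_com e) ?s) 38 + fst (sem b (init_com e) ?s) 37 \<le> 2 ^ b"
   unfolding r0.mid_def[symmetric] r0.mid_props .
  show "tim b (init_com e) ?s + (2 + 7 * fst (sem b (init_com e) ?s) 37) +
    tim b fill_com ((fst (sem b (init_com e) ?s))(81 := 0), overlay (fst (sem b (init_com e) ?s) 38) (fst (sem b (init_com e) ?s) 37) \<rho> (snd (sem b (init_com e) ?s))) \<le> build_bound" for \<rho>
   using T unfolding r0.mid_def .
 qed simp_all
 have R: "fst r0.mid 37 = R" by (rule r0.mid_props)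
 have sup: "\<And>i. \<rho> i < 2 ^ b" if "\<rho> \<in> set_pmf (words b R)" for \<rho>
  using words_bounded[OF that] by simp
 have "1 - 1 / real (length pts) ^ e \<le> measure_pmf.prob (words b R) {\<rho>. covers \<rho> nt s m}"
  by (rule covers_probability)
 also have "\<dots> = measure_pmf.prob (words b R) ({\<rho>. covers \<rho> nt s m} \<inter> set_pmf (words b R))"
  by (simp add: measure_Int_set_pmf)
 also have "\<dots> \<le> measure_pmf.prob (run b (build_program e) build_bound r0.input)
  {ms. halted (build_program e) ms \<and> length (built_structure ms) \<le> space_bound \<and>
    answers_queries b query_program query_bound w (set pts) (built_structure ms)}"
 proof (rule rel_pmf_measure_le[OF rel[unfolded R]])
  fix \<rho> ms'
  assume \<rho>: "\<rho> \<in> {\<rho>. covers \<rho> nt s m} \<inter> set_pmf (words b R)"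
   and ms': "halted (build_program e) ms' \<and> agree ms' (sem b fill_com ((fst r0.mid)(81 := 0), overlay (fst r0.mid 38) R \<rho> (snd r0.mid)))"
  interpret r: points_run pts w e A \<rho> by unfold_locales
  have f: "((fst r0.mid)(81 := 0), overlay (fst r0.mid 38) R \<rho> (snd r0.mid)) = r.filled"
   unfolding r.filled_def r0.mid_props ..
  have "length (built_structure ms') \<le> space_bound \<and> answers_queries b query_program query_bound w (set pts) (built_structure ms')"
   by (rule r.structure_correct) (use \<rho> ms' sup[of \<rho>] in \<open>simp_all add: f\<close>)
  thus "ms' \<in> {ms. halted (build_program e) ms \<and> length (built_structure ms) \<le> space_bound \<and>
    answers_queries b query_program query_bound w (set pts) (built_structure ms)}" using ms' by simp
 qed
 finally show ?thesis unfolding r0.input_def .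
qed

end

section \<open>Growth of the bounds up to polylogarithmic factors\<close>

section \<open>Asymptotics\<close>

text \<open>Resource bounds of exponent \<open>a\<close>. Working with exponents turns nested loops
  into addition of numbers.\<close>

definition PE :: "real => (nat => nat) set" where
 "PE a = {f. (\<lambda>n. real (f n)) \<in> soft_O (\<lambda>n. real n powr a)}"

lemma bound_mono:
 assumes "a \<le> c" "k \<le> l"
 shows "(\<lambda>n::nat. real n powr a * ln (real n) ^ k) \<in> O(\<lambda>n. real n powr c * ln (real n) ^ l)"
proof (rule bigoI[where c = 1])
 show "\<forall>\<^sub>F n in sequentially. norm (real n powr a * ln (real n) ^ k) \<le> 1 * norm (real n powr c * ln (real n) ^ l)"
  \<comment> \<open>From 3 on the logarithm is at least 1, so its powers grow with the
    exponent.\<close>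
  using eventually_ge_at_top[of 3]
 proof eventually_elim
  case (elim n)
  have "exp 1 \<le> real n" using elim exp_le by linarith
  hence l: "1 \<le> ln (real n)" using ln_ge_iff[of "real n" 1] elim by simp
  have "real n powr a * ln (real n) ^ k \<le> real n powr c * ln (real n) ^ l"
   using assms l elim by (intro mult_mono powr_mono power_increasing) auto
  thus ?case using l by simp
 qed
qed

lemma PE_iff: "f \<in> PE a \<longleftrightarrow> (\<exists>k. (\<lambda>n. real (f n)) \<in> O(\<lambda>n. real n powr a * ln (real n) ^ k))"
 by (simp add: PE_def soft_O_def)

lemma PE_mono: "f \<in> PE a ==> a \<le> c ==> f \<in> PE c"
 unfolding PE_iff using bound_mono[of a c] landau_o.big_trans by blast

lemma PE_add: "f \<in> PE a ==> g \<in> PE a ==> (\<lambda>n. f n + g n) \<in> PE a"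
proof -
 assume "f \<in> PE a" "g \<in> PE a"
 then obtain k l where k: "(\<lambda>n. real (f n)) \<in> O(\<lambda>n. real n powr a * ln (real n) ^ k)"
  "(\<lambda>n. real (g n)) \<in> O(\<lambda>n. real n powr a * ln (real n) ^ l)" unfolding PE_iff by blast
 have "(\<lambda>n. real (f n)) \<in> O(\<lambda>n. real n powr a * ln (real n) ^ (k + l))"
  "(\<lambda>n. real (g n)) \<in> O(\<lambda>n. real n powr a * ln (real n) ^ (k + l))"
  by (rule landau_o.big_trans[OF k(1)] landau_o.big_trans[OF k(2)], rule bound_mono; simp)+
 hence "(\<lambda>n. real (f n + g n)) \<in> O(\<lambda>n. real n powr a * ln (real n) ^ (k + l))"
  unfolding of_nat_add by (rule sum_in_bigo)
 thus ?thesis unfolding PE_iff by blast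
qed

lemma PE_mult: "f \<in> PE a ==> g \<in> PE c ==> (\<lambda>n. f n * g n) \<in> PE (a + c)"
proof -
 assume "f \<in> PE a" "g \<in> PE c"
 then obtain k l where "(\<lambda>n. real (f n)) \<in> O(\<lambda>n. real n powr a * ln (real n) ^ k)"
  "(\<lambda>n. real (g n)) \<in> O(\<lambda>n. real n powr c * ln (real n) ^ l)" unfolding PE_iff by blast
 hence "(\<lambda>n. real (f n) * real (g n)) \<in> O(\<lambda>n. (real n powr a * ln (real n) ^ k) * (real n powr c * ln (real n) ^ l))"
  by (rule landau_o.big.mult)
 also have "(\<lambda>n. (real n powr a * ln (real n) ^ k) * (real n powr c * ln (real n) ^ l)) =
   (\<lambda>n. real n powr (a + c) * ln (real n) ^ (k + l))"
  by (simp add: powr_add power_add mult.assoc mult.left_commute)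
 finally show ?thesis unfolding PE_iff by auto
qed

text \<open>Allows negative exponents \<open>c\<close>, which come from the divisions by
  \<open>s\<close> in the numbers of chains and of stored counts.\<close>

lemma PE_scale:
 assumes "g \<in> PE a" "\<And>n. 2 \<le> n ==> real (f n) \<le> C * (real (g n) * real n powr c)"
 shows "f \<in> PE (a + c)"
proof -
 obtain k where k: "(\<lambda>n. real (g n)) \<in> O(\<lambda>n. real n powr a * ln (real n) ^ k)"
  using assms(1) unfolding PE_iff by blast
 have "(\<lambda>n. real (f n)) \<in> O(\<lambda>n. real (g n) * real n powr c)"
 proof (rule bigoI[where c = C])
  show "\<forall>\<^sub>F n in sequentially. norm (real (f n)) \<le> C * norm (real (g n) * real n powr c)"
   using eventually_ge_at_top[of 2] by eventually_elim (use assms(2) in simp)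
 qed
 also have "(\<lambda>n. real (g n) * real n powr c) \<in> O(\<lambda>n. (real n powr a * ln (real n) ^ k) * real n powr c)"
  using k by (rule landau_o.big.mult) simp
 also have "(\<lambda>n. (real n powr a * ln (real n) ^ k) * real n powr c) = (\<lambda>n. real n powr (a + c) * ln (real n) ^ k)"
  by (simp add: powr_add mult.assoc mult.commute mult.left_commute)
 finally show ?thesis unfolding PE_iff by blast
qed

lemma PE_const: "(\<lambda>_. c) \<in> PE 0"
proof -
 have "(\<lambda>n. real c) \<in> O(\<lambda>n. real n powr 0 * ln (real n) ^ 0)"
 proof (rule bigoI[where c = "real c"])
  show "\<forall>\<^sub>F n in sequentially. norm (real c) \<le> real c * norm (real n powr 0 * ln (real n) ^ 0)"
   using eventually_gt_at_top[of 0] by eventually_elim simp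
 qed
 thus ?thesis unfolding PE_iff by blast
qed

lemma PE_le: "g \<in> PE a ==> (\<And>n. 2 \<le> n ==> f n \<le> g n) ==> f \<in> PE a"
 using PE_scale[of g a f 1 0] by simp

lemma PE_powr: "(\<And>n. 2 \<le> n ==> real (f n) \<le> C * real n powr c) ==> f \<in> PE c"
 using PE_scale[OF PE_const, of f C 1 c] by simp

lemma PE_nonneg: "f \<in> PE 0 ==> 0 \<le> a ==> f \<in> PE a"
 by (rule PE_mono)

lemma PE_add0: "f \<in> PE 0 ==> g \<in> PE 0 ==> (\<lambda>n. f n + g n) \<in> PE 0" by (rule PE_add)
lemma PE_mult0: "f \<in> PE 0 ==> g \<in> PE 0 ==> (\<lambda>n. f n * g n) \<in> PE 0" using PE_mult[of f 0 g 0] by simp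

lemma PE_power0: "f \<in> PE 0 ==> (\<lambda>n. f n ^ k) \<in> PE 0"
 by (induction k) (auto intro: PE_mult0 PE_const)

text \<open>Loops with polylogarithmic bounds stay polylogarithmic however they are nested.\<close>

lemma PE_tm_0:
 assumes "\<And>p. p \<in> lp c ==> (\<lambda>n. r n p) \<in> PE 0"
 shows "(\<lambda>n. tm c (r n)) \<in> PE 0"
 using assms
proof (induction c)
 case (For x p c)
 thus ?case unfolding tm.simps by (intro PE_add0 PE_mult0 PE_const) simp_all
next
 case (Cond e c1 c2)
 thus ?case unfolding tm.simps by (intro PE_add0 PE_const) simp_all
qed (auto intro!: PE_const PE_add0)

lemma PE_tm_flat: "(\<And>p. p \<in> lp c ==> (\<lambda>n. r n p) \<in> PE 0) ==> 0 \<le> a ==> (\<lambda>n. tm c (r n)) \<in> PE a"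
 by (rule PE_mono[OF PE_tm_0])

lemma PE_tm_Seq: "(\<lambda>n. tm c1 (r n)) \<in> PE a ==> (\<lambda>n. tm c2 (r n)) \<in> PE a ==> (\<lambda>n. tm (c1 ;; c2) (r n)) \<in> PE a"
 by (simp add: PE_add)

lemma PE_tm_Cond: "0 \<le> a ==> (\<lambda>n. tm c1 (r n)) \<in> PE a ==> (\<lambda>n. tm c2 (r n)) \<in> PE a ==> (\<lambda>n. tm (Cond e c1 c2) (r n)) \<in> PE a"
 unfolding tm.simps by (intro PE_add) (auto intro: PE_mono[OF PE_const])

lemma PE_tm_For:
 assumes "(\<lambda>n. r n p) \<in> PE x" "(\<lambda>n. tm c (r n)) \<in> PE y" "0 \<le> y" "x + y \<le> a" "0 \<le> a"
 shows "(\<lambda>n. tm (For z p c) (r n)) \<in> PE a"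
proof -
 have "(\<lambda>n. tm c (r n) + 4) \<in> PE y" using assms(2,3) by (intro PE_add) (auto intro: PE_mono[OF PE_const])
 hence "(\<lambda>n. r n p * (tm c (r n) + 4)) \<in> PE (x + y)" by (rule PE_mult[OF assms(1)])
 hence "(\<lambda>n. r n p * (tm c (r n) + 4)) \<in> PE a" using assms(4) by (rule PE_mono)
 thus ?thesis unfolding tm.simps using assms(5) by (intro PE_add) (auto intro: PE_mono[OF PE_const])
qed

lemma floorlog_PE: "(\<lambda>n. floorlog 2 n) \<in> PE 0"
proof -
 have "(\<lambda>n. real (floorlog 2 n)) \<in> O(\<lambda>n. real n powr 0 * ln (real n) ^ 1)"
 proof (rule bigoI[where c = 3])
  show "\<forall>\<^sub>F n in sequentially. norm (real (floorlog 2 n)) \<le> 3 * norm (real n powr 0 * ln (real n) ^ 1)"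
   using eventually_ge_at_top[of 3]
  proof eventually_elim
   case (elim n)
   have "exp 1 \<le> real n" using elim exp_le by linarith
   hence l: "1 \<le> ln (real n)" using ln_ge_iff[of "real n" 1] elim by simp
   have "2 ^ (floorlog 2 n - 1) \<le> n" using floorlog_bounds[of n 2] elim by simp
   hence "real (2 ^ (floorlog 2 n - 1)) \<le> real n" by (simp only: of_nat_le_iff)
   hence "ln (2 ^ (floorlog 2 n - 1)) \<le> ln (real n)" by (subst ln_le_cancel_iff) (use elim in simp_all)
   hence "real (floorlog 2 n - 1) * ln 2 \<le> ln (real n)" by (simp add: ln_realpow)
   moreover have "real (floorlog 2 n - 1) * (1 / 2) \<le> real (floorlog 2 n - 1) * ln 2"
    using ln2_ge_two_thirds by (intro mult_left_mono) auto
   ultimately have "real (floorlog 2 n - 1) \<le> 2 * ln (real n)" by simp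
   hence "real (floorlog 2 n) \<le> 3 * ln (real n)" using l by linarith
   thus ?case using l elim by simp
  qed
 qed
 thus ?thesis unfolding PE_iff by blast
qed

context
 fixes \<alpha> :: real and w :: "nat => nat" and e :: nat
 assumes \<alpha>: "0 < \<alpha>" "\<alpha> < 1" and w: "polylog w"
begin

definition Ap :: "nat => nat" where "Ap n = nat \<lfloor>real n powr \<alpha>\<rfloor>"

definition valid :: "nat => bool" where "valid n \<longleftrightarrow> 2 \<le> n \<and> 1 \<le> w n"

lemma Ap: "2 \<le> n ==> 1 \<le> Ap n" "2 \<le> n ==> Ap n \<le> n" "2 \<le> n ==> real (Ap n) \<le> real n powr \<alpha>" "2 \<le> n ==> real n powr \<alpha> < real (Ap n) + 1"
proof -
 assume n: "2 \<le> n"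
 have 1: "1 \<le> real n powr \<alpha>" using n \<alpha> by (intro ge_one_powr_ge_zero) auto
 show "1 \<le> Ap n" using 1 by (simp add: Ap_def le_nat_iff le_floor_iff)
 show le: "real (Ap n) \<le> real n powr \<alpha>" using 1 by (simp add: Ap_def)
 show "real n powr \<alpha> < real (Ap n) + 1" using 1 unfolding Ap_def by linarith
 have "real n powr \<alpha> \<le> real n powr 1" using n \<alpha> by (intro powr_mono) auto
 thus "Ap n \<le> n" using le n by simp
qed

lemma layout: "valid n ==> layout n (w n) (Ap n) (\<lambda>_. 0) (\<lambda>_. 0)"
 unfolding valid_def by unfold_locales (use Ap in simp_all)

text \<open>The parameters make sense for \<open>valid n\<close> only. The default 0 does no harm:
  for \<open>n >= 2\<close> an invalid \<open>n\<close> has a grid with one point and thus no input,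
  and for \<open>n = 1\<close> the claimed probability is 0.\<close>

definition on :: "(nat => nat) => nat => nat" where
 "on f n = (if valid n then f n else 0)"

lemma on_PE: "g \<in> PE a ==> (\<And>n. valid n ==> f n \<le> g n) ==> a \<le> c ==> on f \<in> PE c"
 by (rule PE_mono[OF PE_le]) (auto simp: on_def)

lemma w_PE: "w \<in> PE 0"
proof -
 obtain k where k: "(\<lambda>n. real (w n)) \<in> O(\<lambda>n. 1 * ln (real n) ^ k)"
  using w unfolding polylog_def soft_O_def by blast
 also have "(\<lambda>n. 1 * ln (real n) ^ k) \<in> O(\<lambda>n. real n powr 0 * ln (real n) ^ k)"
 proof (rule bigoI[where c = 1])
  show "\<forall>\<^sub>F n in sequentially. norm (1 * ln (real n) ^ k) \<le> 1 * norm (real n powr 0 * ln (real n) ^ k)"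
   using eventually_gt_at_top[of 0] by eventually_elim simp
 qed
 finally show ?thesis unfolding PE_iff by blast
qed

lemmas flat = PE_add0 PE_mult0 PE_const w_PE floorlog_PE

lemma K_PE: "on (\<lambda>n. layout.K n (w n) e) \<in> PE 0"
 by (rule on_PE[where g = "\<lambda>n. (e + 40) * (w n + floorlog 2 n)" and a = 0])
  (intro flat | simp add: layout.K_def[OF layout] layout.Z_def[OF layout] layout.q0_def[OF layout])+

lemma W_PE: "on (\<lambda>n. layout.W (w n)) \<in> PE 0"
 by (rule on_PE[where g = "\<lambda>n. w n + 1" and a = 0]) (intro flat | simp add: layout.W_def[OF layout])+

lemma KB_PE: "on (\<lambda>n. layout.KB n (w n)) \<in> PE 0"
 by (rule on_PE[where g = "\<lambda>n. 2 * w n + 2 + 3 * floorlog 2 n" and a = 0])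
  (intro flat | simp add: layout.KB_def[OF layout] layout.AB_def[OF layout] layout.q0_def[OF layout])+

lemma n_PE: "(\<lambda>n. n) \<in> PE 1"
 by (rule PE_powr[of _ 1]) simp

lemma N_PE: "on (\<lambda>n. layout.N n (w n)) \<in> PE 3"
proof (rule on_PE)
 have 2: "(\<lambda>n. 2 * n) \<in> PE (0 + 1)" by (intro PE_mult PE_const n_PE)
 show "(\<lambda>n. (2 * n) * (2 * n) * (2 * n) * (2 * (w n + 1)) ^ 6) \<in> PE ((0 + 1) + (0 + 1) + (0 + 1) + 0)"
  by (intro PE_mult 2 PE_power0 flat)
 show "layout.N n (w n) \<le> (2 * n) * (2 * n) * (2 * n) * (2 * (w n + 1)) ^ 6" if v: "valid n" for n
 proof -
  have "layout.L (w n) ^ 6 \<le> (2 * (w n + 1)) ^ 6"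
   using layout.L_le[OF layout[OF v]] unfolding layout.W_def[OF layout[OF v]] by (intro power_mono) auto
  moreover have "layout.NP n ^ 3 \<le> (2 * n) ^ 3" using layout.NP_le[OF layout[OF v]] by (intro power_mono) auto
  ultimately show ?thesis unfolding layout.N_def[OF layout[OF v]] power3_eq_cube by (rule mult_le_mono[rotated])
 qed
qed simp

lemma s_bounds:
 assumes "valid n"
 shows "real (layout.s n (Ap n)) \<le> real n powr (\<alpha> / 4)" "1 / real (layout.s n (Ap n)) \<le> 2 * real n powr (- \<alpha> / 4)"
  "1 \<le> real (layout.s n (Ap n))"
proof -
 let ?s = "layout.s n (Ap n)"
 have n: "2 \<le> n" using assms by (simp add: valid_def)
 note s = layout.s_props[OF layout[OF assms]]
 show s1: "1 \<le> real ?s" using s(1) by simp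
 have root: "(x ^ 4) powr (1 / 4) = x" if "0 < x" for x :: real
 proof -
  have e: "x ^ 4 = x powr 4" using that by simp
  show ?thesis unfolding e powr_powr using that by simp
 qed
 have q: "(real n powr \<alpha>) powr (1 / 4) = real n powr (\<alpha> / 4)" by (simp add: powr_powr)
 have "real (?s ^ 4) \<le> real (Ap n)" using s(2) by (simp only: of_nat_le_iff)
 hence "real ?s ^ 4 \<le> real n powr \<alpha>" using Ap(3)[OF n] by (simp only: of_nat_power)
 hence "(real ?s ^ 4) powr (1 / 4) \<le> (real n powr \<alpha>) powr (1 / 4)" by (intro powr_mono2) auto
 thus "real ?s \<le> real n powr (\<alpha> / 4)" using root[of "real ?s"] s1 q by simp
 \<comment> \<open>For integers \<open>A < (2 * s) ^ 4\<close> gives \<open>A + 1\<close>, which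
   absorbs the floor in \<open>A\<close>.\<close>
 have "real (Ap n + 1) \<le> real ((2 * ?s) ^ 4)" using s(3) by (simp only: of_nat_le_iff Suc_eq_plus1[symmetric] Suc_le_eq)
 hence "real n powr \<alpha> \<le> (2 * real ?s) ^ 4" using Ap(4)[OF n] by simp
 hence "(real n powr \<alpha>) powr (1 / 4) \<le> ((2 * real ?s) ^ 4) powr (1 / 4)" by (intro powr_mono2) auto
 hence "real n powr (\<alpha> / 4) \<le> 2 * real ?s" using root[of "2 * real ?s"] s1 q by simp
 thus "1 / real ?s \<le> 2 * real n powr (- \<alpha> / 4)"
  using s1 n by (simp add: powr_minus field_simps)
qed

lemma s_PE: "on (\<lambda>n. layout.s n (Ap n)) \<in> PE (\<alpha> / 4)"
 by (rule PE_powr[of _ 1]) (use s_bounds(1) in \<open>simp add: on_def\<close>)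

lemma nt_PE: "on (\<lambda>n. layout.nt n (w n) e (Ap n)) \<in> PE (\<alpha> / 4)"
 by (rule on_PE[OF PE_mult[OF s_PE PE_mult0[OF K_PE PE_const[of "16 * (e + 1)"]]]])
  (simp_all add: on_def layout.nt_def[OF layout] algebra_simps)

lemma R_PE: "on (\<lambda>n. layout.R n (w n) e (Ap n)) \<in> PE (\<alpha> / 2)"
 by (rule on_PE[OF PE_mult[OF nt_PE PE_mult[OF s_PE PE_add0[OF K_PE PE_const[of 1]]]]])
  (simp_all add: on_def layout.R_def[OF layout])

lemma m_PE: "on (\<lambda>n. layout.m n (w n) (Ap n)) \<in> PE (3 - \<alpha> / 2)"
proof -
 have "on (\<lambda>n. layout.m n (w n) (Ap n)) \<in> PE (3 + - \<alpha> / 2)"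
 proof (rule PE_scale[OF N_PE, where C = 1])
  fix n assume "2 \<le> (n::nat)"
  show "real (on (\<lambda>n. layout.m n (w n) (Ap n)) n) \<le> 1 * (real (on (\<lambda>n. layout.N n (w n)) n) * real n powr (- \<alpha> / 2))"
  proof (cases "valid n")
   case True
   let ?s = "layout.s n (Ap n)" and ?N = "layout.N n (w n)"
   note s = s_bounds(2,3)[OF True]
   have "real (?N div (4 * ?s * ?s)) \<le> real ?N / real (4 * ?s * ?s)" by (rule of_nat_div_le_of_nat)
   also have "\<dots> = real ?N * (1 / real ?s * (1 / real ?s)) / 4" using s(2) by simp
   also have "\<dots> \<le> real ?N * (2 * real n powr (- \<alpha> / 4) * (2 * real n powr (- \<alpha> / 4))) / 4"
    using s by (intro divide_right_mono mult_left_mono mult_mono) auto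
   also have "\<dots> = real ?N * (real n powr (- \<alpha> / 4) * real n powr (- \<alpha> / 4))" by simp
   also have "\<dots> = real ?N * real n powr (- \<alpha> / 2)" by (simp only: powr_add[symmetric]) simp
   finally show ?thesis using True by (simp add: on_def layout.m_def[OF layout])
  qed (simp add: on_def)
 qed
 thus ?thesis by (simp add: field_simps)
qed

lemma Ns_PE: "on (\<lambda>n. layout.N n (w n) * layout.K n (w n) e div layout.s n (Ap n)) \<in> PE (3 - \<alpha> / 4)"
proof -
 have g: "(\<lambda>n. on (\<lambda>n. layout.N n (w n)) n * on (\<lambda>n. layout.K n (w n) e) n) \<in> PE (3 + 0)"
  by (intro PE_mult N_PE K_PE)
 have "on (\<lambda>n. layout.N n (w n) * layout.K n (w n) e div layout.s n (Ap n)) \<in> PE ((3 + 0) + - \<alpha> / 4)"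
 proof (rule PE_scale[OF g, where C = 2])
  fix n assume "2 \<le> (n::nat)"
  show "real (on (\<lambda>n. layout.N n (w n) * layout.K n (w n) e div layout.s n (Ap n)) n) \<le>
    2 * (real (on (\<lambda>n. layout.N n (w n)) n * on (\<lambda>n. layout.K n (w n) e) n) * real n powr (- \<alpha> / 4))"
  proof (cases "valid n")
   case True
   let ?s = "layout.s n (Ap n)" and ?X = "layout.N n (w n) * layout.K n (w n) e"
   have "real (?X div ?s) \<le> real ?X / real ?s" by (rule of_nat_div_le_of_nat)
   also have "\<dots> = real ?X * (1 / real ?s)" by simp
   also have "\<dots> \<le> real ?X * (2 * real n powr (- \<alpha> / 4))"
    using s_bounds(2)[OF True] by (intro mult_left_mono) auto
   finally show ?thesis using True by (simp add: on_def mult.assoc mult.left_commute)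
  qed (simp add: on_def)
 qed
 thus ?thesis by simp
qed

definition rg :: "nat => nat => nat" where
 "rg n z = on (\<lambda>n. layout.regs n (w n) e (Ap n) z) n"

lemma rg_PE: "(\<lambda>n. rg n 21) \<in> PE 0" "(\<lambda>n. rg n 22) \<in> PE 0" "(\<lambda>n. rg n 25) \<in> PE 3" "(\<lambda>n. rg n 26) \<in> PE (\<alpha> / 4)"
 "(\<lambda>n. rg n 27) \<in> PE (\<alpha> / 4)" "(\<lambda>n. rg n 31) \<in> PE 0" "(\<lambda>n. rg n 32) \<in> PE 0" "(\<lambda>n. rg n 35) \<in> PE (3 - \<alpha> / 2)"
 "(\<lambda>n. rg n 36) \<in> PE 1" "(\<lambda>n. rg n 37) \<in> PE (\<alpha> / 2)"
proof -
 have c: "(\<lambda>n. rg n z) \<in> PE a" if "on g \<in> PE a" "\<And>n. valid n ==> layout.regs n (w n) e (Ap n) z = g n" for z g a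
  using that(1) by (rule PE_le) (use that(2) in \<open>simp add: rg_def on_def\<close>)
 note d = layout.regs_def[OF layout]
 show "(\<lambda>n. rg n 21) \<in> PE 0" by (rule c[OF K_PE]) (simp add: d)
 show "(\<lambda>n. rg n 22) \<in> PE 0" by (rule c[OF W_PE]) (simp add: d)
 show "(\<lambda>n. rg n 25) \<in> PE 3" by (rule c[OF N_PE]) (simp add: d)
 show "(\<lambda>n. rg n 26) \<in> PE (\<alpha> / 4)" by (rule c[OF s_PE]) (simp add: d)
 show "(\<lambda>n. rg n 27) \<in> PE (\<alpha> / 4)" by (rule c[OF nt_PE]) (simp add: d)
 show "(\<lambda>n. rg n 31) \<in> PE 0" by (rule c[OF KB_PE]) (simp add: d)
 show "(\<lambda>n. rg n 32) \<in> PE 0" by (rule c[OF on_PE[OF PE_const[of 2], of "\<lambda>_. 2"]]) (simp_all add: d)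
 show "(\<lambda>n. rg n 35) \<in> PE (3 - \<alpha> / 2)" by (rule c[OF m_PE]) (simp add: d)
 show "(\<lambda>n. rg n 36) \<in> PE 1" by (rule c[OF on_PE[OF n_PE, of "\<lambda>n. n"]]) (simp_all add: d)
 show "(\<lambda>n. rg n 37) \<in> PE (\<alpha> / 2)" by (rule c[OF R_PE]) (simp add: d)
qed

lemmas rg_For = PE_tm_For[where r = rg]

lemma rg_flat: "lp c \<subseteq> {21, 22, 31, 32} ==> 0 \<le> a ==> (\<lambda>n. tm c (rg n)) \<in> PE a"
 using rg_PE by (intro PE_tm_flat) auto

lemma walk_PE: "(\<lambda>n. tm (walk_com y) (rg n)) \<in> PE (\<alpha> / 4)"
 unfolding walk_com_def using \<alpha>
 by (intro rg_For[OF rg_PE(4), of _ 0] rg_flat) (auto simp: lp_walk step_com_def)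

lemma fill_PE: "(\<lambda>n. tm fill_com (rg n)) \<in> PE 3"
proof -
 have pts: "(\<lambda>n. tm (pts_com c) (rg n)) \<in> PE 3" for c
  unfolding pts_com_def by (rule rg_For[OF rg_PE(9) rg_flat[of _ 0]]) (auto simp: put_props)
 have wds: "(\<lambda>n. tm wds_com (rg n)) \<in> PE 3"
  unfolding wds_com_def using \<alpha> by (intro rg_For[OF rg_PE(10) rg_flat[of _ 0]]) (auto simp: put_props)
 have pairs: "(\<lambda>n. tm (each_pair B) (rg n)) \<in> PE 3" if "lp B \<subseteq> {21}" for B
  unfolding each_pair_def by (rule rg_For[OF rg_PE(3) rg_flat[of _ 0]]) (use that in \<open>auto simp: lp_walk\<close>)
 \<comment> \<open>Walking all chains has exponent
   \<open>\<alpha> / 4 + (3 - \<alpha> / 2) + \<alpha> / 4 = 3\<close>: all chains together have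
   about as many steps as there are items.\<close>
 have ends: "(\<lambda>n. tm ends_com (rg n)) \<in> PE 3"
  unfolding ends_com_def
 proof (rule rg_For[OF rg_PE(5)])
  show "(\<lambda>n. tm (For 84 35 (Set rHy (Rg 84) ;; walk_com (Cn 1) ;; Set rVal (Rg 84) ;;
   put (Cn 8 [*] (Rg rHy [*] Rg rNt [+] Rg rHt) [+] Cn 5))) (rg n)) \<in> PE (3 - \<alpha> / 4)"
  proof (rule rg_For[OF rg_PE(8)])
   show "(\<lambda>n. tm (Set rHy (Rg 84) ;; walk_com (Cn 1) ;; Set rVal (Rg 84) ;;
   put (Cn 8 [*] (Rg rHy [*] Rg rNt [+] Rg rHt) [+] Cn 5)) (rg n)) \<in> PE (\<alpha> / 4)"
    using \<alpha> by (intro PE_tm_Seq walk_PE rg_flat) (auto simp: put_props)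
  qed (use \<alpha> in auto)
 qed (use \<alpha> in auto)
 show ?thesis unfolding fill_com_def
  by (intro PE_tm_Seq pts wds pairs ends rg_flat) (auto simp: tally_body_def cts_body_def put_props header_com_def)
qed

text \<open>Tables, columns and the length of a walk contribute \<open>\<alpha> / 4\<close> each.
  Every node is charged a full inversion, also where its count is stored, and the number of nodes is
  polylogarithmic.\<close>

lemma query_PE: "(\<lambda>n. tm query_rest (rg n)) \<in> PE (3 * \<alpha> / 4)"
proof -
 have probe: "(\<lambda>n. tm probe_com (rg n)) \<in> PE (\<alpha> / 4)"
  unfolding probe_com_def using \<alpha> by (intro PE_tm_Seq PE_tm_Cond walk_PE rg_flat) (auto simp: lp_walk)
 have "(\<lambda>n. tm (For rI rS probe_com) (rg n)) \<in> PE (2 * \<alpha> / 4)"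
  using \<alpha> by (intro rg_For[OF rg_PE(4) probe]) auto
 hence probes: "(\<lambda>n. tm (For rHt rNt (For rI rS probe_com)) (rg n)) \<in> PE (3 * \<alpha> / 4)"
  using \<alpha> by (intro rg_For[OF rg_PE(5)]) auto
 have count: "(\<lambda>n. tm count_com (rg n)) \<in> PE (3 * \<alpha> / 4)"
  unfolding count_com_def using \<alpha> by (intro PE_tm_Seq PE_tm_Cond probes rg_flat) (auto simp: lp_walk)
 have leaf: "(\<lambda>n. tm leaf_com (rg n)) \<in> PE (3 * \<alpha> / 4)"
  unfolding leaf_com_def using \<alpha> by (intro PE_tm_Seq count rg_flat) auto
 have nest: "(\<lambda>n. tm (nest_com k) (rg n)) \<in> PE (3 * \<alpha> / 4)" for k
 proof (induction k)
  case 0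
  thus ?case using leaf by simp
 next
  case (Suc k)
  have B: "(\<lambda>n. tm (Cond (Rg (130 + (5 - k))) (Set (160 + (5 - k)) (Rg (100 + (5 - k)))) (Set (160 + (5 - k)) (Rg (110 + (5 - k)))) ;;
   Cond ((Rg (160 + (5 - k)) [>>] Rg (120 + (5 - k))) [mod] Cn 2)
    (Set (141 + (5 - k)) (Rg (140 + (5 - k)) [*] (Cn 2 [*] Rg rPW) [+]
      (((Rg rPW [+] Rg (160 + (5 - k))) [>>] Rg (120 + (5 - k))) [-] Cn 1)) ;;
     Set (151 + (5 - k)) (Rg (150 + (5 - k)) [+] Rg (130 + (5 - k))) ;; nest_com k)
    Skip) (rg n)) \<in> PE (3 * \<alpha> / 4)"
   using \<alpha> by (intro PE_tm_Seq PE_tm_Cond Suc.IH rg_flat) auto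
  show ?case unfolding nest_com.simps level_com_def
   using \<alpha> by (intro rg_For[OF rg_PE(2) rg_For[OF rg_PE(7) B, where a = "3 * \<alpha> / 4"]]) auto
 qed
 have body: "(\<lambda>n. tm search_body (rg n)) \<in> PE (3 * \<alpha> / 4)"
  unfolding search_body_def using \<alpha> by (intro PE_tm_Seq nest rg_flat) auto
 have search: "(\<lambda>n. tm (For 175 rKB search_body) (rg n)) \<in> PE (3 * \<alpha> / 4)"
  using \<alpha> by (intro rg_For[OF rg_PE(6) body]) auto
 show ?thesis unfolding query_rest_def
  using \<alpha> by (intro PE_tm_Seq search rg_flat) (auto simp: bounds_com_def output_com_def lp_walk)
qed

definition build_time :: "nat => nat" where
 "build_time = on (\<lambda>n. layout.build_bound n (w n) e (Ap n))"

definition space :: "nat => nat" where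
 "space = on (\<lambda>n. layout.space_bound n (w n) e (Ap n))"

definition query_time :: "nat => nat" where
 "query_time = on (\<lambda>n. layout.query_bound n (w n) e (Ap n))"

lemma rg_valid: "valid n ==> rg n = layout.regs n (w n) e (Ap n)"
 by (simp add: rg_def on_def fun_eq_iff)

lemma build_time_PE: "build_time \<in> PE 3"
 unfolding build_time_def
proof (rule on_PE)
 let ?g = "\<lambda>n. tm bits_com (\<lambda>_. n) + (tm (sizes_com e) (\<lambda>_. 0) + (tm round_com (\<lambda>_. w n + 1) +
  (tm root_com (\<lambda>_. floorlog 2 n) + tm (params_com e) (\<lambda>_. 0)))) + (2 + 7 * on (\<lambda>n. layout.R n (w n) e (Ap n)) n) +
  tm fill_com (rg n)"
 have "(\<lambda>n. tm bits_com (\<lambda>_. n)) \<in> PE 3"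
  unfolding bits_com_def
  by (intro PE_tm_Seq PE_tm_For[where x = 1 and y = 0 and r = "\<lambda>n _. n"] PE_tm_flat n_PE) auto
 moreover have "(\<lambda>n. tm (sizes_com e) (\<lambda>_. 0) + (tm round_com (\<lambda>_. w n + 1) +
  (tm root_com (\<lambda>_. floorlog 2 n) + tm (params_com e) (\<lambda>_. 0)))) \<in> PE 3"
  by (rule PE_nonneg, intro PE_add0 PE_tm_0 flat) auto
 moreover have "(\<lambda>n. 2 + 7 * on (\<lambda>n. layout.R n (w n) e (Ap n)) n) \<in> PE 3"
 proof -
  have "(\<lambda>n. 7 * on (\<lambda>n. layout.R n (w n) e (Ap n)) n) \<in> PE (0 + \<alpha> / 2)" by (intro PE_mult PE_const R_PE)
  hence "(\<lambda>n. 7 * on (\<lambda>n. layout.R n (w n) e (Ap n)) n) \<in> PE 3" by (rule PE_mono) (use \<alpha> in simp)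
  thus ?thesis by (intro PE_add PE_nonneg[OF PE_const]) auto
 qed
 ultimately show "?g \<in> PE 3" by (rule PE_add[OF PE_add[OF PE_add] fill_PE])
 show "layout.build_bound n (w n) e (Ap n) \<le> ?g n" if "valid n" for n
  using that by (simp add: layout.build_bound_def[OF layout] rg_valid layout.W_def[OF layout] layout.q0_def[OF layout] on_def)
qed simp

lemma space_PE: "space \<in> PE (3 - \<alpha> / 4)"
 unfolding space_def
proof (rule on_PE)
 let ?K = "on (\<lambda>n. layout.K n (w n) e)" and ?R = "on (\<lambda>n. layout.R n (w n) e (Ap n))"
  and ?X = "on (\<lambda>n. layout.N n (w n) * layout.K n (w n) e div layout.s n (Ap n))"
  and ?nt = "on (\<lambda>n. layout.nt n (w n) e (Ap n))" and ?m = "on (\<lambda>n. layout.m n (w n) (Ap n))"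
 let ?g = "\<lambda>n. 2 * n + 36 + 2 * (?K n * (2 * n + ?R n + ?X n + ?nt n * ?m n))"
 have n: "(\<lambda>n. 2 * n) \<in> PE (3 - \<alpha> / 4)"
 proof (rule PE_mono)
  show "(\<lambda>n. 2 * n) \<in> PE (0 + 1)" by (intro PE_mult PE_const n_PE)
 qed (use \<alpha> in simp)
 have R: "?R \<in> PE (3 - \<alpha> / 4)" by (rule PE_mono[OF R_PE]) (use \<alpha> in simp)
 have M: "(\<lambda>n. ?nt n * ?m n) \<in> PE (3 - \<alpha> / 4)"
  by (rule PE_mono[OF PE_mult[OF nt_PE m_PE]]) simp
 have "(\<lambda>n. 2 * (?K n * (2 * n + ?R n + ?X n + ?nt n * ?m n))) \<in> PE (0 + (0 + (3 - \<alpha> / 4)))"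
  by (intro PE_mult PE_const K_PE PE_add n R M Ns_PE)
 hence "(\<lambda>n. 2 * (?K n * (2 * n + ?R n + ?X n + ?nt n * ?m n))) \<in> PE (3 - \<alpha> / 4)" by simp
 moreover have "(\<lambda>n. 36) \<in> PE (3 - \<alpha> / 4)" by (rule PE_nonneg[OF PE_const]) (use \<alpha> in simp)
 ultimately show "?g \<in> PE (3 - \<alpha> / 4)" using n by (intro PE_add)
 show "layout.space_bound n (w n) e (Ap n) \<le> ?g n" if "valid n" for n
  using that by (simp add: layout.space_bound_def[OF layout] on_def)
qed simp

lemma query_time_PE: "query_time \<in> PE \<alpha>"
 unfolding query_time_def
proof (rule on_PE)
 have "(\<lambda>n. tm query_rest (rg n)) \<in> PE \<alpha>" by (rule PE_mono[OF query_PE]) (use \<alpha> in simp)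
 thus "(\<lambda>n. tm load_pars (\<lambda>_. 0) + tm query_rest (rg n)) \<in> PE \<alpha>"
  by (intro PE_add PE_nonneg[OF PE_const]) (use \<alpha> in simp_all)
 show "layout.query_bound n (w n) e (Ap n) \<le> tm load_pars (\<lambda>_. 0) + tm query_rest (rg n)" if "valid n" for n
  using that by (simp add: layout.query_bound_def[OF layout] rg_valid)
qed simp

lemma structure_probability:
 assumes n: "1 \<le> n" and S: "S \<subseteq> grid (w n)" "card S = n" and pts: "distinct pts" "set pts = S"
 shows "measure_pmf.prob
    (run (word_length (2 * (e + 40)) (w n) n) (build_program e) (build_time n) (build_config \<alpha> (w n) pts))
    {s. halted (build_program e) s \<and>
      length (built_structure s) \<le> space n \<and>
      answers_queries (word_length (2 * (e + 40)) (w n) n) query_program (query_time n) (w n) S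
       (built_structure s)}
   \<ge> 1 - 1 / real n ^ e"
proof (cases "2 \<le> n")
 \<comment> \<open>A single point: \<open>1 - 1 / 1 ^ e\<close> is 0.\<close>
 case False
 hence "n = 1" using n by simp
 thus ?thesis by simp
next
 case True
 have len: "length pts = n" using distinct_card[OF pts(1)] pts(2) S(2) by simp
 interpret points pts "w n" e "Ap n"
  by unfold_locales (use True len S pts Ap in simp_all)
 have v: "valid n" using True w1 by (simp add: valid_def)
 \<comment> \<open>The witness for \<open>c\<close> is chosen so that machine words have exactly
   \<open>2 * K\<close> bits.\<close>
 have b: "word_length (2 * (e + 40)) (w n) n = b"
  unfolding b_def K_def Z_def q0_def unfolding len by (simp add: word_length_def)
 have t: "build_time n = build_bound" "space n = space_bound" "query_time n = query_bound"
  using v by (simp_all add: build_time_def space_def query_time_def on_def len)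
 have c: "build_config \<alpha> (w n) pts = init_config [length pts, w n, Ap n] (concat (map (\<lambda>(x, y). [x, y]) pts))"
  by (simp add: build_config_def Ap_def len)
 show ?thesis unfolding b t c using build_correct unfolding len pts(2) .
qed

end

theorem mainTheorem12:
  fixes \<alpha> :: real and w :: "nat \<Rightarrow> nat" and e :: nat
  assumes "0 < \<alpha>" and "\<alpha> < 1" and "polylog w"
  shows "\<exists>(build :: program) (query :: program) (c :: nat)
           (build_time :: nat \<Rightarrow> nat) (space :: nat \<Rightarrow> nat) (query_time :: nat \<Rightarrow> nat).
    3 \<le> c \<and>
    (\<lambda>n. real (build_time n)) \<in> soft_O (\<lambda>n. real n ^ 3) \<and>
    (\<lambda>n. real (space n)) \<in> soft_O (\<lambda>n. real n powr (3 - \<alpha> / 4)) \<and>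
    (\<lambda>n. real (query_time n)) \<in> soft_O (\<lambda>n. real n powr \<alpha>) \<and>
    (\<forall>n S pts.
       1 \<le> n \<longrightarrow> S \<subseteq> grid (w n) \<longrightarrow> card S = n \<longrightarrow> distinct pts \<longrightarrow> set pts = S \<longrightarrow>
       measure_pmf.prob
         (run (word_length c (w n) n) build (build_time n) (build_config \<alpha> (w n) pts))
         {s. halted build s \<and>
             length (built_structure s) \<le> space n \<and>
             answers_queries (word_length c (w n) n) query (query_time n) (w n) S
               (built_structure s)}
       \<ge> 1 - 1 / real n ^ e)"
proof (intro exI conjI allI impI)
 show "3 \<le> 2 * (e + 40)" by simp
 have "(\<lambda>n. real n powr 3 * ln (real n) ^ k) = (\<lambda>n. real n ^ 3 * ln (real n) ^ k)" for k
  by (simp add: fun_eq_iff powr_numeral)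
 thus "(\<lambda>n. real (build_time \<alpha> w e n)) \<in> soft_O (\<lambda>n. real n ^ 3)"
  using build_time_PE[OF assms, of e] unfolding PE_iff soft_O_def by simp
 show "(\<lambda>n. real (space \<alpha> w e n)) \<in> soft_O (\<lambda>n. real n powr (3 - \<alpha> / 4))"
  using space_PE[OF assms, of e] by (simp add: PE_def)
 show "(\<lambda>n. real (query_time \<alpha> w e n)) \<in> soft_O (\<lambda>n. real n powr \<alpha>)"
  using query_time_PE[OF assms, of e] by (simp add: PE_def)
qed (rule structure_probability[OF assms])

end
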